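(* Let $t<T$, and let $\{\phi_j\}_{j=0}^{\infty}$ be either the complete orthonormal system of Legendre polynomials or the complete orthonormal trigonometric system in $L_2([t,T])$. Let $\psi_2:[t,T]\to\mathbb{R}$ be continuously differentiable and $\psi_1,\psi_3:[t,T]\to\mathbb{R}$ be twice continuously differentiable (nonrandom). Let $i_1,i_2,i_3\in\{1,\ldots,m\}$. Then for the iterated Stratonovich stochastic integral $$J^{*}[\psi^{(3)}]_{T,t}=\int_t^{*T}\psi_3(t_3)\int_t^{*t_3}\psi_2(t_2)\int_t^{*t_2}\psi_1(t_1)\,d\mathbf{f}^{(i_1)}_{t_1}\,d\mathbf{f}^{(i_2)}_{t_2}\,d\mathbf{f}^{(i_3)}_{t_3}$$ the following expansion converging in the mean-square sense holds: $$J^{*}[\psi^{(3)}]_{T,t}=\operatorname*{l.i.m.}_{p\to\infty}\sum_{j_1,j_2,j_3=0}^{p}C_{j_3j_2j_1}\,\zeta^{(i_1)}_{j_1}\zeta^{(i_2)}_{j_2}\zeta^{(i_3)}_{j_3},$$ where $$C_{j_3j_2j_1}=\int_t^T\psi_3(s_3)\phi_{j_3}(s_3)\int_t^{s_3}\psi_2(s_2)\phi_{j_2}(s_2)\int_t^{s_2}\psi_1(s_1)\phi_{j_1}(s_1)\,ds_1\,ds_2\,ds_3,\qquad \zeta^{(i)}_j=\int_t^T\phi_j(s)\,d\mathbf{f}^{(i)}_s .$$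
   Context: $(\Omega,\mathrm{F},\mathsf{P})$ is a complete probability space with a nondecreasing right-continuous filtration $\{\mathrm{F}_s\}$, and $\mathbf{f}_s=(\mathbf{f}^{(1)}_s,\ldots,\mathbf{f}^{(m)}_s)$ is a standard $m$-dimensional Wiener process adapted to it with independent components. $\int^{*}$ denotes the Stratonovich stochastic integral, and $\operatorname{l.i.m.}$ denotes the limit in the mean-square sense. The $\zeta^{(i)}_j$ are independent standard Gaussian random variables for distinct $i$ or $j$. The Legendre system on $[t,T]$ is $\phi_j(x)=\sqrt{\frac{2j+1}{T-t}}\,P_j\!\left(\left(x-\frac{T+t}{2}\right)\frac{2}{T-t}\right)$, $j\ge0$, with $P_j$ the Legendre polynomial of degree $j$; the trigonometric system is $\phi_0(x)=\frac{1}{\sqrt{T-t}}$, $\phi_{2r-1}(x)=\sqrt{\frac{2}{T-t}}\sin\frac{2\pi r(x-t)}{T-t}$, $\phi_{2r}(x)=\sqrt{\frac{2}{T-t}}\cos\frac{2\pi r(x-t)}{T-t}$, $r\ge1$. *)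

theory Defs
  imports "HOL-Analysis.Analysis" "HOL-Probability.Probability"
begin

definition legendre_poly :: "nat \<Rightarrow> real \<Rightarrow> real" where
  "legendre_poly n x =
     (\<Sum>k\<le>n. real (n choose k) ^ 2 * (x - 1) ^ (n - k) * (x + 1) ^ k) / 2 ^ n"

definition legendre_sys :: "real \<Rightarrow> real \<Rightarrow> nat \<Rightarrow> real \<Rightarrow> real" where
  "legendre_sys t T j x =
     sqrt ((2 * real j + 1) / (T - t)) * legendre_poly j ((x - (T + t) / 2) * (2 / (T - t)))"

definition trig_sys :: "real \<Rightarrow> real \<Rightarrow> nat \<Rightarrow> real \<Rightarrow> real" where
  "trig_sys t T j x =
     (if j = 0 then 1 / sqrt (T - t)
      else if odd j then sqrt (2 / (T - t)) * sin (2 * pi * real ((j + 1) div 2) * (x - t) / (T - t))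
      else sqrt (2 / (T - t)) * cos (2 * pi * real (j div 2) * (x - t) / (T - t)))"

definition C1_on :: "real set \<Rightarrow> (real \<Rightarrow> real) \<Rightarrow> bool" where
  "C1_on S f \<longleftrightarrow> (\<exists>f'. (\<forall>x\<in>S. (f has_real_derivative f' x) (at x within S))
                     \<and> continuous_on S f')"

definition C2_on :: "real set \<Rightarrow> (real \<Rightarrow> real) \<Rightarrow> bool" where
  "C2_on S f \<longleftrightarrow> (\<exists>f' f''. (\<forall>x\<in>S. (f has_real_derivative f' x) (at x within S))
                     \<and> (\<forall>x\<in>S. (f' has_real_derivative f'' x) (at x within S))
                     \<and> continuous_on S f'')"

definition wiener_mdim ::
  "'a measure \<Rightarrow> (real \<Rightarrow> 'a measure) \<Rightarrow> nat \<Rightarrow> (nat \<Rightarrow> real \<Rightarrow> 'a \<Rightarrow> real) \<Rightarrow> bool" where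
  "wiener_mdim M F m W \<longleftrightarrow>
     prob_space M \<and> complete_measure M \<and>
     filtration (space M) F \<and>
     (\<forall>s. sets (F s) \<subseteq> sets M) \<and>
     (\<forall>s. sets (F s) = (\<Inter>u\<in>{s<..}. sets (F u))) \<and>
     (\<forall>i\<in>{1..m}.
        (\<forall>\<omega>\<in>space M. W i 0 \<omega> = 0) \<and>
        (\<forall>\<omega>\<in>space M. continuous_on {0..} (\<lambda>s. W i s \<omega>)) \<and>
        (\<forall>s\<ge>0. W i s \<in> borel_measurable (F s)) \<and>
        (\<forall>s u. 0 \<le> s \<and> s < u \<longrightarrow>
           distributed M lborel (\<lambda>\<omega>. W i u \<omega> - W i s \<omega>)
             (\<lambda>x. ennreal (normal_density 0 (sqrt (u - s)) x)))) \<and>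
     (\<forall>s u. 0 \<le> s \<and> s < u \<longrightarrow>
        prob_space.indep_vars M (\<lambda>_. borel) (\<lambda>i \<omega>. W i u \<omega> - W i s \<omega>) {1..m} \<and>
        prob_space.indep_set M (sets (F s))
          (sets (vimage_algebra (space M)
             (\<lambda>\<omega>. restrict (\<lambda>i. W i u \<omega> - W i s \<omega>) {1..m}) (PiM {1..m} (\<lambda>_. borel)))))"

definition partition :: "real \<Rightarrow> real \<Rightarrow> (nat \<Rightarrow> real) \<Rightarrow> nat \<Rightarrow> bool" where
  "partition a b p N \<longleftrightarrow> p 0 = a \<and> p N = b \<and> (\<forall>k<N. p k < p (Suc k))"

definition mesh :: "(nat \<Rightarrow> real) \<Rightarrow> nat \<Rightarrow> real" where
  "mesh p N = (if N = 0 then 0 else Max ((\<lambda>k. p (Suc k) - p k) ` {..<N}))"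

definition ms_lim :: "'a measure \<Rightarrow> (nat \<Rightarrow> 'a \<Rightarrow> real) \<Rightarrow> ('a \<Rightarrow> real) \<Rightarrow> bool" where
  "ms_lim M S Y \<longleftrightarrow> Y \<in> borel_measurable M \<and>
     ((\<lambda>n. \<integral>\<^sup>+ \<omega>. ennreal ((S n \<omega> - Y \<omega>)\<^sup>2) \<partial>M) \<longlonglongrightarrow> 0)"

definition ito_sum :: "(real \<Rightarrow> 'a \<Rightarrow> real) \<Rightarrow> (real \<Rightarrow> 'a \<Rightarrow> real) \<Rightarrow> (nat \<Rightarrow> real) \<Rightarrow> nat \<Rightarrow> 'a \<Rightarrow> real" where
  "ito_sum W X p N \<omega> = (\<Sum>k<N. X (p k) \<omega> * (W (p (Suc k)) \<omega> - W (p k) \<omega>))"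

definition strat_sum :: "(real \<Rightarrow> 'a \<Rightarrow> real) \<Rightarrow> (real \<Rightarrow> 'a \<Rightarrow> real) \<Rightarrow> (nat \<Rightarrow> real) \<Rightarrow> nat \<Rightarrow> 'a \<Rightarrow> real" where
  "strat_sum W X p N \<omega> =
     (\<Sum>k<N. (X (p k) \<omega> + X (p (Suc k)) \<omega>) / 2 * (W (p (Suc k)) \<omega> - W (p k) \<omega>))"

definition is_ito_int :: "'a measure \<Rightarrow> (real \<Rightarrow> 'a \<Rightarrow> real) \<Rightarrow> (real \<Rightarrow> 'a \<Rightarrow> real) \<Rightarrow> real \<Rightarrow> real \<Rightarrow> ('a \<Rightarrow> real) \<Rightarrow> bool" where
  "is_ito_int M W X a b Y \<longleftrightarrow>
     (\<forall>P N. (\<forall>n. partition a b (P n) (N n)) \<and> (\<lambda>n. mesh (P n) (N n)) \<longlonglongrightarrow> 0 \<longrightarrow>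
        ms_lim M (\<lambda>n. ito_sum W X (P n) (N n)) Y)"

definition is_strat_int :: "'a measure \<Rightarrow> (real \<Rightarrow> 'a \<Rightarrow> real) \<Rightarrow> (real \<Rightarrow> 'a \<Rightarrow> real) \<Rightarrow> real \<Rightarrow> real \<Rightarrow> ('a \<Rightarrow> real) \<Rightarrow> bool" where
  "is_strat_int M W X a b Y \<longleftrightarrow>
     (\<forall>P N. (\<forall>n. partition a b (P n) (N n)) \<and> (\<lambda>n. mesh (P n) (N n)) \<longlonglongrightarrow> 0 \<longrightarrow>
        ms_lim M (\<lambda>n. strat_sum W X (P n) (N n)) Y)"

definition ito_int :: "'a measure \<Rightarrow> (real \<Rightarrow> 'a \<Rightarrow> real) \<Rightarrow> (real \<Rightarrow> 'a \<Rightarrow> real) \<Rightarrow> real \<Rightarrow> real \<Rightarrow> 'a \<Rightarrow> real" where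
  "ito_int M W X a b = (SOME Y. is_ito_int M W X a b Y)"

definition strat_int :: "'a measure \<Rightarrow> (real \<Rightarrow> 'a \<Rightarrow> real) \<Rightarrow> (real \<Rightarrow> 'a \<Rightarrow> real) \<Rightarrow> real \<Rightarrow> real \<Rightarrow> 'a \<Rightarrow> real" where
  "strat_int M W X a b = (SOME Y. is_strat_int M W X a b Y)"

definition strat_iter3 ::
  "'a measure \<Rightarrow> (nat \<Rightarrow> real \<Rightarrow> 'a \<Rightarrow> real) \<Rightarrow> nat \<Rightarrow> nat \<Rightarrow> nat \<Rightarrow>
   (real \<Rightarrow> real) \<Rightarrow> (real \<Rightarrow> real) \<Rightarrow> (real \<Rightarrow> real) \<Rightarrow> real \<Rightarrow> real \<Rightarrow> 'a \<Rightarrow> real" where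
  "strat_iter3 M W i1 i2 i3 \<psi>1 \<psi>2 \<psi>3 t T =
     (let I1 = (\<lambda>s. strat_int M (W i1) (\<lambda>u \<omega>. \<psi>1 u) t s);
          I2 = (\<lambda>s. strat_int M (W i2) (\<lambda>u \<omega>. \<psi>2 u * I1 u \<omega>) t s)
      in strat_int M (W i3) (\<lambda>u \<omega>. \<psi>3 u * I2 u \<omega>) t T)"

definition coeff3 :: "(nat \<Rightarrow> real \<Rightarrow> real) \<Rightarrow> (real \<Rightarrow> real) \<Rightarrow> (real \<Rightarrow> real) \<Rightarrow> (real \<Rightarrow> real) \<Rightarrow>
   real \<Rightarrow> real \<Rightarrow> nat \<Rightarrow> nat \<Rightarrow> nat \<Rightarrow> real" where
  "coeff3 \<phi> \<psi>1 \<psi>2 \<psi>3 t T j3 j2 j1 =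
     integral {t..T} (\<lambda>s3. \<psi>3 s3 * \<phi> j3 s3 *
       integral {t..s3} (\<lambda>s2. \<psi>2 s2 * \<phi> j2 s2 *
         integral {t..s2} (\<lambda>s1. \<psi>1 s1 * \<phi> j1 s1)))"

definition zeta :: "'a measure \<Rightarrow> (nat \<Rightarrow> real \<Rightarrow> 'a \<Rightarrow> real) \<Rightarrow> (nat \<Rightarrow> real \<Rightarrow> real) \<Rightarrow> real \<Rightarrow> real \<Rightarrow>
   nat \<Rightarrow> nat \<Rightarrow> 'a \<Rightarrow> real" where
  "zeta M W \<phi> t T i j = ito_int M (W i) (\<lambda>s \<omega>. \<phi> j s) t T"

end

theory Submission
  imports Defs "HOL-Computational_Algebra.Polynomial"
begin

text \<open>The argument avoids Ito calculus. Stratonovich sums and truncated expansions are both trilinear forms in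
  a Gaussian Hilbert space. By Wick's formula the \<open>L\<^sub>2\<close> norm of such a form is bounded by the \<open>L\<^sub>2\<close> norms of its
  kernel on \<open>[t, T]\<^sup>3\<close> and of the three traces obtained by contracting two of its variables. So two sequences of
  forms whose kernels and traces have the same limits have the same mean-square limit.

  For the Stratonovich sums the limits are read off pointwise: the kernel is \<open>\<psi>1 \<psi>2 \<psi>3\<close> on the
  simplex, the traces of adjacent variables are half of the integral over the diagonal, and the trace of the outer
  variables vanishes. For the truncated expansions the kernel converges by Parseval's identity, and the traces are
  projections of the partial sums of \<open>\<Sum>j. \<integral>\<integral> f \<phi>\<^sub>j g \<phi>\<^sub>j\<close> over triangles. Symmetrising and integrating by parts
  reduces these to Parseval sums of functions with disjoint supports, for which boundedness and convergence follow
  from Bessel's inequality.\<close>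

section \<open>Square-integrable functions\<close>

text \<open>The obstacle is the traces. They live on diagonals, which are null sets, and they are
  not continuous in the \<open>L2\<close> norm, so convergence of the kernels says nothing about
  them. This is delicate because the limiting kernel jumps exactly on the diagonals where adjacent
  variables meet. Kernel and traces are therefore carried side by side as separate data
  (\<open>form2\<close>, \<open>form3\<close>), and the trace sums need an argument of their own, in
  which the derivatives of the weights appear.

  A second difficulty is that the stochastic integrals are choices, determined only up to null sets,
  and the integrand of an outer integral is such a choice at every time. Hence "is a Wiener integral
  of \<open>f\<close>" and "has kernel \<open>K\<close> and these traces" are relations, each at a
  fixed time, that survive mean-square limits and changes on null sets.

  Squared norms are used in place of norms. This is the source of the factors 2 in the triangle
  inequalities and of the fractions of \<open>e\<close> in the limit arguments.\<close>

definition sq_integrable :: "'a measure \<Rightarrow> ('a \<Rightarrow> real) \<Rightarrow> bool" where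
  "sq_integrable N f \<longleftrightarrow> f \<in> borel_measurable N \<and> integrable N (\<lambda>x. (f x)\<^sup>2)"

definition l2_inner :: "'a measure \<Rightarrow> ('a \<Rightarrow> real) \<Rightarrow> ('a \<Rightarrow> real) \<Rightarrow> real" where
  "l2_inner N f g = (\<integral>x. f x * g x \<partial>N)"

definition l2_sq :: "'a measure \<Rightarrow> ('a \<Rightarrow> real) \<Rightarrow> real" where
  "l2_sq N f = (\<integral>x. (f x)\<^sup>2 \<partial>N)"

definition l2_lim :: "'a measure \<Rightarrow> (nat \<Rightarrow> 'a \<Rightarrow> real) \<Rightarrow> ('a \<Rightarrow> real) \<Rightarrow> bool" where
  "l2_lim N f g \<longleftrightarrow> (\<forall>n. sq_integrable N (f n)) \<and> sq_integrable N g \<and>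
     (\<lambda>n. l2_sq N (\<lambda>x. f n x - g x)) \<longlonglongrightarrow> 0"

lemma sq_integrable_measurable: "sq_integrable N f \<Longrightarrow> f \<in> borel_measurable N"
  by (simp add: sq_integrable_def)

lemma sq_integrable_sq: "sq_integrable N f \<Longrightarrow> integrable N (\<lambda>x. (f x)\<^sup>2)"
  by (simp add: sq_integrable_def)

lemma sq_integrable_mult:
  assumes "sq_integrable N f" "sq_integrable N g"
  shows "integrable N (\<lambda>x. f x * g x)"
proof (rule Bochner_Integration.integrable_bound)
  show "integrable N (\<lambda>x. (f x)\<^sup>2 + (g x)\<^sup>2)"
    using assms by (simp add: sq_integrable_def)
  show "(\<lambda>x. f x * g x) \<in> borel_measurable N"
    using assms by (auto simp: sq_integrable_def)
  have "\<bar>a * b\<bar> \<le> a\<^sup>2 + b\<^sup>2" for a b :: real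
  proof -
    have "0 \<le> (\<bar>a\<bar> - \<bar>b\<bar>)\<^sup>2" by simp
    then have "2 * \<bar>a * b\<bar> \<le> a\<^sup>2 + b\<^sup>2" by (simp add: power2_diff abs_mult)
    then show ?thesis by simp
  qed
  then show "AE x in N. norm (f x * g x) \<le> norm ((f x)\<^sup>2 + (g x)\<^sup>2)" by simp
qed

lemma sq_integrable_cmult [intro]: "sq_integrable N f \<Longrightarrow> sq_integrable N (\<lambda>x. c * f x)"
  by (auto simp: sq_integrable_def power_mult_distrib)

lemma sq_integrable_zero [simp, intro]: "sq_integrable N (\<lambda>x. 0)"
  by (simp add: sq_integrable_def)

lemma sq_integrable_add [intro]:
  assumes "sq_integrable N f" "sq_integrable N g"
  shows "sq_integrable N (\<lambda>x. f x + g x)"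
proof -
  have "integrable N (\<lambda>x. (f x)\<^sup>2 + (g x)\<^sup>2 + 2 * (f x * g x))"
    using assms sq_integrable_mult[OF assms] by (auto simp: sq_integrable_def)
  then show ?thesis using assms by (auto simp: sq_integrable_def power2_sum mult.assoc)
qed

lemma sq_integrable_diff [intro]:
  assumes "sq_integrable N f" "sq_integrable N g"
  shows "sq_integrable N (\<lambda>x. f x - g x)"
  using sq_integrable_add[OF assms(1) sq_integrable_cmult[OF assms(2), of "-1"]] by simp

lemma sq_integrable_sum [intro]:
  "(\<And>i. i \<in> I \<Longrightarrow> sq_integrable N (f i)) \<Longrightarrow> sq_integrable N (\<lambda>x. \<Sum>i\<in>I. f i x)"
  by (induction I rule: infinite_finite_induct) auto

lemma l2_sq_nonneg [simp]: "0 \<le> l2_sq N f"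
  by (simp add: l2_sq_def)

lemma l2_sq_inner: "l2_sq N f = l2_inner N f f"
  by (simp add: l2_sq_def l2_inner_def power2_eq_square)

lemma l2_sq_cmult: "l2_sq N (\<lambda>x. c * f x) = c\<^sup>2 * l2_sq N f"
  by (simp add: l2_sq_def power_mult_distrib)

lemma l2_inner_commute: "l2_inner N f g = l2_inner N g f"
  by (simp add: l2_inner_def mult.commute)

lemma l2_inner_cmult_left: "l2_inner N (\<lambda>x. c * f x) g = c * l2_inner N f g"
  by (simp add: l2_inner_def mult.assoc)

lemma l2_inner_add_left:
  "sq_integrable N f \<Longrightarrow> sq_integrable N g \<Longrightarrow> sq_integrable N h \<Longrightarrow>
   l2_inner N (\<lambda>x. f x + g x) h = l2_inner N f h + l2_inner N g h"
  unfolding l2_inner_def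
  by (simp add: distrib_right sq_integrable_mult)

lemma l2_inner_diff_left:
  "sq_integrable N f \<Longrightarrow> sq_integrable N g \<Longrightarrow> sq_integrable N h \<Longrightarrow>
   l2_inner N (\<lambda>x. f x - g x) h = l2_inner N f h - l2_inner N g h"
  unfolding l2_inner_def
  by (simp add: left_diff_distrib sq_integrable_mult)

lemma l2_inner_sum_left:
  "(\<And>i. i \<in> I \<Longrightarrow> sq_integrable N (f i)) \<Longrightarrow> sq_integrable N h \<Longrightarrow>
   l2_inner N (\<lambda>x. \<Sum>i\<in>I. f i x) h = (\<Sum>i\<in>I. l2_inner N (f i) h)"
  unfolding l2_inner_def
  by (simp add: sum_distrib_right sq_integrable_mult Bochner_Integration.integral_sum)

lemma l2_inner_sum_right:
  "(\<And>i. i \<in> I \<Longrightarrow> sq_integrable N (f i)) \<Longrightarrow> sq_integrable N h \<Longrightarrow>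
   l2_inner N h (\<lambda>x. \<Sum>i\<in>I. f i x) = (\<Sum>i\<in>I. l2_inner N h (f i))"
  using l2_inner_sum_left[of I N f h] by (simp add: l2_inner_commute)

lemma l2_sq_diff_expand:
  assumes "sq_integrable N f" "sq_integrable N g"
  shows "l2_sq N (\<lambda>x. f x - g x) = l2_sq N f - 2 * l2_inner N f g + l2_sq N g"
  using assms sq_integrable_mult[OF assms]
  by (simp add: l2_sq_def l2_inner_def power2_diff sq_integrable_def mult.assoc)

lemma l2_sq_add_expand:
  assumes "sq_integrable N f" "sq_integrable N g"
  shows "l2_sq N (\<lambda>x. f x + g x) = l2_sq N f + 2 * l2_inner N f g + l2_sq N g"
  using assms sq_integrable_mult[OF assms]
  by (simp add: l2_sq_def l2_inner_def power2_sum sq_integrable_def mult.assoc)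

lemma l2_sq_parallelogram:
  assumes "sq_integrable N f" "sq_integrable N g"
  shows "l2_sq N (\<lambda>x. f x + g x) + l2_sq N (\<lambda>x. f x - g x) = 2 * l2_sq N f + 2 * l2_sq N g"
  using l2_sq_diff_expand[OF assms] l2_sq_add_expand[OF assms] by simp

lemma l2_sq_add_le:
  "sq_integrable N f \<Longrightarrow> sq_integrable N g \<Longrightarrow>
   l2_sq N (\<lambda>x. f x + g x) \<le> 2 * l2_sq N f + 2 * l2_sq N g"
  using l2_sq_parallelogram[of N f g] l2_sq_nonneg[of N "\<lambda>x. f x - g x"] by linarith

lemma l2_sq_commute: "l2_sq N (\<lambda>x. f x - g x) = l2_sq N (\<lambda>x. g x - f x)"
  by (simp add: l2_sq_def power2_commute)

lemma l2_sq_triangle: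
  assumes "sq_integrable N f" "sq_integrable N g" "sq_integrable N h"
  shows "l2_sq N (\<lambda>x. f x - h x) \<le> 2 * l2_sq N (\<lambda>x. f x - g x) + 2 * l2_sq N (\<lambda>x. g x - h x)"
  using l2_sq_add_le[OF sq_integrable_diff[OF assms(1,2)] sq_integrable_diff[OF assms(2,3)]] by simp

lemma l2_inner_mean_le:
  assumes "sq_integrable N f" "sq_integrable N g"
  shows "\<bar>l2_inner N f g\<bar> \<le> (l2_sq N f + l2_sq N g) / 2"
  using l2_sq_nonneg[of N "\<lambda>x. f x - g x"] l2_sq_nonneg[of N "\<lambda>x. f x + g x"]
  unfolding l2_sq_add_expand[OF assms] l2_sq_diff_expand[OF assms]
  by (simp add: abs_le_iff field_simps)

text \<open>The quadratic polynomial in \<open>s\<close> given by the squared norm of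
  \<open>s * f - g\<close> is nonnegative everywhere; the inequality says that its discriminant is
  not positive.\<close>

lemma l2_cauchy_schwarz_sq:
  assumes f: "sq_integrable N f" and g: "sq_integrable N g"
  shows "(l2_inner N f g)\<^sup>2 \<le> l2_sq N f * l2_sq N g"
proof -
  let ?a = "l2_sq N f" and ?b = "l2_inner N f g" and ?c = "l2_sq N g"
  have *: "0 \<le> s\<^sup>2 * ?a - 2 * s * ?b + ?c" for s
    using l2_sq_diff_expand[OF sq_integrable_cmult[OF f, of s] g]
      l2_sq_nonneg[of N "\<lambda>x. s * f x - g x"]
    by (simp add: l2_sq_cmult l2_inner_cmult_left)
  show ?thesis
  proof (cases "?a = 0")
    case True
    have "?b = 0"
    proof (rule ccontr)
      assume "?b \<noteq> 0"
      \<comment> \<open>With \<open>?a = 0\<close> the polynomial is linear in \<open>s\<close>; at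
        this point it takes the value -1.\<close>
      then show False using *[of "(?c + 1) / (2 * ?b)"] True by (simp add: field_simps)
    qed
    then show ?thesis by simp
  next
    case False
    then have "?a > 0" using l2_sq_nonneg[of N f] by linarith
    \<comment> \<open>The point \<open>?b / ?a\<close> minimises the polynomial.\<close>
    then show ?thesis using *[of "?b / ?a"] by (simp add: field_simps power2_eq_square)
  qed
qed

lemma l2_cauchy_schwarz:
  assumes "sq_integrable N f" "sq_integrable N g"
  shows "\<bar>l2_inner N f g\<bar> \<le> sqrt (l2_sq N f) * sqrt (l2_sq N g)"
  using real_sqrt_le_mono[OF l2_cauchy_schwarz_sq[OF assms]] by (simp add: real_sqrt_mult)

lemma l2_limD:
  assumes "l2_lim N f g"
  shows "sq_integrable N (f n)" "sq_integrable N g"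
    "(\<lambda>n. l2_sq N (\<lambda>x. f n x - g x)) \<longlonglongrightarrow> 0"
  using assms by (auto simp: l2_lim_def)

lemma l2_limI_le:
  assumes "\<And>n. sq_integrable N (f n)" "sq_integrable N g"
    "\<And>n. l2_sq N (\<lambda>x. f n x - g x) \<le> e n" "e \<longlonglongrightarrow> 0"
  shows "l2_lim N f g"
  unfolding l2_lim_def
proof (intro conjI allI assms)
  show "(\<lambda>n. l2_sq N (\<lambda>x. f n x - g x)) \<longlonglongrightarrow> 0"
    by (rule tendsto_sandwich[OF _ _ tendsto_const assms(4)]) (use assms(3) in auto)
qed

lemma l2_lim_const: "sq_integrable N f \<Longrightarrow> l2_lim N (\<lambda>n. f) f"
  by (simp add: l2_lim_def l2_sq_def)

lemma l2_lim_add: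
  assumes "l2_lim N f f'" "l2_lim N g g'"
  shows "l2_lim N (\<lambda>n x. f n x + g n x) (\<lambda>x. f' x + g' x)"
proof (rule l2_limI_le)
  note lims [intro] = l2_limD(1,2)[OF assms(1)] l2_limD(1,2)[OF assms(2)]
  show "sq_integrable N (\<lambda>x. f n x + g n x)" "sq_integrable N (\<lambda>x. f' x + g' x)" for n
    by (intro sq_integrable_add lims)+
  show "l2_sq N (\<lambda>x. f n x + g n x - (f' x + g' x)) \<le>
     2 * l2_sq N (\<lambda>x. f n x - f' x) + 2 * l2_sq N (\<lambda>x. g n x - g' x)" for n
    using l2_sq_add_le[of N "\<lambda>x. f n x - f' x" "\<lambda>x. g n x - g' x"]
    by (auto simp: algebra_simps)
  show "(\<lambda>n. 2 * l2_sq N (\<lambda>x. f n x - f' x) + 2 * l2_sq N (\<lambda>x. g n x - g' x)) \<longlonglongrightarrow> 0"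
    using tendsto_add[OF tendsto_mult_left[OF l2_limD(3)[OF assms(1)], of 2]
        tendsto_mult_left[OF l2_limD(3)[OF assms(2)], of 2]] by simp
qed

lemma l2_lim_cmult:
  assumes "l2_lim N f f'"
  shows "l2_lim N (\<lambda>n x. c * f n x) (\<lambda>x. c * f' x)"
proof (rule l2_limI_le)
  show "sq_integrable N (\<lambda>x. c * f n x)" "sq_integrable N (\<lambda>x. c * f' x)" for n
    using l2_limD(1,2)[OF assms] by (intro sq_integrable_cmult; simp)+
  show "l2_sq N (\<lambda>x. c * f n x - c * f' x) \<le> c\<^sup>2 * l2_sq N (\<lambda>x. f n x - f' x)" for n
    by (simp add: l2_sq_cmult flip: right_diff_distrib)
  show "(\<lambda>n. c\<^sup>2 * l2_sq N (\<lambda>x. f n x - f' x)) \<longlonglongrightarrow> 0"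
    using tendsto_mult_left[OF l2_limD(3)[OF assms], of "c\<^sup>2"] by simp
qed

lemma l2_lim_diff:
  assumes "l2_lim N f f'" "l2_lim N g g'"
  shows "l2_lim N (\<lambda>n x. f n x - g n x) (\<lambda>x. f' x - g' x)"
  using l2_lim_add[OF assms(1) l2_lim_cmult[OF assms(2), of "-1"]] by simp

lemma l2_lim_subseq:
  assumes "l2_lim N f g" "strict_mono r"
  shows "l2_lim N (\<lambda>n. f (r n)) g"
  using assms LIMSEQ_subseq_LIMSEQ[OF l2_limD(3)[OF assms(1)] assms(2)]
  by (simp add: l2_lim_def o_def)

lemma l2_inner_tendsto:
  assumes "l2_lim N f f'" "l2_lim N g g'"
  shows "(\<lambda>n. l2_inner N (f n) (g n)) \<longlonglongrightarrow> l2_inner N f' g'"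
proof -
  have sqi: "sq_integrable N (f n)" "sq_integrable N f'" "sq_integrable N (g n)" "sq_integrable N g'" for n
    using assms by (auto simp: l2_lim_def)
  let ?F = "\<lambda>n x. f n x - f' x" and ?G = "\<lambda>n x. g n x - g' x"
  have F: "(\<lambda>n. sqrt (l2_sq N (?F n))) \<longlonglongrightarrow> 0" and G: "(\<lambda>n. sqrt (l2_sq N (?G n))) \<longlonglongrightarrow> 0"
    using tendsto_real_sqrt[OF l2_limD(3)[OF assms(1)]] tendsto_real_sqrt[OF l2_limD(3)[OF assms(2)]] by auto
  have eq: "l2_inner N (f n) (g n) - l2_inner N f' g' =
     l2_inner N (?F n) (?G n) + l2_inner N (?F n) g' + l2_inner N f' (?G n)" for n
  proof -
    have F: "l2_inner N (?F n) h = l2_inner N (f n) h - l2_inner N f' h"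
      and G: "l2_inner N h (?G n) = l2_inner N h (g n) - l2_inner N h g'"
      if "sq_integrable N h" for h
      using that sqi by (simp_all add: l2_inner_diff_left l2_inner_commute[of N h])
    show ?thesis
      using F[OF sqi(4)] G[OF sqi(2)] F[OF sq_integrable_diff[OF sqi(3,4)], of n] G[OF sqi(1), of n]
      by (simp add: G[OF sqi(2)])
  qed
  have abs3: "\<bar>a + b + c\<bar> \<le> \<bar>a\<bar> + \<bar>b\<bar> + \<bar>c\<bar>" for a b c :: real by simp
  define b where "b n = sqrt (l2_sq N (?F n)) * sqrt (l2_sq N (?G n)) + sqrt (l2_sq N (?F n)) * sqrt (l2_sq N g')
     + sqrt (l2_sq N f') * sqrt (l2_sq N (?G n))" for n
  have "b \<longlonglongrightarrow> 0 * 0 + 0 * sqrt (l2_sq N g') + sqrt (l2_sq N f') * 0"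
    unfolding b_def by (intro tendsto_intros F G)
  then have b0: "b \<longlonglongrightarrow> 0" by simp
  have le: "norm (l2_inner N (f n) (g n) - l2_inner N f' g') \<le> b n" for n
    unfolding eq real_norm_def b_def
    by (rule order_trans[OF abs3]) (intro add_mono l2_cauchy_schwarz sq_integrable_diff sqi)
  have "(\<lambda>n. l2_inner N (f n) (g n) - l2_inner N f' g') \<longlonglongrightarrow> 0"
    by (rule Lim_null_comparison[OF always_eventually[OF allI[OF le]] b0])
  then show ?thesis by (simp add: LIM_zero_iff)
qed

lemma l2_sq_tendsto: "l2_lim N f f' \<Longrightarrow> (\<lambda>n. l2_sq N (f n)) \<longlonglongrightarrow> l2_sq N f'"
  unfolding l2_sq_inner by (rule l2_inner_tendsto)

text \<open>The squared differences tend to 0 in mean, hence almost everywhere along a subsequence.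
  This is the passage from mean-square limits to pointwise identities: uniqueness of limits and the
  identification of limits of products rest on it.\<close>

lemma l2_lim_AE_subseq:
  assumes "l2_lim N f g"
  shows "\<exists>r. strict_mono r \<and> (AE x in N. (\<lambda>n. f (r n) x) \<longlonglongrightarrow> g x)"
proof -
  have "\<exists>r. strict_mono r \<and> (AE x in N. (\<lambda>n. (f (r n) x - g x)\<^sup>2) \<longlonglongrightarrow> 0)"
    using sq_integrable_sq[OF sq_integrable_diff[OF l2_limD(1,2)[OF assms]]] l2_limD(3)[OF assms]
    by (intro tendsto_L1_AE_subseq[where u="\<lambda>n x. (f n x - g x)\<^sup>2"]) (auto simp: l2_sq_def)
  then obtain r where r: "strict_mono r" "AE x in N. (\<lambda>n. (f (r n) x - g x)\<^sup>2) \<longlonglongrightarrow> 0"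
    by blast
  have "AE x in N. (\<lambda>n. f (r n) x) \<longlonglongrightarrow> g x"
    using r(2)
  proof eventually_elim
    case (elim x)
    from tendsto_real_sqrt[OF elim] have "(\<lambda>n. f (r n) x - g x) \<longlonglongrightarrow> 0"
      by (simp add: tendsto_rabs_zero_iff)
    then show ?case by (simp add: LIM_zero_iff)
  qed
  with r(1) show ?thesis by blast
qed

lemma l2_lim_unique:
  assumes "l2_lim N f g" "l2_lim N f h"
  shows "AE x in N. g x = h x"
proof -
  from l2_lim_AE_subseq[OF assms(1)] obtain r where
    r: "strict_mono r" "AE x in N. (\<lambda>n. f (r n) x) \<longlonglongrightarrow> g x" by blast
  from l2_lim_AE_subseq[OF l2_lim_subseq[OF assms(2) r(1)]] obtain r' where
    r': "strict_mono r'" "AE x in N. (\<lambda>n. f (r (r' n)) x) \<longlonglongrightarrow> h x" by blast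
  from r(2) r'(2) show ?thesis
  proof eventually_elim
    case (elim x)
    from LIMSEQ_subseq_LIMSEQ[OF elim(1) r'(1)] elim(2) show ?case
      by (auto simp: o_def intro: LIMSEQ_unique)
  qed
qed

lemma l2_sq_cong_AE:
  assumes "AE x in N. f x = g x" "f \<in> borel_measurable N" "g \<in> borel_measurable N"
  shows "l2_sq N f = l2_sq N g"
  unfolding l2_sq_def using assms by (intro integral_cong_AE) auto

lemma sq_integrable_cong_AE:
  assumes "AE x in N. f x = g x" "sq_integrable N f" "g \<in> borel_measurable N"
  shows "sq_integrable N g"
  using assms unfolding sq_integrable_def
  by (auto intro: integrable_cong_AE_imp[where g="\<lambda>x. (f x)\<^sup>2"])

lemma nn_integral_sq:
  "sq_integrable N f \<Longrightarrow> (\<integral>\<^sup>+x. ennreal ((f x)\<^sup>2) \<partial>N) = ennreal (l2_sq N f)"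
  unfolding l2_sq_def by (rule nn_integral_eq_integral) (auto simp: sq_integrable_def)

lemma sq_integrableI_nn:
  assumes "f \<in> borel_measurable N" "(\<integral>\<^sup>+x. ennreal ((f x)\<^sup>2) \<partial>N) < \<infinity>"
  shows "sq_integrable N f"
  unfolding sq_integrable_def using assms by (auto intro!: integrableI_bounded)

lemma l2_lim_imp_ms_lim:
  assumes "l2_lim N f g"
  shows "ms_lim N f g"
proof -
  have "(\<integral>\<^sup>+x. ennreal ((f n x - g x)\<^sup>2) \<partial>N) = ennreal (l2_sq N (\<lambda>x. f n x - g x))" for n
    using assms by (intro nn_integral_sq) (auto simp: l2_lim_def)
  then show ?thesis
    using assms tendsto_ennrealI[OF l2_limD(3)[OF assms]]
    by (simp add: ms_lim_def l2_lim_def sq_integrable_def)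
qed

text \<open>\<open>ms_lim\<close> asks only that the limit be measurable. Its square integrability
  follows because the nonnegative integral is finite for at least one \<open>n\<close>, so that the
  limit differs from \<open>f n\<close> by a square integrable function.\<close>

lemma ms_lim_imp_l2_lim:
  assumes "ms_lim N f g" "\<And>n. sq_integrable N (f n)"
  shows "l2_lim N f g"
proof -
  have lim: "(\<lambda>n. \<integral>\<^sup>+x. ennreal ((f n x - g x)\<^sup>2) \<partial>N) \<longlonglongrightarrow> 0" and g: "g \<in> borel_measurable N"
    using assms(1) by (auto simp: ms_lim_def)
  from order_tendstoD(2)[OF lim, of 1] obtain n where "(\<integral>\<^sup>+x. ennreal ((f n x - g x)\<^sup>2) \<partial>N) < 1"
    by (auto dest!: eventually_happens)
  then have "(\<integral>\<^sup>+x. ennreal ((f n x - g x)\<^sup>2) \<partial>N) < \<infinity>"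
    by (rule order_less_trans) simp
  then have "sq_integrable N (\<lambda>x. f n x - g x)"
    using assms(2)[of n] g by (intro sq_integrableI_nn) (auto dest: sq_integrable_measurable)
  from sq_integrable_diff[OF assms(2)[of n] this] have g2: "sq_integrable N g" by simp
  have "(\<integral>\<^sup>+x. ennreal ((f n x - g x)\<^sup>2) \<partial>N) = ennreal (l2_sq N (\<lambda>x. f n x - g x))" for n
    using assms g2 by (intro nn_integral_sq) auto
  then have "(\<lambda>n. ennreal (l2_sq N (\<lambda>x. f n x - g x))) \<longlonglongrightarrow> ennreal 0"
    using lim by simp
  then have "(\<lambda>n. l2_sq N (\<lambda>x. f n x - g x)) \<longlonglongrightarrow> 0"
    by (subst (asm) tendsto_ennreal_iff) auto
  then show ?thesis using assms g2 by (auto simp: l2_lim_def)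
qed

text \<open>Along a subsequence with increments \<open>d k\<close> of size \<open>l2_sq (d k) \<le> 4 ^ -k\<close> the series
  \<open>\<Sum>k. 2 ^ k * (d k)\<^sup>2\<close> is integrable, and it dominates \<open>\<Sum>k. \<bar>d k\<bar>\<close> up to a geometric
  series because \<open>2 * \<bar>d\<bar> \<le> 2 ^ -k + 2 ^ k * d\<^sup>2\<close>.\<close>

lemma l2_complete:
  assumes sqi: "\<And>n. sq_integrable N (f n)"
    and cau: "\<And>e. e > 0 \<Longrightarrow> \<exists>n0. \<forall>m\<ge>n0. \<forall>n\<ge>n0. l2_sq N (\<lambda>x. f m x - f n x) < e"
  shows "\<exists>g. l2_lim N f g"
proof -
  note [measurable] = sq_integrable_measurable[OF sqi]
  have "\<exists>n0. \<forall>m\<ge>n0. \<forall>n\<ge>n0. l2_sq N (\<lambda>x. f m x - f n x) < (1/4)^k" for k :: nat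
    by (rule cau) simp
  then obtain R where R: "\<And>k m n. m \<ge> R k \<Longrightarrow> n \<ge> R k \<Longrightarrow> l2_sq N (\<lambda>x. f m x - f n x) < (1/4)^k"
    by metis
  \<comment> \<open>The sum puts \<open>r k\<close> above \<open>R k\<close>, and the summand
    \<open>k\<close> makes \<open>r\<close> strictly increasing.\<close>
  define r where "r k = (\<Sum>i\<le>k. R i) + k" for k
  have rR: "r k \<ge> R k" for k unfolding r_def by (simp add: member_le_sum trans_le_add1)
  have r_mono: "strict_mono r"
    by (rule strict_monoI_Suc) (simp add: r_def)
  define d where "d k x = f (r (Suc k)) x - f (r k) x" for k x
  have d_sqi: "sq_integrable N (d k)" for k unfolding d_def[abs_def] using sqi by auto
  note [measurable] = sq_integrable_measurable[OF d_sqi]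
  have dk: "l2_sq N (d k) \<le> (1/4)^k" for k
    unfolding d_def[abs_def] using R[of k "r (Suc k)" "r k"] rR[of k] r_mono
    by (meson less_imp_le order_trans strict_mono_less_eq lessI)
  have "(\<integral>\<^sup>+x. (\<Sum>k. ennreal (2^k * (d k x)\<^sup>2)) \<partial>N) = (\<Sum>k. \<integral>\<^sup>+x. ennreal (2^k * (d k x)\<^sup>2) \<partial>N)"
    by (rule nn_integral_suminf) simp
  also have "\<dots> = (\<Sum>k. ennreal (2^k * l2_sq N (d k)))"
  proof (rule arg_cong[where f=suminf], rule ext)
    fix k
    have "(\<integral>\<^sup>+x. ennreal (2^k * (d k x)\<^sup>2) \<partial>N) = ennreal (2^k) * (\<integral>\<^sup>+x. ennreal ((d k x)\<^sup>2) \<partial>N)"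
      by (subst nn_integral_cmult[symmetric]) (auto simp: ennreal_mult)
    then show "(\<integral>\<^sup>+x. ennreal (2^k * (d k x)\<^sup>2) \<partial>N) = ennreal (2^k * l2_sq N (d k))"
      using nn_integral_sq[OF d_sqi, of k] by (simp add: ennreal_mult)
  qed
  also have "\<dots> \<le> (\<Sum>k. ennreal ((1/2)^k))"
  proof (intro suminf_le ennreal_leI summableI)
    fix k
    have "2^k * l2_sq N (d k) \<le> 2^k * (1/4)^k" using dk by (intro mult_left_mono) auto
    also have "\<dots> = (1/2)^k" by (simp flip: power_mult_distrib)
    finally show "2^k * l2_sq N (d k) \<le> (1/2)^k" .
  qed
  also have "\<dots> = ennreal (\<Sum>k. (1/2)^k)" by (intro suminf_ennreal2) (auto intro: summable_geometric)
  also have "\<dots> < \<infinity>" by simp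
  finally have "(\<integral>\<^sup>+x. (\<Sum>k. ennreal (2^k * (d k x)\<^sup>2)) \<partial>N) \<noteq> \<infinity>" by simp
  then have "AE x in N. (\<Sum>k. ennreal (2^k * (d k x)\<^sup>2)) \<noteq> \<infinity>"
    by (intro nn_integral_PInf_AE) auto
  then have conv: "AE x in N. convergent (\<lambda>k. f (r k) x)"
  proof eventually_elim
    case (elim x)
    have "summable (\<lambda>k. 2^k * (d k x)\<^sup>2)"
      using elim by (intro summable_suminf_not_top) (auto simp: top_ennreal_def)
    then have s: "summable (\<lambda>k. (1/2)^k + 2^k * (d k x)\<^sup>2)"
      by (intro summable_add summable_geometric) auto
    have "summable (\<lambda>k. d k x)"
    proof (rule summable_comparison_test[OF _ s], intro exI allI impI)
      fix k
      have "0 \<le> (1 - 2^k * \<bar>d k x\<bar>)\<^sup>2" by simp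
      then have "2 * (2^k * \<bar>d k x\<bar>) \<le> 1 + (2^k * \<bar>d k x\<bar>)\<^sup>2" by (simp add: power2_diff)
      then have "(1/2)^k * (2 * (2^k * \<bar>d k x\<bar>)) \<le> (1/2)^k * (1 + (2^k * \<bar>d k x\<bar>)\<^sup>2)"
        by (rule mult_left_mono) simp
      then have "2 * \<bar>d k x\<bar> \<le> (1/2)^k + 2^k * (d k x)\<^sup>2"
        by (simp add: field_simps power2_eq_square power_one_over)
      moreover have "\<bar>d k x\<bar> \<le> 2 * \<bar>d k x\<bar>" by simp
      ultimately show "norm (d k x) \<le> (1/2)^k + 2^k * (d k x)\<^sup>2" by simp
    qed
    then have "convergent (\<lambda>n. \<Sum>k<n. d k x)" by (simp add: summable_iff_convergent)
    then have "convergent (\<lambda>n. f (r n) x - f (r 0) x)"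
      unfolding d_def using sum_lessThan_telescope[of "\<lambda>k. f (r k) x"] by simp
    then show ?case using convergent_diff_const_right_iff[of "\<lambda>n. f (r n) x" "f (r 0) x"] by simp
  qed
  define g where "g x = lim (\<lambda>k. f (r k) x)" for x
  have g_meas[measurable]: "g \<in> borel_measurable N" unfolding g_def[abs_def] by measurable
  have lim: "AE x in N. (\<lambda>k. f (r k) x) \<longlonglongrightarrow> g x"
    using conv by eventually_elim (simp add: g_def convergent_LIMSEQ_iff)
  \<comment> \<open>Almost sure convergence is known only along \<open>r\<close>. Fatou's lemma,
    applied to \<open>f n - f (r k)\<close> with \<open>n\<close> fixed, turns it into a mean-square
    estimate for the whole sequence.\<close>
  have fatou: "(\<integral>\<^sup>+x. ennreal ((f n x - g x)\<^sup>2) \<partial>N) \<le> ennreal e"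
    if "e > 0" and n0: "\<forall>m\<ge>n0. \<forall>n\<ge>n0. l2_sq N (\<lambda>x. f m x - f n x) < e" and "n \<ge> n0" for e n n0
  proof -
    have "(\<integral>\<^sup>+x. ennreal ((f n x - g x)\<^sup>2) \<partial>N) = (\<integral>\<^sup>+x. liminf (\<lambda>k. ennreal ((f n x - f (r k) x)\<^sup>2)) \<partial>N)"
    proof (rule nn_integral_cong_AE, use lim in eventually_elim)
      case (elim x)
      then have "(\<lambda>k. ennreal ((f n x - f (r k) x)\<^sup>2)) \<longlonglongrightarrow> ennreal ((f n x - g x)\<^sup>2)"
        by (intro tendsto_ennrealI tendsto_intros)
      from lim_imp_Liminf[OF _ this] show ?case by simp
    qed
    also have "\<dots> \<le> liminf (\<lambda>k. \<integral>\<^sup>+x. ennreal ((f n x - f (r k) x)\<^sup>2) \<partial>N)"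
      by (rule nn_integral_liminf) simp
    also have "\<dots> \<le> liminf (\<lambda>k. ennreal e)"
    proof (rule Liminf_mono, rule eventually_sequentiallyI[of n0])
      fix k assume "n0 \<le> k"
      then have "n0 \<le> r k" using seq_suble[OF r_mono, of k] by simp
      then show "(\<integral>\<^sup>+x. ennreal ((f n x - f (r k) x)\<^sup>2) \<partial>N) \<le> ennreal e"
        using that n0 sqi by (subst nn_integral_sq) (auto intro!: ennreal_leI less_imp_le)
    qed
    also have "\<dots> = ennreal e" by (simp add: Liminf_const)
    finally show ?thesis .
  qed
  have "ms_lim N f g"
    unfolding ms_lim_def
  proof (intro conjI g_meas)
    show "(\<lambda>n. \<integral>\<^sup>+x. ennreal ((f n x - g x)\<^sup>2) \<partial>N) \<longlonglongrightarrow> 0"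
    proof (rule order_tendstoI)
      fix a :: ennreal assume "0 < a"
      then obtain b where b: "0 < b" "b < a" using dense by blast
      then obtain e where e: "b = ennreal e" "e \<ge> 0"
        by (cases b) auto
      with b have e: "e > 0" "ennreal e < a" by auto
      from cau[OF e(1)] obtain n0 where "\<forall>m\<ge>n0. \<forall>n\<ge>n0. l2_sq N (\<lambda>x. f m x - f n x) < e" by blast
      from fatou[OF e(1) this] e(2) show "\<forall>\<^sub>F n in sequentially. (\<integral>\<^sup>+x. ennreal ((f n x - g x)\<^sup>2) \<partial>N) < a"
        by (auto intro!: eventually_sequentiallyI[of n0] intro: le_less_trans)
    qed simp
  qed
  from ms_lim_imp_l2_lim[OF this sqi] show ?thesis by blast
qed

text \<open>On a finite measure space such functions are integrable together with their products,
  squares and sections, so Fubini's theorem and Cauchy-Schwarz apply without further side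
  conditions. All integrands and kernels of the approximating forms are of this kind.\<close>

definition bounded_meas :: "'a measure \<Rightarrow> ('a \<Rightarrow> real) \<Rightarrow> bool" where
  "bounded_meas N f \<longleftrightarrow> f \<in> borel_measurable N \<and> (\<exists>B. \<forall>x\<in>space N. \<bar>f x\<bar> \<le> B)"

lemma bounded_measI: "f \<in> borel_measurable N \<Longrightarrow> (\<And>x. x \<in> space N \<Longrightarrow> \<bar>f x\<bar> \<le> B) \<Longrightarrow> bounded_meas N f"
  by (auto simp: bounded_meas_def)

lemma bounded_meas_measurable: "bounded_meas N f \<Longrightarrow> f \<in> borel_measurable N"
  by (simp add: bounded_meas_def)

lemma bounded_meas_bound:
  assumes "bounded_meas N f"
  obtains B where "B \<ge> 0" "\<And>x. x \<in> space N \<Longrightarrow> \<bar>f x\<bar> \<le> B"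
proof -
  from assms obtain B where "\<forall>x\<in>space N. \<bar>f x\<bar> \<le> B" by (auto simp: bounded_meas_def)
  then show ?thesis by (intro that[of "max B 0"]) auto
qed

lemma bounded_meas_const [simp, intro]: "bounded_meas N (\<lambda>x. c)"
  by (auto simp: bounded_meas_def)

lemma bounded_meas_mult [intro]:
  assumes f: "bounded_meas N f" and g: "bounded_meas N g"
  shows "bounded_meas N (\<lambda>x. f x * g x)"
proof -
  obtain B where "B \<ge> 0" and B: "\<And>x. x \<in> space N \<Longrightarrow> \<bar>f x\<bar> \<le> B" using bounded_meas_bound[OF f] by blast
  obtain C where "C \<ge> 0" and C: "\<And>x. x \<in> space N \<Longrightarrow> \<bar>g x\<bar> \<le> C" using bounded_meas_bound[OF g] by blast
  show ?thesis
  proof (rule bounded_measI)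
    show "(\<lambda>x. f x * g x) \<in> borel_measurable N" using f g by (auto simp: bounded_meas_def)
    show "\<bar>f x * g x\<bar> \<le> B * C" if "x \<in> space N" for x
      unfolding abs_mult using B C that \<open>B \<ge> 0\<close> by (intro mult_mono) auto
  qed
qed

lemma bounded_meas_add [intro]:
  assumes f: "bounded_meas N f" and g: "bounded_meas N g"
  shows "bounded_meas N (\<lambda>x. f x + g x)"
proof -
  obtain B where B: "\<And>x. x \<in> space N \<Longrightarrow> \<bar>f x\<bar> \<le> B" using bounded_meas_bound[OF f] by blast
  obtain C where C: "\<And>x. x \<in> space N \<Longrightarrow> \<bar>g x\<bar> \<le> C" using bounded_meas_bound[OF g] by blast
  show ?thesis
  proof (rule bounded_measI)
    show "(\<lambda>x. f x + g x) \<in> borel_measurable N" using f g by (auto simp: bounded_meas_def)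
    show "\<bar>f x + g x\<bar> \<le> B + C" if "x \<in> space N" for x
      using B[OF that] C[OF that] by linarith
  qed
qed

lemma bounded_meas_cmult [intro]: "bounded_meas N f \<Longrightarrow> bounded_meas N (\<lambda>x. c * f x)"
  by auto

lemma bounded_meas_diff [intro]:
  "bounded_meas N f \<Longrightarrow> bounded_meas N g \<Longrightarrow> bounded_meas N (\<lambda>x. f x - g x)"
  using bounded_meas_add[of N f "\<lambda>x. (-1) * g x"] bounded_meas_cmult[of N g "-1"] by simp

lemma bounded_meas_sum [intro]:
  "(\<And>i. i \<in> I \<Longrightarrow> bounded_meas N (f i)) \<Longrightarrow> bounded_meas N (\<lambda>x. \<Sum>i\<in>I. f i x)"
  by (induction I rule: infinite_finite_induct) auto

lemma (in finite_measure) bounded_meas_integrable: "bounded_meas M f \<Longrightarrow> integrable M f"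
  by (rule bounded_meas_bound, assumption, rule integrable_const_bound) (auto dest: bounded_meas_measurable)

lemma (in finite_measure) bounded_meas_sq: "bounded_meas M f \<Longrightarrow> sq_integrable M f"
  using bounded_meas_integrable[OF bounded_meas_mult, of f f]
  by (simp add: sq_integrable_def bounded_meas_def power2_eq_square)

text \<open>Dominated convergence with a constant majorant. Kernels and traces are computed
  pointwise off a null set, and this lemma turns the result into an \<open>L2\<close> limit.\<close>

lemma (in finite_measure) bounded_meas_l2_lim:
  assumes f: "\<And>n. f n \<in> borel_measurable M" and g: "g \<in> borel_measurable M"
    and B: "\<And>n x. x \<in> space M \<Longrightarrow> \<bar>f n x\<bar> \<le> B"
    and lim: "AE x in M. (\<lambda>n. f n x) \<longlonglongrightarrow> g x"
    and gB: "\<And>x. x \<in> space M \<Longrightarrow> \<bar>g x\<bar> \<le> C"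
  shows "l2_lim M f g"
  unfolding l2_lim_def
proof (intro conjI allI)
  show "sq_integrable M (f n)" for n using f B by (intro bounded_meas_sq bounded_measI)
  show "sq_integrable M g" using g gB by (intro bounded_meas_sq bounded_measI)
  have "(\<lambda>n. \<integral>x. (f n x - g x)\<^sup>2 \<partial>M) \<longlonglongrightarrow> (\<integral>x. 0 \<partial>M)"
  proof (rule integral_dominated_convergence[where w="\<lambda>x. (B + C)\<^sup>2"])
    show "AE x in M. (\<lambda>n. (f n x - g x)\<^sup>2) \<longlonglongrightarrow> 0"
      using lim
    proof eventually_elim
      case (elim x)
      have "(\<lambda>n. (f n x - g x)\<^sup>2) \<longlonglongrightarrow> (g x - g x)\<^sup>2" by (intro tendsto_intros elim)
      then show ?case by simp
    qed
    show "AE x in M. norm ((f n x - g x)\<^sup>2) \<le> (B + C)\<^sup>2" for n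
    proof (rule AE_I2)
      fix x assume x: "x \<in> space M"
      have "\<bar>f n x - g x\<bar> \<le> B + C" using B[OF x, of n] gB[OF x] by linarith
      then show "norm ((f n x - g x)\<^sup>2) \<le> (B + C)\<^sup>2" using abs_le_square_iff by fastforce
    qed
  qed (use f g in auto)
  then show "(\<lambda>n. l2_sq M (\<lambda>x. f n x - g x)) \<longlonglongrightarrow> 0" by (simp add: l2_sq_def)
qed

section \<open>Wick's formula\<close>

text \<open>Moments are postulated for single elements only; since \<open>G\<close> is closed under
  linear combinations, all mixed moments follow by polarisation. The constants 3 and 15 are the
  numbers of pairings of four and of six points.\<close>

locale gaussian_space =
  fixes M :: "'a measure" and G :: "('a \<Rightarrow> real) set"
  assumes sq: "X \<in> G \<Longrightarrow> sq_integrable M X"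
    and add: "X \<in> G \<Longrightarrow> Y \<in> G \<Longrightarrow> (\<lambda>\<omega>. X \<omega> + Y \<omega>) \<in> G"
    and cmult: "X \<in> G \<Longrightarrow> (\<lambda>\<omega>. c * X \<omega>) \<in> G"
    and moment4: "X \<in> G \<Longrightarrow> has_bochner_integral M (\<lambda>\<omega>. X \<omega> ^ 4) (3 * (l2_sq M X)\<^sup>2)"
    and moment6: "X \<in> G \<Longrightarrow> has_bochner_integral M (\<lambda>\<omega>. X \<omega> ^ 6) (15 * (l2_sq M X) ^ 3)"
begin

abbreviation cov :: "('a \<Rightarrow> real) \<Rightarrow> ('a \<Rightarrow> real) \<Rightarrow> real" where
  "cov \<equiv> l2_inner M"

lemma lin: "X \<in> G \<Longrightarrow> Y \<in> G \<Longrightarrow> (\<lambda>\<omega>. X \<omega> + c * Y \<omega>) \<in> G"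
  by (intro add cmult)

lemma cov_lin_left:
  "X \<in> G \<Longrightarrow> Y \<in> G \<Longrightarrow> Z \<in> G \<Longrightarrow> cov (\<lambda>\<omega>. X \<omega> + c * Y \<omega>) Z = cov X Z + c * cov Y Z"
  by (simp add: l2_inner_add_left sq cmult l2_inner_cmult_left)

lemma cov_lin_right:
  "X \<in> G \<Longrightarrow> Y \<in> G \<Longrightarrow> Z \<in> G \<Longrightarrow> cov Z (\<lambda>\<omega>. X \<omega> + c * Y \<omega>) = cov Z X + c * cov Z Y"
  using cov_lin_left[of X Y Z c] by (simp add: l2_inner_commute)

lemma cov_lin_self:
  "X \<in> G \<Longrightarrow> Y \<in> G \<Longrightarrow>
   cov (\<lambda>\<omega>. X \<omega> + c * Y \<omega>) (\<lambda>\<omega>. X \<omega> + c * Y \<omega>) = cov X X + 2 * c * cov X Y + c\<^sup>2 * cov Y Y"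
  by (simp add: cov_lin_left cov_lin_right lin l2_inner_commute[of M Y X] algebra_simps power2_eq_square)

text \<open>The identity \<open>x * y = ((x + y)^2 - (x - y)^2) / 4\<close>, with a factor
  \<open>R\<close> carried along. The redundant coefficients \<open>1\<close> and \<open>-1\<close>
  make the arguments of \<open>q\<close> instances of the \<open>cov_lin\<close> lemmas, so the side
  condition on \<open>v\<close> becomes a polynomial identity in covariances.\<close>

lemma polarise:
  assumes "X \<in> G" "Y \<in> G"
    and q: "\<And>U. U \<in> G \<Longrightarrow> has_bochner_integral M (\<lambda>\<omega>. (U \<omega>)\<^sup>2 * R \<omega>) (q U)"
    and v: "4 * v = q (\<lambda>\<omega>. X \<omega> + 1 * Y \<omega>) - q (\<lambda>\<omega>. X \<omega> + (-1) * Y \<omega>)"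
  shows "has_bochner_integral M (\<lambda>\<omega>. X \<omega> * Y \<omega> * R \<omega>) v"
proof -
  have "has_bochner_integral M (\<lambda>\<omega>. ((X \<omega> + 1 * Y \<omega>)\<^sup>2 * R \<omega> - (X \<omega> + (-1) * Y \<omega>)\<^sup>2 * R \<omega>) / 4)
     ((q (\<lambda>\<omega>. X \<omega> + 1 * Y \<omega>) - q (\<lambda>\<omega>. X \<omega> + (-1) * Y \<omega>)) / 4)"
    by (intro has_bochner_integral_divide has_bochner_integral_diff q lin assms)
  moreover have "((x + 1 * y)\<^sup>2 * r - (x + (-1) * y)\<^sup>2 * r) / 4 = x * y * r" for x y r :: real
    by (simp add: power2_eq_square field_simps)
  moreover have "(q (\<lambda>\<omega>. X \<omega> + 1 * Y \<omega>) - q (\<lambda>\<omega>. X \<omega> + (-1) * Y \<omega>)) / 4 = v"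
    using v by simp
  ultimately show ?thesis by (simp only:)
qed

text \<open>In \<open>(x + y)^4 + (x - y)^4\<close> the odd terms cancel and
  \<open>12 * x^2 * y^2\<close> remains beside the pure fourth powers.\<close>

lemma moment22:
  assumes XY: "X \<in> G" "Y \<in> G"
  shows "has_bochner_integral M (\<lambda>\<omega>. (X \<omega>)\<^sup>2 * (Y \<omega>)\<^sup>2) (cov X X * cov Y Y + 2 * (cov X Y)\<^sup>2)"
proof -
  let ?v = "\<lambda>c. cov X X + 2 * c * cov X Y + c\<^sup>2 * cov Y Y"
  have m: "has_bochner_integral M (\<lambda>\<omega>. (X \<omega> + c * Y \<omega>) ^ 4) (3 * (?v c)\<^sup>2)" for c
    using moment4[OF lin[OF XY, of c]] cov_lin_self[OF XY, of c] by (simp add: l2_sq_inner)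
  have "has_bochner_integral M
      (\<lambda>\<omega>. ((X \<omega> + 1 * Y \<omega>) ^ 4 + (X \<omega> + (-1) * Y \<omega>) ^ 4 - 2 * X \<omega> ^ 4 - 2 * Y \<omega> ^ 4) / 12)
      ((3 * (?v 1)\<^sup>2 + 3 * (?v (-1))\<^sup>2 - 2 * (3 * (cov X X)\<^sup>2) - 2 * (3 * (cov Y Y)\<^sup>2)) / 12)"
    using moment4[OF XY(1)] moment4[OF XY(2)]
    by (intro has_bochner_integral_divide has_bochner_integral_diff has_bochner_integral_add
        has_bochner_integral_mult_right m) (simp_all add: l2_sq_inner)
  moreover have "((x + 1 * y) ^ 4 + (x + (-1) * y) ^ 4 - 2 * x ^ 4 - 2 * y ^ 4) / 12 = x\<^sup>2 * y\<^sup>2" for x y :: real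
    by (simp add: field_simps power4_eq_xxxx power2_eq_square)
  moreover have "(3 * (?v 1)\<^sup>2 + 3 * (?v (-1))\<^sup>2 - 2 * (3 * (cov X X)\<^sup>2) - 2 * (3 * (cov Y Y)\<^sup>2)) / 12
     = cov X X * cov Y Y + 2 * (cov X Y)\<^sup>2"
    by (simp add: field_simps power2_eq_square)
  ultimately show ?thesis by (simp only:)
qed

text \<open>Two polarisations of \<open>moment22\<close>, one in each squared slot.\<close>

lemma wick4:
  assumes G: "X1 \<in> G" "X2 \<in> G" "Y1 \<in> G" "Y2 \<in> G"
  shows "has_bochner_integral M (\<lambda>\<omega>. X1 \<omega> * X2 \<omega> * (Y1 \<omega> * Y2 \<omega>))
    (cov X1 X2 * cov Y1 Y2 + cov X1 Y1 * cov X2 Y2 + cov X1 Y2 * cov X2 Y1)"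
proof -
  have 1: "has_bochner_integral M (\<lambda>\<omega>. X1 \<omega> * X2 \<omega> * (Y \<omega>)\<^sup>2) (cov X1 X2 * cov Y Y + 2 * cov X1 Y * cov X2 Y)"
    if Y: "Y \<in> G" for Y
    by (rule polarise[OF G(1,2) moment22[OF _ Y]], assumption)
       (simp only: cov_lin_self cov_lin_left G Y, simp add: field_simps power2_eq_square)
  have 1: "has_bochner_integral M (\<lambda>\<omega>. (Y \<omega>)\<^sup>2 * (X1 \<omega> * X2 \<omega>)) (cov X1 X2 * cov Y Y + 2 * cov X1 Y * cov X2 Y)"
    if Y: "Y \<in> G" for Y
    using 1[OF Y] by (simp add: mult.commute)
  have "has_bochner_integral M (\<lambda>\<omega>. Y1 \<omega> * Y2 \<omega> * (X1 \<omega> * X2 \<omega>))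
    (cov X1 X2 * cov Y1 Y2 + cov X1 Y1 * cov X2 Y2 + cov X1 Y2 * cov X2 Y1)"
    by (rule polarise[OF G(3,4) 1], assumption)
       (simp only: cov_lin_self cov_lin_right G, simp add: field_simps power2_eq_square)
  then show ?thesis by (simp add: mult.commute)
qed

text \<open>The even part of \<open>(x + c * y)^6\<close> has the coefficient
  \<open>15 * c^2\<close> at \<open>x^4 * y^2\<close> and \<open>15 * c^4\<close> at
  \<open>x^2 * y^4\<close>. Weighting \<open>c = 1\<close> by 16 against \<open>c = 2\<close>
  cancels the second and leaves \<open>360 * x^4 * y^2\<close>, up to the pure powers corrected by
  -30 and 96.\<close>

lemma moment42:
  assumes XY: "X \<in> G" "Y \<in> G"
  shows "has_bochner_integral M (\<lambda>\<omega>. X \<omega> ^ 4 * (Y \<omega>)\<^sup>2) (12 * cov X X * (cov X Y)\<^sup>2 + 3 * (cov X X)\<^sup>2 * cov Y Y)"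
proof -
  let ?v = "\<lambda>c. cov X X + 2 * c * cov X Y + c\<^sup>2 * cov Y Y"
  have m: "has_bochner_integral M (\<lambda>\<omega>. (X \<omega> + c * Y \<omega>) ^ 6) (15 * (?v c) ^ 3)" for c
    using moment6[OF lin[OF XY, of c]] cov_lin_self[OF XY, of c] by (simp add: l2_sq_inner)
  have "has_bochner_integral M
      (\<lambda>\<omega>. (16 * ((X \<omega> + 1 * Y \<omega>) ^ 6 + (X \<omega> + (-1) * Y \<omega>) ^ 6)
          - ((X \<omega> + 2 * Y \<omega>) ^ 6 + (X \<omega> + (-2) * Y \<omega>) ^ 6) - 30 * X \<omega> ^ 6 + 96 * Y \<omega> ^ 6) / 360)
      ((16 * (15 * (?v 1) ^ 3 + 15 * (?v (-1)) ^ 3) - (15 * (?v 2) ^ 3 + 15 * (?v (-2)) ^ 3)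
          - 30 * (15 * (cov X X) ^ 3) + 96 * (15 * (cov Y Y) ^ 3)) / 360)"
    using moment6[OF XY(1)] moment6[OF XY(2)]
    by (intro has_bochner_integral_divide has_bochner_integral_diff has_bochner_integral_add
        has_bochner_integral_mult_right m) (simp_all add: l2_sq_inner)
  moreover have "(16 * ((x + 1 * y) ^ 6 + (x + (-1) * y) ^ 6)
          - ((x + 2 * y) ^ 6 + (x + (-2) * y) ^ 6) - 30 * x ^ 6 + 96 * y ^ 6) / 360 = x ^ 4 * y\<^sup>2" for x y :: real
    by (simp add: divide_eq_eq) algebra
  moreover have "(16 * (15 * (?v 1) ^ 3 + 15 * (?v (-1)) ^ 3) - (15 * (?v 2) ^ 3 + 15 * (?v (-2)) ^ 3)
          - 30 * (15 * (cov X X) ^ 3) + 96 * (15 * (cov Y Y) ^ 3)) / 360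
     = 12 * cov X X * (cov X Y)\<^sup>2 + 3 * (cov X X)\<^sup>2 * cov Y Y"
    by (simp add: divide_eq_eq) algebra
  ultimately show ?thesis by (simp only:)
qed

text \<open>The combination of \<open>moment22\<close>, now in \<open>X\<close> and
  \<open>Z\<close>, with the factor \<open>Y^2\<close> carried along through
  \<open>moment42\<close>.\<close>

lemma moment222:
  assumes G: "X \<in> G" "Y \<in> G" "Z \<in> G"
  shows "has_bochner_integral M (\<lambda>\<omega>. (X \<omega>)\<^sup>2 * ((Y \<omega>)\<^sup>2 * (Z \<omega>)\<^sup>2))
    (cov X X * cov Y Y * cov Z Z + 2 * (cov X X * (cov Y Z)\<^sup>2 + cov Y Y * (cov X Z)\<^sup>2 + cov Z Z * (cov X Y)\<^sup>2)
      + 8 * cov X Y * cov Y Z * cov X Z)"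
proof -
  let ?v = "\<lambda>c. cov X X + 2 * c * cov X Z + c\<^sup>2 * cov Z Z"
  let ?w = "\<lambda>c. cov X Y + c * cov Z Y"
  let ?f = "\<lambda>c. 12 * ?v c * (?w c)\<^sup>2 + 3 * (?v c)\<^sup>2 * cov Y Y"
  have m: "has_bochner_integral M (\<lambda>\<omega>. (X \<omega> + c * Z \<omega>) ^ 4 * (Y \<omega>)\<^sup>2) (?f c)" for c
    using moment42[OF lin[OF G(1,3), of c] G(2)] by (simp only: cov_lin_self cov_lin_left G)
  have "has_bochner_integral M
      (\<lambda>\<omega>. ((X \<omega> + 1 * Z \<omega>) ^ 4 * (Y \<omega>)\<^sup>2 + (X \<omega> + (-1) * Z \<omega>) ^ 4 * (Y \<omega>)\<^sup>2
         - 2 * (X \<omega> ^ 4 * (Y \<omega>)\<^sup>2) - 2 * (Z \<omega> ^ 4 * (Y \<omega>)\<^sup>2)) / 12)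
      ((?f 1 + ?f (-1) - 2 * (12 * cov X X * (cov X Y)\<^sup>2 + 3 * (cov X X)\<^sup>2 * cov Y Y)
         - 2 * (12 * cov Z Z * (cov Z Y)\<^sup>2 + 3 * (cov Z Z)\<^sup>2 * cov Y Y)) / 12)"
    by (intro has_bochner_integral_divide has_bochner_integral_diff has_bochner_integral_add
        has_bochner_integral_mult_right m moment42 G)
  moreover have "((x + 1 * z) ^ 4 * y\<^sup>2 + (x + (-1) * z) ^ 4 * y\<^sup>2
         - 2 * (x ^ 4 * y\<^sup>2) - 2 * (z ^ 4 * y\<^sup>2)) / 12 = x\<^sup>2 * (y\<^sup>2 * z\<^sup>2)" for x y z :: real
    by (simp add: divide_eq_eq) algebra
  moreover have "(?f 1 + ?f (-1) - 2 * (12 * cov X X * (cov X Y)\<^sup>2 + 3 * (cov X X)\<^sup>2 * cov Y Y)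
         - 2 * (12 * cov Z Z * (cov Z Y)\<^sup>2 + 3 * (cov Z Z)\<^sup>2 * cov Y Y)) / 12
     = cov X X * cov Y Y * cov Z Z + 2 * (cov X X * (cov Y Z)\<^sup>2 + cov Y Y * (cov X Z)\<^sup>2 + cov Z Z * (cov X Y)\<^sup>2)
      + 8 * cov X Y * cov Y Z * cov X Z"
    unfolding l2_inner_commute[of M Z Y] by (simp add: divide_eq_eq) algebra
  ultimately show ?thesis by (simp only:)
qed

text \<open>Three polarisations of \<open>moment222\<close>. Of the fifteen pairings, the first six
  match the two triples completely; the other nine contract one pair inside each triple and are
  grouped by the pair contracted in the first one. The six become kernel terms and the nine become
  trace terms in \<open>form3_bound\<close>.\<close>

lemma wick6:
  assumes G: "X1 \<in> G" "Y1 \<in> G" "Z1 \<in> G" "X2 \<in> G" "Y2 \<in> G" "Z2 \<in> G"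
  shows "has_bochner_integral M (\<lambda>\<omega>. (X1 \<omega> * Y1 \<omega> * Z1 \<omega>) * (X2 \<omega> * Y2 \<omega> * Z2 \<omega>))
   (cov X1 X2 * cov Y1 Y2 * cov Z1 Z2 + cov X1 X2 * cov Y1 Z2 * cov Z1 Y2
  + cov X1 Y2 * cov Y1 X2 * cov Z1 Z2 + cov X1 Y2 * cov Y1 Z2 * cov Z1 X2
  + cov X1 Z2 * cov Y1 X2 * cov Z1 Y2 + cov X1 Z2 * cov Y1 Y2 * cov Z1 X2
  + (cov X1 Y1 * cov X2 Y2 * cov Z1 Z2 + cov X1 Y1 * cov X2 Z2 * cov Z1 Y2 + cov X1 Y1 * cov Y2 Z2 * cov Z1 X2)
  + (cov X1 Z1 * cov X2 Y2 * cov Y1 Z2 + cov X1 Z1 * cov X2 Z2 * cov Y1 Y2 + cov X1 Z1 * cov Y2 Z2 * cov Y1 X2)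
  + (cov Y1 Z1 * cov X2 Y2 * cov X1 Z2 + cov Y1 Z1 * cov X2 Z2 * cov X1 Y2 + cov Y1 Z1 * cov Y2 Z2 * cov X1 X2))"
proof -
  have 1: "has_bochner_integral M (\<lambda>\<omega>. (Y \<omega>)\<^sup>2 * (X1 \<omega> * X2 \<omega> * (Z \<omega>)\<^sup>2))
     (cov X1 X2 * cov Y Y * cov Z Z + 2 * (cov X1 X2 * (cov Y Z)\<^sup>2 + cov Y Y * cov X1 Z * cov X2 Z
        + cov Z Z * cov X1 Y * cov X2 Y) + 4 * cov Y Z * (cov X1 Y * cov X2 Z + cov X2 Y * cov X1 Z))"
    if YZ: "Y \<in> G" "Z \<in> G" for Y Z
  proof -
    have "has_bochner_integral M (\<lambda>\<omega>. X1 \<omega> * X2 \<omega> * ((Y \<omega>)\<^sup>2 * (Z \<omega>)\<^sup>2))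
     (cov X1 X2 * cov Y Y * cov Z Z + 2 * (cov X1 X2 * (cov Y Z)\<^sup>2 + cov Y Y * cov X1 Z * cov X2 Z
        + cov Z Z * cov X1 Y * cov X2 Y) + 4 * cov Y Z * (cov X1 Y * cov X2 Z + cov X2 Y * cov X1 Z))"
      by (rule polarise[OF G(1,4) moment222[OF _ YZ]], assumption)
         (simp only: cov_lin_self cov_lin_left G YZ, simp only: power_one mult_1_left mult_1_right power2_minus mult_minus_left mult_minus_right, algebra)
    then show ?thesis by (simp add: mult_ac)
  qed
  have 2: "has_bochner_integral M (\<lambda>\<omega>. (Z \<omega>)\<^sup>2 * (X1 \<omega> * X2 \<omega> * (Y1 \<omega> * Y2 \<omega>)))
     (cov X1 X2 * cov Y1 Y2 * cov Z Z + 2 * cov X1 X2 * cov Y1 Z * cov Y2 Z + 2 * cov Y1 Y2 * cov X1 Z * cov X2 Z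
        + cov Z Z * (cov X1 Y1 * cov X2 Y2 + cov X1 Y2 * cov X2 Y1)
        + 2 * (cov Y1 Z * (cov X1 Y2 * cov X2 Z + cov X2 Y2 * cov X1 Z)
             + cov Y2 Z * (cov X1 Y1 * cov X2 Z + cov X2 Y1 * cov X1 Z)))"
    if Z: "Z \<in> G" for Z
  proof -
    have "has_bochner_integral M (\<lambda>\<omega>. Y1 \<omega> * Y2 \<omega> * (X1 \<omega> * X2 \<omega> * (Z \<omega>)\<^sup>2))
     (cov X1 X2 * cov Y1 Y2 * cov Z Z + 2 * cov X1 X2 * cov Y1 Z * cov Y2 Z + 2 * cov Y1 Y2 * cov X1 Z * cov X2 Z
        + cov Z Z * (cov X1 Y1 * cov X2 Y2 + cov X1 Y2 * cov X2 Y1)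
        + 2 * (cov Y1 Z * (cov X1 Y2 * cov X2 Z + cov X2 Y2 * cov X1 Z)
             + cov Y2 Z * (cov X1 Y1 * cov X2 Z + cov X2 Y1 * cov X1 Z)))"
      by (rule polarise[OF G(2,5) 1[OF _ Z]], assumption)
         (simp only: cov_lin_self cov_lin_left cov_lin_right G Z, simp only: power_one mult_1_left mult_1_right power2_minus mult_minus_left mult_minus_right, algebra)
    then show ?thesis by (simp add: mult_ac)
  qed
  have "has_bochner_integral M (\<lambda>\<omega>. Z1 \<omega> * Z2 \<omega> * (X1 \<omega> * X2 \<omega> * (Y1 \<omega> * Y2 \<omega>)))
   (cov X1 X2 * cov Y1 Y2 * cov Z1 Z2 + cov X1 X2 * cov Y1 Z2 * cov Z1 Y2
  + cov X1 Y2 * cov Y1 X2 * cov Z1 Z2 + cov X1 Y2 * cov Y1 Z2 * cov Z1 X2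
  + cov X1 Z2 * cov Y1 X2 * cov Z1 Y2 + cov X1 Z2 * cov Y1 Y2 * cov Z1 X2
  + (cov X1 Y1 * cov X2 Y2 * cov Z1 Z2 + cov X1 Y1 * cov X2 Z2 * cov Z1 Y2 + cov X1 Y1 * cov Y2 Z2 * cov Z1 X2)
  + (cov X1 Z1 * cov X2 Y2 * cov Y1 Z2 + cov X1 Z1 * cov X2 Z2 * cov Y1 Y2 + cov X1 Z1 * cov Y2 Z2 * cov Y1 X2)
  + (cov Y1 Z1 * cov X2 Y2 * cov X1 Z2 + cov Y1 Z1 * cov X2 Z2 * cov X1 Y2 + cov Y1 Z1 * cov Y2 Z2 * cov X1 X2))"
    by (rule polarise[OF G(3,6) 2], assumption)
       (simp only: cov_lin_self cov_lin_left cov_lin_right G l2_inner_commute[of M Z1 X2]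
          l2_inner_commute[of M Z1 Y2] l2_inner_commute[of M Y1 X2], simp only: power_one mult_1_left mult_1_right power2_minus mult_minus_left mult_minus_right, algebra)
  then show ?thesis by (simp add: mult_ac)
qed

end

section \<open>Gaussian random variables\<close>

context prob_space
begin

text \<open>The characteristic function admits the degenerate case \<open>v = 0\<close>, multiplies
  over independent sums and is continuous under mean-square limits; a density would have none of
  these advantages.\<close>

definition gaussian :: "('a \<Rightarrow> real) \<Rightarrow> real \<Rightarrow> bool" where
  "gaussian X v \<longleftrightarrow> X \<in> borel_measurable M \<and> 0 \<le> v \<and>
     (\<forall>s. char (distr M borel X) s = complex_of_real (exp (- (v * s\<^sup>2) / 2)))"

lemma char_distr:
  assumes [measurable]: "X \<in> borel_measurable M"
  shows "char (distr M borel X) s = (\<integral>x. iexp (s * X x) \<partial>M)"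
  by (simp add: char_def integral_distr)

text \<open>By Levy's uniqueness theorem the law is that of a standard normal variable scaled by
  \<open>sqrt v\<close>, also for \<open>v = 0\<close>. All moments are read off from the standard
  normal law.\<close>

lemma gaussian_distr:
  assumes X: "gaussian X v"
  shows "distr M borel X = distr std_normal_distribution borel (\<lambda>x. sqrt v * x)"
proof (rule Levy_uniqueness)
  have [measurable]: "X \<in> borel_measurable M" using X by (simp add: gaussian_def)
  show "real_distribution (distr M borel X)" by (rule real_distribution_distr) simp
  interpret S: real_distribution std_normal_distribution by (rule real_dist_normal_dist)
  show "real_distribution (distr std_normal_distribution borel (\<lambda>x. sqrt v * x))"
    by (rule S.real_distribution_distr) simp
  show "char (distr M borel X) = char (distr std_normal_distribution borel (\<lambda>x. sqrt v * x))"
  proof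
    fix s
    have "char (distr std_normal_distribution borel (\<lambda>x. sqrt v * x)) s = char std_normal_distribution (s * sqrt v)"
      by (subst S.char_distr) (auto simp: char_def mult.assoc)
    also have "\<dots> = complex_of_real (exp (- (v * s\<^sup>2) / 2))"
      using X by (simp add: char_std_normal_distribution power_mult_distrib gaussian_def mult.commute)
    finally show "char (distr M borel X) s = char (distr std_normal_distribution borel (\<lambda>x. sqrt v * x)) s"
      using X by (simp add: gaussian_def)
  qed
qed

lemma gaussian_moment:
  assumes X: "gaussian X v"
  shows "has_bochner_integral M (\<lambda>\<omega>. X \<omega> ^ (2 * k)) (v ^ k * (fact (2 * k) / (2 ^ k * fact k)))"
proof -
  have [measurable]: "X \<in> borel_measurable M" using X by (simp add: gaussian_def)
  have v: "sqrt v ^ (2 * k) = v ^ k" using X by (simp add: gaussian_def power_mult)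
  have "has_bochner_integral std_normal_distribution (\<lambda>x. (sqrt v * x) ^ (2 * k)) (v ^ k * (fact (2 * k) / (2 ^ k * fact k)))"
    unfolding power_mult_distrib v
    by (intro has_bochner_integral_mult_right)
       (auto simp: has_bochner_integral_iff std_normal_distribution_even_moments)
  then have "has_bochner_integral (distr M borel X) (\<lambda>x. x ^ (2 * k)) (v ^ k * (fact (2 * k) / (2 ^ k * fact k)))"
    unfolding gaussian_distr[OF X] by (intro has_bochner_integral_distr) auto
  then show ?thesis
    by (simp add: has_bochner_integral_iff integrable_distr_eq integral_distr)
qed

lemma gaussian_sq_integrable: "gaussian X v \<Longrightarrow> sq_integrable M X"
  using gaussian_moment[of X v 1] by (simp add: sq_integrable_def gaussian_def has_bochner_integral_iff)

lemma gaussian_l2_sq: "gaussian X v \<Longrightarrow> l2_sq M X = v"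
  using gaussian_moment[of X v 1] by (simp add: l2_sq_def has_bochner_integral_iff)

lemma gaussian_moment4: "gaussian X v \<Longrightarrow> has_bochner_integral M (\<lambda>\<omega>. X \<omega> ^ 4) (3 * v\<^sup>2)"
  using gaussian_moment[of X v 2] by (simp add: fact_numeral mult.commute)

lemma gaussian_moment6: "gaussian X v \<Longrightarrow> has_bochner_integral M (\<lambda>\<omega>. X \<omega> ^ 6) (15 * v ^ 3)"
  using gaussian_moment[of X v 3] by (simp add: fact_numeral mult.commute)

lemma gaussian_expectation:
  assumes X: "gaussian X v"
  shows "has_bochner_integral M X 0"
proof -
  have [measurable]: "X \<in> borel_measurable M" using X by (simp add: gaussian_def)
  have "has_bochner_integral std_normal_distribution (\<lambda>x. sqrt v * x) (sqrt v * 0)"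
    using integrable_std_normal_distribution_moment[of 1] integral_std_normal_distribution_moment_odd[of 1]
    by (intro has_bochner_integral_mult_right) (auto simp: has_bochner_integral_iff)
  then have "has_bochner_integral (distr M borel X) (\<lambda>x. x) 0"
    unfolding gaussian_distr[OF X] by (intro has_bochner_integral_distr) auto
  then show ?thesis
    by (simp add: has_bochner_integral_iff integrable_distr_eq integral_distr)
qed

lemma gaussian_zero: "gaussian (\<lambda>\<omega>. 0) 0"
  by (simp add: gaussian_def char_def integral_return)

lemma gaussian_cmult:
  assumes "gaussian X v"
  shows "gaussian (\<lambda>\<omega>. c * X \<omega>) (c\<^sup>2 * v)"
proof -
  have [measurable]: "X \<in> borel_measurable M" using assms by (simp add: gaussian_def)
  have "char (distr M borel (\<lambda>\<omega>. c * X \<omega>)) s = char (distr M borel X) (s * c)" for s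
    by (simp add: char_distr mult.assoc)
  then show ?thesis using assms by (auto simp: gaussian_def power_mult_distrib mult_ac)
qed

lemma gaussian_add_indep:
  assumes "indep_var borel X borel Y" "gaussian X v" "gaussian Y u"
  shows "gaussian (\<lambda>\<omega>. X \<omega> + Y \<omega>) (v + u)"
  using assms by (auto simp: gaussian_def char_distr_add add_divide_distrib distrib_right exp_add[symmetric]
      simp flip: of_real_mult)

lemma gaussian_sum_indep:
  assumes ind: "indep_vars (\<lambda>_. borel) X I" and I: "finite I" and g: "\<And>i. i \<in> I \<Longrightarrow> gaussian (X i) (v i)"
  shows "gaussian (\<lambda>\<omega>. \<Sum>i\<in>I. X i \<omega>) (\<Sum>i\<in>I. v i)"
proof -
  have "(\<lambda>\<omega>. \<Sum>i\<in>I. X i \<omega>) \<in> borel_measurable M" using g by (intro borel_measurable_sum) (auto simp: gaussian_def)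
  moreover have "char (distr M borel (\<lambda>\<omega>. \<Sum>i\<in>I. X i \<omega>)) s = complex_of_real (exp (- ((\<Sum>i\<in>I. v i) * s\<^sup>2) / 2))" for s
  proof -
    have "char (distr M borel (\<lambda>\<omega>. \<Sum>i\<in>I. X i \<omega>)) s = (\<Prod>i\<in>I. complex_of_real (exp (- (v i * s\<^sup>2) / 2)))"
      unfolding char_distr_sum[OF ind] using g by (intro prod.cong) (auto simp: gaussian_def)
    also have "\<dots> = complex_of_real (exp (\<Sum>i\<in>I. - (v i * s\<^sup>2) / 2))"
      using I by (simp add: exp_sum)
    also have "(\<Sum>i\<in>I. - (v i * s\<^sup>2) / 2) = - ((\<Sum>i\<in>I. v i) * s\<^sup>2) / 2"
      by (simp add: sum_distrib_right sum_negf sum_divide_distrib)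
    finally show ?thesis .
  qed
  ultimately show ?thesis using g by (auto simp: gaussian_def intro!: sum_nonneg)
qed

lemma gaussian_normal:
  assumes X: "distributed M lborel X (normal_density 0 \<sigma>)" and \<sigma>: "0 < \<sigma>"
  shows "gaussian X (\<sigma>\<^sup>2)"
proof -
  have [measurable]: "X \<in> borel_measurable M" using distributed_measurable[OF X] by simp
  have "distributed M lborel (\<lambda>x. (X x - 0) / \<sigma>) std_normal_density"
    using normal_standard_normal_convert[OF \<sigma>, of X 0] X by blast
  then have d: "distr M lborel (\<lambda>x. X x / \<sigma>) = std_normal_distribution"
    by (simp add: distributed_distr_eq_density)
  have "distr M borel (\<lambda>x. X x / \<sigma>) = distr M lborel (\<lambda>x. X x / \<sigma>)" by (rule distr_cong) auto
  with d have d: "distr M borel (\<lambda>x. X x / \<sigma>) = std_normal_distribution" by simp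
  have "gaussian (\<lambda>x. X x / \<sigma>) 1"
    unfolding gaussian_def d char_std_normal_distribution by auto
  from gaussian_cmult[OF this, of \<sigma>] show ?thesis using \<sigma> by simp
qed

text \<open>The characteristic functions converge because the difference of
  \<open>iexp (s * x)\<close> and \<open>iexp (s * y)\<close> is at most
  \<open>\<bar>s\<bar> * \<bar>x - y\<bar>\<close> in norm, and the variances converge because they
  are the squared norms.\<close>

lemma gaussian_l2_lim:
  assumes lim: "l2_lim M X Y" and g: "\<And>n. gaussian (X n) (v n)"
  shows "gaussian Y (l2_sq M Y)"
proof -
  have [measurable]: "X n \<in> borel_measurable M" "Y \<in> borel_measurable M" for n
    using l2_limD(1,2)[OF lim] by (auto dest: sq_integrable_measurable)
  have v: "v \<longlonglongrightarrow> l2_sq M Y"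
    using l2_sq_tendsto[OF lim] gaussian_l2_sq[OF g] by simp
  have "char (distr M borel Y) s = complex_of_real (exp (- (l2_sq M Y * s\<^sup>2) / 2))" for s
  proof (rule LIMSEQ_unique)
    show "(\<lambda>n. char (distr M borel (X n)) s) \<longlonglongrightarrow> complex_of_real (exp (- (l2_sq M Y * s\<^sup>2) / 2))"
      using g unfolding gaussian_def by (auto intro!: tendsto_intros v)
    have sq1: "sq_integrable M (\<lambda>\<omega>. 1)" by (simp add: sq_integrable_def)
    have one: "l2_sq M (\<lambda>\<omega>. 1) = 1" by (simp add: l2_sq_def prob_space)
    have bound: "norm (char (distr M borel (X n)) s - char (distr M borel Y) s) \<le>
       \<bar>s\<bar> * sqrt (l2_sq M (\<lambda>\<omega>. X n \<omega> - Y \<omega>))" for n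
    proof -
      have d: "sq_integrable M (\<lambda>\<omega>. X n \<omega> - Y \<omega>)" using l2_limD[OF lim] by (intro sq_integrable_diff)
      have da: "sq_integrable M (\<lambda>\<omega>. \<bar>X n \<omega> - Y \<omega>\<bar>)"
        using d by (simp add: sq_integrable_def)
      have int: "integrable M (\<lambda>\<omega>. iexp (s * Z \<omega>))" if "Z \<in> borel_measurable M" for Z :: "'a \<Rightarrow> real"
        using that by (intro integrable_const_bound[where B=1]) auto
      have "char (distr M borel (X n)) s - char (distr M borel Y) s = (\<integral>\<omega>. iexp (s * X n \<omega>) - iexp (s * Y \<omega>) \<partial>M)"
        by (simp add: char_distr int del: of_real_mult)
      also have "norm \<dots> \<le> (\<integral>\<omega>. norm (iexp (s * X n \<omega>) - iexp (s * Y \<omega>)) \<partial>M)"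
        by (rule integral_norm_bound)
      also have "\<dots> \<le> (\<integral>\<omega>. \<bar>s\<bar> * (1 * \<bar>X n \<omega> - Y \<omega>\<bar>) \<partial>M)"
      proof (rule integral_mono)
        show "integrable M (\<lambda>\<omega>. norm (iexp (s * X n \<omega>) - iexp (s * Y \<omega>)))"
          by (intro integrable_norm Bochner_Integration.integrable_diff int) auto
        show "integrable M (\<lambda>\<omega>. \<bar>s\<bar> * (1 * \<bar>X n \<omega> - Y \<omega>\<bar>))"
          by (intro integrable_mult_right sq_integrable_mult[OF sq1 da])
        show "norm (iexp (s * X n \<omega>) - iexp (s * Y \<omega>)) \<le> \<bar>s\<bar> * (1 * \<bar>X n \<omega> - Y \<omega>\<bar>)" for \<omega>
        proof -
          have "norm (iexp (s * X n \<omega>) - iexp (s * Y \<omega>)) = norm (iexp (s * Y \<omega>) * (iexp (s * (X n \<omega> - Y \<omega>)) - 1))"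
            by (simp add: algebra_simps flip: exp_add)
          also have "\<dots> = norm (iexp (s * (X n \<omega> - Y \<omega>)) - 1)"
            by (simp add: norm_mult del: of_real_mult of_real_diff)
          also have "\<dots> \<le> \<bar>s * (X n \<omega> - Y \<omega>)\<bar>"
            using iexp_approx1[of "s * (X n \<omega> - Y \<omega>)" 0] by (simp del: of_real_mult of_real_diff)
          finally show ?thesis by (simp add: abs_mult)
        qed
      qed
      also have "\<dots> = \<bar>s\<bar> * l2_inner M (\<lambda>\<omega>. 1) (\<lambda>\<omega>. \<bar>X n \<omega> - Y \<omega>\<bar>)" by (simp add: l2_inner_def)
      also have "\<dots> \<le> \<bar>s\<bar> * (sqrt (l2_sq M (\<lambda>\<omega>. 1)) * sqrt (l2_sq M (\<lambda>\<omega>. \<bar>X n \<omega> - Y \<omega>\<bar>)))"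
        using l2_cauchy_schwarz[OF sq1 da] by (intro mult_left_mono) auto
      also have "\<dots> = \<bar>s\<bar> * sqrt (l2_sq M (\<lambda>\<omega>. X n \<omega> - Y \<omega>))"
        unfolding one by (simp add: l2_sq_def)
      finally show ?thesis .
    qed
    have z: "(\<lambda>n. \<bar>s\<bar> * sqrt (l2_sq M (\<lambda>\<omega>. X n \<omega> - Y \<omega>))) \<longlonglongrightarrow> 0"
      using tendsto_mult_left[OF tendsto_real_sqrt[OF l2_limD(3)[OF lim]], of "\<bar>s\<bar>"] by simp
    have "(\<lambda>n. char (distr M borel (X n)) s - char (distr M borel Y) s) \<longlonglongrightarrow> 0"
      by (rule Lim_null_comparison[OF always_eventually[OF allI[OF bound]] z])
    then show "(\<lambda>n. char (distr M borel (X n)) s) \<longlonglongrightarrow> char (distr M borel Y) s"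
      by (simp add: LIM_zero_iff)
  qed
  then show ?thesis by (simp add: gaussian_def)
qed

end

section \<open>The Gaussian space of a Wiener process\<close>

lemma measurable_mono_sets:
  "f \<in> measurable A N \<Longrightarrow> space A = space B \<Longrightarrow> sets A \<subseteq> sets B \<Longrightarrow> f \<in> measurable B N"
  by (auto simp: measurable_def)

locale wiener_interval =
  fixes M :: "'a measure" and F :: "real \<Rightarrow> 'a measure" and m :: nat
    and W :: "nat \<Rightarrow> real \<Rightarrow> 'a \<Rightarrow> real" and t T :: real
  assumes wiener: "wiener_mdim M F m W" and t_nonneg: "0 \<le> t" and t_less_T: "t < T"
begin

sublocale prob_space M
  using wiener by (simp add: wiener_mdim_def)

lemma filtration_F: "filtration (space M) F"
  using wiener unfolding wiener_mdim_def by (elim conjE)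

lemmas space_F = filtration.space_F[OF filtration_F]
  and sets_F_mono = filtration.sets_F_mono[OF filtration_F]

lemma sets_F: "sets (F s) \<subseteq> sets M"
  using wiener unfolding wiener_mdim_def by (elim conjE) (erule spec)

lemma measurable_F_mono: "X \<in> borel_measurable (F a) \<Longrightarrow> a \<le> b \<Longrightarrow> X \<in> borel_measurable (F b)"
  by (erule measurable_mono_sets) (auto simp: space_F sets_F_mono)

lemma measurable_F_M: "X \<in> borel_measurable (F a) \<Longrightarrow> X \<in> borel_measurable M"
  by (erule measurable_mono_sets) (auto simp: space_F sets_F)

lemma W_measurable_F: "i \<in> {1..m} \<Longrightarrow> 0 \<le> s \<Longrightarrow> s \<le> b \<Longrightarrow> W i s \<in> borel_measurable (F b)"
  using wiener measurable_F_mono[of "W i s" s b] unfolding wiener_mdim_def by blast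

lemma increment_gaussian:
  assumes "i \<in> {1..m}" "0 \<le> a" "a < b"
  shows "gaussian (\<lambda>\<omega>. W i b \<omega> - W i a \<omega>) (b - a)"
proof -
  have "distributed M lborel (\<lambda>\<omega>. W i b \<omega> - W i a \<omega>) (\<lambda>x. ennreal (normal_density 0 (sqrt (b - a)) x))"
    using wiener assms unfolding wiener_mdim_def by blast
  from gaussian_normal[OF this] assms show ?thesis by simp
qed

lemma increments_indep_vars:
  "0 \<le> a \<Longrightarrow> a < b \<Longrightarrow> indep_vars (\<lambda>_. borel) (\<lambda>i \<omega>. W i b \<omega> - W i a \<omega>) {1..m}"
  using wiener unfolding wiener_mdim_def by blast

lemma increments_sum_gaussian:
  assumes "0 \<le> a" "a < b"
  shows "gaussian (\<lambda>\<omega>. \<Sum>i\<in>{1..m}. d i * (W i b \<omega> - W i a \<omega>)) (\<Sum>i\<in>{1..m}. (d i)\<^sup>2 * (b - a))"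
proof (rule gaussian_sum_indep)
  show "indep_vars (\<lambda>_. borel) (\<lambda>i \<omega>. d i * (W i b \<omega> - W i a \<omega>)) {1..m}"
    using indep_vars_compose2[OF increments_indep_vars[OF assms], of "\<lambda>i x. d i * x" "\<lambda>_. borel"] by simp
  show "gaussian (\<lambda>\<omega>. d i * (W i b \<omega> - W i a \<omega>)) ((d i)\<^sup>2 * (b - a))" if "i \<in> {1..m}" for i
    by (intro gaussian_cmult increment_gaussian that assms)
qed simp

text \<open>The filtration at time \<open>a\<close> is independent of the sigma-algebra generated by
  the vector of all component increments after \<open>a\<close>; a linear combination of these
  increments is measurable for that sigma-algebra.\<close>

lemma past_indep_increments:
  assumes ab: "0 \<le> a" "a < b" and X: "X \<in> borel_measurable (F a)"
  shows "indep_var borel X borel (\<lambda>\<omega>. \<Sum>i\<in>{1..m}. d i * (W i b \<omega> - W i a \<omega>))" (is "indep_var _ _ _ ?Y")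
proof -
  define V where "V \<omega> = restrict (\<lambda>i. W i b \<omega> - W i a \<omega>) {1..m}" for \<omega>
  let ?P = "PiM {1..m} (\<lambda>_. borel :: real measure)"
  let ?A = "vimage_algebra (space M) V ?P"
  have ind: "indep_set (sets (F a)) (sets ?A)"
    using wiener ab unfolding wiener_mdim_def V_def by blast
  have V: "V \<in> measurable ?A ?P"
    by (rule measurable_vimage_algebra1) (auto simp: V_def space_PiM)
  have g: "(\<lambda>v. \<Sum>i\<in>{1..m}. d i * v i) \<in> borel_measurable ?P"
    by (intro borel_measurable_sum borel_measurable_times borel_measurable_const measurable_component_singleton)
  have "?Y = (\<lambda>\<omega>. \<Sum>i\<in>{1..m}. d i * V \<omega> i)" by (auto simp: V_def)
  then have Y: "?Y \<in> borel_measurable ?A"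
    using measurable_compose[OF V g] by simp
  have YM: "?Y \<in> borel_measurable M"
    using increments_sum_gaussian[OF ab] by (simp add: gaussian_def)
  have s1: "{X -` B \<inter> space M | B. B \<in> sets borel} \<subseteq> sets (F a)"
    using measurable_sets[OF X] by (auto simp: space_F)
  have s2: "{?Y -` B \<inter> space M | B. B \<in> sets borel} \<subseteq> sets ?A"
    using measurable_sets[OF Y] by auto
  show ?thesis
    unfolding indep_var_eq
  proof (intro conjI measurable_F_M[OF X] YM)
    have X': "sigma_sets (space M) {X -` B \<inter> space M | B. B \<in> sets borel} \<subseteq> sets (F a)"
      using sets.sigma_sets_subset[OF s1] by (simp add: space_F)
    have Y': "sigma_sets (space M) {?Y -` B \<inter> space M | B. B \<in> sets borel} \<subseteq> sets ?A"
      using sets.sigma_sets_subset[OF s2] by simp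
    show "indep_set (sigma_sets (space M) {X -` B \<inter> space M | B. B \<in> sets borel})
        (sigma_sets (space M) {?Y -` B \<inter> space M | B. B \<in> sets borel})"
      unfolding indep_set_def
      by (rule indep_sets_mono_sets[OF ind[unfolded indep_set_def]])
         (simp add: X' Y' split: bool.split del: One_nat_def)
  qed
qed

section \<open>Increments after time \<open>t\<close> and the Gaussian space they span\<close>

definition inc :: "nat \<Rightarrow> real \<Rightarrow> 'a \<Rightarrow> real" where
  "inc i u \<omega> = W i u \<omega> - W i t \<omega>"

definition inc_sum :: "(nat \<Rightarrow> real \<Rightarrow> real) \<Rightarrow> real set \<Rightarrow> 'a \<Rightarrow> real" where
  "inc_sum c U \<omega> = (\<Sum>i\<in>{1..m}. \<Sum>u\<in>U. c i u * inc i u \<omega>)"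

lemma inc_measurable_F: "i \<in> {1..m} \<Longrightarrow> t \<le> u \<Longrightarrow> u \<le> b \<Longrightarrow> inc i u \<in> borel_measurable (F b)"
  unfolding inc_def[abs_def] using t_nonneg
  by (intro borel_measurable_diff W_measurable_F) auto

lemma inc_sum_measurable_F:
  "(\<And>u. u \<in> U \<Longrightarrow> t \<le> u \<and> u \<le> b) \<Longrightarrow> inc_sum c U \<in> borel_measurable (F b)"
  unfolding inc_sum_def[abs_def]
  by (intro borel_measurable_sum borel_measurable_times borel_measurable_const inc_measurable_F) auto

text \<open>Induction on the largest time \<open>b\<close>. With \<open>a\<close> a bound of the
  earlier times, the increment up to \<open>b\<close> is the increment up to \<open>a\<close> plus a
  fresh one over \<open>[a, b]\<close>. The fresh part is independent of everything up to
  \<open>a\<close>, and the rest is again a combination over the earlier times.\<close>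

lemma inc_sum_gaussian:
  assumes "finite U" "U \<subseteq> {t..}"
  shows "\<exists>v. gaussian (inc_sum c U) v"
  using assms
proof (induction U arbitrary: c rule: finite_linorder_max_induct)
  case empty
  then show ?case using gaussian_zero by (auto simp: inc_sum_def[abs_def])
next
  case (insert b A)
  have bA: "b \<notin> A" using insert.hyps by auto
  show ?case
  proof (cases "b = t")
    case True
    then have "A = {}" using insert.hyps insert.prems by force
    then have "inc_sum c (insert b A) = (\<lambda>\<omega>. 0)" using True by (auto simp: inc_sum_def inc_def)
    then show ?thesis using gaussian_zero by metis
  next
    case False
    then have tb: "t < b" using insert.prems by auto
    \<comment> \<open>\<open>c'\<close> moves the coefficient at \<open>b\<close> to the largest
      earlier time. If there is none, \<open>a = t\<close> works, since the increments at
      \<open>t\<close> vanish.\<close>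
    obtain a c' where a: "t \<le> a" "a < b" "\<And>u. u \<in> A \<Longrightarrow> u \<le> a"
      and c': "\<And>\<omega>. (\<Sum>i\<in>{1..m}. \<Sum>u\<in>A. c i u * inc i u \<omega>) + (\<Sum>i\<in>{1..m}. c i b * inc i a \<omega>) = inc_sum c' A \<omega>"
    proof (cases "A = {}")
      case True
      then show ?thesis by (intro that[of t c]) (auto simp: tb inc_sum_def inc_def)
    next
      case False
      let ?a = "Max A"
      have aA: "?a \<in> A" using False insert.hyps by auto
      show ?thesis
      proof (rule that[of ?a "\<lambda>i u. c i u + (if u = ?a then c i b else 0)"])
        show "t \<le> ?a" "?a < b" using aA insert.hyps insert.prems by auto
        show "u \<le> ?a" if "u \<in> A" for u using that insert.hyps by auto
        show "(\<Sum>i\<in>{1..m}. \<Sum>u\<in>A. c i u * inc i u \<omega>) + (\<Sum>i\<in>{1..m}. c i b * inc i ?a \<omega>) =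
           inc_sum (\<lambda>i u. c i u + (if u = ?a then c i b else 0)) A \<omega>" for \<omega>
          using aA insert.hyps
          by (simp add: inc_sum_def distrib_right sum.distrib if_distrib[of "\<lambda>x. x * _"] sum.delta cong: if_cong)
      qed
    qed
    have "inc_sum c (insert b A) \<omega> = inc_sum c' A \<omega> + (\<Sum>i\<in>{1..m}. c i b * (W i b \<omega> - W i a \<omega>))" for \<omega>
      unfolding c'[symmetric] using bA insert.hyps
      by (simp add: inc_sum_def inc_def sum.distrib algebra_simps sum_subtractf)
    then have eq: "inc_sum c (insert b A) = (\<lambda>\<omega>. inc_sum c' A \<omega> + (\<Sum>i\<in>{1..m}. c i b * (W i b \<omega> - W i a \<omega>)))"
      by auto
    obtain v where v: "gaussian (inc_sum c' A) v" using insert.IH[of c'] insert.prems by auto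
    have "indep_var borel (inc_sum c' A) borel (\<lambda>\<omega>. \<Sum>i\<in>{1..m}. c i b * (W i b \<omega> - W i a \<omega>))"
      using a t_nonneg insert.prems by (intro past_indep_increments inc_sum_measurable_F) auto
    from gaussian_add_indep[OF this v increments_sum_gaussian] show ?thesis
      unfolding eq using a t_nonneg by auto
  qed
qed

lemma inc_gaussian:
  assumes "i \<in> {1..m}" "t \<le> u"
  shows "gaussian (inc i u) (u - t)"
proof (cases "u = t")
  case True
  then show ?thesis using gaussian_zero by (simp add: inc_def[abs_def])
next
  case False
  then show ?thesis unfolding inc_def[abs_def] using assms t_nonneg by (intro increment_gaussian) auto
qed

lemma inc_sq_integrable: "i \<in> {1..m} \<Longrightarrow> t \<le> u \<Longrightarrow> sq_integrable M (inc i u)"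
  using inc_gaussian gaussian_sq_integrable by blast

lemma inc_cov_same:
  assumes ij: "i \<in> {1..m}" "j \<in> {1..m}" and u: "t \<le> u"
  shows "l2_inner M (inc i u) (inc j u) = (if i = j then u - t else 0)"
proof (cases "i = j")
  case True
  then show ?thesis
    using gaussian_l2_sq[OF inc_gaussian[OF ij(1) u]] by (simp add: l2_sq_inner)
next
  case False
  show ?thesis
  proof (cases "u = t")
    case True
    then show ?thesis by (simp add: l2_inner_def inc_def)
  next
    case False
    then have tu: "t < u" using u by simp
    have iv: "indep_vars (\<lambda>_. borel) (\<lambda>i \<omega>. inc i u \<omega>) {i, j}"
      using indep_vars_subset[OF increments_indep_vars[OF t_nonneg tu], of "{i,j}"] ij by (simp add: inc_def)
    have int: "has_bochner_integral M (inc k u) 0" if "k \<in> {i, j}" for k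
      using that ij inc_gaussian[OF _ u] gaussian_expectation by blast
    have "(\<integral>\<omega>. (\<Prod>k\<in>{i, j}. inc k u \<omega>) \<partial>M) = (\<Prod>k\<in>{i, j}. \<integral>\<omega>. inc k u \<omega> \<partial>M)"
      using int by (intro indep_vars_lebesgue_integral iv) (auto simp: has_bochner_integral_iff)
    also have "\<dots> = 0" using int[of i] \<open>i \<noteq> j\<close> by (simp add: has_bochner_integral_iff)
    finally show ?thesis using \<open>i \<noteq> j\<close> by (simp add: l2_inner_def)
  qed
qed

text \<open>The part of \<open>inc j v\<close> after \<open>u\<close> is centred and independent of
  the past at \<open>u\<close>, so only the covariance at the common time \<open>u\<close>
  remains.\<close>

lemma inc_cov_le:
  assumes ij: "i \<in> {1..m}" "j \<in> {1..m}" and u: "t \<le> u" "u \<le> v"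
  shows "l2_inner M (inc i u) (inc j v) = (if i = j then u - t else 0)"
proof (cases "u = v")
  case True
  then show ?thesis using inc_cov_same[OF ij u(1)] by simp
next
  case False
  then have uv: "u < v" using u by simp
  have g: "gaussian (\<lambda>\<omega>. W j v \<omega> - W j u \<omega>) (v - u)"
    using ij u uv t_nonneg by (intro increment_gaussian) auto
  \<comment> \<open>Independence is available for combinations of all components; the unit
    coefficient vector selects the component \<open>j\<close>.\<close>
  have "(\<lambda>\<omega>. \<Sum>k\<in>{1..m}. (if k = j then 1 else 0) * (W k v \<omega> - W k u \<omega>)) = (\<lambda>\<omega>. W j v \<omega> - W j u \<omega>)"
    using ij by (auto simp: if_distrib[of "\<lambda>x. x * _"] cong: if_cong)
  then have ind: "indep_var borel (inc i u) borel (\<lambda>\<omega>. W j v \<omega> - W j u \<omega>)"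
    using past_indep_increments[of u v "inc i u" "\<lambda>k. if k = j then 1 else 0"] ij u uv t_nonneg
      inc_measurable_F[OF ij(1) u(1), of u] by simp
  have "(\<integral>\<omega>. inc i u \<omega> * (W j v \<omega> - W j u \<omega>) \<partial>M) = (\<integral>\<omega>. inc i u \<omega> \<partial>M) * (\<integral>\<omega>. W j v \<omega> - W j u \<omega> \<partial>M)"
    using gaussian_expectation[OF g] gaussian_expectation[OF inc_gaussian[OF ij(1) u(1)]]
    by (intro indep_var_lebesgue_integral ind) (auto simp: has_bochner_integral_iff)
  then have 0: "l2_inner M (\<lambda>\<omega>. W j v \<omega> - W j u \<omega>) (inc i u) = 0"
    using gaussian_expectation[OF g] by (simp add: l2_inner_def mult.commute has_bochner_integral_iff)
  have "inc j v = (\<lambda>\<omega>. inc j u \<omega> + (W j v \<omega> - W j u \<omega>))" by (auto simp: inc_def)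
  then have "l2_inner M (inc j v) (inc i u) = l2_inner M (inc j u) (inc i u)"
    using l2_inner_add_left[OF inc_sq_integrable[OF ij(2) u(1)] gaussian_sq_integrable[OF g] inc_sq_integrable[OF ij(1) u(1)]] 0
    by simp
  then show ?thesis using inc_cov_same[OF ij u(1)] by (simp add: l2_inner_commute)
qed

lemma inc_cov:
  assumes ij: "i \<in> {1..m}" "j \<in> {1..m}" and u: "t \<le> u" "t \<le> v"
  shows "l2_inner M (inc i u) (inc j v) = (if i = j then min u v - t else 0)"
  using inc_cov_le[OF ij u(1), of v] inc_cov_le[OF ij(2,1) u(2), of u]
  by (cases "u \<le> v") (auto simp: l2_inner_commute min_def)

text \<open>The mean-square closure of the span of the increments. All components are taken
  together, so that one Wick formula covers products of integrals with equal and with different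
  indices.\<close>

definition chaos1 :: "('a \<Rightarrow> real) set" where
  "chaos1 = {X. \<exists>c U. (\<forall>n. finite (U n) \<and> U n \<subseteq> {t..}) \<and> l2_lim M (\<lambda>n. inc_sum (c n) (U n)) X}"

lemma inc_sum_add:
  assumes "finite U" "finite V"
  shows "inc_sum c U \<omega> + inc_sum d V \<omega> =
    inc_sum (\<lambda>i u. (if u \<in> U then c i u else 0) + (if u \<in> V then d i u else 0)) (U \<union> V) \<omega>"
proof -
  have "(\<Sum>u\<in>U \<union> V. ((if u \<in> U then c i u else 0) + (if u \<in> V then d i u else 0)) * inc i u \<omega>)
     = (\<Sum>u\<in>U. c i u * inc i u \<omega>) + (\<Sum>u\<in>V. d i u * inc i u \<omega>)" for i
    unfolding distrib_right sum.distrib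
    using assms by (intro arg_cong2[where f="(+)"] sum.mono_neutral_cong_right) auto
  then show ?thesis by (simp add: inc_sum_def sum.distrib)
qed

lemma chaos1_gaussian: "X \<in> chaos1 \<Longrightarrow> gaussian X (l2_sq M X)"
  unfolding chaos1_def
proof safe
  fix c U assume U: "\<forall>n. finite (U n) \<and> U n \<subseteq> {t..}" and lim: "l2_lim M (\<lambda>n. inc_sum (c n) (U n)) X"
  have "\<exists>v. gaussian (inc_sum (c n) (U n)) v" for n using U inc_sum_gaussian by blast
  then obtain v where "\<And>n. gaussian (inc_sum (c n) (U n)) (v n)" by metis
  from gaussian_l2_lim[OF lim this] show ?thesis .
qed

sublocale chaos: gaussian_space M chaos1
proof
  show "sq_integrable M X" if "X \<in> chaos1" for X
    using that by (auto simp: chaos1_def l2_lim_def)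
  show "has_bochner_integral M (\<lambda>\<omega>. X \<omega> ^ 4) (3 * (l2_sq M X)\<^sup>2)" if "X \<in> chaos1" for X
    using gaussian_moment4[OF chaos1_gaussian[OF that]] .
  show "has_bochner_integral M (\<lambda>\<omega>. X \<omega> ^ 6) (15 * (l2_sq M X) ^ 3)" if "X \<in> chaos1" for X
    using gaussian_moment6[OF chaos1_gaussian[OF that]] .
  show "(\<lambda>\<omega>. a * X \<omega>) \<in> chaos1" if "X \<in> chaos1" for X a
  proof -
    from that obtain c U where U: "\<forall>n. finite (U n) \<and> U n \<subseteq> {t..}"
      and lim: "l2_lim M (\<lambda>n. inc_sum (c n) (U n)) X" by (auto simp: chaos1_def)
    have "l2_lim M (\<lambda>n. inc_sum (\<lambda>i u. a * c n i u) (U n)) (\<lambda>\<omega>. a * X \<omega>)"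
      using l2_lim_cmult[OF lim, of a] by (simp add: inc_sum_def[abs_def] sum_distrib_left mult.assoc)
    with U show ?thesis
      unfolding chaos1_def by (intro CollectI exI[of _ "\<lambda>n i u. a * c n i u"] exI[of _ U]) simp
  qed
  show "(\<lambda>\<omega>. X \<omega> + Y \<omega>) \<in> chaos1" if "X \<in> chaos1" "Y \<in> chaos1" for X Y
  proof -
    from that obtain c U d V where U: "\<forall>n. finite (U n) \<and> U n \<subseteq> {t..}"
      and lim: "l2_lim M (\<lambda>n. inc_sum (c n) (U n)) X" and V: "\<forall>n. finite (V n) \<and> V n \<subseteq> {t..}"
      and lim2: "l2_lim M (\<lambda>n. inc_sum (d n) (V n)) Y" by (auto simp: chaos1_def)
    from l2_lim_add[OF lim lim2] have
      "l2_lim M (\<lambda>n. inc_sum (\<lambda>i u. (if u \<in> U n then c n i u else 0) + (if u \<in> V n then d n i u else 0)) (U n \<union> V n))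
         (\<lambda>\<omega>. X \<omega> + Y \<omega>)"
      using U V by (simp add: inc_sum_add)
    with U V show ?thesis
      unfolding chaos1_def
      by (intro CollectI exI[of _ "\<lambda>n i u. (if u \<in> U n then c n i u else 0) + (if u \<in> V n then d n i u else 0)"]
           exI[of _ "\<lambda>n. U n \<union> V n"]) simp
  qed
qed

end

section \<open>Wiener integrals\<close>

text \<open>Lebesgue measure on the interval as its own space: bounds and pointwise conditions are
  asked on \<open>[a, b]\<close> only.\<close>

definition Icc_measure :: "real \<Rightarrow> real \<Rightarrow> real measure" where
  "Icc_measure a b = restrict_space lborel {a..b}"

lemma space_Icc_measure [simp]: "space (Icc_measure a b) = {a..b}"
  by (simp add: Icc_measure_def space_restrict_space)

lemma finite_measure_Icc_measure: "finite_measure (Icc_measure a b)"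
proof
  have "emeasure (Icc_measure a b) {a..b} = emeasure lborel {a..b}"
    unfolding Icc_measure_def by (rule emeasure_restrict_space) auto
  also have "\<dots> \<noteq> \<infinity>" by (simp add: emeasure_lborel_Icc_eq)
  finally show "emeasure (Icc_measure a b) (space (Icc_measure a b)) \<noteq> \<infinity>" by simp
qed

lemma borel_measurable_Icc_measure:
  "f \<in> borel_measurable borel \<Longrightarrow> f \<in> borel_measurable (Icc_measure a b)"
  unfolding Icc_measure_def by (rule measurable_restrict_space1) simp

lemma continuous_on_measurable_Icc_measure:
  fixes f :: "real \<Rightarrow> real"
  shows "continuous_on {a..b} f \<Longrightarrow> f \<in> borel_measurable (Icc_measure a b)"
  using borel_measurable_continuous_on_restrict[of "{a..b}" f]
  by (simp add: Icc_measure_def measurable_cong_sets[OF sets_restrict_space_cong[OF sets_lborel] refl])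

context wiener_interval
begin

definition L :: "real measure" where
  "L = Icc_measure t T"

sublocale L: finite_measure L
  unfolding L_def by (rule finite_measure_Icc_measure)

lemma space_L [simp]: "space L = {t..T}"
  by (simp add: L_def)

text \<open>Initial segments serve as the building blocks, because the indicator of
  \<open>{..u}\<close> on \<open>[t, T]\<close> corresponds to the single variable
  \<open>inc i u\<close>. Sums of step functions are then formed without a common
  refinement.\<close>

definition step :: "(real \<Rightarrow> real) \<Rightarrow> real set \<Rightarrow> real \<Rightarrow> real" where
  "step c U x = (\<Sum>u\<in>U. c u * indicator {..u} x)"

definition step_integral :: "nat \<Rightarrow> (real \<Rightarrow> real) \<Rightarrow> real set \<Rightarrow> 'a \<Rightarrow> real" where
  "step_integral i c U \<omega> = (\<Sum>u\<in>U. c u * inc i u \<omega>)"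

text \<open>The Wiener integral as a relation, since the integral is determined only almost surely.
  One and the same step function has to approximate \<open>f\<close> and, through its integral,
  \<open>X\<close>.\<close>

definition wint :: "nat \<Rightarrow> (real \<Rightarrow> real) \<Rightarrow> ('a \<Rightarrow> real) \<Rightarrow> bool" where
  "wint i f X \<longleftrightarrow> i \<in> {1..m} \<and> bounded_meas L f \<and> sq_integrable M X \<and>
     (\<forall>e>0. \<exists>c U. finite U \<and> U \<subseteq> {t..T} \<and> l2_sq L (\<lambda>x. f x - step c U x) < e \<and>
        l2_sq M (\<lambda>\<omega>. X \<omega> - step_integral i c U \<omega>) < e)"

lemma indicator_bounded_meas: "bounded_meas L (indicator {..u})"
  by (rule bounded_measI[where B=1])
     (auto simp: L_def intro!: borel_measurable_Icc_measure split: split_indicator)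

lemma step_eq: "step c U = (\<lambda>x. \<Sum>u\<in>U. c u * indicator {..u} x)"
  by (auto simp: step_def)

lemma step_integral_eq: "step_integral i c U = (\<lambda>\<omega>. \<Sum>u\<in>U. c u * inc i u \<omega>)"
  by (auto simp: step_integral_def)

lemma step_cmult: "step (\<lambda>u. a * c u) U = (\<lambda>x. a * step c U x)"
  by (simp add: step_eq sum_distrib_left mult.assoc)

lemma step_integral_cmult: "step_integral i (\<lambda>u. a * c u) U = (\<lambda>x. a * step_integral i c U x)"
  by (simp add: step_integral_eq sum_distrib_left mult.assoc)

lemma step_bounded_meas: "bounded_meas L (step c U)"
  unfolding step_def[abs_def] by (intro bounded_meas_sum bounded_meas_cmult indicator_bounded_meas)

lemma step_sq_integrable: "sq_integrable L (step c U)"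
  by (intro L.bounded_meas_sq step_bounded_meas)

lemma step_integral_sq_integrable: "i \<in> {1..m} \<Longrightarrow> U \<subseteq> {t..T} \<Longrightarrow> sq_integrable M (step_integral i c U)"
  unfolding step_integral_def[abs_def]
  by (intro sq_integrable_sum sq_integrable_cmult inc_sq_integrable) auto

lemma indicator_inner:
  assumes "u \<in> {t..T}" "v \<in> {t..T}"
  shows "l2_inner L (indicator {..u}) (indicator {..v}) = min u v - t"
proof -
  have "l2_inner L (indicator {..u}) (indicator {..v}) = (\<integral>x. indicator {t..min u v} x \<partial>L)"
    unfolding l2_inner_def
    by (intro Bochner_Integration.integral_cong) (auto split: split_indicator)
  also have "\<dots> = (\<integral>x. indicator {t..T} x *\<^sub>R indicator {t..min u v} x \<partial>lborel)"
    unfolding L_def Icc_measure_def by (subst integral_restrict_space) auto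
  also have "\<dots> = (\<integral>x. indicator {t..min u v} x \<partial>lborel)"
    using assms by (intro Bochner_Integration.integral_cong) (auto split: split_indicator)
  also have "\<dots> = min u v - t" using assms by simp
  finally show ?thesis .
qed

text \<open>Both inner products expand into the same double sum: \<open>min u v - t\<close> is the
  covariance of two increments of one component and also the inner product of two initial
  segments.\<close>

lemma step_isometry:
  assumes ij: "i \<in> {1..m}" "j \<in> {1..m}" and U: "finite U" "U \<subseteq> {t..T}" and V: "finite V" "V \<subseteq> {t..T}"
  shows "l2_inner M (step_integral i c U) (step_integral j d V) =
    (if i = j then l2_inner L (step c U) (step d V) else 0)"
proof -
  have "l2_inner M (step_integral i c U) (step_integral j d V) =
     (\<Sum>u\<in>U. c u * (\<Sum>v\<in>V. d v * l2_inner M (inc i u) (inc j v)))"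
  proof -
    have "l2_inner M (step_integral i c U) (step_integral j d V) =
      (\<Sum>u\<in>U. l2_inner M (\<lambda>\<omega>. c u * inc i u \<omega>) (step_integral j d V))"
      unfolding step_integral_eq[of i c U]
      using U ij by (intro l2_inner_sum_left sq_integrable_cmult inc_sq_integrable step_integral_sq_integrable V) auto
    also have "\<dots> = (\<Sum>u\<in>U. c u * (\<Sum>v\<in>V. l2_inner M (inc i u) (\<lambda>\<omega>. d v * inc j v \<omega>)))"
      unfolding l2_inner_cmult_left step_integral_eq[of j d V] using U V ij
      by (intro sum.cong refl arg_cong2[where f="(*)"] l2_inner_sum_right sq_integrable_cmult inc_sq_integrable) auto
    finally show ?thesis by (simp add: l2_inner_cmult_left l2_inner_commute[of M "inc i _"])
  qed
  also have "\<dots> = (\<Sum>u\<in>U. c u * (\<Sum>v\<in>V. d v * (if i = j then min u v - t else 0)))"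
    using U V ij by (intro sum.cong refl arg_cong2[where f="(*)"] inc_cov) auto
  finally have 1: "l2_inner M (step_integral i c U) (step_integral j d V) =
     (\<Sum>u\<in>U. c u * (\<Sum>v\<in>V. d v * (if i = j then min u v - t else 0)))" .
  have "l2_inner L (step c U) (step d V) = (\<Sum>u\<in>U. l2_inner L (\<lambda>x. c u * indicator {..u} x) (step d V))"
    unfolding step_eq[of c U]
    by (intro l2_inner_sum_left step_sq_integrable L.bounded_meas_sq bounded_meas_cmult indicator_bounded_meas)
  also have "\<dots> = (\<Sum>u\<in>U. c u * (\<Sum>v\<in>V. l2_inner L (indicator {..u}) (\<lambda>x. d v * indicator {..v} x)))"
    unfolding l2_inner_cmult_left step_eq[of d V]
    by (intro sum.cong refl arg_cong2[where f="(*)"] l2_inner_sum_right L.bounded_meas_sq bounded_meas_cmult indicator_bounded_meas)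
  also have "\<dots> = (\<Sum>u\<in>U. c u * (\<Sum>v\<in>V. d v * (min u v - t)))"
    using U V
    by (intro sum.cong refl arg_cong2[where f="(*)"])
       (subst l2_inner_commute, subst l2_inner_cmult_left, subst indicator_inner, auto simp: min.commute)
  finally show ?thesis using 1 by simp
qed

lemma wintD:
  assumes "wint i f X"
  shows "i \<in> {1..m}" "bounded_meas L f" "sq_integrable M X" "sq_integrable L f"
  using assms L.bounded_meas_sq unfolding wint_def by blast+

lemma wint_approx:
  "wint i f X \<Longrightarrow> e > 0 \<Longrightarrow> \<exists>c U. finite U \<and> U \<subseteq> {t..T} \<and> l2_sq L (\<lambda>x. f x - step c U x) < e \<and>
        l2_sq M (\<lambda>\<omega>. X \<omega> - step_integral i c U \<omega>) < e"
  unfolding wint_def by (elim conjE allE[of _ e] impE)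

lemma wint_seq:
  assumes "wint i f X"
  obtains c U where "\<And>n. finite (U n)" "\<And>n. U n \<subseteq> {t..T}"
    "l2_lim L (\<lambda>n. step (c n) (U n)) f" "l2_lim M (\<lambda>n. step_integral i (c n) (U n)) X"
proof -
  have "\<exists>c U. finite U \<and> U \<subseteq> {t..T} \<and> l2_sq L (\<lambda>x. f x - step c U x) < 1 / Suc n \<and>
        l2_sq M (\<lambda>\<omega>. X \<omega> - step_integral i c U \<omega>) < 1 / Suc n" for n
    using assms by (simp add: wint_def)
  then obtain c U where U: "\<And>n. finite (U n)" "\<And>n. U n \<subseteq> {t..T}"
    and l: "\<And>n. l2_sq L (\<lambda>x. f x - step (c n) (U n) x) < 1 / Suc n"
      "\<And>n. l2_sq M (\<lambda>\<omega>. X \<omega> - step_integral i (c n) (U n) \<omega>) < 1 / Suc n" by metis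
  show ?thesis
  proof (rule that[of U c])
    show "l2_lim L (\<lambda>n. step (c n) (U n)) f"
      using l(1)[THEN less_imp_le] wintD[OF assms]
      by (intro l2_limI_le[where e="\<lambda>n. 1 / Suc n"] step_sq_integrable LIMSEQ_Suc[OF lim_inverse_n'])
         (simp_all add: l2_sq_commute)
    show "l2_lim M (\<lambda>n. step_integral i (c n) (U n)) X"
      using l(2)[THEN less_imp_le] wintD[OF assms] U
      by (intro l2_limI_le[where e="\<lambda>n. 1 / Suc n"] step_integral_sq_integrable LIMSEQ_Suc[OF lim_inverse_n'])
         (simp_all add: l2_sq_commute)
  qed (use U in auto)
qed

lemma wint_isometry:
  assumes f: "wint i f X" and g: "wint j g Y"
  shows "l2_inner M X Y = (if i = j then l2_inner L f g else 0)"
proof -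
  obtain c U where U: "\<And>n. finite (U n)" "\<And>n. U n \<subseteq> {t..T}"
    and lf: "l2_lim L (\<lambda>n. step (c n) (U n)) f" "l2_lim M (\<lambda>n. step_integral i (c n) (U n)) X"
    by (rule wint_seq[OF f]) (rule that)
  obtain d V where V: "\<And>n. finite (V n)" "\<And>n. V n \<subseteq> {t..T}"
    and lg: "l2_lim L (\<lambda>n. step (d n) (V n)) g" "l2_lim M (\<lambda>n. step_integral j (d n) (V n)) Y"
    by (rule wint_seq[OF g]) (rule that)
  have ij: "i \<in> {1..m}" "j \<in> {1..m}" using wintD(1)[OF f] wintD(1)[OF g] by auto
  have 1: "(\<lambda>n. if i = j then l2_inner L (step (c n) (U n)) (step (d n) (V n)) else 0) \<longlonglongrightarrow> l2_inner M X Y"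
    using l2_inner_tendsto[OF lf(2) lg(2)] by (simp add: step_isometry[OF ij U V])
  have 2: "(\<lambda>n. if i = j then l2_inner L (step (c n) (U n)) (step (d n) (V n)) else 0) \<longlonglongrightarrow>
      (if i = j then l2_inner L f g else 0)"
    using l2_inner_tendsto[OF lf(1) lg(1)] by simp
  from LIMSEQ_unique[OF 1 2] show ?thesis .
qed

lemma wint_chaos1: "wint i f X \<Longrightarrow> X \<in> chaos1"
proof -
  assume X: "wint i f X"
  obtain c U where U: "\<And>n. finite (U n)" "\<And>n. U n \<subseteq> {t..T}"
    and lf: "l2_lim M (\<lambda>n. step_integral i (c n) (U n)) X"
    by (rule wint_seq[OF X]) (rule that)
  have i: "i \<in> {1..m}" by (rule wintD(1)[OF X])
  have "step_integral i (c n) (U n) = inc_sum (\<lambda>j u. if j = i then c n u else 0) (U n)" for n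
  proof
    fix \<omega>
    have "inc_sum (\<lambda>j u. if j = i then c n u else 0) (U n) \<omega> =
       (\<Sum>j\<in>{1..m}. if j = i then step_integral i (c n) (U n) \<omega> else 0)"
      unfolding inc_sum_def step_integral_def by (intro sum.cong) auto
    then show "step_integral i (c n) (U n) \<omega> = inc_sum (\<lambda>j u. if j = i then c n u else 0) (U n) \<omega>"
      using i by simp
  qed
  with lf have "l2_lim M (\<lambda>n. inc_sum (\<lambda>j u. if j = i then c n u else 0) (U n)) X" by simp
  with U show ?thesis
    unfolding chaos1_def
    by (intro CollectI exI[of _ "\<lambda>n j u. if j = i then c n u else 0"] exI[of _ U]) fastforce
qed

lemma step_add:
  assumes "finite U" "finite V"
  shows "step c U x + step d V x = step (\<lambda>u. (if u \<in> U then c u else 0) + (if u \<in> V then d u else 0)) (U \<union> V) x"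
  unfolding step_def distrib_right sum.distrib
  using assms by (intro arg_cong2[where f="(+)"] sum.mono_neutral_cong_left) auto

lemma step_integral_add:
  assumes "finite U" "finite V"
  shows "step_integral i c U x + step_integral i d V x =
    step_integral i (\<lambda>u. (if u \<in> U then c u else 0) + (if u \<in> V then d u else 0)) (U \<union> V) x"
  unfolding step_integral_def distrib_right sum.distrib
  using assms by (intro arg_cong2[where f="(+)"] sum.mono_neutral_cong_left) auto

lemma wint_seqI:
  assumes "i \<in> {1..m}" "bounded_meas L f" "\<And>n. finite (U n)" "\<And>n. U n \<subseteq> {t..T}"
    "l2_lim L (\<lambda>n. step (c n) (U n)) f" "l2_lim M (\<lambda>n. step_integral i (c n) (U n)) X"
  shows "wint i f X"
  unfolding wint_def
proof (intro conjI allI impI)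
  show "sq_integrable M X" using l2_limD(2)[OF assms(6)] .
  fix e :: real assume "e > 0"
  from eventually_conj[OF order_tendstoD(2)[OF l2_limD(3)[OF assms(5)] this] order_tendstoD(2)[OF l2_limD(3)[OF assms(6)] this]]
  obtain n where "l2_sq L (\<lambda>x. step (c n) (U n) x - f x) < e" "l2_sq M (\<lambda>x. step_integral i (c n) (U n) x - X x) < e"
    by (auto dest: eventually_happens)
  then show "\<exists>c U. finite U \<and> U \<subseteq> {t..T} \<and> l2_sq L (\<lambda>x. f x - step c U x) < e \<and>
        l2_sq M (\<lambda>\<omega>. X \<omega> - step_integral i c U \<omega>) < e"
    using assms(3,4) by (intro exI[of _ "c n"] exI[of _ "U n"]) (simp add: l2_sq_commute)
qed (use assms in auto)

lemma wint_add:
  assumes f: "wint i f X" and g: "wint i g Y"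
  shows "wint i (\<lambda>x. f x + g x) (\<lambda>\<omega>. X \<omega> + Y \<omega>)"
proof -
  obtain c U where U: "\<And>n. finite (U n)" "\<And>n. U n \<subseteq> {t..T}"
    and lf: "l2_lim L (\<lambda>n. step (c n) (U n)) f" "l2_lim M (\<lambda>n. step_integral i (c n) (U n)) X"
    by (rule wint_seq[OF f]) (rule that)
  obtain d V where V: "\<And>n. finite (V n)" "\<And>n. V n \<subseteq> {t..T}"
    and lg: "l2_lim L (\<lambda>n. step (d n) (V n)) g" "l2_lim M (\<lambda>n. step_integral i (d n) (V n)) Y"
    by (rule wint_seq[OF g]) (rule that)
  show ?thesis
  proof (rule wint_seqI)
    show "i \<in> {1..m}" "bounded_meas L (\<lambda>x. f x + g x)"
      by (rule wintD(1)[OF f] bounded_meas_add wintD(2)[OF f] wintD(2)[OF g])+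
    show "finite (U n \<union> V n)" "U n \<union> V n \<subseteq> {t..T}" for n using U V by simp_all
    show "l2_lim L (\<lambda>n. step (\<lambda>u. (if u \<in> U n then c n u else 0) + (if u \<in> V n then d n u else 0)) (U n \<union> V n))
        (\<lambda>x. f x + g x)"
      using l2_lim_add[OF lf(1) lg(1)] unfolding step_add[OF U(1) V(1)] by simp
    show "l2_lim M (\<lambda>n. step_integral i (\<lambda>u. (if u \<in> U n then c n u else 0) + (if u \<in> V n then d n u else 0)) (U n \<union> V n))
        (\<lambda>\<omega>. X \<omega> + Y \<omega>)"
      using l2_lim_add[OF lf(2) lg(2)] unfolding step_integral_add[OF U(1) V(1)] by simp
  qed
qed

lemma wint_cmult:
  assumes f: "wint i f X"
  shows "wint i (\<lambda>x. a * f x) (\<lambda>\<omega>. a * X \<omega>)"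
proof -
  obtain c U where U: "\<And>n. finite (U n)" "\<And>n. U n \<subseteq> {t..T}"
    and lf: "l2_lim L (\<lambda>n. step (c n) (U n)) f" "l2_lim M (\<lambda>n. step_integral i (c n) (U n)) X"
    by (rule wint_seq[OF f]) (rule that)
  show ?thesis
  proof (rule wint_seqI)
    show "i \<in> {1..m}" "bounded_meas L (\<lambda>x. a * f x)"
      by (rule wintD(1)[OF f] bounded_meas_cmult wintD(2)[OF f])+
    show "l2_lim L (\<lambda>n. step (\<lambda>u. a * c n u) (U n)) (\<lambda>x. a * f x)"
      using l2_lim_cmult[OF lf(1), of a] by (simp only: step_cmult)
    show "l2_lim M (\<lambda>n. step_integral i (\<lambda>u. a * c n u) (U n)) (\<lambda>\<omega>. a * X \<omega>)"
      using l2_lim_cmult[OF lf(2), of a] by (simp only: step_integral_cmult)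
  qed (rule U)+
qed

lemma wint_diff: "wint i f X \<Longrightarrow> wint i g Y \<Longrightarrow> wint i (\<lambda>x. f x - g x) (\<lambda>\<omega>. X \<omega> - Y \<omega>)"
  using wint_add[OF _ wint_cmult[of i g Y "-1"], of f X] by simp

lemma wint_zero: "i \<in> {1..m} \<Longrightarrow> wint i (\<lambda>x. 0) (\<lambda>\<omega>. 0)"
  using wint_seqI[of i "\<lambda>x. 0" "\<lambda>n. {}" "\<lambda>n u. 0" "\<lambda>\<omega>. 0"] l2_lim_const[OF sq_integrable_zero[of L]] l2_lim_const[OF sq_integrable_zero[of M]]
  by (simp add: step_def[abs_def] step_integral_def[abs_def])

lemma wint_sum:
  "i \<in> {1..m} \<Longrightarrow> (\<And>k. k \<in> K \<Longrightarrow> wint i (f k) (X k)) \<Longrightarrow>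
   wint i (\<lambda>x. \<Sum>k\<in>K. f k x) (\<lambda>\<omega>. \<Sum>k\<in>K. X k \<omega>)"
  by (induction K rule: infinite_finite_induct) (auto intro: wint_add wint_zero)

lemma wint_inc:
  assumes "i \<in> {1..m}" "u \<in> {t..T}"
  shows "wint i (indicator {..u}) (inc i u)"
  using wint_seqI[of i "indicator {..u}" "\<lambda>n. {u}" "\<lambda>n u. 1" "inc i u"] assms
    l2_lim_const[OF L.bounded_meas_sq[OF indicator_bounded_meas]] l2_lim_const[OF inc_sq_integrable[of i u]]
  by (simp add: step_def[abs_def] step_integral_def[abs_def] indicator_bounded_meas)

lemma wint_l2_sq_diff:
  assumes "wint i f X" "wint i g Y"
  shows "l2_sq M (\<lambda>\<omega>. X \<omega> - Y \<omega>) = l2_sq L (\<lambda>x. f x - g x)"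
  using wint_isometry[OF wint_diff[OF assms] wint_diff[OF assms]] by (simp add: l2_sq_inner)

text \<open>By the isometry the integrals form a Cauchy sequence, so completeness yields a limit;
  approximating one late member by a step function on both sides shows that the limit is an integral
  of \<open>g\<close>.\<close>

lemma wint_lim:
  assumes w: "\<And>n. wint i (f n) (X n)" and g: "bounded_meas L g" and lim: "l2_lim L f g"
  shows "\<exists>Y. wint i g Y \<and> l2_lim M X Y"
proof -
  have sqi: "sq_integrable L (f n)" "sq_integrable L g" for n using l2_limD(1,2)[OF lim] by auto
  have "\<exists>Y. l2_lim M X Y"
  proof (rule l2_complete)
    show "sq_integrable M (X n)" for n by (rule wintD(3)[OF w])
    fix e :: real assume "e > 0"
    \<comment> \<open>Two terms, each with the factor 2 of \<open>l2_sq_triangle\<close>, account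
      for the quarter.\<close>
    then have "e / 4 > 0" by simp
    from order_tendstoD(2)[OF l2_limD(3)[OF lim] this] obtain n0 where
      n0: "\<And>n. n \<ge> n0 \<Longrightarrow> l2_sq L (\<lambda>x. f n x - g x) < e / 4" by (auto simp: eventually_sequentially)
    show "\<exists>n0. \<forall>m\<ge>n0. \<forall>n\<ge>n0. l2_sq M (\<lambda>x. X m x - X n x) < e"
    proof (intro exI allI impI)
      fix k n assume kn: "n0 \<le> k" "n0 \<le> n"
      have "l2_sq M (\<lambda>x. X k x - X n x) = l2_sq L (\<lambda>x. f k x - f n x)" by (rule wint_l2_sq_diff[OF w w])
      also have "\<dots> \<le> 2 * l2_sq L (\<lambda>x. f k x - g x) + 2 * l2_sq L (\<lambda>x. g x - f n x)"
        by (rule l2_sq_triangle[OF sqi(1) sqi(2) sqi(1)])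
      also have "\<dots> < e" using n0[OF kn(1)] n0[OF kn(2)] by (simp add: l2_sq_commute[of L g])
      finally show "l2_sq M (\<lambda>x. X k x - X n x) < e" .
    qed
  qed
  then obtain Y where Y: "l2_lim M X Y" by blast
  have "wint i g Y"
    unfolding wint_def
  proof (intro conjI g allI impI)
    show "i \<in> {1..m}" by (rule wintD(1)[OF w])
    show sY: "sq_integrable M Y" by (rule l2_limD(2)[OF Y])
    fix e :: real assume "e > 0"
    then have e: "e / 4 > 0" by simp
    from eventually_conj[OF order_tendstoD(2)[OF l2_limD(3)[OF lim] e] order_tendstoD(2)[OF l2_limD(3)[OF Y] e]]
    obtain n where n: "l2_sq L (\<lambda>x. f n x - g x) < e / 4" "l2_sq M (\<lambda>x. X n x - Y x) < e / 4"
      by (auto dest: eventually_happens)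
    from wint_approx[OF w[of n] e] obtain c U where U: "finite U" "U \<subseteq> {t..T}"
      and l: "l2_sq L (\<lambda>x. f n x - step c U x) < e / 4" "l2_sq M (\<lambda>\<omega>. X n \<omega> - step_integral i c U \<omega>) < e / 4"
      by metis
    have i: "i \<in> {1..m}" and sX: "sq_integrable M (X n)" by (rule wintD(1)[OF w] wintD(3)[OF w])+
    have "l2_sq L (\<lambda>x. g x - step c U x) < e"
      using l2_sq_triangle[OF sqi(2) sqi(1)[of n] step_sq_integrable, of c U] l(1) n(1)
      by (simp add: l2_sq_commute[of L g])
    moreover have "l2_sq M (\<lambda>x. Y x - step_integral i c U x) < e"
      using l2_sq_triangle[OF sY sX step_integral_sq_integrable[OF i U(2)], of c] l(2) n(2)
      by (simp add: l2_sq_commute[of M Y])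
    ultimately show "\<exists>c U. finite U \<and> U \<subseteq> {t..T} \<and> l2_sq L (\<lambda>x. g x - step c U x) < e \<and>
        l2_sq M (\<lambda>\<omega>. Y \<omega> - step_integral i c U \<omega>) < e" using U by blast
  qed
  with Y show ?thesis by blast
qed

text \<open>Integrals given by a choice are known only up to a null set; this lemma transfers the
  relation to the chosen version.\<close>

lemma wint_cong_AE:
  assumes w: "wint i f X" and eq: "AE x in L. f x = g x" and g: "bounded_meas L g"
    and eq': "AE \<omega> in M. X \<omega> = Y \<omega>" and Y: "Y \<in> borel_measurable M"
  shows "wint i g Y"
proof -
  obtain c U where U: "\<And>n. finite (U n)" "\<And>n. U n \<subseteq> {t..T}"
    and lf: "l2_lim L (\<lambda>n. step (c n) (U n)) f" "l2_lim M (\<lambda>n. step_integral i (c n) (U n)) X"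
    by (rule wint_seq[OF w]) (rule that)
  note s = wintD[OF w]
  have sY: "sq_integrable M Y" using sq_integrable_cong_AE[OF eq' s(3) Y] .
  have "l2_sq L (\<lambda>x. step (c n) (U n) x - g x) = l2_sq L (\<lambda>x. step (c n) (U n) x - f x)" for n
    using eq s(2) g step_bounded_meas[of "c n" "U n"]
    by (intro l2_sq_cong_AE borel_measurable_diff bounded_meas_measurable) (auto dest: bounded_meas_measurable)
  then have 1: "l2_lim L (\<lambda>n. step (c n) (U n)) g"
    using lf(1) L.bounded_meas_sq[OF g] by (simp add: l2_lim_def)
  have "l2_sq M (\<lambda>x. step_integral i (c n) (U n) x - Y x) = l2_sq M (\<lambda>x. step_integral i (c n) (U n) x - X x)" for n
    using eq' sq_integrable_measurable[OF s(3)] Y sq_integrable_measurable[OF step_integral_sq_integrable[OF s(1) U(2)[of n]]]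
    by (intro l2_sq_cong_AE) auto
  then have 2: "l2_lim M (\<lambda>n. step_integral i (c n) (U n)) Y"
    using lf(2) sY by (simp add: l2_lim_def)
  show ?thesis by (rule wint_seqI[OF s(1) g U 1 2])
qed

end

section \<open>Bilinear and trilinear forms\<close>

lemma sum_split_add: "(\<Sum>\<alpha><n + k. \<phi> \<alpha>) = (\<Sum>\<alpha><n. \<phi> \<alpha>) + (\<Sum>\<alpha><k. \<phi> (n + \<alpha>))"
  for \<phi> :: "nat \<Rightarrow> 'b::comm_monoid_add"
  by (induction k) (simp_all add: add.assoc)

lemma bounded_meas_tensor:
  assumes f: "bounded_meas A f" and g: "bounded_meas B g"
  shows "bounded_meas (A \<Otimes>\<^sub>M B) (\<lambda>(x, y). f x * g y)"
proof -
  obtain C where "C \<ge> 0" and C: "\<And>x. x \<in> space A \<Longrightarrow> \<bar>f x\<bar> \<le> C" using bounded_meas_bound[OF f] by blast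
  obtain D where "D \<ge> 0" and D: "\<And>x. x \<in> space B \<Longrightarrow> \<bar>g x\<bar> \<le> D" using bounded_meas_bound[OF g] by blast
  show ?thesis
  proof (rule bounded_measI)
    have [measurable]: "f \<in> borel_measurable A" "g \<in> borel_measurable B"
      using f g by (auto dest: bounded_meas_measurable)
    show "(\<lambda>(x, y). f x * g y) \<in> borel_measurable (A \<Otimes>\<^sub>M B)" by measurable
    show "\<bar>case p of (x, y) \<Rightarrow> f x * g y\<bar> \<le> C * D" if "p \<in> space (A \<Otimes>\<^sub>M B)" for p
      using that C D \<open>C \<ge> 0\<close> by (auto simp: space_pair_measure abs_mult intro!: mult_mono)
  qed
qed

lemma tensor_inner:
  assumes A: "finite_measure A" and B: "finite_measure B"
    and f: "bounded_meas A f" "bounded_meas A u" and g: "bounded_meas B g" "bounded_meas B v"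
  shows "l2_inner (A \<Otimes>\<^sub>M B) (\<lambda>(x, y). f x * g y) (\<lambda>(x, y). u x * v y) = l2_inner A f u * l2_inner B g v"
proof -
  interpret A: finite_measure A by fact
  interpret B: finite_measure B by fact
  interpret AB: finite_measure "A \<Otimes>\<^sub>M B" by (rule finite_measure_pair_measure[OF B A])
  interpret P: pair_sigma_finite A B ..
  let ?h = "\<lambda>(x, y). (f x * u x) * (g y * v y)"
  have "bounded_meas (A \<Otimes>\<^sub>M B) ?h" using f g by (intro bounded_meas_tensor bounded_meas_mult)
  then have int: "integrable (A \<Otimes>\<^sub>M B) ?h" by (rule AB.bounded_meas_integrable)
  have "l2_inner (A \<Otimes>\<^sub>M B) (\<lambda>(x, y). f x * g y) (\<lambda>(x, y). u x * v y) = integral\<^sup>L (A \<Otimes>\<^sub>M B) ?h"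
    unfolding l2_inner_def by (intro Bochner_Integration.integral_cong) auto
  also have "\<dots> = (\<integral>x. \<integral>y. ?h (x, y) \<partial>B \<partial>A)" by (rule P.integral_fst'[OF int, symmetric])
  also have "\<dots> = l2_inner A f u * l2_inner B g v" by (simp add: l2_inner_def)
  finally show ?thesis .
qed

lemma l2_inner_cmult_right: "l2_inner N f (\<lambda>x. c * g x) = c * l2_inner N f g"
  using l2_inner_cmult_left[of N c g f] by (simp add: l2_inner_commute)

lemma l2_inner_double_sum:
  assumes "\<And>\<alpha>. \<alpha> < n \<Longrightarrow> sq_integrable N (f \<alpha>)" "\<And>\<beta>. \<beta> < k \<Longrightarrow> sq_integrable N (g \<beta>)"
  shows "l2_inner N (\<lambda>x. \<Sum>\<alpha><n. f \<alpha> x) (\<lambda>x. \<Sum>\<beta><k. g \<beta> x) = (\<Sum>\<alpha><n. \<Sum>\<beta><k. l2_inner N (f \<alpha>) (g \<beta>))"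
proof -
  have "l2_inner N (\<lambda>x. \<Sum>\<alpha><n. f \<alpha> x) (\<lambda>x. \<Sum>\<beta><k. g \<beta> x) =
      (\<Sum>\<alpha><n. l2_inner N (f \<alpha>) (\<lambda>x. \<Sum>\<beta><k. g \<beta> x))"
    using assms by (intro l2_inner_sum_left sq_integrable_sum) auto
  also have "\<dots> = (\<Sum>\<alpha><n. \<Sum>\<beta><k. l2_inner N (f \<alpha>) (g \<beta>))"
    using assms by (intro sum.cong refl l2_inner_sum_right) auto
  finally show ?thesis .
qed

context wiener_interval
begin

abbreviation L2 :: "(real \<times> real) measure" where "L2 \<equiv> L \<Otimes>\<^sub>M L"
abbreviation L3 :: "(real \<times> real \<times> real) measure" where "L3 \<equiv> L \<Otimes>\<^sub>M L2"

sublocale L2: finite_measure L2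
  by (intro finite_measure_pair_measure L.finite_measure_axioms)

sublocale L3: finite_measure L3
  by (intro finite_measure_pair_measure L.finite_measure_axioms L2.finite_measure_axioms)

abbreviation ip :: "(real \<Rightarrow> real) \<Rightarrow> (real \<Rightarrow> real) \<Rightarrow> real" where "ip \<equiv> l2_inner L"

definition ind_eq :: "nat \<Rightarrow> nat \<Rightarrow> real" where
  "ind_eq i j = (if i = j then 1 else 0)"

lemma wint_cov: "wint i f X \<Longrightarrow> wint j g Y \<Longrightarrow> l2_inner M X Y = ind_eq i j * ip f g"
  by (simp add: wint_isometry ind_eq_def)

definition kernel2 :: "nat \<Rightarrow> (nat \<Rightarrow> real \<Rightarrow> real) \<Rightarrow> (nat \<Rightarrow> real \<Rightarrow> real) \<Rightarrow> real \<times> real \<Rightarrow> real" where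
  "kernel2 n f g = (\<lambda>p. \<Sum>\<alpha><n. (case p of (x, y) \<Rightarrow> f \<alpha> x * g \<alpha> y))"

text \<open>The variables are nested as \<open>(x, (y, z))\<close> to fit the iterated product
  measure, so that two applications of \<open>tensor_inner\<close> compute inner products.\<close>

definition kernel3 :: "nat \<Rightarrow> (nat \<Rightarrow> real \<Rightarrow> real) \<Rightarrow> (nat \<Rightarrow> real \<Rightarrow> real) \<Rightarrow> (nat \<Rightarrow> real \<Rightarrow> real) \<Rightarrow>
    real \<times> real \<times> real \<Rightarrow> real" where
  "kernel3 n f g h = (\<lambda>p. \<Sum>\<alpha><n. (case p of (x, q) \<Rightarrow> f \<alpha> x * (case q of (y, z) \<Rightarrow> g \<alpha> y * h \<alpha> z)))"

lemma kernel2_bounded_meas: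
  "(\<And>\<alpha>. \<alpha> < n \<Longrightarrow> bounded_meas L (f \<alpha>)) \<Longrightarrow> (\<And>\<alpha>. \<alpha> < n \<Longrightarrow> bounded_meas L (g \<alpha>)) \<Longrightarrow>
   bounded_meas L2 (kernel2 n f g)"
  unfolding kernel2_def by (intro bounded_meas_sum bounded_meas_tensor) auto

lemma kernel3_bounded_meas:
  "(\<And>\<alpha>. \<alpha> < n \<Longrightarrow> bounded_meas L (f \<alpha>)) \<Longrightarrow> (\<And>\<alpha>. \<alpha> < n \<Longrightarrow> bounded_meas L (g \<alpha>)) \<Longrightarrow>
   (\<And>\<alpha>. \<alpha> < n \<Longrightarrow> bounded_meas L (h \<alpha>)) \<Longrightarrow> bounded_meas L3 (kernel3 n f g h)"
  unfolding kernel3_def by (intro bounded_meas_sum bounded_meas_tensor) auto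

lemma kernel2_inner:
  assumes "\<And>\<alpha>. \<alpha> < n \<Longrightarrow> bounded_meas L (f \<alpha>)" "\<And>\<alpha>. \<alpha> < n \<Longrightarrow> bounded_meas L (g \<alpha>)"
    "\<And>\<alpha>. \<alpha> < k \<Longrightarrow> bounded_meas L (u \<alpha>)" "\<And>\<alpha>. \<alpha> < k \<Longrightarrow> bounded_meas L (v \<alpha>)"
  shows "l2_inner L2 (kernel2 n f g) (kernel2 k u v) = (\<Sum>\<alpha><n. \<Sum>\<beta><k. ip (f \<alpha>) (u \<beta>) * ip (g \<alpha>) (v \<beta>))"
  unfolding kernel2_def using assms
  by (subst l2_inner_double_sum)
     (auto intro!: sum.cong tensor_inner L2.bounded_meas_sq bounded_meas_tensor L.finite_measure_axioms)

lemma kernel3_inner: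
  assumes "\<And>\<alpha>. \<alpha> < n \<Longrightarrow> bounded_meas L (f \<alpha>)" "\<And>\<alpha>. \<alpha> < n \<Longrightarrow> bounded_meas L (g \<alpha>)"
    "\<And>\<alpha>. \<alpha> < n \<Longrightarrow> bounded_meas L (h \<alpha>)"
    "\<And>\<alpha>. \<alpha> < k \<Longrightarrow> bounded_meas L (u \<alpha>)" "\<And>\<alpha>. \<alpha> < k \<Longrightarrow> bounded_meas L (v \<alpha>)"
    "\<And>\<alpha>. \<alpha> < k \<Longrightarrow> bounded_meas L (w \<alpha>)"
  shows "l2_inner L3 (kernel3 n f g h) (kernel3 k u v w) =
     (\<Sum>\<alpha><n. \<Sum>\<beta><k. ip (f \<alpha>) (u \<beta>) * (ip (g \<alpha>) (v \<beta>) * ip (h \<alpha>) (w \<beta>)))"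
proof -
  have "l2_inner L3 (kernel3 n f g h) (kernel3 k u v w) =
     (\<Sum>\<alpha><n. \<Sum>\<beta><k. l2_inner L3 (\<lambda>(x, q). f \<alpha> x * (case q of (y, z) \<Rightarrow> g \<alpha> y * h \<alpha> z))
        (\<lambda>(x, q). u \<beta> x * (case q of (y, z) \<Rightarrow> v \<beta> y * w \<beta> z)))"
    unfolding kernel3_def using assms
    by (intro l2_inner_double_sum L3.bounded_meas_sq bounded_meas_tensor)
  also have "\<dots> = (\<Sum>\<alpha><n. \<Sum>\<beta><k. ip (f \<alpha>) (u \<beta>) *
      l2_inner L2 (\<lambda>(y, z). g \<alpha> y * h \<alpha> z) (\<lambda>(y, z). v \<beta> y * w \<beta> z))"
    using assms
    by (intro sum.cong refl tensor_inner bounded_meas_tensor L.finite_measure_axioms L2.finite_measure_axioms) auto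
  also have "\<dots> = (\<Sum>\<alpha><n. \<Sum>\<beta><k. ip (f \<alpha>) (u \<beta>) * (ip (g \<alpha>) (v \<beta>) * ip (h \<alpha>) (w \<beta>)))"
    using assms
    by (intro sum.cong refl arg_cong2[where f="(*)"] tensor_inner L.finite_measure_axioms) auto
  finally show ?thesis .
qed

text \<open>A finite sum of products of Wiener integrals with its kernel and its trace
  \<open>k\<close>, which is also its expectation. The trace is separate data because the norm of
  the kernel does not control it.\<close>

definition form2 :: "nat \<Rightarrow> nat \<Rightarrow> (real \<times> real \<Rightarrow> real) \<Rightarrow> real \<Rightarrow> ('a \<Rightarrow> real) \<Rightarrow> bool" where
  "form2 i j K k Q \<longleftrightarrow> (\<exists>n f g X Y. (\<forall>\<alpha><n. wint i (f \<alpha>) (X \<alpha>) \<and> wint j (g \<alpha>) (Y \<alpha>)) \<and>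
     K = kernel2 n f g \<and> k = (\<Sum>\<alpha><n. ind_eq i j * ip (f \<alpha>) (g \<alpha>)) \<and>
     Q = (\<lambda>\<omega>. \<Sum>\<alpha><n. X \<alpha> \<omega> * Y \<alpha> \<omega>))"

text \<open>The functions \<open>a\<close>, \<open>b\<close>, \<open>c\<close> are the contractions
  of the variable pairs (1,2), (1,3) and (2,3), each a function of the variable left over.
  Contractions of different components are switched off by \<open>ind_eq\<close>.\<close>

definition form3 :: "nat \<Rightarrow> nat \<Rightarrow> nat \<Rightarrow> (real \<times> real \<times> real \<Rightarrow> real) \<Rightarrow> (real \<Rightarrow> real) \<Rightarrow> (real \<Rightarrow> real) \<Rightarrow>
    (real \<Rightarrow> real) \<Rightarrow> ('a \<Rightarrow> real) \<Rightarrow> bool" where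
  "form3 i j l K a b c Q \<longleftrightarrow> (\<exists>n f g h X Y Z.
     (\<forall>\<alpha><n. wint i (f \<alpha>) (X \<alpha>) \<and> wint j (g \<alpha>) (Y \<alpha>) \<and> wint l (h \<alpha>) (Z \<alpha>)) \<and>
     K = kernel3 n f g h \<and>
     a = (\<lambda>z. \<Sum>\<alpha><n. ind_eq i j * ip (f \<alpha>) (g \<alpha>) * h \<alpha> z) \<and>
     b = (\<lambda>y. \<Sum>\<alpha><n. ind_eq i l * ip (f \<alpha>) (h \<alpha>) * g \<alpha> y) \<and>
     c = (\<lambda>x. \<Sum>\<alpha><n. ind_eq j l * ip (g \<alpha>) (h \<alpha>) * f \<alpha> x) \<and>
     Q = (\<lambda>\<omega>. \<Sum>\<alpha><n. X \<alpha> \<omega> * Y \<alpha> \<omega> * Z \<alpha> \<omega>))"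

lemma wint_prod2_sq:
  assumes "wint i f X" "wint j g Y"
  shows "sq_integrable M (\<lambda>\<omega>. X \<omega> * Y \<omega>)"
  using chaos.wick4[of X Y X Y] assms wintD(3)[OF assms(1)] wintD(3)[OF assms(2)]
  by (auto simp: wint_chaos1 has_bochner_integral_iff sq_integrable_def power2_eq_square)

lemma wint_prod3_sq:
  assumes "wint i f X" "wint j g Y" "wint l h Z"
  shows "sq_integrable M (\<lambda>\<omega>. X \<omega> * Y \<omega> * Z \<omega>)"
  using chaos.wick6[of X Y Z X Y Z] assms wintD(3)[OF assms(1)] wintD(3)[OF assms(2)] wintD(3)[OF assms(3)]
  by (auto simp: wint_chaos1 has_bochner_integral_iff sq_integrable_def power2_eq_square)

lemma ind_eq_bound: "\<bar>ind_eq i j * s\<bar> \<le> \<bar>s\<bar>"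
  by (simp add: ind_eq_def)

text \<open>Wick's formula has three pairings. One gives the square of the trace, one the squared
  norm of the kernel, and one the inner product of the kernel with its transpose, which is at most
  the squared norm again.\<close>

lemma form2_bound:
  assumes "form2 i j K k Q"
  shows "sq_integrable M Q" "bounded_meas L2 K" "l2_sq M Q \<le> 2 * l2_sq L2 K + k\<^sup>2"
proof -
  from assms[unfolded form2_def] obtain n f g X Y where
    w': "\<forall>\<alpha><n. wint i (f \<alpha>) (X \<alpha>) \<and> wint j (g \<alpha>) (Y \<alpha>)"
    and K: "K = kernel2 n f g" and k: "k = (\<Sum>\<alpha><n. ind_eq i j * ip (f \<alpha>) (g \<alpha>))"
    and Q: "Q = (\<lambda>\<omega>. \<Sum>\<alpha><n. X \<alpha> \<omega> * Y \<alpha> \<omega>)"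
    by (elim exE conjE) (rule that)
  have w: "\<And>\<alpha>. \<alpha> < n \<Longrightarrow> wint i (f \<alpha>) (X \<alpha>)" "\<And>\<alpha>. \<alpha> < n \<Longrightarrow> wint j (g \<alpha>) (Y \<alpha>)"
    using w' by auto
  note b = wintD(2)[OF w(1)] wintD(2)[OF w(2)]
  show "bounded_meas L2 K" unfolding K by (intro kernel2_bounded_meas b)
  have s: "sq_integrable M (\<lambda>\<omega>. X \<alpha> \<omega> * Y \<alpha> \<omega>)" if "\<alpha> < n" for \<alpha>
    using wint_prod2_sq[OF w[OF that]] .
  then show "sq_integrable M Q" unfolding Q by (intro sq_integrable_sum) auto
  let ?S = "\<lambda>f g u v. \<Sum>\<alpha><n. \<Sum>\<beta><n. ip (f \<alpha>) (u \<beta>) * ip (g \<alpha>) (v \<beta>)"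
  have "l2_sq M Q = (\<Sum>\<alpha><n. \<Sum>\<beta><n. l2_inner M (\<lambda>\<omega>. X \<alpha> \<omega> * Y \<alpha> \<omega>) (\<lambda>\<omega>. X \<beta> \<omega> * Y \<beta> \<omega>))"
    unfolding Q l2_sq_inner by (rule l2_inner_double_sum) (use s in auto)
  also have "\<dots> = (\<Sum>\<alpha><n. \<Sum>\<beta><n. ind_eq i j * ip (f \<alpha>) (g \<alpha>) * (ind_eq i j * ip (f \<beta>) (g \<beta>))
      + ip (f \<alpha>) (f \<beta>) * ip (g \<alpha>) (g \<beta>) + ind_eq i j * (ip (f \<alpha>) (g \<beta>) * ip (g \<alpha>) (f \<beta>)))"
  proof (intro sum.cong refl)
    fix \<alpha> \<beta> assume "\<alpha> \<in> {..<n}" "\<beta> \<in> {..<n}"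
    then have ab: "\<alpha> < n" "\<beta> < n" by auto
    have "l2_inner M (\<lambda>\<omega>. X \<alpha> \<omega> * Y \<alpha> \<omega>) (\<lambda>\<omega>. X \<beta> \<omega> * Y \<beta> \<omega>) =
       l2_inner M (X \<alpha>) (Y \<alpha>) * l2_inner M (X \<beta>) (Y \<beta>) + l2_inner M (X \<alpha>) (X \<beta>) * l2_inner M (Y \<alpha>) (Y \<beta>)
       + l2_inner M (X \<alpha>) (Y \<beta>) * l2_inner M (Y \<alpha>) (X \<beta>)"
      using chaos.wick4[OF wint_chaos1[OF w(1)[OF ab(1)]] wint_chaos1[OF w(2)[OF ab(1)]]
          wint_chaos1[OF w(1)[OF ab(2)]] wint_chaos1[OF w(2)[OF ab(2)]]]
      by (simp add: l2_inner_def[of M "\<lambda>\<omega>. X \<alpha> \<omega> * Y \<alpha> \<omega>"] has_bochner_integral_iff)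
    then show "l2_inner M (\<lambda>\<omega>. X \<alpha> \<omega> * Y \<alpha> \<omega>) (\<lambda>\<omega>. X \<beta> \<omega> * Y \<beta> \<omega>) =
      ind_eq i j * ip (f \<alpha>) (g \<alpha>) * (ind_eq i j * ip (f \<beta>) (g \<beta>))
      + ip (f \<alpha>) (f \<beta>) * ip (g \<alpha>) (g \<beta>) + ind_eq i j * (ip (f \<alpha>) (g \<beta>) * ip (g \<alpha>) (f \<beta>))"
      by (simp add: wint_cov[OF w(1)[OF ab(1)] w(2)[OF ab(1)]] wint_cov[OF w(1)[OF ab(2)] w(2)[OF ab(2)]]
          wint_cov[OF w(1)[OF ab(1)] w(1)[OF ab(2)]] wint_cov[OF w(2)[OF ab(1)] w(2)[OF ab(2)]]
          wint_cov[OF w(1)[OF ab(1)] w(2)[OF ab(2)]] wint_cov[OF w(2)[OF ab(1)] w(1)[OF ab(2)]] ind_eq_def)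
  qed
  also have "\<dots> = k\<^sup>2 + ?S f g f g + ind_eq i j * ?S f g g f"
    unfolding k power2_eq_square sum_product by (simp add: sum.distrib sum_distrib_left)
  also have "\<dots> \<le> k\<^sup>2 + ?S f g f g + ?S f g f g"
  proof -
    have sq: "sq_integrable L2 (kernel2 n f g)" "sq_integrable L2 (kernel2 n g f)"
      by (intro L2.bounded_meas_sq kernel2_bounded_meas b; assumption)+
    have "\<bar>?S f g g f\<bar> \<le> (?S f g f g + ?S g f g f) / 2"
      using l2_inner_mean_le[OF sq] unfolding l2_sq_inner by (simp add: kernel2_inner b)
    also have "?S g f g f = ?S f g f g" by (simp add: mult.commute)
    finally have "\<bar>?S f g g f\<bar> \<le> ?S f g f g" by simp
    then show ?thesis using ind_eq_bound[of i j "?S f g g f"] by linarith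
  qed
  also have "?S f g f g = l2_sq L2 K" unfolding K l2_sq_inner by (simp add: kernel2_inner b)
  finally show "l2_sq M Q \<le> 2 * l2_sq L2 K + k\<^sup>2" by simp
qed

text \<open>Six of Wick's pairings are inner products of the kernel with its six rearrangements,
  each bounded by the squared norm: hence the 6. The other nine are the inner products among
  \<open>a\<close>, \<open>b\<close>, \<open>c\<close>; bounding the mixed ones by arithmetic means
  gives the 3.\<close>

lemma form3_bound:
  assumes "form3 i j l K a b c Q"
  shows "sq_integrable M Q" "bounded_meas L3 K" "bounded_meas L a" "bounded_meas L b" "bounded_meas L c"
    "l2_sq M Q \<le> 6 * l2_sq L3 K + 3 * (l2_sq L a + l2_sq L b + l2_sq L c)"
proof -
  from assms[unfolded form3_def] obtain n f g h X Y Z where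
    w': "\<forall>\<alpha><n. wint i (f \<alpha>) (X \<alpha>) \<and> wint j (g \<alpha>) (Y \<alpha>) \<and> wint l (h \<alpha>) (Z \<alpha>)"
    and K: "K = kernel3 n f g h"
    and a: "a = (\<lambda>z. \<Sum>\<alpha><n. ind_eq i j * ip (f \<alpha>) (g \<alpha>) * h \<alpha> z)"
    and b: "b = (\<lambda>y. \<Sum>\<alpha><n. ind_eq i l * ip (f \<alpha>) (h \<alpha>) * g \<alpha> y)"
    and c: "c = (\<lambda>x. \<Sum>\<alpha><n. ind_eq j l * ip (g \<alpha>) (h \<alpha>) * f \<alpha> x)"
    and Q: "Q = (\<lambda>\<omega>. \<Sum>\<alpha><n. X \<alpha> \<omega> * Y \<alpha> \<omega> * Z \<alpha> \<omega>)"
    by (elim exE conjE) (rule that)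
  have w: "\<And>\<alpha>. \<alpha> < n \<Longrightarrow> wint i (f \<alpha>) (X \<alpha>)" "\<And>\<alpha>. \<alpha> < n \<Longrightarrow> wint j (g \<alpha>) (Y \<alpha>)"
    "\<And>\<alpha>. \<alpha> < n \<Longrightarrow> wint l (h \<alpha>) (Z \<alpha>)"
    using w' by auto
  note bm = wintD(2)[OF w(1)] wintD(2)[OF w(2)] wintD(2)[OF w(3)]
  note sm = wintD(4)[OF w(1)] wintD(4)[OF w(2)] wintD(4)[OF w(3)]
  show "bounded_meas L3 K" unfolding K by (intro kernel3_bounded_meas bm)
  show "bounded_meas L a" "bounded_meas L b" "bounded_meas L c"
    unfolding a b c by (intro bounded_meas_sum bounded_meas_cmult bm; simp)+
  have s: "sq_integrable M (\<lambda>\<omega>. X \<alpha> \<omega> * Y \<alpha> \<omega> * Z \<alpha> \<omega>)" if "\<alpha> < n" for \<alpha>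
    using wint_prod3_sq[OF w[OF that]] .
  then show "sq_integrable M Q" unfolding Q by (intro sq_integrable_sum) auto
  let ?S = "\<lambda>f g h u v w. \<Sum>\<alpha><n. \<Sum>\<beta><n. ip (f \<alpha>) (u \<beta>) * (ip (g \<alpha>) (v \<beta>) * ip (h \<alpha>) (w \<beta>))"
  let ?d = ind_eq
  \<comment> \<open>These are the coefficients of \<open>a\<close>, \<open>b\<close> and
    \<open>c\<close> as combinations of the \<open>h\<close>, \<open>g\<close> and
    \<open>f\<close>.\<close>
  define A B C where "A \<alpha> = ?d i j * ip (f \<alpha>) (g \<alpha>)" and "B \<alpha> = ?d i l * ip (f \<alpha>) (h \<alpha>)"
    and "C \<alpha> = ?d j l * ip (g \<alpha>) (h \<alpha>)" for \<alpha>
  let ?P = "\<lambda>A B u v. \<Sum>\<alpha><n. \<Sum>\<beta><n. A \<alpha> * (B \<beta> * ip (u \<alpha>) (v \<beta>))"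
  have "l2_sq M Q = (\<Sum>\<alpha><n. \<Sum>\<beta><n. l2_inner M (\<lambda>\<omega>. X \<alpha> \<omega> * Y \<alpha> \<omega> * Z \<alpha> \<omega>) (\<lambda>\<omega>. X \<beta> \<omega> * Y \<beta> \<omega> * Z \<beta> \<omega>))"
    unfolding Q l2_sq_inner by (rule l2_inner_double_sum) (use s in auto)
  also have "\<dots> = (\<Sum>\<alpha><n. \<Sum>\<beta><n.
       ip (f \<alpha>) (f \<beta>) * (ip (g \<alpha>) (g \<beta>) * ip (h \<alpha>) (h \<beta>))
     + (?d j l * (ip (f \<alpha>) (f \<beta>) * (ip (g \<alpha>) (h \<beta>) * ip (h \<alpha>) (g \<beta>)))
     + (?d i j * (ip (f \<alpha>) (g \<beta>) * (ip (g \<alpha>) (f \<beta>) * ip (h \<alpha>) (h \<beta>)))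
     + (?d i j * ?d j l * (ip (f \<alpha>) (g \<beta>) * (ip (g \<alpha>) (h \<beta>) * ip (h \<alpha>) (f \<beta>)))
     + (?d i j * ?d j l * (ip (f \<alpha>) (h \<beta>) * (ip (g \<alpha>) (f \<beta>) * ip (h \<alpha>) (g \<beta>)))
     + (?d i l * (ip (f \<alpha>) (h \<beta>) * (ip (g \<alpha>) (g \<beta>) * ip (h \<alpha>) (f \<beta>)))
     + (A \<alpha> * (A \<beta> * ip (h \<alpha>) (h \<beta>)) + (?d j l * (A \<alpha> * (B \<beta> * ip (h \<alpha>) (g \<beta>)))
     + (?d i l * (A \<alpha> * (C \<beta> * ip (h \<alpha>) (f \<beta>)))
     + (?d j l * (B \<alpha> * (A \<beta> * ip (g \<alpha>) (h \<beta>))) + (B \<alpha> * (B \<beta> * ip (g \<alpha>) (g \<beta>))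
     + (?d i j * (B \<alpha> * (C \<beta> * ip (g \<alpha>) (f \<beta>)))
     + (?d i l * (C \<alpha> * (A \<beta> * ip (f \<alpha>) (h \<beta>))) + (?d i j * (C \<alpha> * (B \<beta> * ip (f \<alpha>) (g \<beta>)))
     + C \<alpha> * (C \<beta> * ip (f \<alpha>) (f \<beta>))))))))))))))))"
  proof (intro sum.cong refl)
    fix \<alpha> \<beta> assume "\<alpha> \<in> {..<n}" "\<beta> \<in> {..<n}"
    then have ab: "\<alpha> < n" "\<beta> < n" by auto
    note G = wint_chaos1[OF w(1)[OF ab(1)]] wint_chaos1[OF w(2)[OF ab(1)]] wint_chaos1[OF w(3)[OF ab(1)]]
      wint_chaos1[OF w(1)[OF ab(2)]] wint_chaos1[OF w(2)[OF ab(2)]] wint_chaos1[OF w(3)[OF ab(2)]]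
    note wa = w[OF ab(1)] note wb = w[OF ab(2)]
    show "l2_inner M (\<lambda>\<omega>. X \<alpha> \<omega> * Y \<alpha> \<omega> * Z \<alpha> \<omega>) (\<lambda>\<omega>. X \<beta> \<omega> * Y \<beta> \<omega> * Z \<beta> \<omega>) =
       ip (f \<alpha>) (f \<beta>) * (ip (g \<alpha>) (g \<beta>) * ip (h \<alpha>) (h \<beta>))
     + (?d j l * (ip (f \<alpha>) (f \<beta>) * (ip (g \<alpha>) (h \<beta>) * ip (h \<alpha>) (g \<beta>)))
     + (?d i j * (ip (f \<alpha>) (g \<beta>) * (ip (g \<alpha>) (f \<beta>) * ip (h \<alpha>) (h \<beta>)))
     + (?d i j * ?d j l * (ip (f \<alpha>) (g \<beta>) * (ip (g \<alpha>) (h \<beta>) * ip (h \<alpha>) (f \<beta>)))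
     + (?d i j * ?d j l * (ip (f \<alpha>) (h \<beta>) * (ip (g \<alpha>) (f \<beta>) * ip (h \<alpha>) (g \<beta>)))
     + (?d i l * (ip (f \<alpha>) (h \<beta>) * (ip (g \<alpha>) (g \<beta>) * ip (h \<alpha>) (f \<beta>)))
     + (A \<alpha> * (A \<beta> * ip (h \<alpha>) (h \<beta>)) + (?d j l * (A \<alpha> * (B \<beta> * ip (h \<alpha>) (g \<beta>)))
     + (?d i l * (A \<alpha> * (C \<beta> * ip (h \<alpha>) (f \<beta>)))
     + (?d j l * (B \<alpha> * (A \<beta> * ip (g \<alpha>) (h \<beta>))) + (B \<alpha> * (B \<beta> * ip (g \<alpha>) (g \<beta>))
     + (?d i j * (B \<alpha> * (C \<beta> * ip (g \<alpha>) (f \<beta>)))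
     + (?d i l * (C \<alpha> * (A \<beta> * ip (f \<alpha>) (h \<beta>))) + (?d i j * (C \<alpha> * (B \<beta> * ip (f \<alpha>) (g \<beta>)))
     + C \<alpha> * (C \<beta> * ip (f \<alpha>) (f \<beta>)))))))))))))))"
      unfolding l2_inner_def[of M "\<lambda>\<omega>. X \<alpha> \<omega> * Y \<alpha> \<omega> * Z \<alpha> \<omega>"]
        has_bochner_integral_integral_eq[OF chaos.wick6[OF G]]
        wint_cov[OF wa(1) wb(1)] wint_cov[OF wa(1) wb(2)] wint_cov[OF wa(1) wb(3)]
        wint_cov[OF wa(2) wb(1)] wint_cov[OF wa(2) wb(2)] wint_cov[OF wa(2) wb(3)]
        wint_cov[OF wa(3) wb(1)] wint_cov[OF wa(3) wb(2)] wint_cov[OF wa(3) wb(3)]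
        wint_cov[OF wa(1) wa(2)] wint_cov[OF wa(1) wa(3)] wint_cov[OF wa(2) wa(3)]
        wint_cov[OF wb(1) wb(2)] wint_cov[OF wb(1) wb(3)] wint_cov[OF wb(2) wb(3)] A_def B_def C_def
      by (cases "i = j"; cases "j = l"; cases "i = l") (simp_all add: ind_eq_def)
  qed
  also have "\<dots> = ?S f g h f g h + (?d j l * ?S f g h f h g + (?d i j * ?S f g h g f h
     + (?d i j * ?d j l * ?S f g h g h f + (?d i j * ?d j l * ?S f g h h f g + (?d i l * ?S f g h h g f
     + (?P A A h h + (?d j l * ?P A B h g + (?d i l * ?P A C h f
     + (?d j l * ?P B A g h + (?P B B g g + (?d i j * ?P B C g f
     + (?d i l * ?P C A f h + (?d i j * ?P C B f g + ?P C C f f)))))))))))))"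
    by (simp only: sum.distrib sum_distrib_left)
  also have "\<dots> \<le> 6 * l2_sq L3 K + 3 * (l2_sq L a + l2_sq L b + l2_sq L c)"
  proof -
    \<comment> \<open>Permuting the variables of a kernel preserves its norm; the last premise
      expresses this for the permutation at hand.\<close>
    have bS: "\<bar>?S f g h u v w\<bar> \<le> ?S f g h f g h"
      if "\<And>\<alpha>. \<alpha> < n \<Longrightarrow> bounded_meas L (u \<alpha>)" "\<And>\<alpha>. \<alpha> < n \<Longrightarrow> bounded_meas L (v \<alpha>)"
        "\<And>\<alpha>. \<alpha> < n \<Longrightarrow> bounded_meas L (w \<alpha>)" "?S u v w u v w = ?S f g h f g h" for u v w
    proof -
      have sq: "sq_integrable L3 (kernel3 n f g h)" "sq_integrable L3 (kernel3 n u v w)"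
        by (intro L3.bounded_meas_sq kernel3_bounded_meas bm that; assumption)+
      have "\<bar>?S f g h u v w\<bar> \<le> (?S f g h f g h + ?S u v w u v w) / 2"
        using l2_inner_mean_le[OF sq] unfolding l2_sq_inner by (simp add: kernel3_inner bm that(1-3))
      then show ?thesis using that(4) by simp
    qed
    have S: "\<bar>?S f g h f h g\<bar> \<le> ?S f g h f g h" "\<bar>?S f g h g f h\<bar> \<le> ?S f g h f g h"
      "\<bar>?S f g h g h f\<bar> \<le> ?S f g h f g h" "\<bar>?S f g h h f g\<bar> \<le> ?S f g h f g h"
      "\<bar>?S f g h h g f\<bar> \<le> ?S f g h f g h"
      by (rule bS; simp add: bm mult_ac)+
    have SK: "?S f g h f g h = l2_sq L3 K" unfolding K l2_sq_inner by (simp add: kernel3_inner bm)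
    have aA: "a = (\<lambda>z. \<Sum>\<alpha><n. A \<alpha> * h \<alpha> z)" and bB: "b = (\<lambda>z. \<Sum>\<alpha><n. B \<alpha> * g \<alpha> z)"
      and cC: "c = (\<lambda>z. \<Sum>\<alpha><n. C \<alpha> * f \<alpha> z)"
      by (simp_all add: a b c A_def B_def C_def)
    have P: "ip (\<lambda>z. \<Sum>\<alpha><n. A \<alpha> * u \<alpha> z) (\<lambda>z. \<Sum>\<alpha><n. B \<alpha> * v \<alpha> z) = ?P A B u v"
      if "\<And>\<alpha>. \<alpha> < n \<Longrightarrow> sq_integrable L (u \<alpha>)" "\<And>\<alpha>. \<alpha> < n \<Longrightarrow> sq_integrable L (v \<alpha>)" for A B u v
      using that by (subst l2_inner_double_sum)
        (auto intro!: sum.cong simp: l2_inner_cmult_left l2_inner_cmult_right)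
    have Ps: "?P A A h h = l2_sq L a" "?P B B g g = l2_sq L b" "?P C C f f = l2_sq L c"
      "?P A B h g = ip a b" "?P A C h f = ip a c" "?P B A g h = ip b a" "?P B C g f = ip b c"
      "?P C A f h = ip c a" "?P C B f g = ip c b"
      unfolding l2_sq_inner aA bB cC by (rule P[symmetric]; rule sm; assumption)+
    have sq: "sq_integrable L a" "sq_integrable L b" "sq_integrable L c"
      by (intro L.bounded_meas_sq \<open>bounded_meas L a\<close> \<open>bounded_meas L b\<close> \<open>bounded_meas L c\<close>)+
    note m = l2_inner_mean_le[OF sq(1,2)] l2_inner_mean_le[OF sq(1,3)] l2_inner_mean_le[OF sq(2,1)]
      l2_inner_mean_le[OF sq(2,3)] l2_inner_mean_le[OF sq(3,1)] l2_inner_mean_le[OF sq(3,2)]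
    have d: "?d p q * s \<le> r" if "\<bar>s\<bar> \<le> r" for p q s r using that by (auto simp: ind_eq_def)
    have d2: "?d p q * ?d p' q' * s \<le> r" if "\<bar>s\<bar> \<le> r" for p q p' q' s r
      using that by (auto simp: ind_eq_def)
    note [simp del] = l2_sq_nonneg
    show ?thesis
      unfolding Ps SK
      using d[OF S(1), of j l] d[OF S(2), of i j] d2[OF S(3), of i j j l] d2[OF S(4), of i j j l] d[OF S(5), of i l]
        d[OF m(1), of j l] d[OF m(2), of i l] d[OF m(3), of j l] d[OF m(4), of i j] d[OF m(5), of i l] d[OF m(6), of i j]
      unfolding SK by argo
  qed
  finally show "l2_sq M Q \<le> 6 * l2_sq L3 K + 3 * (l2_sq L a + l2_sq L b + l2_sq L c)" .
qed

end

section \<open>Mean-square limits of forms\<close>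

lemma bounded_meas_section:
  "bounded_meas (A \<Otimes>\<^sub>M B) K \<Longrightarrow> x \<in> space A \<Longrightarrow> bounded_meas B (\<lambda>y. K (x, y))"
  unfolding bounded_meas_def by (auto simp: space_pair_measure)

lemma bounded_meas_swap:
  assumes "bounded_meas (A \<Otimes>\<^sub>M B) K"
  shows "bounded_meas (B \<Otimes>\<^sub>M A) (\<lambda>p. K (snd p, fst p))"
proof -
  have "(\<lambda>p. (snd p, fst p)) \<in> measurable (B \<Otimes>\<^sub>M A) (A \<Otimes>\<^sub>M B)" by measurable
  from measurable_compose[OF this bounded_meas_measurable[OF assms]]
  show ?thesis using assms by (auto simp: bounded_meas_def space_pair_measure)
qed

lemma bounded_meas_integral:
  assumes B: "finite_measure B" and K: "bounded_meas (A \<Otimes>\<^sub>M B) K"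
  shows "bounded_meas A (\<lambda>x. \<integral>y. K (x, y) \<partial>B)"
proof -
  interpret B: finite_measure B by fact
  obtain C where C: "C \<ge> 0" "\<And>p. p \<in> space (A \<Otimes>\<^sub>M B) \<Longrightarrow> \<bar>K p\<bar> \<le> C" using bounded_meas_bound[OF K] by blast
  have [measurable]: "K \<in> borel_measurable (A \<Otimes>\<^sub>M B)" using K by (rule bounded_meas_measurable)
  show ?thesis
  proof (rule bounded_measI)
    show "(\<lambda>x. \<integral>y. K (x, y) \<partial>B) \<in> borel_measurable A" by measurable
    fix x assume x: "x \<in> space A"
    have "\<bar>\<integral>y. K (x, y) \<partial>B\<bar> \<le> (\<integral>y. \<bar>K (x, y)\<bar> \<partial>B)" by (rule integral_abs_bound)
    also have "\<dots> \<le> (\<integral>y. C \<partial>B)"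
      using C x bounded_meas_section[OF K x]
      by (intro integral_mono integrable_abs B.bounded_meas_integrable B.integrable_const) (auto simp: space_pair_measure)
    finally show "\<bar>\<integral>y. K (x, y) \<partial>B\<bar> \<le> C * measure B (space B)" by (simp add: mult.commute)
  qed
qed

lemma bounded_meas_fubini:
  assumes A: "finite_measure A" and B: "finite_measure B" and K: "bounded_meas (A \<Otimes>\<^sub>M B) K"
  shows "(\<integral>p. K p \<partial>(A \<Otimes>\<^sub>M B)) = (\<integral>x. \<integral>y. K (x, y) \<partial>B \<partial>A)"
    and "(\<integral>p. K p \<partial>(A \<Otimes>\<^sub>M B)) = (\<integral>y. \<integral>x. K (x, y) \<partial>A \<partial>B)"
proof -
  interpret A: finite_measure A by fact
  interpret B: finite_measure B by fact
  interpret AB: finite_measure "A \<Otimes>\<^sub>M B" by (rule finite_measure_pair_measure[OF B A])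
  interpret P: pair_sigma_finite A B ..
  have int: "integrable (A \<Otimes>\<^sub>M B) K" using K by (rule AB.bounded_meas_integrable)
  show 1: "(\<integral>p. K p \<partial>(A \<Otimes>\<^sub>M B)) = (\<integral>x. \<integral>y. K (x, y) \<partial>B \<partial>A)"
    by (rule P.integral_fst'[OF int, symmetric])
  have "integrable (A \<Otimes>\<^sub>M B) (\<lambda>(x, y). K (x, y))" using int by simp
  from P.Fubini_integral[OF this]
  show "(\<integral>p. K p \<partial>(A \<Otimes>\<^sub>M B)) = (\<integral>y. \<integral>x. K (x, y) \<partial>A \<partial>B)"
    using 1 by simp
qed

lemma bounded_meas_power2: "bounded_meas N f \<Longrightarrow> bounded_meas N (\<lambda>x. (f x)\<^sup>2)"
  by (simp add: power2_eq_square bounded_meas_mult)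

lemma l2_sq_swap:
  assumes A: "finite_measure A" and B: "finite_measure B" and K: "bounded_meas (A \<Otimes>\<^sub>M B) K"
  shows "l2_sq (B \<Otimes>\<^sub>M A) (\<lambda>p. K (snd p, fst p)) = l2_sq (A \<Otimes>\<^sub>M B) K"
  unfolding l2_sq_def
  using bounded_meas_fubini(1)[OF B A bounded_meas_power2[OF bounded_meas_swap[OF K]]]
    bounded_meas_fubini(2)[OF A B bounded_meas_power2[OF K]] by simp

text \<open>The Hilbert-Schmidt bound: Cauchy-Schwarz in \<open>y\<close> for each fixed
  \<open>x\<close>, then Fubini.\<close>

lemma l2_sq_contract:
  assumes A: "finite_measure A" and B: "finite_measure B" and K: "bounded_meas (A \<Otimes>\<^sub>M B) K" and h: "bounded_meas B h"
  shows "l2_sq A (\<lambda>x. \<integral>y. K (x, y) * h y \<partial>B) \<le> l2_sq B h * l2_sq (A \<Otimes>\<^sub>M B) K"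
proof -
  interpret A: finite_measure A by fact
  interpret B: finite_measure B by fact
  have Kh: "bounded_meas (A \<Otimes>\<^sub>M B) (\<lambda>p. K p * h (snd p))"
  proof (intro bounded_meas_mult K)
    show "bounded_meas (A \<Otimes>\<^sub>M B) (\<lambda>p. h (snd p))"
      using bounded_meas_tensor[OF bounded_meas_const[of A 1] h] by (simp add: case_prod_beta')
  qed
  have "l2_sq A (\<lambda>x. \<integral>y. K (x, y) * h y \<partial>B) \<le> (\<integral>x. l2_sq B h * (\<integral>y. (K (x, y))\<^sup>2 \<partial>B) \<partial>A)"
    unfolding l2_sq_def[of A]
  proof (rule integral_mono)
    show "integrable A (\<lambda>x. (\<integral>y. K (x, y) * h y \<partial>B)\<^sup>2)"
      using bounded_meas_integral[OF B Kh] by (intro A.bounded_meas_integrable bounded_meas_power2) simp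
    show "integrable A (\<lambda>x. l2_sq B h * (\<integral>y. (K (x, y))\<^sup>2 \<partial>B))"
      by (intro A.bounded_meas_integrable bounded_meas_cmult bounded_meas_integral[OF B] bounded_meas_power2 K)
    fix x assume "x \<in> space A"
    then have s: "sq_integrable B (\<lambda>y. K (x, y))" "sq_integrable B h"
      using bounded_meas_section[OF K] h by (auto intro: B.bounded_meas_sq)
    show "(\<integral>y. K (x, y) * h y \<partial>B)\<^sup>2 \<le> l2_sq B h * (\<integral>y. (K (x, y))\<^sup>2 \<partial>B)"
      using l2_cauchy_schwarz_sq[OF s] by (simp add: l2_inner_def l2_sq_def mult.commute)
  qed
  also have "\<dots> = l2_sq B h * l2_sq (A \<Otimes>\<^sub>M B) K"
    using bounded_meas_fubini(1)[OF A B bounded_meas_power2[OF K]] by (simp add: l2_sq_def)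
  finally show ?thesis .
qed

lemma l2_lim_unique_limit:
  assumes "l2_lim N f g" "g' \<in> borel_measurable N" "AE x in N. g x = g' x"
  shows "l2_lim N f g'"
proof -
  have g': "sq_integrable N g'" using sq_integrable_cong_AE[OF assms(3) l2_limD(2)[OF assms(1)] assms(2)] .
  have "l2_sq N (\<lambda>x. f n x - g' x) = l2_sq N (\<lambda>x. f n x - g x)" for n
    using assms(2,3) sq_integrable_measurable[OF l2_limD(1)[OF assms(1)], of n] sq_integrable_measurable[OF l2_limD(2)[OF assms(1)]]
    by (intro l2_sq_cong_AE) auto
  with g' l2_limD[OF assms(1)] show ?thesis unfolding l2_lim_def by simp
qed

lemma l2_lim_Cauchy:
  assumes "l2_lim N f g" "e > 0"
  shows "\<exists>n0. \<forall>m\<ge>n0. \<forall>n\<ge>n0. l2_sq N (\<lambda>x. f m x - f n x) < e"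
proof -
  have "e / 4 > 0" using assms(2) by simp
  from order_tendstoD(2)[OF l2_limD(3)[OF assms(1)] this] obtain n0 where
    n0: "\<And>n. n \<ge> n0 \<Longrightarrow> l2_sq N (\<lambda>x. f n x - g x) < e / 4" by (auto simp: eventually_sequentially)
  show ?thesis
  proof (intro exI allI impI)
    fix m n assume "n0 \<le> m" "n0 \<le> n"
    then show "l2_sq N (\<lambda>x. f m x - f n x) < e"
      using l2_sq_triangle[OF l2_limD(1)[OF assms(1)] l2_limD(2)[OF assms(1)] l2_limD(1)[OF assms(1)], of m n] n0[of m] n0[of n]
      by (simp add: l2_sq_commute[of N g])
  qed
qed

lemma l2_lim_diff_zero:
  assumes "l2_lim N f h" "l2_lim N g h"
  shows "(\<lambda>n. l2_sq N (\<lambda>x. f n x - g n x)) \<longlonglongrightarrow> 0"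
  using l2_sq_tendsto[OF l2_lim_diff[OF assms]] by (simp add: l2_sq_def)

context wiener_interval
begin

section \<open>Linear operations on forms\<close>

lemma form2_single:
  "wint i f X \<Longrightarrow> wint j g Y \<Longrightarrow> form2 i j (\<lambda>(x, y). f x * g y) (ind_eq i j * ip f g) (\<lambda>\<omega>. X \<omega> * Y \<omega>)"
  unfolding form2_def
  by (rule exI[of _ 1], rule exI[of _ "\<lambda>_. f"], rule exI[of _ "\<lambda>_. g"], rule exI[of _ "\<lambda>_. X"], rule exI[of _ "\<lambda>_. Y"])
     (simp add: kernel2_def)

lemma form3_single:
  "wint i f X \<Longrightarrow> wint j g Y \<Longrightarrow> wint l h Z \<Longrightarrow>
   form3 i j l (\<lambda>(x, y, z). f x * (g y * h z)) (\<lambda>z. ind_eq i j * ip f g * h z) (\<lambda>y. ind_eq i l * ip f h * g y)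
      (\<lambda>x. ind_eq j l * ip g h * f x) (\<lambda>\<omega>. X \<omega> * Y \<omega> * Z \<omega>)"
  unfolding form3_def
  by (rule exI[of _ 1], rule exI[of _ "\<lambda>_. f"], rule exI[of _ "\<lambda>_. g"], rule exI[of _ "\<lambda>_. h"],
      rule exI[of _ "\<lambda>_. X"], rule exI[of _ "\<lambda>_. Y"], rule exI[of _ "\<lambda>_. Z"])
     (auto simp: kernel3_def fun_eq_iff)

lemma form2_zero: "form2 i j (\<lambda>p. 0) 0 (\<lambda>\<omega>. 0)"
  unfolding form2_def by (rule exI[of _ 0]) (simp add: kernel2_def)

lemma form3_zero: "form3 i j l (\<lambda>p. 0) (\<lambda>x. 0) (\<lambda>x. 0) (\<lambda>x. 0) (\<lambda>\<omega>. 0)"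
  unfolding form3_def by (rule exI[of _ 0]) (simp add: kernel3_def)

lemma form2E:
  assumes "form2 i j K k Q"
  obtains n f g X Y where "\<And>\<alpha>. \<alpha> < n \<Longrightarrow> wint i (f \<alpha>) (X \<alpha>)" "\<And>\<alpha>. \<alpha> < n \<Longrightarrow> wint j (g \<alpha>) (Y \<alpha>)"
    "K = kernel2 n f g" "k = (\<Sum>\<alpha><n. ind_eq i j * ip (f \<alpha>) (g \<alpha>))" "Q = (\<lambda>\<omega>. \<Sum>\<alpha><n. X \<alpha> \<omega> * Y \<alpha> \<omega>)"
  using assms[unfolded form2_def]
proof (elim exE conjE)
  fix n f g X Y
  assume "\<forall>\<alpha><n. wint i (f \<alpha>) (X \<alpha>) \<and> wint j (g \<alpha>) (Y \<alpha>)"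
    "K = kernel2 n f g" "k = (\<Sum>\<alpha><n. ind_eq i j * ip (f \<alpha>) (g \<alpha>))" "Q = (\<lambda>\<omega>. \<Sum>\<alpha><n. X \<alpha> \<omega> * Y \<alpha> \<omega>)"
  then show thesis by (intro that) auto
qed

lemma form3E:
  assumes "form3 i j l K a b c Q"
  obtains n f g h X Y Z where "\<And>\<alpha>. \<alpha> < n \<Longrightarrow> wint i (f \<alpha>) (X \<alpha>)" "\<And>\<alpha>. \<alpha> < n \<Longrightarrow> wint j (g \<alpha>) (Y \<alpha>)"
    "\<And>\<alpha>. \<alpha> < n \<Longrightarrow> wint l (h \<alpha>) (Z \<alpha>)" "K = kernel3 n f g h"
    "a = (\<lambda>z. \<Sum>\<alpha><n. ind_eq i j * ip (f \<alpha>) (g \<alpha>) * h \<alpha> z)"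
    "b = (\<lambda>y. \<Sum>\<alpha><n. ind_eq i l * ip (f \<alpha>) (h \<alpha>) * g \<alpha> y)"
    "c = (\<lambda>x. \<Sum>\<alpha><n. ind_eq j l * ip (g \<alpha>) (h \<alpha>) * f \<alpha> x)"
    "Q = (\<lambda>\<omega>. \<Sum>\<alpha><n. X \<alpha> \<omega> * Y \<alpha> \<omega> * Z \<alpha> \<omega>)"
  using assms[unfolded form3_def]
proof (elim exE conjE)
  fix n f g h X Y Z
  assume "\<forall>\<alpha><n. wint i (f \<alpha>) (X \<alpha>) \<and> wint j (g \<alpha>) (Y \<alpha>) \<and> wint l (h \<alpha>) (Z \<alpha>)"
    "K = kernel3 n f g h"
    "a = (\<lambda>z. \<Sum>\<alpha><n. ind_eq i j * ip (f \<alpha>) (g \<alpha>) * h \<alpha> z)"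
    "b = (\<lambda>y. \<Sum>\<alpha><n. ind_eq i l * ip (f \<alpha>) (h \<alpha>) * g \<alpha> y)"
    "c = (\<lambda>x. \<Sum>\<alpha><n. ind_eq j l * ip (g \<alpha>) (h \<alpha>) * f \<alpha> x)"
    "Q = (\<lambda>\<omega>. \<Sum>\<alpha><n. X \<alpha> \<omega> * Y \<alpha> \<omega> * Z \<alpha> \<omega>)"
  then show thesis by (intro that) auto
qed

lemma form2_cmult:
  assumes "form2 i j K k Q"
  shows "form2 i j (\<lambda>p. s * K p) (s * k) (\<lambda>\<omega>. s * Q \<omega>)"
proof -
  obtain n f g X Y where w: "\<And>\<alpha>. \<alpha> < n \<Longrightarrow> wint i (f \<alpha>) (X \<alpha>)" "\<And>\<alpha>. \<alpha> < n \<Longrightarrow> wint j (g \<alpha>) (Y \<alpha>)"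
    and e: "K = kernel2 n f g" "k = (\<Sum>\<alpha><n. ind_eq i j * ip (f \<alpha>) (g \<alpha>))" "Q = (\<lambda>\<omega>. \<Sum>\<alpha><n. X \<alpha> \<omega> * Y \<alpha> \<omega>)"
    by (rule form2E[OF assms]) (rule that)
  show ?thesis
    unfolding form2_def
    by (rule exI[of _ n], rule exI[of _ "\<lambda>\<alpha> x. s * f \<alpha> x"], rule exI[of _ g],
        rule exI[of _ "\<lambda>\<alpha> \<omega>. s * X \<alpha> \<omega>"], rule exI[of _ Y])
       (simp add: w wint_cmult e kernel2_def sum_distrib_left l2_inner_cmult_left case_prod_beta mult_ac)
qed

lemma form3_cmult:
  assumes "form3 i j l K a b c Q"
  shows "form3 i j l (\<lambda>p. s * K p) (\<lambda>x. s * a x) (\<lambda>x. s * b x) (\<lambda>x. s * c x) (\<lambda>\<omega>. s * Q \<omega>)"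
proof -
  obtain n f g h X Y Z where w: "\<And>\<alpha>. \<alpha> < n \<Longrightarrow> wint i (f \<alpha>) (X \<alpha>)" "\<And>\<alpha>. \<alpha> < n \<Longrightarrow> wint j (g \<alpha>) (Y \<alpha>)"
    "\<And>\<alpha>. \<alpha> < n \<Longrightarrow> wint l (h \<alpha>) (Z \<alpha>)"
    and e: "K = kernel3 n f g h"
    "a = (\<lambda>z. \<Sum>\<alpha><n. ind_eq i j * ip (f \<alpha>) (g \<alpha>) * h \<alpha> z)"
    "b = (\<lambda>y. \<Sum>\<alpha><n. ind_eq i l * ip (f \<alpha>) (h \<alpha>) * g \<alpha> y)"
    "c = (\<lambda>x. \<Sum>\<alpha><n. ind_eq j l * ip (g \<alpha>) (h \<alpha>) * f \<alpha> x)"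
    "Q = (\<lambda>\<omega>. \<Sum>\<alpha><n. X \<alpha> \<omega> * Y \<alpha> \<omega> * Z \<alpha> \<omega>)"
    by (rule form3E[OF assms]) (rule that)
  show ?thesis
    unfolding form3_def
    by (rule exI[of _ n], rule exI[of _ "\<lambda>\<alpha> x. s * f \<alpha> x"], rule exI[of _ g], rule exI[of _ h],
        rule exI[of _ "\<lambda>\<alpha> \<omega>. s * X \<alpha> \<omega>"], rule exI[of _ Y], rule exI[of _ Z])
       (simp add: w wint_cmult e kernel3_def sum_distrib_left l2_inner_cmult_left case_prod_beta mult_ac)
qed

lemma form2_add:
  assumes 1: "form2 i j K k Q" and 2: "form2 i j K' k' Q'"
  shows "form2 i j (\<lambda>p. K p + K' p) (k + k') (\<lambda>\<omega>. Q \<omega> + Q' \<omega>)"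
proof -
  obtain n f g X Y where w: "\<And>\<alpha>. \<alpha> < n \<Longrightarrow> wint i (f \<alpha>) (X \<alpha>)" "\<And>\<alpha>. \<alpha> < n \<Longrightarrow> wint j (g \<alpha>) (Y \<alpha>)"
    and e: "K = kernel2 n f g" "k = (\<Sum>\<alpha><n. ind_eq i j * ip (f \<alpha>) (g \<alpha>))" "Q = (\<lambda>\<omega>. \<Sum>\<alpha><n. X \<alpha> \<omega> * Y \<alpha> \<omega>)"
    by (rule form2E[OF 1]) (rule that)
  obtain n' f' g' X' Y' where w': "\<And>\<alpha>. \<alpha> < n' \<Longrightarrow> wint i (f' \<alpha>) (X' \<alpha>)" "\<And>\<alpha>. \<alpha> < n' \<Longrightarrow> wint j (g' \<alpha>) (Y' \<alpha>)"
    and e': "K' = kernel2 n' f' g'" "k' = (\<Sum>\<alpha><n'. ind_eq i j * ip (f' \<alpha>) (g' \<alpha>))" "Q' = (\<lambda>\<omega>. \<Sum>\<alpha><n'. X' \<alpha> \<omega> * Y' \<alpha> \<omega>)"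
    by (rule form2E[OF 2]) (rule that)
  \<comment> \<open>Concatenation of the two families: the second one is shifted by
    \<open>n\<close>.\<close>
  let ?j = "\<lambda>u v \<alpha>. if \<alpha> < n then u \<alpha> else v (\<alpha> - n)"
  show ?thesis
    unfolding form2_def
  proof (rule exI[of _ "n + n'"], rule exI[of _ "?j f f'"], rule exI[of _ "?j g g'"],
        rule exI[of _ "?j X X'"], rule exI[of _ "?j Y Y'"], intro conjI)
    show "\<forall>\<alpha><n + n'. wint i (?j f f' \<alpha>) (?j X X' \<alpha>) \<and> wint j (?j g g' \<alpha>) (?j Y Y' \<alpha>)"
      by (auto intro: w w')
    show "(\<lambda>p. K p + K' p) = kernel2 (n + n') (?j f f') (?j g g')"
      unfolding e e' kernel2_def sum_split_add by (simp cong: sum.cong_simp)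
    show "k + k' = (\<Sum>\<alpha><n + n'. ind_eq i j * ip (?j f f' \<alpha>) (?j g g' \<alpha>))"
      unfolding e e' sum_split_add by (simp cong: sum.cong_simp)
    show "(\<lambda>\<omega>. Q \<omega> + Q' \<omega>) = (\<lambda>\<omega>. \<Sum>\<alpha><n + n'. ?j X X' \<alpha> \<omega> * ?j Y Y' \<alpha> \<omega>)"
      unfolding e e' sum_split_add by (simp cong: sum.cong_simp)
  qed
qed

lemma form3_add:
  assumes 1: "form3 i j l K a b c Q" and 2: "form3 i j l K' a' b' c' Q'"
  shows "form3 i j l (\<lambda>p. K p + K' p) (\<lambda>x. a x + a' x) (\<lambda>x. b x + b' x) (\<lambda>x. c x + c' x) (\<lambda>\<omega>. Q \<omega> + Q' \<omega>)"
proof -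
  obtain n f g h X Y Z where w: "\<And>\<alpha>. \<alpha> < n \<Longrightarrow> wint i (f \<alpha>) (X \<alpha>)" "\<And>\<alpha>. \<alpha> < n \<Longrightarrow> wint j (g \<alpha>) (Y \<alpha>)"
    "\<And>\<alpha>. \<alpha> < n \<Longrightarrow> wint l (h \<alpha>) (Z \<alpha>)"
    and e: "K = kernel3 n f g h"
    "a = (\<lambda>z. \<Sum>\<alpha><n. ind_eq i j * ip (f \<alpha>) (g \<alpha>) * h \<alpha> z)"
    "b = (\<lambda>y. \<Sum>\<alpha><n. ind_eq i l * ip (f \<alpha>) (h \<alpha>) * g \<alpha> y)"
    "c = (\<lambda>x. \<Sum>\<alpha><n. ind_eq j l * ip (g \<alpha>) (h \<alpha>) * f \<alpha> x)"
    "Q = (\<lambda>\<omega>. \<Sum>\<alpha><n. X \<alpha> \<omega> * Y \<alpha> \<omega> * Z \<alpha> \<omega>)"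
    by (rule form3E[OF 1]) (rule that)
  obtain n' f' g' h' X' Y' Z' where w': "\<And>\<alpha>. \<alpha> < n' \<Longrightarrow> wint i (f' \<alpha>) (X' \<alpha>)" "\<And>\<alpha>. \<alpha> < n' \<Longrightarrow> wint j (g' \<alpha>) (Y' \<alpha>)"
    "\<And>\<alpha>. \<alpha> < n' \<Longrightarrow> wint l (h' \<alpha>) (Z' \<alpha>)"
    and e': "K' = kernel3 n' f' g' h'"
    "a' = (\<lambda>z. \<Sum>\<alpha><n'. ind_eq i j * ip (f' \<alpha>) (g' \<alpha>) * h' \<alpha> z)"
    "b' = (\<lambda>y. \<Sum>\<alpha><n'. ind_eq i l * ip (f' \<alpha>) (h' \<alpha>) * g' \<alpha> y)"
    "c' = (\<lambda>x. \<Sum>\<alpha><n'. ind_eq j l * ip (g' \<alpha>) (h' \<alpha>) * f' \<alpha> x)"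
    "Q' = (\<lambda>\<omega>. \<Sum>\<alpha><n'. X' \<alpha> \<omega> * Y' \<alpha> \<omega> * Z' \<alpha> \<omega>)"
    by (rule form3E[OF 2]) (rule that)
  let ?j = "\<lambda>u v \<alpha>. if \<alpha> < n then u \<alpha> else v (\<alpha> - n)"
  show ?thesis
    unfolding form3_def
  proof (rule exI[of _ "n + n'"], rule exI[of _ "?j f f'"], rule exI[of _ "?j g g'"], rule exI[of _ "?j h h'"],
        rule exI[of _ "?j X X'"], rule exI[of _ "?j Y Y'"], rule exI[of _ "?j Z Z'"], intro conjI)
    show "\<forall>\<alpha><n + n'. wint i (?j f f' \<alpha>) (?j X X' \<alpha>) \<and> wint j (?j g g' \<alpha>) (?j Y Y' \<alpha>) \<and> wint l (?j h h' \<alpha>) (?j Z Z' \<alpha>)"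
      by (auto intro: w w')
    show "(\<lambda>p. K p + K' p) = kernel3 (n + n') (?j f f') (?j g g') (?j h h')"
      unfolding e e' kernel3_def sum_split_add by (simp cong: sum.cong_simp)
    show "(\<lambda>z. a z + a' z) = (\<lambda>z. \<Sum>\<alpha><n + n'. ind_eq i j * ip (?j f f' \<alpha>) (?j g g' \<alpha>) * ?j h h' \<alpha> z)"
      unfolding e e' sum_split_add by (simp cong: sum.cong_simp)
    show "(\<lambda>z. b z + b' z) = (\<lambda>z. \<Sum>\<alpha><n + n'. ind_eq i l * ip (?j f f' \<alpha>) (?j h h' \<alpha>) * ?j g g' \<alpha> z)"
      unfolding e e' sum_split_add by (simp cong: sum.cong_simp)
    show "(\<lambda>z. c z + c' z) = (\<lambda>z. \<Sum>\<alpha><n + n'. ind_eq j l * ip (?j g g' \<alpha>) (?j h h' \<alpha>) * ?j f f' \<alpha> z)"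
      unfolding e e' sum_split_add by (simp cong: sum.cong_simp)
    show "(\<lambda>\<omega>. Q \<omega> + Q' \<omega>) = (\<lambda>\<omega>. \<Sum>\<alpha><n + n'. ?j X X' \<alpha> \<omega> * ?j Y Y' \<alpha> \<omega> * ?j Z Z' \<alpha> \<omega>)"
      unfolding e e' sum_split_add by (simp cong: sum.cong_simp)
  qed
qed

lemma form2_diff:
  "form2 i j K k Q \<Longrightarrow> form2 i j K' k' Q' \<Longrightarrow> form2 i j (\<lambda>p. K p - K' p) (k - k') (\<lambda>\<omega>. Q \<omega> - Q' \<omega>)"
  using form2_add[OF _ form2_cmult[of i j K' k' Q' "-1"], of K k Q] by simp

lemma form2_sum:
  "(\<And>r. r \<in> R \<Longrightarrow> form2 i j (K r) (k r) (Q r)) \<Longrightarrow>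
   form2 i j (\<lambda>p. \<Sum>r\<in>R. K r p) (\<Sum>r\<in>R. k r) (\<lambda>\<omega>. \<Sum>r\<in>R. Q r \<omega>)"
  by (induction R rule: infinite_finite_induct) (auto intro: form2_add form2_zero)

lemma form3_sum:
  "(\<And>r. r \<in> R \<Longrightarrow> form3 i j l (K r) (a r) (b r) (c r) (Q r)) \<Longrightarrow>
   form3 i j l (\<lambda>p. \<Sum>r\<in>R. K r p) (\<lambda>x. \<Sum>r\<in>R. a r x) (\<lambda>x. \<Sum>r\<in>R. b r x) (\<lambda>x. \<Sum>r\<in>R. c r x)
     (\<lambda>\<omega>. \<Sum>r\<in>R. Q r \<omega>)"
  by (induction R rule: infinite_finite_induct) (auto intro: form3_add form3_zero)

section \<open>Mean-square closures of the forms\<close>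

definition chaos2 :: "nat \<Rightarrow> nat \<Rightarrow> (real \<times> real \<Rightarrow> real) \<Rightarrow> real \<Rightarrow> ('a \<Rightarrow> real) \<Rightarrow> bool" where
  "chaos2 i j K k Q \<longleftrightarrow> bounded_meas L2 K \<and> (\<exists>K' k' Q'. (\<forall>n. form2 i j (K' n) (k' n) (Q' n)) \<and>
     l2_lim L2 K' K \<and> k' \<longlonglongrightarrow> k \<and> l2_lim M Q' Q)"

text \<open>In \<open>chaos2\<close> the limiting kernel is required to be bounded, because it is
  contracted once more when the form is multiplied by a Wiener integral. Third order is the last
  stage, and square integrability of the kernel, contained in \<open>l2_lim\<close>,
  suffices.\<close>

definition chaos3 :: "nat \<Rightarrow> nat \<Rightarrow> nat \<Rightarrow> (real \<times> real \<times> real \<Rightarrow> real) \<Rightarrow> (real \<Rightarrow> real) \<Rightarrow> (real \<Rightarrow> real) \<Rightarrow>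
    (real \<Rightarrow> real) \<Rightarrow> ('a \<Rightarrow> real) \<Rightarrow> bool" where
  "chaos3 i j l K a b c Q \<longleftrightarrow> (\<exists>K' a' b' c' Q'. (\<forall>n. form3 i j l (K' n) (a' n) (b' n) (c' n) (Q' n)) \<and>
     l2_lim L3 K' K \<and> l2_lim L a' a \<and> l2_lim L b' b \<and> l2_lim L c' c \<and> l2_lim M Q' Q)"

lemma chaos2I:
  assumes "bounded_meas L2 K" "\<And>n. form2 i j (K' n) (k' n) (Q' n)" "l2_lim L2 K' K" "k' \<longlonglongrightarrow> k" "l2_lim M Q' Q"
  shows "chaos2 i j K k Q"
  unfolding chaos2_def using assms by blast

lemma chaos2E:
  assumes "chaos2 i j K k Q"
  obtains K' k' Q' where "bounded_meas L2 K" "\<And>n. form2 i j (K' n) (k' n) (Q' n)" "l2_lim L2 K' K" "k' \<longlonglongrightarrow> k"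
    "l2_lim M Q' Q"
  using assms unfolding chaos2_def by blast

lemma chaos3I:
  assumes "\<And>n. form3 i j l (K' n) (a' n) (b' n) (c' n) (Q' n)" "l2_lim L3 K' K" "l2_lim L a' a" "l2_lim L b' b"
    "l2_lim L c' c" "l2_lim M Q' Q"
  shows "chaos3 i j l K a b c Q"
  unfolding chaos3_def using assms by blast

lemma chaos3E:
  assumes "chaos3 i j l K a b c Q"
  obtains K' a' b' c' Q' where "\<And>n. form3 i j l (K' n) (a' n) (b' n) (c' n) (Q' n)" "l2_lim L3 K' K" "l2_lim L a' a"
    "l2_lim L b' b" "l2_lim L c' c" "l2_lim M Q' Q"
  using assms unfolding chaos3_def by blast

lemma chaos2_add:
  assumes "chaos2 i j K k Q" "chaos2 i j K1 k1 Q1"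
  shows "chaos2 i j (\<lambda>p. K p + K1 p) (k + k1) (\<lambda>\<omega>. Q \<omega> + Q1 \<omega>)"
proof -
  obtain K' k' Q' where a: "bounded_meas L2 K" "\<And>n. form2 i j (K' n) (k' n) (Q' n)" "l2_lim L2 K' K" "k' \<longlonglongrightarrow> k"
    "l2_lim M Q' Q" by (rule chaos2E[OF assms(1)]) (rule that)
  obtain K1' k1' Q1' where b: "bounded_meas L2 K1" "\<And>n. form2 i j (K1' n) (k1' n) (Q1' n)" "l2_lim L2 K1' K1"
    "k1' \<longlonglongrightarrow> k1" "l2_lim M Q1' Q1" by (rule chaos2E[OF assms(2)]) (rule that)
  show ?thesis
    by (rule chaos2I[OF bounded_meas_add[OF a(1) b(1)] form2_add[OF a(2) b(2)] l2_lim_add[OF a(3) b(3)]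
          tendsto_add[OF a(4) b(4)] l2_lim_add[OF a(5) b(5)]])
qed

lemma chaos2_cmult:
  assumes "chaos2 i j K k Q"
  shows "chaos2 i j (\<lambda>p. s * K p) (s * k) (\<lambda>\<omega>. s * Q \<omega>)"
proof -
  obtain K' k' Q' where a: "bounded_meas L2 K" "\<And>n. form2 i j (K' n) (k' n) (Q' n)" "l2_lim L2 K' K" "k' \<longlonglongrightarrow> k"
    "l2_lim M Q' Q" by (rule chaos2E[OF assms(1)]) (rule that)
  show ?thesis
    by (rule chaos2I[OF bounded_meas_cmult[OF a(1)] form2_cmult[OF a(2)] l2_lim_cmult[OF a(3)]
          tendsto_mult_left[OF a(4)] l2_lim_cmult[OF a(5)]])
qed

lemma chaos3_add:
  assumes "chaos3 i j l K a b c Q" "chaos3 i j l K1 a1 b1 c1 Q1"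
  shows "chaos3 i j l (\<lambda>p. K p + K1 p) (\<lambda>x. a x + a1 x) (\<lambda>x. b x + b1 x) (\<lambda>x. c x + c1 x) (\<lambda>\<omega>. Q \<omega> + Q1 \<omega>)"
proof -
  obtain K' a' b' c' Q' where a: "\<And>n. form3 i j l (K' n) (a' n) (b' n) (c' n) (Q' n)" "l2_lim L3 K' K" "l2_lim L a' a"
    "l2_lim L b' b" "l2_lim L c' c" "l2_lim M Q' Q" by (rule chaos3E[OF assms(1)]) (rule that)
  obtain K1' a1' b1' c1' Q1' where b: "\<And>n. form3 i j l (K1' n) (a1' n) (b1' n) (c1' n) (Q1' n)" "l2_lim L3 K1' K1"
    "l2_lim L a1' a1" "l2_lim L b1' b1" "l2_lim L c1' c1" "l2_lim M Q1' Q1" by (rule chaos3E[OF assms(2)]) (rule that)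
  show ?thesis
    by (rule chaos3I[OF form3_add[OF a(1) b(1)] l2_lim_add[OF a(2) b(2)] l2_lim_add[OF a(3) b(3)]
          l2_lim_add[OF a(4) b(4)] l2_lim_add[OF a(5) b(5)] l2_lim_add[OF a(6) b(6)]])
qed

lemma form3_chaos3:
  assumes "form3 i j l K a b c Q"
  shows "chaos3 i j l K a b c Q"
  by (rule chaos3I[OF assms]; intro l2_lim_const L.bounded_meas_sq L3.bounded_meas_sq form3_bound(1-5)[OF assms])

lemma chaos3_zero: "chaos3 i j l (\<lambda>p. 0) (\<lambda>x. 0) (\<lambda>x. 0) (\<lambda>x. 0) (\<lambda>\<omega>. 0)"
  by (rule form3_chaos3[OF form3_zero])

lemma chaos3_cmult:
  assumes "chaos3 i j l K a b c Q"
  shows "chaos3 i j l (\<lambda>p. s * K p) (\<lambda>x. s * a x) (\<lambda>x. s * b x) (\<lambda>x. s * c x) (\<lambda>\<omega>. s * Q \<omega>)"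
proof -
  obtain K' a' b' c' Q' where a: "\<And>n. form3 i j l (K' n) (a' n) (b' n) (c' n) (Q' n)" "l2_lim L3 K' K" "l2_lim L a' a"
    "l2_lim L b' b" "l2_lim L c' c" "l2_lim M Q' Q" by (rule chaos3E[OF assms(1)]) (rule that)
  show ?thesis
    by (rule chaos3I[OF form3_cmult[OF a(1)] l2_lim_cmult[OF a(2)] l2_lim_cmult[OF a(3)]
          l2_lim_cmult[OF a(4)] l2_lim_cmult[OF a(5)] l2_lim_cmult[OF a(6)]])
qed

lemma chaos3_diff:
  "chaos3 i j l K a b c Q \<Longrightarrow> chaos3 i j l K' a' b' c' Q' \<Longrightarrow>
   chaos3 i j l (\<lambda>p. K p - K' p) (\<lambda>x. a x - a' x) (\<lambda>x. b x - b' x) (\<lambda>x. c x - c' x) (\<lambda>\<omega>. Q \<omega> - Q' \<omega>)"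
  using chaos3_add[OF _ chaos3_cmult[of i j l K' a' b' c' Q' "-1"], of K a b c Q] by simp

lemma chaos3_sum:
  "(\<And>r. r \<in> R \<Longrightarrow> chaos3 i j l (K r) (a r) (b r) (c r) (Q r)) \<Longrightarrow>
   chaos3 i j l (\<lambda>p. \<Sum>r\<in>R. K r p) (\<lambda>x. \<Sum>r\<in>R. a r x) (\<lambda>x. \<Sum>r\<in>R. b r x) (\<lambda>x. \<Sum>r\<in>R. c r x)
     (\<lambda>\<omega>. \<Sum>r\<in>R. Q r \<omega>)"
  by (induction R rule: infinite_finite_induct) (auto intro: chaos3_add chaos3_zero)

lemma chaos3_bound:
  assumes "chaos3 i j l K a b c Q"
  shows "sq_integrable M Q" "l2_sq M Q \<le> 6 * l2_sq L3 K + 3 * (l2_sq L a + l2_sq L b + l2_sq L c)"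
proof -
  obtain K' a' b' c' Q' where a: "\<And>n. form3 i j l (K' n) (a' n) (b' n) (c' n) (Q' n)" "l2_lim L3 K' K" "l2_lim L a' a"
    "l2_lim L b' b" "l2_lim L c' c" "l2_lim M Q' Q" by (rule chaos3E[OF assms(1)]) (rule that)
  show "sq_integrable M Q" by (rule l2_limD(2)[OF a(6)])
  show "l2_sq M Q \<le> 6 * l2_sq L3 K + 3 * (l2_sq L a + l2_sq L b + l2_sq L c)"
  proof (rule LIMSEQ_le)
    show "(\<lambda>n. l2_sq M (Q' n)) \<longlonglongrightarrow> l2_sq M Q" by (intro l2_sq_tendsto a)
    show "(\<lambda>n. 6 * l2_sq L3 (K' n) + 3 * (l2_sq L (a' n) + l2_sq L (b' n) + l2_sq L (c' n)))
        \<longlonglongrightarrow> 6 * l2_sq L3 K + 3 * (l2_sq L a + l2_sq L b + l2_sq L c)"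
      by (intro tendsto_intros l2_sq_tendsto a)
    show "\<exists>N. \<forall>n\<ge>N. l2_sq M (Q' n) \<le> 6 * l2_sq L3 (K' n) + 3 * (l2_sq L (a' n) + l2_sq L (b' n) + l2_sq L (c' n))"
      by (intro exI allI impI form3_bound(6)[OF a(1)])
  qed
qed

text \<open>The comparison principle, applied with Stratonovich sums as one sequence and truncated
  expansions as the other.\<close>

lemma chaos3_diff_lim:
  assumes 1: "\<And>n. chaos3 i j l (K1 n) (a1 n) (b1 n) (c1 n) (Q1 n)"
    and 2: "\<And>n. chaos3 i j l (K2 n) (a2 n) (b2 n) (c2 n) (Q2 n)"
    and K: "l2_lim L3 K1 K" "l2_lim L3 K2 K" and a: "l2_lim L a1 a" "l2_lim L a2 a"
    and b: "l2_lim L b1 b" "l2_lim L b2 b" and c: "l2_lim L c1 c" "l2_lim L c2 c"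
  shows "(\<lambda>n. l2_sq M (\<lambda>\<omega>. Q1 n \<omega> - Q2 n \<omega>)) \<longlonglongrightarrow> 0"
proof (rule tendsto_sandwich[OF _ _ tendsto_const])
  let ?b = "\<lambda>n. 6 * l2_sq L3 (\<lambda>p. K1 n p - K2 n p) +
     3 * (l2_sq L (\<lambda>x. a1 n x - a2 n x) + l2_sq L (\<lambda>x. b1 n x - b2 n x) + l2_sq L (\<lambda>x. c1 n x - c2 n x))"
  show "\<forall>\<^sub>F n in sequentially. l2_sq M (\<lambda>\<omega>. Q1 n \<omega> - Q2 n \<omega>) \<le> ?b n"
    by (intro always_eventually allI chaos3_bound(2)[OF chaos3_diff[OF 1 2]])
  have "?b \<longlonglongrightarrow> 6 * 0 + 3 * (0 + 0 + 0)"
    by (intro tendsto_intros l2_lim_diff_zero[OF K] l2_lim_diff_zero[OF a] l2_lim_diff_zero[OF b] l2_lim_diff_zero[OF c])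
  then show "?b \<longlonglongrightarrow> 0" by simp
qed simp

lemma chaos3_converges:
  assumes 1: "\<And>n. chaos3 i j l (K' n) (a' n) (b' n) (c' n) (Q n)"
    and lim: "l2_lim L3 K' K" "l2_lim L a' a" "l2_lim L b' b" "l2_lim L c' c"
  shows "\<exists>Y. l2_lim M Q Y"
proof (rule l2_complete)
  show "sq_integrable M (Q n)" for n by (rule chaos3_bound(1)[OF 1])
  fix e :: real assume "e > 0"
  \<comment> \<open>The bound of \<open>chaos3_bound\<close> weighs the kernel by 6 and each of the
    three traces by 3, together 15.\<close>
  then have e: "e / 15 > 0" by simp
  from l2_lim_Cauchy[OF lim(1) e] obtain n1 where
    n1: "\<And>m n. m \<ge> n1 \<Longrightarrow> n \<ge> n1 \<Longrightarrow> l2_sq L3 (\<lambda>x. K' m x - K' n x) < e / 15" by blast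
  from l2_lim_Cauchy[OF lim(2) e] obtain n2 where
    n2: "\<And>m n. m \<ge> n2 \<Longrightarrow> n \<ge> n2 \<Longrightarrow> l2_sq L (\<lambda>x. a' m x - a' n x) < e / 15" by blast
  from l2_lim_Cauchy[OF lim(3) e] obtain n3 where
    n3: "\<And>m n. m \<ge> n3 \<Longrightarrow> n \<ge> n3 \<Longrightarrow> l2_sq L (\<lambda>x. b' m x - b' n x) < e / 15" by blast
  from l2_lim_Cauchy[OF lim(4) e] obtain n4 where
    n4: "\<And>m n. m \<ge> n4 \<Longrightarrow> n \<ge> n4 \<Longrightarrow> l2_sq L (\<lambda>x. c' m x - c' n x) < e / 15" by blast
  show "\<exists>n0. \<forall>m\<ge>n0. \<forall>n\<ge>n0. l2_sq M (\<lambda>x. Q m x - Q n x) < e"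
  proof (intro exI[of _ "max (max n1 n2) (max n3 n4)"] allI impI)
    fix p q assume "max (max n1 n2) (max n3 n4) \<le> p" "max (max n1 n2) (max n3 n4) \<le> q"
    then show "l2_sq M (\<lambda>x. Q p x - Q q x) < e"
      using chaos3_bound(2)[OF chaos3_diff[OF 1[of p] 1[of q]]] n1[of p q] n2[of p q] n3[of p q] n4[of p q]
      by simp
  qed
qed

lemma form2_diff_lim:
  assumes 1: "\<And>n. form2 i j (K1 n) (k1 n) (Q1 n)" and 2: "\<And>n. form2 i j (K2 n) (k2 n) (Q2 n)"
    and K: "l2_lim L2 K1 K" "l2_lim L2 K2 K" and k: "k1 \<longlonglongrightarrow> k" "k2 \<longlonglongrightarrow> k"
  shows "(\<lambda>n. l2_sq M (\<lambda>\<omega>. Q1 n \<omega> - Q2 n \<omega>)) \<longlonglongrightarrow> 0"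
proof (rule tendsto_sandwich[OF _ _ tendsto_const])
  let ?b = "\<lambda>n. 2 * l2_sq L2 (\<lambda>p. K1 n p - K2 n p) + (k1 n - k2 n)\<^sup>2"
  show "\<forall>\<^sub>F n in sequentially. l2_sq M (\<lambda>\<omega>. Q1 n \<omega> - Q2 n \<omega>) \<le> ?b n"
    by (intro always_eventually allI form2_bound(3)[OF form2_diff[OF 1 2]])
  have "?b \<longlonglongrightarrow> 2 * 0 + (k - k)\<^sup>2"
    by (intro tendsto_intros l2_lim_diff_zero[OF K] k)
  then show "?b \<longlonglongrightarrow> 0" by simp
qed simp

lemma form2_converges:
  assumes 1: "\<And>n. form2 i j (K' n) (k' n) (Q n)" and lim: "l2_lim L2 K' K" "k' \<longlonglongrightarrow> k" and K: "bounded_meas L2 K"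
  shows "\<exists>Y. l2_lim M Q Y \<and> chaos2 i j K k Y"
proof -
  have "\<exists>Y. l2_lim M Q Y"
  proof (rule l2_complete)
    show "sq_integrable M (Q n)" for n by (rule form2_bound(1)[OF 1])
    fix e :: real assume "e > 0"
    \<comment> \<open>Chosen so that \<open>2 * (e / 4) + e / 2 = e\<close> in the bound of
      \<open>form2_bound\<close>.\<close>
    then have e: "e / 4 > 0" "sqrt (e / 2) > 0" by auto
    from lim(2) have "Cauchy k'" by (rule LIMSEQ_imp_Cauchy)
    from CauchyD[OF this e(2)] obtain n2 where n2: "\<And>m n. m \<ge> n2 \<Longrightarrow> n \<ge> n2 \<Longrightarrow> \<bar>k' m - k' n\<bar> < sqrt (e / 2)" by auto
    from l2_lim_Cauchy[OF lim(1) e(1)] obtain n1 where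
      n1: "\<And>m n. m \<ge> n1 \<Longrightarrow> n \<ge> n1 \<Longrightarrow> l2_sq L2 (\<lambda>x. K' m x - K' n x) < e / 4" by auto
    show "\<exists>n0. \<forall>m\<ge>n0. \<forall>n\<ge>n0. l2_sq M (\<lambda>x. Q m x - Q n x) < e"
    proof (intro exI[of _ "max n1 n2"] allI impI)
      fix p q assume pq: "max n1 n2 \<le> p" "max n1 n2 \<le> q"
      then have "\<bar>k' p - k' q\<bar>\<^sup>2 < (sqrt (e / 2))\<^sup>2" by (intro power_strict_mono n2) auto
      then have "(k' p - k' q)\<^sup>2 < e / 2" using \<open>e > 0\<close> by simp
      with pq show "l2_sq M (\<lambda>x. Q p x - Q q x) < e"
        using form2_bound(3)[OF form2_diff[OF 1[of p] 1[of q]]] n1[of p q] by simp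
    qed
  qed
  then obtain Y where Y: "l2_lim M Q Y" by blast
  have "chaos2 i j K k Y"
    by (rule chaos2I[OF K 1 lim Y])
  with Y show ?thesis by blast
qed

section \<open>Products of a second order form with a Wiener integral\<close>

lemma integral_L3:
  assumes F: "bounded_meas L3 G"
  shows "(\<integral>p. G p \<partial>L3) = (\<integral>x. \<integral>y. \<integral>z. G (x, y, z) \<partial>L \<partial>L \<partial>L)"
proof -
  have "(\<integral>p. G p \<partial>L3) = (\<integral>x. \<integral>q. G (x, q) \<partial>L2 \<partial>L)"
    by (rule bounded_meas_fubini(1)[OF L.finite_measure_axioms L2.finite_measure_axioms F])
  also have "\<dots> = (\<integral>x. \<integral>y. \<integral>z. G (x, y, z) \<partial>L \<partial>L \<partial>L)"
    by (intro Bochner_Integration.integral_cong refl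
        bounded_meas_fubini(1)[OF L.finite_measure_axioms L.finite_measure_axioms bounded_meas_section[OF F]])
  finally show ?thesis .
qed

lemma bounded_meas_L3_tensor:
  assumes "bounded_meas L2 K" "bounded_meas L h"
  shows "bounded_meas L3 (\<lambda>(x, y, z). K (x, y) * h z)"
proof -
  have [measurable]: "K \<in> borel_measurable L2" "h \<in> borel_measurable L"
    using assms by (auto dest: bounded_meas_measurable)
  obtain C where C: "C \<ge> 0" "\<And>p. p \<in> space L2 \<Longrightarrow> \<bar>K p\<bar> \<le> C" using bounded_meas_bound[OF assms(1)] by blast
  obtain D where D: "D \<ge> 0" "\<And>p. p \<in> space L \<Longrightarrow> \<bar>h p\<bar> \<le> D" using bounded_meas_bound[OF assms(2)] by blast
  show ?thesis
  proof (rule bounded_measI)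
    show "(\<lambda>(x, y, z). K (x, y) * h z) \<in> borel_measurable L3" by measurable
    show "\<bar>case p of (x, y, z) \<Rightarrow> K (x, y) * h z\<bar> \<le> C * D" if "p \<in> space L3" for p
      using that C D by (auto simp: space_pair_measure abs_mult simp del: space_L intro!: mult_mono)
  qed
qed

lemma l2_sq_L3_tensor:
  assumes K: "bounded_meas L2 K" and h: "bounded_meas L h"
  shows "l2_sq L3 (\<lambda>(x, y, z). K (x, y) * h z) = l2_sq L2 K * l2_sq L h"
proof -
  have "l2_sq L3 (\<lambda>(x, y, z). K (x, y) * h z) = (\<integral>x. \<integral>y. (K (x, y))\<^sup>2 * l2_sq L h \<partial>L \<partial>L)"
    unfolding l2_sq_def
    by (subst integral_L3[OF bounded_meas_power2[OF bounded_meas_L3_tensor[OF K h]]]) (simp add: power_mult_distrib)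
  also have "\<dots> = l2_sq L2 K * l2_sq L h"
    using bounded_meas_fubini(1)[OF L.finite_measure_axioms L.finite_measure_axioms bounded_meas_power2[OF K]]
    by (simp add: l2_sq_def)
  finally show ?thesis .
qed

text \<open>The contraction of the two old variables is inherited as \<open>k\<close>; a contraction
  with the new variable integrates one variable of \<open>K\<close> against
  \<open>h\<close>.\<close>

lemma form2_tensor:
  assumes Q: "form2 i j K k Q" and Z: "wint l h Z"
  shows "form3 i j l (\<lambda>(x, y, z). K (x, y) * h z) (\<lambda>z. k * h z) (\<lambda>y. ind_eq i l * (\<integral>x. K (x, y) * h x \<partial>L))
      (\<lambda>x. ind_eq j l * (\<integral>y. K (x, y) * h y \<partial>L)) (\<lambda>\<omega>. Q \<omega> * Z \<omega>)"
proof -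
  obtain n f g X Y where w: "\<And>\<alpha>. \<alpha> < n \<Longrightarrow> wint i (f \<alpha>) (X \<alpha>)" "\<And>\<alpha>. \<alpha> < n \<Longrightarrow> wint j (g \<alpha>) (Y \<alpha>)"
    and e: "K = kernel2 n f g" "k = (\<Sum>\<alpha><n. ind_eq i j * ip (f \<alpha>) (g \<alpha>))" "Q = (\<lambda>\<omega>. \<Sum>\<alpha><n. X \<alpha> \<omega> * Y \<alpha> \<omega>)"
    by (rule form2E[OF Q]) (rule that)
  have fh: "integrable L (\<lambda>x. f \<alpha> x * h x)" "integrable L (\<lambda>x. g \<alpha> x * h x)" if "\<alpha> < n" for \<alpha>
    using that by (intro sq_integrable_mult wintD(4)[OF w(1)] wintD(4)[OF w(2)] wintD(4)[OF Z]; assumption)+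
  have 1: "(\<integral>x. K (x, y) * h x \<partial>L) = (\<Sum>\<alpha><n. ip (f \<alpha>) h * g \<alpha> y)" for y
  proof -
    have "(\<integral>x. K (x, y) * h x \<partial>L) = (\<integral>x. (\<Sum>\<alpha><n. (f \<alpha> x * h x) * g \<alpha> y) \<partial>L)"
      by (intro Bochner_Integration.integral_cong) (auto simp: e kernel2_def sum_distrib_left sum_distrib_right mult_ac)
    also have "\<dots> = (\<Sum>\<alpha><n. ip (f \<alpha>) h * g \<alpha> y)"
      unfolding l2_inner_def using fh by (subst Bochner_Integration.integral_sum) auto
    finally show ?thesis .
  qed
  have 2: "(\<integral>y. K (x, y) * h y \<partial>L) = (\<Sum>\<alpha><n. ip (g \<alpha>) h * f \<alpha> x)" for x
  proof -
    have "(\<integral>y. K (x, y) * h y \<partial>L) = (\<integral>y. (\<Sum>\<alpha><n. (g \<alpha> y * h y) * f \<alpha> x) \<partial>L)"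
      by (intro Bochner_Integration.integral_cong) (auto simp: e kernel2_def sum_distrib_left sum_distrib_right mult_ac)
    also have "\<dots> = (\<Sum>\<alpha><n. ip (g \<alpha>) h * f \<alpha> x)"
      unfolding l2_inner_def using fh by (subst Bochner_Integration.integral_sum) auto
    finally show ?thesis .
  qed
  show ?thesis
    unfolding form3_def
  proof (rule exI[of _ n], rule exI[of _ f], rule exI[of _ g], rule exI[of _ "\<lambda>_. h"],
        rule exI[of _ X], rule exI[of _ Y], rule exI[of _ "\<lambda>_. Z"], intro conjI)
    show "\<forall>\<alpha><n. wint i (f \<alpha>) (X \<alpha>) \<and> wint j (g \<alpha>) (Y \<alpha>) \<and> wint l h Z" by (auto intro: w Z)
    show "(\<lambda>(x, y, z). K (x, y) * h z) = kernel3 n f g (\<lambda>_. h)"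
      by (auto simp: e kernel3_def kernel2_def sum_distrib_right mult.assoc)
    show "(\<lambda>z. k * h z) = (\<lambda>z. \<Sum>\<alpha><n. ind_eq i j * ip (f \<alpha>) (g \<alpha>) * h z)"
      by (simp add: e sum_distrib_right)
    show "(\<lambda>y. ind_eq i l * (\<integral>x. K (x, y) * h x \<partial>L)) = (\<lambda>y. \<Sum>\<alpha><n. ind_eq i l * ip (f \<alpha>) h * g \<alpha> y)"
      unfolding 1 by (simp add: sum_distrib_left mult.assoc)
    show "(\<lambda>x. ind_eq j l * (\<integral>y. K (x, y) * h y \<partial>L)) = (\<lambda>x. \<Sum>\<alpha><n. ind_eq j l * ip (g \<alpha>) h * f \<alpha> x)"
      unfolding 2 by (simp add: sum_distrib_left mult.assoc)
    show "(\<lambda>\<omega>. Q \<omega> * Z \<omega>) = (\<lambda>\<omega>. \<Sum>\<alpha><n. X \<alpha> \<omega> * Y \<alpha> \<omega> * Z \<omega>)"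
      by (simp add: e sum_distrib_right)
  qed
qed

lemma contract_snd_lim:
  assumes K: "\<And>n. bounded_meas L2 (K' n)" "bounded_meas L2 K" and lim: "l2_lim L2 K' K" and h: "bounded_meas L h"
  shows "l2_lim L (\<lambda>n x. \<integral>y. K' n (x, y) * h y \<partial>L) (\<lambda>x. \<integral>y. K (x, y) * h y \<partial>L)"
proof (rule l2_limI_le)
  have hs: "bounded_meas L2 (\<lambda>p. h (snd p))"
    using bounded_meas_tensor[OF bounded_meas_const[of L 1] h] by (simp add: case_prod_beta')
  have c: "bounded_meas L (\<lambda>x. \<integral>y. G (x, y) * h y \<partial>L)" if "bounded_meas L2 G" for G
    using bounded_meas_integral[OF L.finite_measure_axioms bounded_meas_mult[OF that hs]] by simp
  show "sq_integrable L (\<lambda>x. \<integral>y. K' n (x, y) * h y \<partial>L)" "sq_integrable L (\<lambda>x. \<integral>y. K (x, y) * h y \<partial>L)" for n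
    by (intro L.bounded_meas_sq c K)+
  have i: "integrable L (\<lambda>y. G (x, y) * h y)" if "bounded_meas L2 G" "x \<in> space L" for G x
    using bounded_meas_section[OF that] by (intro L.bounded_meas_integrable bounded_meas_mult h)
  show "l2_sq L (\<lambda>x. (\<integral>y. K' n (x, y) * h y \<partial>L) - (\<integral>y. K (x, y) * h y \<partial>L))
      \<le> l2_sq L h * l2_sq L2 (\<lambda>p. K' n p - K p)" for n
  proof -
    have "l2_sq L (\<lambda>x. (\<integral>y. K' n (x, y) * h y \<partial>L) - (\<integral>y. K (x, y) * h y \<partial>L)) =
        l2_sq L (\<lambda>x. \<integral>y. (K' n (x, y) - K (x, y)) * h y \<partial>L)"
      unfolding l2_sq_def using i[OF K(1)] i[OF K(2)]
      by (intro Bochner_Integration.integral_cong) (auto simp: left_diff_distrib)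
    also have "\<dots> \<le> l2_sq L h * l2_sq L2 (\<lambda>p. K' n p - K p)"
      by (rule l2_sq_contract[OF L.finite_measure_axioms L.finite_measure_axioms bounded_meas_diff[OF K] h])
    finally show ?thesis .
  qed
  show "(\<lambda>n. l2_sq L h * l2_sq L2 (\<lambda>p. K' n p - K p)) \<longlonglongrightarrow> 0"
    using tendsto_mult_left[OF l2_limD(3)[OF lim], of "l2_sq L h"] by simp
qed

text \<open>Transposing the kernel reduces contractions in the first variable to
  \<open>contract_snd_lim\<close>.\<close>

lemma l2_lim_swap:
  assumes K: "\<And>n. bounded_meas L2 (K' n)" "bounded_meas L2 K" and lim: "l2_lim L2 K' K"
  shows "l2_lim L2 (\<lambda>n p. K' n (snd p, fst p)) (\<lambda>p. K (snd p, fst p))"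
proof (rule l2_limI_le[OF _ _ _ l2_limD(3)[OF lim]])
  show "sq_integrable L2 (\<lambda>p. K' n (snd p, fst p))" "sq_integrable L2 (\<lambda>p. K (snd p, fst p))" for n
    by (intro L2.bounded_meas_sq bounded_meas_swap K)+
  show "l2_sq L2 (\<lambda>p. K' n (snd p, fst p) - K (snd p, fst p)) \<le> l2_sq L2 (\<lambda>p. K' n p - K p)" for n
    using l2_sq_swap[OF L.finite_measure_axioms L.finite_measure_axioms bounded_meas_diff[OF K], of n] by simp
qed

lemma tensor_lim:
  assumes K: "\<And>n. bounded_meas L2 (K' n)" "bounded_meas L2 K" and lim: "l2_lim L2 K' K" and h: "bounded_meas L h"
  shows "l2_lim L3 (\<lambda>n. \<lambda>(x, y, z). K' n (x, y) * h z) (\<lambda>(x, y, z). K (x, y) * h z)"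
proof (rule l2_limI_le)
  show "sq_integrable L3 (\<lambda>(x, y, z). K' n (x, y) * h z)" "sq_integrable L3 (\<lambda>(x, y, z). K (x, y) * h z)" for n
    by (intro L3.bounded_meas_sq bounded_meas_L3_tensor K h)+
  have "(\<lambda>p. (case p of (x, y, z) \<Rightarrow> K' n (x, y) * h z) - (case p of (x, y, z) \<Rightarrow> K (x, y) * h z)) =
     (\<lambda>(x, y, z). (K' n (x, y) - K (x, y)) * h z)" for n
    by (auto simp: left_diff_distrib)
  then show "l2_sq L3 (\<lambda>p. (case p of (x, y, z) \<Rightarrow> K' n (x, y) * h z) - (case p of (x, y, z) \<Rightarrow> K (x, y) * h z))
      \<le> l2_sq L2 (\<lambda>p. K' n p - K p) * l2_sq L h" for n
    using l2_sq_L3_tensor[OF bounded_meas_diff[OF K] h, of n] by simp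
  show "(\<lambda>n. l2_sq L2 (\<lambda>p. K' n p - K p) * l2_sq L h) \<longlonglongrightarrow> 0"
    using tendsto_mult_right[OF l2_limD(3)[OF lim], of "l2_sq L h"] by simp
qed

text \<open>The products \<open>Q' n * Z\<close> converge because they are third order forms with convergent kernel and traces;
  an almost surely convergent subsequence of \<open>Q' n\<close> identifies their limit as \<open>Q * Z\<close>.\<close>

lemma chaos2_tensor:
  assumes Q: "chaos2 i j K k Q" and Z: "wint l h Z"
  shows "chaos3 i j l (\<lambda>(x, y, z). K (x, y) * h z) (\<lambda>z. k * h z) (\<lambda>y. ind_eq i l * (\<integral>x. K (x, y) * h x \<partial>L))
      (\<lambda>x. ind_eq j l * (\<integral>y. K (x, y) * h y \<partial>L)) (\<lambda>\<omega>. Q \<omega> * Z \<omega>)"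
proof -
  obtain K' k' Q' where bK: "bounded_meas L2 K" and f: "\<And>n. form2 i j (K' n) (k' n) (Q' n)" and K: "l2_lim L2 K' K"
    and k: "k' \<longlonglongrightarrow> k" and lQ: "l2_lim M Q' Q"
    by (rule chaos2E[OF Q]) (rule that)
  note bK' = form2_bound(2)[OF f]
  note h = wintD(2)[OF Z]
  note f3 = form2_tensor[OF f Z]
  note lK = tensor_lim[OF bK' bK K h]
  have la: "l2_lim L (\<lambda>n z. k' n * h z) (\<lambda>z. k * h z)"
  proof (rule l2_limI_le)
    show "sq_integrable L (\<lambda>z. k' n * h z)" "sq_integrable L (\<lambda>z. k * h z)" for n
      by (intro sq_integrable_cmult wintD(4)[OF Z])+
    show "l2_sq L (\<lambda>z. k' n * h z - k * h z) \<le> (k' n - k)\<^sup>2 * l2_sq L h" for n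
      by (simp add: l2_sq_cmult flip: left_diff_distrib)
    have "(\<lambda>n. (k' n - k)\<^sup>2 * l2_sq L h) \<longlonglongrightarrow> (k - k)\<^sup>2 * l2_sq L h" by (intro tendsto_intros k)
    then show "(\<lambda>n. (k' n - k)\<^sup>2 * l2_sq L h) \<longlonglongrightarrow> 0" by simp
  qed
  have lc: "l2_lim L (\<lambda>n x. ind_eq j l * (\<integral>y. K' n (x, y) * h y \<partial>L)) (\<lambda>x. ind_eq j l * (\<integral>y. K (x, y) * h y \<partial>L))"
    by (rule l2_lim_cmult[OF contract_snd_lim[OF bK' bK K h]])
  have lb: "l2_lim L (\<lambda>n x. ind_eq i l * (\<integral>y. K' n (y, x) * h y \<partial>L)) (\<lambda>x. ind_eq i l * (\<integral>y. K (y, x) * h y \<partial>L))"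
    using l2_lim_cmult[OF contract_snd_lim[OF bounded_meas_swap[OF bK'] bounded_meas_swap[OF bK] l2_lim_swap[OF bK' bK K] h]] by simp
  from chaos3_converges[OF form3_chaos3[OF f3] lK la lb lc] obtain R where R: "l2_lim M (\<lambda>n \<omega>. Q' n \<omega> * Z \<omega>) R" by blast
  have "AE \<omega> in M. R \<omega> = Q \<omega> * Z \<omega>"
  proof -
    from l2_lim_AE_subseq[OF lQ] obtain r where
      r: "strict_mono r" "AE x in M. (\<lambda>n. Q' (r n) x) \<longlonglongrightarrow> Q x" by blast
    from l2_lim_AE_subseq[OF l2_lim_subseq[OF R r(1)]] obtain r' where
      r': "strict_mono r'" "AE x in M. (\<lambda>n. Q' (r (r' n)) x * Z x) \<longlonglongrightarrow> R x" by blast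
    from r(2) r'(2) show ?thesis
    proof eventually_elim
      case (elim x)
      have "(\<lambda>n. Q' (r (r' n)) x * Z x) \<longlonglongrightarrow> Q x * Z x"
        using tendsto_mult_right[OF LIMSEQ_subseq_LIMSEQ[OF elim(1) r'(1)], of "Z x"] by (simp add: o_def)
      with elim(2) show ?case by (rule LIMSEQ_unique)
    qed
  qed
  then have "l2_lim M (\<lambda>n \<omega>. Q' n \<omega> * Z \<omega>) (\<lambda>\<omega>. Q \<omega> * Z \<omega>)"
    using sq_integrable_measurable[OF l2_limD(2)[OF lQ]] sq_integrable_measurable[OF wintD(3)[OF Z]]
    by (intro l2_lim_unique_limit[OF R]) auto
  from chaos3I[OF f3 lK la lb lc this] show ?thesis .
qed

end

section \<open>Orthonormal systems\<close>

lemma integral_Icc_measure: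
  fixes f :: "real \<Rightarrow> real"
  assumes "continuous_on {a..b} f"
  shows "(\<integral>x. f x \<partial>(Icc_measure a b)) = integral {a..b} f"
proof -
  have "(\<integral>x. f x \<partial>(Icc_measure a b)) = (LINT x:{a..b}|lborel. f x)"
    unfolding Icc_measure_def set_lebesgue_integral_def by (subst integral_restrict_space) auto
  also have "\<dots> = integral {a..b} f"
    by (rule set_borel_integral_eq_integral(2)) (rule borel_integrable_atLeastAtMost', rule assms)
  finally show ?thesis .
qed

lemma continuous_bounded_meas:
  fixes f :: "real \<Rightarrow> real"
  assumes "continuous_on {a..b} f"
  shows "bounded_meas (Icc_measure a b) f"
proof -
  have "bounded (f ` {a..b})" using assms by (intro compact_imp_bounded compact_continuous_image) auto
  then obtain B where "\<forall>x\<in>{a..b}. \<bar>f x\<bar> \<le> B" by (auto simp: bounded_iff)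
  then show ?thesis
    by (intro bounded_measI continuous_on_measurable_Icc_measure assms) auto
qed

lemma borel_set_Icc_measure: "S \<in> sets borel \<Longrightarrow> bounded_meas (Icc_measure a b) (indicator S)"
  by (rule bounded_measI[where B=1]) (auto intro!: borel_measurable_Icc_measure split: split_indicator)

lemma AE_interval_neq: "AE x in Icc_measure a b. x \<noteq> c"
  unfolding Icc_measure_def
  by (subst AE_restrict_space_iff) (auto intro: AE_mp[OF AE_lborel_singleton[of c]])

text \<open>The common interface of the Legendre and the trigonometric system. Completeness is
  stated as mean-square approximability of continuous functions; discontinuous cut-offs are reached
  from it by limits.\<close>

locale ortho_system =
  fixes a b :: real and \<phi> :: "nat \<Rightarrow> real \<Rightarrow> real"
  assumes ab: "a < b"
    and phi_cont: "\<And>j. continuous_on {a..b} (\<phi> j)"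
    and phi_orth: "\<And>i j. integral {a..b} (\<lambda>x. \<phi> i x * \<phi> j x) = (if i = j then 1 else 0)"
    and phi_dense: "\<And>f e. continuous_on {a..b} f \<Longrightarrow> e > 0 \<Longrightarrow>
      \<exists>n c. l2_sq (Icc_measure a b) (\<lambda>x. f x - (\<Sum>j\<le>n. c j * \<phi> j x)) < e"
begin

abbreviation I :: "real measure" where "I \<equiv> Icc_measure a b"

sublocale I: finite_measure I by (rule finite_measure_Icc_measure)

definition coef :: "(real \<Rightarrow> real) \<Rightarrow> nat \<Rightarrow> real" where
  "coef f j = l2_inner I f (\<phi> j)"

definition proj :: "nat \<Rightarrow> (real \<Rightarrow> real) \<Rightarrow> real \<Rightarrow> real" where
  "proj p f x = (\<Sum>j\<le>p. coef f j * \<phi> j x)"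

text \<open>Parseval's identity is used only for particular functions, namely continuous ones and
  their cut-offs, so membership in the closed span is carried as a predicate.\<close>

definition spanned :: "(real \<Rightarrow> real) \<Rightarrow> bool" where
  "spanned f \<longleftrightarrow> bounded_meas I f \<and> (\<forall>e>0. \<exists>n c. l2_sq I (\<lambda>x. f x - (\<Sum>j\<le>n. c j * \<phi> j x)) < e)"

lemma phi_bounded_meas: "bounded_meas I (\<phi> j)"
  by (rule continuous_bounded_meas[OF phi_cont])

lemma phi_sq: "sq_integrable I (\<phi> j)"
  by (rule I.bounded_meas_sq[OF phi_bounded_meas])

lemma phi_inner: "l2_inner I (\<phi> i) (\<phi> j) = (if i = j then 1 else 0)"
  unfolding l2_inner_def
  by (subst integral_Icc_measure) (auto intro!: continuous_on_mult phi_cont simp: phi_orth)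

lemma comb_bounded_meas: "bounded_meas I (\<lambda>x. \<Sum>j\<le>n. c j * \<phi> j x)"
  by (intro bounded_meas_sum bounded_meas_cmult phi_bounded_meas)

lemma comb_sq: "sq_integrable I (\<lambda>x. \<Sum>j\<le>n. c j * \<phi> j x)"
  by (rule I.bounded_meas_sq[OF comb_bounded_meas])

lemma proj_bounded_meas: "bounded_meas I (proj p f)"
  unfolding proj_def[abs_def] by (rule comb_bounded_meas)

lemma proj_sq: "sq_integrable I (proj p f)"
  by (rule I.bounded_meas_sq[OF proj_bounded_meas])

lemma comb_inner:
  assumes "sq_integrable I f"
  shows "l2_inner I f (\<lambda>x. \<Sum>j\<le>n. c j * \<phi> j x) = (\<Sum>j\<le>n. c j * coef f j)"
  using assms unfolding coef_def
  by (subst l2_inner_sum_right) (auto intro: phi_sq simp: l2_inner_cmult_right)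

lemma coef_comb: "coef (\<lambda>x. \<Sum>j\<le>n. c j * \<phi> j x) i = (if i \<le> n then c i else 0)"
proof -
  have "coef (\<lambda>x. \<Sum>j\<le>n. c j * \<phi> j x) i = (\<Sum>j\<le>n. c j * l2_inner I (\<phi> j) (\<phi> i))"
    unfolding coef_def by (subst l2_inner_sum_left) (auto intro: phi_sq simp: l2_inner_cmult_left)
  then show ?thesis by (simp add: phi_inner if_distrib[of "\<lambda>x. _ * x"] cong: if_cong)
qed

lemma comb_l2_sq: "l2_sq I (\<lambda>x. \<Sum>j\<le>n. c j * \<phi> j x) = (\<Sum>j\<le>n. (c j)\<^sup>2)"
  unfolding l2_sq_inner comb_inner[OF comb_sq] coef_comb by (simp add: power2_eq_square)

text \<open>Completing the square: the last sum measures the deviation from the Fourier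
  coefficients, which are therefore optimal.\<close>

lemma proj_diff_l2_sq:
  assumes "sq_integrable I f"
  shows "l2_sq I (\<lambda>x. f x - (\<Sum>j\<le>n. c j * \<phi> j x)) =
    l2_sq I f - (\<Sum>j\<le>n. (coef f j)\<^sup>2) + (\<Sum>j\<le>n. (coef f j - c j)\<^sup>2)"
  unfolding l2_sq_diff_expand[OF assms comb_sq] comb_inner[OF assms] comb_l2_sq
  by (simp add: power2_diff sum.distrib sum_subtractf sum_distrib_left mult_ac)

lemma bessel:
  assumes "sq_integrable I f"
  shows "(\<Sum>j\<le>p. (coef f j)\<^sup>2) \<le> l2_sq I f"
  using proj_diff_l2_sq[OF assms, where c="coef f" and n=p]
    l2_sq_nonneg[of I "\<lambda>x. f x - (\<Sum>j\<le>p. coef f j * \<phi> j x)"] by simp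

lemma coef_diff: "sq_integrable I f \<Longrightarrow> sq_integrable I g \<Longrightarrow> coef (\<lambda>x. f x - g x) j = coef f j - coef g j"
  unfolding coef_def by (rule l2_inner_diff_left) (auto intro: phi_sq)

lemma proj_contract: "sq_integrable I f \<Longrightarrow> l2_sq I (proj p f) \<le> l2_sq I f"
  unfolding proj_def[abs_def] comb_l2_sq by (rule bessel)

lemma proj_diff: "sq_integrable I f \<Longrightarrow> sq_integrable I g \<Longrightarrow> proj p (\<lambda>x. f x - g x) x = proj p f x - proj p g x"
  by (simp add: proj_def coef_diff sum_subtractf left_diff_distrib)

lemma spanned_sq: "spanned f \<Longrightarrow> sq_integrable I f"
  by (auto simp: spanned_def intro: I.bounded_meas_sq)

text \<open>The projection beats any combination of the first functions, and its error decreases in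
  \<open>p\<close>, so one good combination bounds all later errors.\<close>

lemma spanned_proj_lim:
  assumes f: "spanned f"
  shows "l2_lim I (\<lambda>p. proj p f) f"
  unfolding l2_lim_def
proof (intro conjI allI proj_sq spanned_sq f)
  note sq = spanned_sq[OF f]
  show "(\<lambda>p. l2_sq I (\<lambda>x. proj p f x - f x)) \<longlonglongrightarrow> 0"
  proof (rule order_tendstoI)
    fix e :: real assume "0 < e"
    then obtain n c where nc: "l2_sq I (\<lambda>x. f x - (\<Sum>j\<le>n. c j * \<phi> j x)) < e"
      using f by (auto simp: spanned_def)
    show "\<forall>\<^sub>F p in sequentially. l2_sq I (\<lambda>x. proj p f x - f x) < e"
    proof (rule eventually_sequentiallyI)
      fix p assume p: "n \<le> p"
      have "l2_sq I (\<lambda>x. proj p f x - f x) = l2_sq I f - (\<Sum>j\<le>p. (coef f j)\<^sup>2)"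
        unfolding l2_sq_commute[of I "proj p f"] unfolding proj_def[abs_def] proj_diff_l2_sq[OF sq] by simp
      also have "\<dots> \<le> l2_sq I f - (\<Sum>j\<le>n. (coef f j)\<^sup>2)"
        using p by (intro diff_mono sum_mono2) auto
      also have "\<dots> \<le> l2_sq I (\<lambda>x. f x - (\<Sum>j\<le>n. c j * \<phi> j x))"
        unfolding proj_diff_l2_sq[OF sq] by (simp add: sum_nonneg)
      finally show "l2_sq I (\<lambda>x. proj p f x - f x) < e" using nc by simp
    qed
  next
    fix e :: real assume "e < 0"
    then show "\<forall>\<^sub>F p in sequentially. e < l2_sq I (\<lambda>x. proj p f x - f x)"
      by (intro always_eventually allI less_le_trans[OF _ l2_sq_nonneg])
  qed
qed

lemma parseval:
  assumes f: "spanned f" and g: "sq_integrable I g"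
  shows "(\<lambda>p. \<Sum>j\<le>p. coef f j * coef g j) \<longlonglongrightarrow> l2_inner I f g"
proof -
  have "l2_inner I (proj p f) g = (\<Sum>j\<le>p. coef f j * coef g j)" for p
    unfolding l2_inner_commute[of I _ g] proj_def[abs_def] by (rule comb_inner[OF g])
  with l2_inner_tendsto[OF spanned_proj_lim[OF f] l2_lim_const[OF g]] show ?thesis by simp
qed

lemma parseval_sq:
  "spanned f \<Longrightarrow> (\<lambda>p. \<Sum>j\<le>p. (coef f j)\<^sup>2) \<longlonglongrightarrow> l2_sq I f"
  using parseval[OF _ spanned_sq, of f f] by (simp add: power2_eq_square l2_sq_inner)

text \<open>The arithmetic mean and Bessel's inequality give a bound independent of
  \<open>p\<close>, as dominated convergence requires later.\<close>

lemma coef_prod_bound: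
  assumes "sq_integrable I f" "sq_integrable I g"
  shows "\<bar>\<Sum>j\<le>p. coef f j * coef g j\<bar> \<le> (l2_sq I f + l2_sq I g) / 2"
proof -
  have "\<bar>x * y\<bar> \<le> (x\<^sup>2 + y\<^sup>2) / 2" for x y :: real
  proof -
    have "0 \<le> (\<bar>x\<bar> - \<bar>y\<bar>)\<^sup>2" by simp
    then show ?thesis by (simp add: power2_diff abs_mult)
  qed
  then have "\<bar>\<Sum>j\<le>p. coef f j * coef g j\<bar> \<le> (\<Sum>j\<le>p. ((coef f j)\<^sup>2 + (coef g j)\<^sup>2) / 2)"
    by (intro order_trans[OF sum_abs] sum_mono)
  also have "\<dots> = ((\<Sum>j\<le>p. (coef f j)\<^sup>2) + (\<Sum>j\<le>p. (coef g j)\<^sup>2)) / 2"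
    by (simp add: sum.distrib flip: sum_divide_distrib)
  also have "\<dots> \<le> (l2_sq I f + l2_sq I g) / 2"
    using bessel[OF assms(1), of p] bessel[OF assms(2), of p] by (intro divide_right_mono add_mono) auto
  finally show ?thesis .
qed

lemma spanned_limit:
  assumes s: "\<And>n. spanned (f n)" and lim: "l2_lim I f g" and g: "bounded_meas I g"
  shows "spanned g"
  unfolding spanned_def
proof (intro conjI g allI impI)
  fix e :: real assume "e > 0"
  then have e: "e / 4 > 0" by simp
  from order_tendstoD(2)[OF l2_limD(3)[OF lim] e] obtain n where n: "l2_sq I (\<lambda>x. f n x - g x) < e / 4"
    by (auto dest: eventually_happens)
  from s[of n] e obtain k c where kc: "l2_sq I (\<lambda>x. f n x - (\<Sum>j\<le>k. c j * \<phi> j x)) < e / 4"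
    unfolding spanned_def by blast
  have "l2_sq I (\<lambda>x. g x - (\<Sum>j\<le>k. c j * \<phi> j x)) < e"
    using l2_sq_triangle[OF I.bounded_meas_sq[OF g] spanned_sq[OF s[of n]] comb_sq, of c k] n kc
    by (simp add: l2_sq_commute[of I g])
  then show "\<exists>n c. l2_sq I (\<lambda>x. g x - (\<Sum>j\<le>n. c j * \<phi> j x)) < e" by blast
qed

lemma spanned_continuous: "continuous_on {a..b} f \<Longrightarrow> spanned f"
  unfolding spanned_def by (intro conjI continuous_bounded_meas allI impI phi_dense)

text \<open>A cut-off of a continuous function is a mean-square limit of continuous ones. The
  endpoints form a null set, so open, closed and half-open intervals are treated alike.\<close>

lemma spanned_interval:
  assumes h: "continuous_on {a..b} h" and uv: "a \<le> u" "v \<le> b"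
    and S: "{u<..<v} \<subseteq> S" "S \<subseteq> {u..v}" "S \<in> sets borel"
  shows "spanned (\<lambda>x. indicator S x * h x)"
proof (rule spanned_limit)
  \<comment> \<open>A continuous trapezoid that vanishes outside \<open>(u, v)\<close> and equals 1
    at distance at least \<open>1 / n\<close> from both ends.\<close>
  define r where "r n x = min 1 (real n * max 0 (x - u)) * min 1 (real n * max 0 (v - x))" for n x
  have hB: "bounded_meas I h" by (rule continuous_bounded_meas[OF h])
  show "bounded_meas I (\<lambda>x. indicator S x * h x)"
    by (intro bounded_meas_mult hB borel_set_Icc_measure S)
  have rc: "continuous_on {a..b} (\<lambda>x. r n x * h x)" for n
    unfolding r_def by (intro continuous_intros h)
  show "spanned (\<lambda>x. r n x * h x)" for n by (rule spanned_continuous[OF rc])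
  obtain B where B: "B \<ge> 0" "\<And>x. x \<in> space I \<Longrightarrow> \<bar>h x\<bar> \<le> B" using bounded_meas_bound[OF hB] by blast
  have r01: "0 \<le> r n x" "r n x \<le> 1" for n x
    unfolding r_def by (auto intro!: mult_nonneg_nonneg mult_le_one)
  show "l2_lim I (\<lambda>n x. r n x * h x) (\<lambda>x. indicator S x * h x)"
  proof (rule I.bounded_meas_l2_lim)
    show "(\<lambda>x. r n x * h x) \<in> borel_measurable I" for n
      by (rule bounded_meas_measurable[OF continuous_bounded_meas[OF rc]])
    show "(\<lambda>x. indicator S x * h x) \<in> borel_measurable I"
      by (intro bounded_meas_measurable bounded_meas_mult hB borel_set_Icc_measure S)
    show "\<bar>r n x * h x\<bar> \<le> B" if "x \<in> space I" for n x
      using mult_mono[OF r01(2) B(2)[OF that], of n x] r01[of n x] by (simp add: abs_mult)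
    show "\<bar>indicator S x * h x\<bar> \<le> B" if "x \<in> space I" for x
      using B(1) B(2)[OF that] by (auto split: split_indicator)
    have conv: "(\<lambda>n. r n x * h x) \<longlonglongrightarrow> indicator S x * h x" if "x \<noteq> u" "x \<noteq> v" for x
    proof (rule tendsto_mult_right)
      show "(\<lambda>n. r n x) \<longlonglongrightarrow> indicator S x"
      proof (cases "u < x \<and> x < v")
        case True
        define d where "d = min (x - u) (v - x)"
        have d: "d > 0" "d \<le> x - u" "d \<le> v - x" using True by (auto simp: d_def)
        obtain N where N: "1 / d < real N" using reals_Archimedean2 by blast
        have "r n x = 1" if "n \<ge> N" for n
        proof -
          have "1 \<le> real n * d" using N that d by (simp add: field_simps) (smt (verit) mult_mono of_nat_mono of_nat_0_le_iff)
          then have "1 \<le> real n * (x - u)" "1 \<le> real n * (v - x)"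
            using d by (meson mult_left_mono of_nat_0_le_iff order_trans)+
          then show ?thesis using True by (simp add: r_def max_def)
        qed
        then have "eventually (\<lambda>n. r n x = 1) sequentially" by (rule eventually_sequentiallyI)
        moreover have "indicator S x = (1 :: real)" using True S by auto
        ultimately show ?thesis using tendsto_eventually by metis
      next
        case False
        then have "r n x = 0" for n using that by (auto simp: r_def max_def)
        moreover have "indicator S x = (0 :: real)" using False S(2) that by (auto simp: indicator_def)
        ultimately show ?thesis by simp
      qed
    qed
    show "AE x in I. (\<lambda>n. r n x * h x) \<longlonglongrightarrow> indicator S x * h x"
      using AE_interval_neq[of u] AE_interval_neq[of v] by eventually_elim (rule conv)
  qed
qed

end

section \<open>The Legendre system\<close>

text \<open>The alternating sum is the forward difference of order \<open>n\<close> of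
  \<open>g\<close> at 0. This is the recursion for differences, obtained from Pascal's rule.\<close>

lemma alternating_binomial_sum_Suc:
  fixes g :: "nat \<Rightarrow> real"
  shows "(\<Sum>k\<le>Suc n. (-1) ^ (Suc n - k) * real (Suc n choose k) * g k) =
    (\<Sum>k\<le>n. (-1) ^ (n - k) * real (n choose k) * g (Suc k)) - (\<Sum>k\<le>n. (-1) ^ (n - k) * real (n choose k) * g k)"
proof -
  have "(\<Sum>k\<le>Suc n. (-1) ^ (Suc n - k) * real (Suc n choose k) * g k) =
     (-1) ^ Suc n * g 0 + (\<Sum>k\<le>n. (-1) ^ (n - k) * real (Suc n choose Suc k) * g (Suc k))"
    by (subst sum.atMost_Suc_shift) simp
  also have "(\<Sum>k\<le>n. (-1) ^ (n - k) * real (Suc n choose Suc k) * g (Suc k)) =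
     (\<Sum>k\<le>n. (-1) ^ (n - k) * real (n choose k) * g (Suc k)) +
     (\<Sum>k\<le>n. (-1) ^ (n - k) * real (n choose Suc k) * g (Suc k))"
    by (simp add: algebra_simps sum.distrib)
  also have "(\<Sum>k\<le>n. (-1) ^ (n - k) * real (n choose Suc k) * g (Suc k)) =
     (\<Sum>k\<le>Suc n. (-1) ^ (Suc n - k) * real (n choose k) * g k) - (-1) ^ Suc n * g 0"
    by (subst sum.atMost_Suc_shift) simp
  also have "(\<Sum>k\<le>Suc n. (-1) ^ (Suc n - k) * real (n choose k) * g k) =
     - (\<Sum>k\<le>n. (-1) ^ (n - k) * real (n choose k) * g k)"
    by (auto simp: Suc_diff_le sum_negf[symmetric] intro!: sum.cong)
  finally show ?thesis by simp
qed

text \<open>A forward difference lowers the lower index of a binomial coefficient by one, again by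
  Pascal's rule; after more than \<open>m\<close> differences nothing is left.\<close>

lemma alternating_binomial_sum_choose:
  "(\<Sum>k\<le>n. (-1) ^ (n - k) * real (n choose k) * real ((k + c) choose m)) =
   (if n \<le> m then real (c choose (m - n)) else 0)"
proof (induction n arbitrary: c)
  case 0
  show ?case by simp
next
  case (Suc n)
  have "(\<Sum>k\<le>Suc n. (-1) ^ (Suc n - k) * real (Suc n choose k) * real ((k + c) choose m)) =
     (if n \<le> m then real (Suc c choose (m - n)) else 0) - (if n \<le> m then real (c choose (m - n)) else 0)"
    unfolding alternating_binomial_sum_Suc using Suc.IH[of c] Suc.IH[of "Suc c"] by simp
  also have "\<dots> = (if Suc n \<le> m then real (c choose (m - Suc n)) else 0)"
  proof (cases "Suc n \<le> m")
    case True
    then obtain d where d: "m - n = Suc d" "m - Suc n = d" by (metis Suc_diff_Suc Suc_le_lessD)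
    show ?thesis using True unfolding d by simp
  next
    case False
    then show ?thesis by (cases "n = m") auto
  qed
  finally show ?case .
qed

text \<open>A beta integral, by induction on \<open>p\<close>: each integration by parts moves one
  power from \<open>y - 1\<close> to \<open>y + 1\<close>.\<close>

lemma jacobi_integral:
  "((\<lambda>y :: real. (y - 1) ^ p * (y + 1) ^ q) has_integral
     ((-1) ^ p * 2 ^ (p + q + 1) * fact p * fact q / fact (p + q + 1))) {-1..1}"
proof (induction p arbitrary: q)
  case 0
  have "((\<lambda>y :: real. (y + 1) ^ q) has_integral (((1 + 1) ^ Suc q / Suc q) - ((-1 + 1) ^ Suc q / Suc q))) {-1..1}"
  proof (rule fundamental_theorem_of_calculus)
    fix x :: real
    have "((\<lambda>y. (y + 1) ^ Suc q / Suc q) has_real_derivative (x + 1) ^ q) (at x)"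
      by (auto intro!: derivative_eq_intros simp del: power_Suc of_nat_Suc)
    then show "((\<lambda>y. (y + 1) ^ Suc q / Suc q) has_vector_derivative (x + 1) ^ q) (at x within {-1..1})"
      by (simp only: has_real_derivative_iff_has_vector_derivative[symmetric] has_field_derivative_at_within)
  qed simp
  moreover have "((1 + 1) ^ Suc q / Suc q) - ((-1 + 1) ^ Suc q / Suc q) =
      ((-1) ^ 0 * 2 ^ (0 + q + 1) * fact 0 * fact q / fact (0 + q + 1) :: real)"
    by (simp add: frac_eq_eq)
  ultimately show ?case by (simp del: power_Suc)
next
  case (Suc p)
  \<comment> \<open>The boundary term of the integration by parts; it vanishes at both ends because
    both exponents are positive.\<close>
  let ?f = "\<lambda>y :: real. (y - 1) ^ Suc p * (y + 1) ^ Suc q / Suc q"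
  have 1: "((\<lambda>y :: real. Suc p / Suc q * ((y - 1) ^ p * (y + 1) ^ Suc q) + (y - 1) ^ Suc p * (y + 1) ^ q) has_integral
      (?f 1 - ?f (-1))) {-1..1}"
  proof (rule fundamental_theorem_of_calculus)
    fix x :: real
    have "(?f has_real_derivative (Suc p / Suc q * ((x - 1) ^ p * (x + 1) ^ Suc q) + (x - 1) ^ Suc p * (x + 1) ^ q)) (at x)"
      by (rule derivative_eq_intros refl | simp)+ (simp add: field_simps)
    then show "(?f has_vector_derivative (Suc p / Suc q * ((x - 1) ^ p * (x + 1) ^ Suc q) + (x - 1) ^ Suc p * (x + 1) ^ q))
        (at x within {-1..1})"
      by (simp only: has_real_derivative_iff_has_vector_derivative[symmetric] has_field_derivative_at_within)
  qed simp
  have 2: "((\<lambda>y :: real. Suc p / Suc q * ((y - 1) ^ p * (y + 1) ^ Suc q)) has_integral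
      Suc p / Suc q * ((-1) ^ p * 2 ^ (p + Suc q + 1) * fact p * fact (Suc q) / fact (p + Suc q + 1))) {-1..1}"
    by (rule has_integral_mult_right[OF Suc.IH])
  have "((\<lambda>y :: real. (y - 1) ^ Suc p * (y + 1) ^ q) has_integral
     (?f 1 - ?f (-1) - Suc p / Suc q * ((-1) ^ p * 2 ^ (p + Suc q + 1) * fact p * fact (Suc q) / fact (p + Suc q + 1)))) {-1..1}"
    using has_integral_diff[OF 1 2] by (simp only: add_diff_cancel_left')
  moreover have "?f 1 - ?f (-1) - Suc p / Suc q * ((-1) ^ p * 2 ^ (p + Suc q + 1) * fact p * fact (Suc q) / fact (p + Suc q + 1))
     = (-1) ^ Suc p * 2 ^ (Suc p + q + 1) * fact (Suc p) * fact q / (fact (Suc p + q + 1) :: real)"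
  proof -
    have "- (a / b) * (m * k * f * (b * g) / w) = (- m) * k * (a * f) * g / w" if "b \<noteq> 0" for a b m k f g w :: real
      using that by simp
    from this[of "Suc q" "Suc p" "(-1) ^ p" "2 ^ (p + Suc q + 1)" "fact p" "fact q" "fact (p + Suc q + 1)"]
    show ?thesis by simp
  qed
  ultimately show ?case by (simp only:)
qed

text \<open>Every summand is a beta integral. Its factorials and one of the two binomials combine
  into a constant times \<open>(k + m) choose m\<close>, and the other binomial makes the sum a
  difference of order \<open>n\<close>, which vanishes for \<open>m < n\<close>.\<close>

lemma legendre_integral_power:
  "((\<lambda>y. legendre_poly n y * (y + 1) ^ m) has_integral
     (if n \<le> m then 2 ^ (m + 1) * fact n * fact m * real (m choose n) / fact (n + m + 1) else 0)) {-1..1}"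
proof -
  have eq: "legendre_poly n y * (y + 1) ^ m =
     (\<Sum>k\<le>n. real (n choose k) ^ 2 / 2 ^ n * ((y - 1) ^ (n - k) * (y + 1) ^ (k + m)))" for y
    by (simp add: legendre_poly_def sum_distrib_left sum_distrib_right sum_divide_distrib power_add mult_ac)
  have "((\<lambda>y. legendre_poly n y * (y + 1) ^ m) has_integral
     (\<Sum>k\<le>n. real (n choose k) ^ 2 / 2 ^ n *
       ((-1) ^ (n - k) * 2 ^ ((n - k) + (k + m) + 1) * fact (n - k) * fact (k + m) / fact ((n - k) + (k + m) + 1)))) {-1..1}"
    unfolding eq by (intro has_integral_sum has_integral_mult_right jacobi_integral) auto
  also have "(\<Sum>k\<le>n. real (n choose k) ^ 2 / 2 ^ n *
       ((-1) ^ (n - k) * 2 ^ ((n - k) + (k + m) + 1) * fact (n - k) * fact (k + m) / fact ((n - k) + (k + m) + 1))) =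
     (\<Sum>k\<le>n. 2 ^ (m + 1) * fact n * fact m / fact (n + m + 1) *
        ((-1) ^ (n - k) * real (n choose k) * real ((k + m) choose m)))"
  proof (intro sum.cong refl)
    fix k assume "k \<in> {..n}"
    then have k: "k \<le> n" by simp
    have b1: "real (n choose k) = fact n / (fact k * fact (n - k))" using k by (rule binomial_fact)
    have b2: "real ((k + m) choose m) = fact (k + m) / (fact m * fact k)" by (simp add: binomial_fact)
    have e: "(n - k) + (k + m) + 1 = n + m + 1" using k by simp
    have p2: "(2 :: real) ^ (n + m + 1) = 2 ^ n * 2 ^ (m + 1)" by (simp add: power_add)
    show "real (n choose k) ^ 2 / 2 ^ n *
       ((-1) ^ (n - k) * 2 ^ ((n - k) + (k + m) + 1) * fact (n - k) * fact (k + m) / fact ((n - k) + (k + m) + 1)) =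
       2 ^ (m + 1) * fact n * fact m / fact (n + m + 1) *
        ((-1) ^ (n - k) * real (n choose k) * real ((k + m) choose m))"
      unfolding e p2 b1 b2 power2_eq_square by (simp add: field_simps)
  qed
  also have "\<dots> = (if n \<le> m then 2 ^ (m + 1) * fact n * fact m * real (m choose n) / fact (n + m + 1) else 0)"
    unfolding sum_distrib_left[symmetric] alternating_binomial_sum_choose
    by (simp add: binomial_symmetric[symmetric])
  finally show ?thesis .
qed

text \<open>Powers of \<open>y + 1\<close> are the right basis because the integrals against them
  are known. The leading coefficient is a sum of squared binomials, evaluated by Vandermonde's
  identity.\<close>

lemma legendre_expand:
  "\<exists>l. (\<forall>y. legendre_poly n y = (\<Sum>k\<le>n. l k * (y + 1) ^ k)) \<and> l n = real ((2 * n) choose n) / 2 ^ n"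
proof -
  \<comment> \<open>In the variable \<open>y + 1\<close> the factor \<open>y - 1\<close> is the
    linear polynomial \<open>[:-2, 1:]\<close>.\<close>
  define P where "P = (\<Sum>k\<le>n. smult (real (n choose k) ^ 2) ([:-2, 1:] ^ (n - k) * [:0, 1:] ^ k))"
  have deg: "degree ([:-2, 1:] ^ (n - k) * [:0, 1:] ^ k :: real poly) = n" if "k \<le> n" for k
    using that by (subst degree_mult_eq) (auto simp: degree_power_eq)
  have lead: "coeff ([:-2, 1:] ^ (n - k) * [:0, 1:] ^ k :: real poly) n = 1" if "k \<le> n" for k
  proof -
    have "lead_coeff ([:-2, 1:] ^ (n - k) * [:0, 1:] ^ k :: real poly) = 1"
      by (simp add: lead_coeff_mult lead_coeff_power)
    then show ?thesis using deg[OF that] by simp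
  qed
  have dP: "degree P \<le> n" unfolding P_def
    by (intro degree_sum_le) (auto intro: order_trans[OF degree_smult_le] simp: deg)
  have "coeff P n = (\<Sum>k\<le>n. real (n choose k) ^ 2)"
    unfolding P_def coeff_sum coeff_smult by (intro sum.cong) (auto simp: lead)
  also have "\<dots> = real ((2 * n) choose n)"
    unfolding choose_square_sum[symmetric] by simp
  finally have cP: "coeff P n = real ((2 * n) choose n)" .
  have "legendre_poly n y = (\<Sum>k\<le>n. coeff P k / 2 ^ n * (y + 1) ^ k)" for y
  proof -
    have "legendre_poly n y = poly P (y + 1) / 2 ^ n"
      unfolding legendre_poly_def P_def by (simp add: poly_sum mult_ac)
    also have "poly P (y + 1) = (\<Sum>k\<le>n. coeff P k * (y + 1) ^ k)"
      unfolding poly_altdef using dP by (intro sum.mono_neutral_left) (auto simp: coeff_eq_0)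
    finally show ?thesis by (simp add: sum_divide_distrib)
  qed
  then show ?thesis using cP by (intro exI[of _ "\<lambda>k. coeff P k / 2 ^ n"]) auto
qed

text \<open>The polynomial of degree \<open>j\<close> is orthogonal to all lower powers of
  \<open>y + 1\<close>. Expanding the other factor leaves nothing for \<open>i < j\<close>, and only
  the leading term for \<open>i = j\<close>.\<close>

lemma legendre_orthogonal_le:
  assumes "i \<le> j"
  shows "((\<lambda>y. legendre_poly j y * legendre_poly i y) has_integral (if i = j then 2 / (2 * real j + 1) else 0)) {-1..1}"
proof -
  obtain l where l: "\<And>y. legendre_poly i y = (\<Sum>k\<le>i. l k * (y + 1) ^ k)" "l i = real ((2 * i) choose i) / 2 ^ i"
    using legendre_expand by metis
  have eq: "legendre_poly j y * legendre_poly i y = (\<Sum>k\<le>i. l k * (legendre_poly j y * (y + 1) ^ k))" for y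
    unfolding l by (simp add: sum_distrib_left mult_ac)
  have "((\<lambda>y. legendre_poly j y * legendre_poly i y) has_integral (\<Sum>k\<le>i. l k *
     (if j \<le> k then 2 ^ (k + 1) * fact j * fact k * real (k choose j) / fact (j + k + 1) else 0))) {-1..1}"
    unfolding eq by (intro has_integral_sum has_integral_mult_right legendre_integral_power) auto
  also have "(\<Sum>k\<le>i. l k * (if j \<le> k then 2 ^ (k + 1) * fact j * fact k * real (k choose j) / fact (j + k + 1) else 0)) =
     (if i = j then 2 / (2 * real j + 1) else 0)"
  proof (cases "i = j")
    case True
    have "(\<Sum>k\<le>i. l k * (if j \<le> k then 2 ^ (k + 1) * fact j * fact k * real (k choose j) / fact (j + k + 1) else 0)) =
      (\<Sum>k\<in>{j}. l k * (if j \<le> k then 2 ^ (k + 1) * fact j * fact k * real (k choose j) / fact (j + k + 1) else 0))"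
      using True by (intro sum.mono_neutral_right) auto
    also have "\<dots> = l j * (2 ^ (j + 1) * fact j * fact j / fact (j + j + 1))" by simp
    also have "\<dots> = real ((2 * j) choose j) / 2 ^ j * (2 ^ (j + 1) * fact j * fact j / fact (2 * j + 1))"
      unfolding l(2)[unfolded True] mult_2 ..
    also have "real ((2 * j) choose j) = fact (2 * j) / (fact j * fact j)"
      by (subst binomial_fact) (auto simp: mult_2)
    also have "fact (2 * j) / (fact j * fact j) / 2 ^ j * (2 ^ (j + 1) * fact j * fact j / fact (2 * j + 1)) = 2 / (2 * real j + 1)"
    proof -
      have f: "fact (2 * j + 1) = (2 * real j + 1) * (fact (2 * j) :: real)" by simp
      have "x / (y * y) / z * (2 * z * y * y / (w * x)) = 2 / w" if "x \<noteq> 0" "y \<noteq> 0" "z \<noteq> 0" for x y z w :: real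
        using that by (simp add: divide_simps)
      from this[of "fact (2 * j)" "fact j" "2 ^ j" "2 * real j + 1"] show ?thesis
        unfolding f by (simp only: power_Suc Suc_eq_plus1[symmetric]) simp
    qed
    finally show ?thesis using True by simp
  next
    case False
    then show ?thesis using assms by (auto intro!: sum.neutral)
  qed
  finally show ?thesis .
qed

lemma legendre_orthogonal:
  "((\<lambda>y. legendre_poly i y * legendre_poly j y) has_integral (if i = j then 2 / (2 * real j + 1) else 0)) {-1..1}"
  using legendre_orthogonal_le[of i j] legendre_orthogonal_le[of j i]
  by (cases "i \<le> j") (auto simp: mult.commute split: if_splits)

section \<open>The rescaled Legendre system: orthonormality and density\<close>

lemma legendre_poly_continuous: "continuous_on S (legendre_poly n)"
  unfolding legendre_poly_def[abs_def] by (intro continuous_intros) auto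

lemma legendre_sys_continuous: "continuous_on S (legendre_sys t T j)"
  unfolding legendre_sys_def[abs_def]
  by (intro continuous_intros continuous_on_compose2[OF legendre_poly_continuous[of UNIV]]) auto

lemma legendre_sys_orthonormal:
  assumes "t < T"
  shows "integral {t..T} (\<lambda>x. legendre_sys t T i x * legendre_sys t T j x) = (if i = j then 1 else 0)"
proof -
  define s where "s = 2 / (T - t)"
  have s: "s > 0" using assms by (simp add: s_def)
  define c where "c = - (T + t) / 2 * s"
  have e1: "(-1 - c) / s = t" "(1 - c) / s = T" using assms by (auto simp: c_def s_def field_simps)
  let ?F = "\<lambda>y. legendre_poly i y * legendre_poly j y"
  let ?I = "if i = j then 2 / (2 * real j + 1) else 0"
  have "((\<lambda>x. ?F (s *\<^sub>R x + c)) has_integral (?I /\<^sub>R s ^ DIM(real))) (cbox ((-1 - c) /\<^sub>R s) ((1 - c) /\<^sub>R s))"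
    by (rule has_integral_affinity') (use legendre_orthogonal[of i j] s in auto)
  moreover have "(-1 - c) /\<^sub>R s = t" "(1 - c) /\<^sub>R s = T" using e1 by (auto simp: field_simps)
  ultimately have 1: "((\<lambda>x. ?F (s * x + c)) has_integral (?I / s)) {t..T}" by (simp add: field_simps)
  have arg: "(x - (T + t) / 2) * (2 / (T - t)) = s * x + c" for x
    unfolding c_def s_def[symmetric] by (simp only: left_diff_distrib mult.commute[of s x])
  let ?k = "sqrt ((2 * real i + 1) / (T - t)) * sqrt ((2 * real j + 1) / (T - t))"
  have "((\<lambda>x. ?k * ?F (s * x + c)) has_integral (?k * (?I / s))) {t..T}"
    by (rule has_integral_mult_right[OF 1])
  moreover have "(\<lambda>x. ?k * ?F (s * x + c)) = (\<lambda>x. legendre_sys t T i x * legendre_sys t T j x)"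
    unfolding legendre_sys_def arg by (simp only: mult_ac)
  moreover have "?k * (?I / s) = (if i = j then 1 else 0)"
  proof (cases "i = j")
    case True
    then have "?k = (2 * real j + 1) / (T - t)" using assms by simp
    moreover have "(2 * real j + 1) / (T - t) * (2 / (2 * real j + 1) / s) = 1"
    proof -
      have "0 < 2 * real j + 1" "0 < T - t" using assms by auto
      then show ?thesis unfolding s_def by (simp add: divide_simps) (simp add: algebra_simps)
    qed
    ultimately show ?thesis using True by simp
  qed simp
  ultimately show ?thesis by (simp only: integral_unique)
qed

text \<open>The rescaled argument satisfies \<open>y + 1 = (x - t) * (2 / (T - t))\<close>. The
  expansion of the polynomials in its powers is triangular with nonzero leading coefficient, hence
  is inverted by strong induction.\<close>

lemma legendre_sys_span_power:
  assumes "t < T"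
  shows "\<exists>c. \<forall>x. ((x - t) * (2 / (T - t))) ^ n = (\<Sum>j\<le>n. c j * legendre_sys t T j x)"
proof (induction n rule: less_induct)
  case (less n)
  let ?z = "\<lambda>x. (x - t) * (2 / (T - t))"
  obtain l where l: "\<And>y. legendre_poly n y = (\<Sum>k\<le>n. l k * (y + 1) ^ k)" "l n = real ((2 * n) choose n) / 2 ^ n"
    using legendre_expand by metis
  have ln: "l n \<noteq> 0" using l(2) by simp
  have "\<forall>k. \<exists>c. k < n \<longrightarrow> (\<forall>x. ?z x ^ k = (\<Sum>j\<le>k. c j * legendre_sys t T j x))" using less by blast
  then obtain c where c: "\<And>k x. k < n \<Longrightarrow> ?z x ^ k = (\<Sum>j\<le>k. c k j * legendre_sys t T j x)" by metis
  define q where "q = sqrt ((2 * real n + 1) / (T - t))"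
  have q: "q > 0" using assms by (simp add: q_def)
  have z: "(x - (T + t) / 2) * (2 / (T - t)) + 1 = ?z x" for x using assms by (simp add: field_simps)
  \<comment> \<open>The coefficient of the function \<open>j\<close> after all powers below
    \<open>n\<close> have been replaced by their expansions.\<close>
  define S where "S j = (\<Sum>k\<in>{j..<n}. l k * c k j)" for j
  define d where "d j = (if j = n then 1 / (l n * q) else - S j / l n)" for j
  have "?z x ^ n = (\<Sum>j\<le>n. d j * legendre_sys t T j x)" for x
  proof -
    have "legendre_sys t T n x / q = (\<Sum>k\<le>n. l k * ?z x ^ k)"
      using q unfolding legendre_sys_def l z q_def[symmetric] by simp
    also have "\<dots> = l n * ?z x ^ n + (\<Sum>k<n. l k * ?z x ^ k)"
      by (simp add: lessThan_Suc_atMost[symmetric])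
    also have "(\<Sum>k<n. l k * ?z x ^ k) = (\<Sum>k<n. \<Sum>j<n. if j \<le> k then l k * c k j * legendre_sys t T j x else 0)"
    proof (intro sum.cong refl)
      fix k assume "k \<in> {..<n}"
      then have k: "k < n" by simp
      have "l k * ?z x ^ k = (\<Sum>j\<le>k. l k * c k j * legendre_sys t T j x)"
        unfolding c[OF k] by (simp add: sum_distrib_left mult_ac)
      also have "\<dots> = (\<Sum>j<n. if j \<le> k then l k * c k j * legendre_sys t T j x else 0)"
        using k by (intro sum.mono_neutral_cong_left) auto
      finally show "l k * ?z x ^ k = (\<Sum>j<n. if j \<le> k then l k * c k j * legendre_sys t T j x else 0)" .
    qed
    also have "\<dots> = (\<Sum>j<n. S j * legendre_sys t T j x)"
    proof (subst sum.swap, intro sum.cong refl)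
      fix j
      show "(\<Sum>k<n. if j \<le> k then l k * c k j * legendre_sys t T j x else 0) = S j * legendre_sys t T j x"
        unfolding S_def sum_distrib_right by (intro sum.mono_neutral_cong_right) auto
    qed
    finally have "l n * ?z x ^ n = legendre_sys t T n x / q - (\<Sum>j<n. S j * legendre_sys t T j x)"
      by simp
    then have "?z x ^ n = legendre_sys t T n x / (l n * q) - (\<Sum>j<n. S j * legendre_sys t T j x) / l n"
      using ln q by (simp add: field_simps)
    then show ?thesis
      using ln q by (simp add: d_def lessThan_Suc_atMost[symmetric] sum_divide_distrib sum_negf[symmetric])
  qed
  then show ?case by (intro exI[of _ d] allI)
qed

text \<open>Weierstrass approximation in the variable \<open>y + 1\<close>, which ranges over
  \<open>[0, 2]\<close>; on a finite measure space a uniform error is a mean-square error.\<close>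

lemma legendre_dense:
  assumes tT: "t < T" and f: "continuous_on {t..T} f" and e: "e > 0"
  shows "\<exists>n c. l2_sq (Icc_measure t T) (\<lambda>x. f x - (\<Sum>j\<le>n. c j * legendre_sys t T j x)) < e"
proof -
  interpret I: finite_measure "Icc_measure t T" by (rule finite_measure_Icc_measure)
  define V where "V = measure (Icc_measure t T) {t..T}"
  \<comment> \<open>Makes the total error \<open>V * d^2\<close> at most
    \<open>e / 2\<close>.\<close>
  define d where "d = sqrt (e / (V + 1) / 2)"
  have V: "V \<ge> 0" by (simp add: V_def)
  have d: "d > 0" using e V by (simp add: d_def)
  let ?z = "\<lambda>x. (x - t) * (2 / (T - t))"
  let ?w = "\<lambda>y. t + y * ((T - t) / 2)"
  have "continuous_on {0..2} (\<lambda>y. f (?w y))"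
  proof (rule continuous_on_compose2[OF f])
    show "continuous_on {0..2} ?w" by (intro continuous_intros)
    show "?w ` {0..2} \<subseteq> {t..T}"
    proof safe
      fix y :: real assume y: "y \<in> {0..2}"
      have "y * ((T - t) / 2) \<le> 2 * ((T - t) / 2)" using y tT by (intro mult_right_mono) auto
      moreover have "0 \<le> y * ((T - t) / 2)" using y tT by auto
      ultimately show "?w y \<in> {t..T}" by auto
    qed
  qed
  then obtain g where g: "real_polynomial_function g" "\<And>y. y \<in> {0..2} \<Longrightarrow> \<bar>f (?w y) - g y\<bar> < d"
    using Stone_Weierstrass_real_polynomial_function[OF compact_Icc _ d] by blast
  from g(1) obtain a n where ga: "g = (\<lambda>y. \<Sum>i\<le>n. a i * y ^ i)" by (auto simp: real_polynomial_function_iff_sum)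
  obtain c where c: "\<And>k x. ?z x ^ k = (\<Sum>j\<le>k. c k j * legendre_sys t T j x)"
    using legendre_sys_span_power[OF tT] by metis
  define b where "b j = (\<Sum>k\<in>{j..n}. a k * c k j)" for j
  have gz: "g (?z x) = (\<Sum>j\<le>n. b j * legendre_sys t T j x)" for x
  proof -
    have "g (?z x) = (\<Sum>k\<le>n. \<Sum>j\<le>n. if j \<le> k then a k * c k j * legendre_sys t T j x else 0)"
      unfolding ga c
      by (intro sum.cong refl, subst sum_distrib_left, intro sum.mono_neutral_cong_left) auto
    also have "\<dots> = (\<Sum>j\<le>n. b j * legendre_sys t T j x)"
      unfolding b_def sum_distrib_right
      by (subst sum.swap, intro sum.cong refl sum.mono_neutral_cong_right) auto
    finally show ?thesis .
  qed
  have "\<bar>f x - (\<Sum>j\<le>n. b j * legendre_sys t T j x)\<bar> \<le> d" if x: "x \<in> {t..T}" for x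
  proof -
    have "?z x \<in> {0..2}" using x tT by (auto simp: field_simps)
    from g(2)[OF this] have "\<bar>f (?w (?z x)) - (\<Sum>j\<le>n. b j * legendre_sys t T j x)\<bar> < d" unfolding gz .
    moreover have "?w (?z x) = x" using tT by (simp add: field_simps)
    ultimately show ?thesis by simp
  qed note bound = this
  have "l2_sq (Icc_measure t T) (\<lambda>x. f x - (\<Sum>j\<le>n. b j * legendre_sys t T j x)) \<le> (\<integral>x. d\<^sup>2 \<partial>(Icc_measure t T))"
    unfolding l2_sq_def
  proof (rule integral_mono)
    show "integrable (Icc_measure t T) (\<lambda>x. (f x - (\<Sum>j\<le>n. b j * legendre_sys t T j x))\<^sup>2)"
      by (intro I.bounded_meas_integrable bounded_meas_power2 continuous_bounded_meas continuous_intros f legendre_sys_continuous)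
    show "(f x - (\<Sum>j\<le>n. b j * legendre_sys t T j x))\<^sup>2 \<le> d\<^sup>2" if "x \<in> space (Icc_measure t T)" for x
      using bound[of x] that d by (subst abs_le_square_iff[symmetric]) auto
  qed simp
  also have "\<dots> = V * (e / (V + 1) / 2)" using e V by (simp add: V_def d_def)
  also have "\<dots> < e"
  proof -
    have "V / (V + 1) \<le> 1" using V by simp
    then have "V / (V + 1) * (e / 2) \<le> 1 * (e / 2)" using e by (intro mult_right_mono) auto
    moreover have "V * (e / (V + 1) / 2) = V / (V + 1) * (e / 2)" by simp
    ultimately show ?thesis using e by linarith
  qed
  finally show ?thesis by blast
qed

lemma ortho_system_legendre: "t < T \<Longrightarrow> ortho_system t T (legendre_sys t T)"
  by standard (auto simp: legendre_sys_continuous legendre_sys_orthonormal legendre_dense)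

section \<open>The trigonometric system\<close>

context
  fixes t T :: real
  assumes tT: "t < T"
begin

text \<open>The phase, which maps \<open>[t, T]\<close> onto one period; the system consists of
  sines and cosines of its integer multiples.\<close>

definition theta :: "real \<Rightarrow> real" where
  "theta x = 2 * pi * (x - t) / (T - t)"

lemma theta_cont: "continuous_on S theta"
  using tT unfolding theta_def by (intro continuous_intros) auto

lemma theta_deriv: "(theta has_real_derivative 2 * pi / (T - t)) (at x within S)"
  unfolding theta_def[abs_def] using tT by (auto intro!: derivative_eq_intros)

lemma theta_ends: "theta t = 0" "theta T = 2 * pi"
  using tT by (auto simp: theta_def)

lemma theta_range: "x \<in> {t..T} \<Longrightarrow> theta x \<in> {0..2 * pi}"
  using tT by (auto simp: theta_def field_simps)

lemma integral_cos_theta: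
  fixes k :: int
  shows "((\<lambda>x. cos (k * theta x)) has_integral (if k = 0 then T - t else 0)) {t..T}"
proof (cases "k = 0")
  case True
  then show ?thesis using has_integral_const_real[of "1 :: real" t T] tT by simp
next
  case False
  define r where "r = k * (2 * pi / (T - t))"
  have r: "r \<noteq> 0" using False tT by (simp add: r_def)
  have "((\<lambda>x. cos (k * theta x)) has_integral (sin (k * theta T) / r - sin (k * theta t) / r)) {t..T}"
  proof (rule fundamental_theorem_of_calculus)
    fix x
    have "((\<lambda>x. sin (k * theta x)) has_real_derivative cos (k * theta x) * r) (at x within {t..T})"
      unfolding r_def by (rule derivative_eq_intros theta_deriv refl)+ simp
    from DERIV_cdivide[OF this, of r] have "((\<lambda>x. sin (k * theta x) / r) has_real_derivative cos (k * theta x)) (at x within {t..T})"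
      using r by simp
    then show "((\<lambda>x. sin (k * theta x) / r) has_vector_derivative cos (k * theta x)) (at x within {t..T})"
      by (simp only: has_real_derivative_iff_has_vector_derivative)
  qed (use tT in simp)
  moreover have "sin (k * theta T) = 0" unfolding theta_ends by (metis mult.left_commute mult.commute sin_int_2pin)
  ultimately show ?thesis using False by (simp add: theta_ends)
qed

lemma integral_sin_theta:
  fixes k :: int
  shows "((\<lambda>x. sin (k * theta x)) has_integral 0) {t..T}"
proof (cases "k = 0")
  case True
  then show ?thesis by simp
next
  case False
  define r where "r = k * (2 * pi / (T - t))"
  have r: "r \<noteq> 0" using False tT by (simp add: r_def)
  have "((\<lambda>x. sin (k * theta x)) has_integral (- cos (k * theta T) / r - (- cos (k * theta t) / r))) {t..T}"
  proof (rule fundamental_theorem_of_calculus)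
    fix x
    have "((\<lambda>x. - cos (k * theta x)) has_real_derivative sin (k * theta x) * r) (at x within {t..T})"
      unfolding r_def by (rule derivative_eq_intros theta_deriv refl)+ simp
    from DERIV_cdivide[OF this, of r] have "((\<lambda>x. - cos (k * theta x) / r) has_real_derivative sin (k * theta x)) (at x within {t..T})"
      using r by simp
    then show "((\<lambda>x. - cos (k * theta x) / r) has_vector_derivative sin (k * theta x)) (at x within {t..T})"
      by (simp only: has_real_derivative_iff_has_vector_derivative)
  qed (use tT in simp)
  moreover have "cos (k * theta T) = 1" unfolding theta_ends by (metis mult.left_commute mult.commute cos_int_2pin)
  ultimately show ?thesis by (simp add: theta_ends)
qed

text \<open>The product-to-sum formula. The sign conditions exclude \<open>k + l = 0\<close>, so the
  constant frequency occurs exactly for \<open>k = l\<close>.\<close>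

lemma integral_coscos:
  fixes k l :: int
  assumes "0 \<le> k" "0 < l"
  shows "((\<lambda>x. cos (k * theta x) * cos (l * theta x)) has_integral (if k = l then (T - t) / 2 else 0)) {t..T}"
proof -
  have "((\<lambda>x. (cos ((k - l) * theta x) + cos ((k + l) * theta x)) / 2) has_integral
     ((if k - l = 0 then T - t else 0) + (if k + l = 0 then T - t else 0)) / 2) {t..T}"
    using has_integral_divide[OF has_integral_add[OF integral_cos_theta[of "k - l"] integral_cos_theta[of "k + l"]], of 2]
    by simp
  moreover have "(cos ((k - l) * theta x) + cos ((k + l) * theta x)) / 2 = cos (k * theta x) * cos (l * theta x)" for x
    by (simp add: left_diff_distrib distrib_right cos_diff cos_add)
  moreover have "((if k - l = 0 then T - t else 0) + (if k + l = 0 then T - t else 0)) / 2 = (if k = l then (T - t) / 2 else 0)"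
    using assms by auto
  ultimately show ?thesis by (simp only:)
qed

lemma integral_sinsin:
  fixes k l :: int
  assumes "0 \<le> k" "0 < l"
  shows "((\<lambda>x. sin (k * theta x) * sin (l * theta x)) has_integral (if k = l then (T - t) / 2 else 0)) {t..T}"
proof -
  have "((\<lambda>x. (cos ((k - l) * theta x) - cos ((k + l) * theta x)) / 2) has_integral
     ((if k - l = 0 then T - t else 0) - (if k + l = 0 then T - t else 0)) / 2) {t..T}"
    using has_integral_divide[OF has_integral_diff[OF integral_cos_theta[of "k - l"] integral_cos_theta[of "k + l"]], of 2]
    by simp
  moreover have "(cos ((k - l) * theta x) - cos ((k + l) * theta x)) / 2 = sin (k * theta x) * sin (l * theta x)" for x
    by (simp add: left_diff_distrib distrib_right cos_diff cos_add)
  moreover have "((if k - l = 0 then T - t else 0) - (if k + l = 0 then T - t else 0)) / 2 = (if k = l then (T - t) / 2 else 0)"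
    using assms by auto
  ultimately show ?thesis by (simp only:)
qed

lemma integral_sincos:
  fixes k l :: int
  shows "((\<lambda>x. sin (k * theta x) * cos (l * theta x)) has_integral 0) {t..T}"
proof -
  have "((\<lambda>x. (sin ((k - l) * theta x) + sin ((k + l) * theta x)) / 2) has_integral (0 + 0) / 2) {t..T}"
    using has_integral_divide[OF has_integral_add[OF integral_sin_theta[of "k - l"] integral_sin_theta[of "k + l"]], of 2]
    by simp
  moreover have "(sin ((k - l) * theta x) + sin ((k + l) * theta x)) / 2 = sin (k * theta x) * cos (l * theta x)" for x
    by (simp add: left_diff_distrib distrib_right sin_diff sin_add)
  ultimately show ?thesis by simp
qed

text \<open>Reindexing by the frequency \<open>r\<close>, taken as an integer because product-to-sum
  formulas produce differences of frequencies.\<close>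

lemma trig_sys_cases:
  obtains "j = 0" "trig_sys t T j = (\<lambda>x. 1 / sqrt (T - t))"
  | r :: int where "r > 0" "j = 2 * nat r - 1" "trig_sys t T j = (\<lambda>x. sqrt (2 / (T - t)) * sin (r * theta x))"
  | r :: int where "r > 0" "j = 2 * nat r" "trig_sys t T j = (\<lambda>x. sqrt (2 / (T - t)) * cos (r * theta x))"
proof (cases "j = 0")
  case True
  then show ?thesis by (intro that(1)) (auto simp: trig_sys_def)
next
  case False
  have arg: "2 * pi * real n * (x - t) / (T - t) = of_int (int n) * theta x" for n x
    by (simp add: theta_def)
  show ?thesis
  proof (cases "odd j")
    case True
    then obtain k where k: "j = 2 * k + 1" by (elim oddE)
    have "(j + 1) div 2 = k + 1" using k by simp
    then have "trig_sys t T j = (\<lambda>x. sqrt (2 / (T - t)) * sin (int (k + 1) * theta x))"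
      using True False unfolding trig_sys_def arg by auto
    then show ?thesis using k by (intro that(2)[of "int (k + 1)"]) auto
  next
    case even: False
    then obtain k where k: "j = 2 * k" by (auto elim: evenE)
    have "j div 2 = k" using k by simp
    then have "trig_sys t T j = (\<lambda>x. sqrt (2 / (T - t)) * cos (int k * theta x))"
      using even False unfolding trig_sys_def arg by auto
    then show ?thesis using k False by (intro that(3)[of "int k"]) auto
  qed
qed

lemma trig_sys_continuous: "continuous_on S (trig_sys t T j)"
  by (cases j rule: trig_sys_cases) (auto intro!: continuous_intros theta_cont)

lemma sqrt_2_square: "sqrt (2 / (T - t)) * sqrt (2 / (T - t)) = 2 / (T - t)"
  using tT by simp

lemma trig_sys_orthonormal:
  "integral {t..T} (\<lambda>x. trig_sys t T i x * trig_sys t T j x) = (if i = j then 1 else 0)"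
proof -
  let ?s = "sqrt (2 / (T - t))"
  have scale: "((\<lambda>x. (a * f x) * (b * g x)) has_integral (a * b * I)) {t..T}"
    if "((\<lambda>x. f x * g x) has_integral I) {t..T}" for a b I and f g :: "real \<Rightarrow> real"
    using has_integral_mult_right[OF that, of "a * b"] by (simp add: mult_ac)
  have ss: "?s * ?s * ((T - t) / 2) = 1" using tT by (simp only: sqrt_2_square) simp
  have swap: "((\<lambda>x. f x * g x) has_integral I) {t..T}" if "((\<lambda>x. g x * f x) has_integral I) {t..T}"
    for I and f g :: "real \<Rightarrow> real"
    using that by (simp add: mult.commute)
  have one: "((\<lambda>x. 1 * cos (r * theta x)) has_integral 0) {t..T}" "((\<lambda>x. 1 * sin (r * theta x)) has_integral 0) {t..T}"
    if "r > 0" for r :: int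
    using integral_cos_theta[of r] integral_sin_theta[of r] that by auto
  have "((\<lambda>x. trig_sys t T i x * trig_sys t T j x) has_integral (if i = j then 1 else 0)) {t..T}"
  proof (cases i rule: trig_sys_cases)
    case i: 1
    show ?thesis
    proof (cases j rule: trig_sys_cases)
      case 1
      have "1 / sqrt (T - t) * (1 / sqrt (T - t)) = 1 / (T - t)" using tT by simp
      then have "((\<lambda>x. 1 / sqrt (T - t) * (1 / sqrt (T - t))) has_integral 1) {t..T}"
        using has_integral_const_real[of "1 / (T - t)" t T] tT by simp
      then show ?thesis using i 1 by simp
    next
      case (2 r)
      then show ?thesis using i scale[OF one(2)[of r], of "1 / sqrt (T - t)" ?s] by simp
    next
      case (3 r)
      then show ?thesis using i scale[OF one(1)[of r], of "1 / sqrt (T - t)" ?s] by simp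
    qed
  next
    case i: (2 q)
    show ?thesis
    proof (cases j rule: trig_sys_cases)
      case 1
      then show ?thesis using i scale[OF swap[OF one(2)[of q]], of ?s "1 / sqrt (T - t)"] by simp
    next
      case (2 r)
      have "q = r \<longleftrightarrow> i = j" using i 2 by (auto simp: nat_eq_iff)
      then show ?thesis
        using i 2 scale[OF integral_sinsin[of q r], of ?s ?s] ss by (cases "i = j") auto
    next
      case (3 r)
      have "nat q > 0" using i(1) by simp
      \<comment> \<open>A successor resolves the truncated subtraction in
        \<open>2 * nat q - 1\<close>; parity then separates the indices of sines and
        cosines.\<close>
      then obtain a where a: "nat q = Suc a" by (cases "nat q") auto
      have "even i \<noteq> even j" using i(2) 3(2) unfolding a by simp
      then have "i \<noteq> j" by auto
      then show ?thesis using i 3 scale[OF integral_sincos[of q r], of ?s ?s] by simp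
    qed
  next
    case i: (3 q)
    show ?thesis
    proof (cases j rule: trig_sys_cases)
      case 1
      then show ?thesis using i scale[OF swap[OF one(1)[of q]], of ?s "1 / sqrt (T - t)"] by simp
    next
      case (2 r)
      have "nat r > 0" using 2(1) by simp
      then obtain a where a: "nat r = Suc a" by (cases "nat r") auto
      have "even i \<noteq> even j" using i(2) 2(2) unfolding a by simp
      then have "i \<noteq> j" by auto
      then show ?thesis using i 2 scale[OF swap[OF integral_sincos[of r q]], of ?s ?s] by simp
    next
      case (3 r)
      have "q = r \<longleftrightarrow> i = j" using i 3 by (auto simp: nat_eq_iff)
      then show ?thesis
        using i 3 scale[OF integral_coscos[of q r], of ?s ?s] ss by (cases "i = j") auto
    qed
  qed
  then show ?thesis by (rule integral_unique)
qed

section \<open>Trigonometric polynomials and their density\<close>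

definition trig_span :: "(real \<Rightarrow> real) \<Rightarrow> bool" where
  "trig_span f \<longleftrightarrow> (\<exists>n c. \<forall>x. f x = (\<Sum>j\<le>n. c j * trig_sys t T j x))"

lemma trig_span_add:
  assumes "trig_span f" "trig_span g"
  shows "trig_span (\<lambda>x. f x + g x)"
proof -
  from assms obtain n c k d where f: "\<And>x. f x = (\<Sum>j\<le>n. c j * trig_sys t T j x)"
    and g: "\<And>x. g x = (\<Sum>j\<le>k. d j * trig_sys t T j x)" unfolding trig_span_def by auto
  have "f x + g x = (\<Sum>j\<le>max n k. ((if j \<le> n then c j else 0) + (if j \<le> k then d j else 0)) * trig_sys t T j x)" for x
    unfolding f g distrib_right sum.distrib
    by (intro arg_cong2[where f="(+)"] sum.mono_neutral_cong_left) auto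
  then show ?thesis unfolding trig_span_def
    by (intro exI[of _ "max n k"] exI[of _ "\<lambda>j. (if j \<le> n then c j else 0) + (if j \<le> k then d j else 0)"]) simp
qed

lemma trig_span_cmult: "trig_span f \<Longrightarrow> trig_span (\<lambda>x. a * f x)"
  unfolding trig_span_def
proof (elim exE)
  fix n c assume "\<forall>x. f x = (\<Sum>j\<le>n. c j * trig_sys t T j x)"
  then show "\<exists>n c. \<forall>x. a * f x = (\<Sum>j\<le>n. c j * trig_sys t T j x)"
    by (intro exI[of _ n] exI[of _ "\<lambda>j. a * c j"]) (simp add: sum_distrib_left mult.assoc)
qed

lemma trig_span_sum: "(\<And>i. i \<in> K \<Longrightarrow> trig_span (f i)) \<Longrightarrow> trig_span (\<lambda>x. \<Sum>i\<in>K. f i x)"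
proof (induction K rule: infinite_finite_induct)
  case (insert i K)
  then show ?case using trig_span_add[of "f i" "\<lambda>x. \<Sum>i\<in>K. f i x"] by simp
qed (auto simp: trig_span_def intro!: exI[of _ 0] exI[of _ "\<lambda>_. 0"])

lemma trig_span_sys: "trig_span (trig_sys t T j)"
  unfolding trig_span_def
  by (intro exI[of _ j] exI[of _ "\<lambda>k. if k = j then 1 else 0"])
     (simp add: if_distrib[of "\<lambda>x. x * _"] cong: if_cong)

lemma trig_span_base: "trig_span (\<lambda>x. cos (int n * theta x))" "trig_span (\<lambda>x. sin (int n * theta x))"
proof -
  let ?s = "sqrt (2 / (T - t))"
  have s: "?s > 0" "sqrt (T - t) > 0" using tT by auto
  have arg: "2 * pi * real n * (x - t) / (T - t) = of_int (int n) * theta x" for n x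
    by (simp add: theta_def)
  show "trig_span (\<lambda>x. cos (int n * theta x))"
  proof (cases "n = 0")
    case True
    then show ?thesis using trig_span_cmult[OF trig_span_sys[of 0], of "sqrt (T - t)"] s by (simp add: trig_sys_def[abs_def])
  next
    case False
    have "trig_sys t T (2 * n) = (\<lambda>x. ?s * cos (int n * theta x))"
      using False unfolding trig_sys_def arg by auto
    then show ?thesis using trig_span_cmult[OF trig_span_sys[of "2 * n"], of "1 / ?s"] s by simp
  qed
  show "trig_span (\<lambda>x. sin (int n * theta x))"
  proof (cases "n = 0")
    case True
    then show ?thesis using trig_span_cmult[OF trig_span_sys[of 0], of 0] by simp
  next
    case False
    have "odd (2 * n - 1)" "(2 * n - 1 + 1) div 2 = n" "2 * n - 1 \<noteq> 0" using False by auto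
    then have "trig_sys t T (2 * n - 1) = (\<lambda>x. ?s * sin (int n * theta x))"
      unfolding trig_sys_def arg by auto
    then show ?thesis using trig_span_cmult[OF trig_span_sys[of "2 * n - 1"], of "1 / ?s"] s by simp
  qed
qed

lemma trig_span_int: "trig_span (\<lambda>x. cos (of_int k * theta x))" "trig_span (\<lambda>x. sin (of_int k * theta x))"
proof -
  obtain n where "k = int n \<or> k = - int n" by (metis int_cases2)
  then have "trig_span (\<lambda>x. cos (of_int k * theta x)) \<and> trig_span (\<lambda>x. sin (of_int k * theta x))"
    using trig_span_base[of n] trig_span_cmult[OF trig_span_base(2)[of n], of "-1"] by auto
  then show "trig_span (\<lambda>x. cos (of_int k * theta x))" "trig_span (\<lambda>x. sin (of_int k * theta x))" by auto
qed

text \<open>Multiplication by \<open>cos (theta x)\<close> averages the neighbouring frequencies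
  \<open>k + 1\<close> and \<open>k - 1\<close>, so the induction runs over all integer frequencies
  at once.\<close>

lemma trig_span_power:
  "trig_span (\<lambda>x. cos (of_int k * theta x) * cos (theta x) ^ n)"
  "trig_span (\<lambda>x. sin (of_int k * theta x) * cos (theta x) ^ n)"
proof (induction n arbitrary: k)
  case 0
  case 1 show ?case using trig_span_int by simp
  case 2 show ?case using trig_span_int by simp
next
  case (Suc n)
  case 1
  have "cos (of_int k * theta x) * cos (theta x) ^ Suc n =
     (1/2) * (cos (of_int (k + 1) * theta x) * cos (theta x) ^ n + cos (of_int (k - 1) * theta x) * cos (theta x) ^ n)" for x
    by (simp add: distrib_right left_diff_distrib cos_add cos_diff)
  then show ?case
    using trig_span_cmult[OF trig_span_add[OF Suc(1)[of "k + 1"] Suc(1)[of "k - 1"]], of "1/2"] by (simp only:)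
  case 2
  have "sin (of_int k * theta x) * cos (theta x) ^ Suc n =
     (1/2) * (sin (of_int (k + 1) * theta x) * cos (theta x) ^ n + sin (of_int (k - 1) * theta x) * cos (theta x) ^ n)" for x
    by (simp add: distrib_right left_diff_distrib sin_add sin_diff)
  then show ?case
    using trig_span_cmult[OF trig_span_add[OF Suc(2)[of "k + 1"] Suc(2)[of "k - 1"]], of "1/2"] by (simp only:)
qed

text \<open>A function symmetric about the midpoint is a continuous function of
  \<open>cos (theta x)\<close>, through \<open>arccos\<close>; Weierstrass approximation on
  \<open>[-1, 1]\<close> then gives polynomials in the cosine.\<close>

lemma even_about_pi:
  assumes h: "continuous_on {t..T} h" and sym: "\<And>x. x \<in> {t..T} \<Longrightarrow> h (t + T - x) = h x" and e: "e > 0"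
  shows "\<exists>c n. \<forall>x\<in>{t..T}. \<bar>h x - (\<Sum>i\<le>n. c i * cos (theta x) ^ i)\<bar> < e"
proof -
  let ?w = "\<lambda>y. t + arccos y * (T - t) / (2 * pi)"
  have w: "?w y \<in> {t..T}" if "y \<in> {-1..1}" for y
  proof -
    have "0 \<le> arccos y" "arccos y \<le> pi" using that by (auto intro: arccos_lbound arccos_ubound)
    then have "0 \<le> arccos y * (T - t)" "arccos y * (T - t) \<le> 2 * pi * (T - t)"
      using tT by (auto intro!: mult_right_mono)
    then show ?thesis by (auto simp: field_simps)
  qed
  have "continuous_on {-1..1} (\<lambda>y. h (?w y))"
    by (rule continuous_on_compose2[OF h]) (use w in \<open>auto intro!: continuous_intros\<close>)
  then obtain g where g: "real_polynomial_function g" "\<And>y. y \<in> {-1..1} \<Longrightarrow> \<bar>h (?w y) - g y\<bar> < e"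
    using Stone_Weierstrass_real_polynomial_function[OF compact_Icc _ e] by blast
  from g(1) obtain a n where ga: "g = (\<lambda>y. \<Sum>i\<le>n. a i * y ^ i)" by (auto simp: real_polynomial_function_iff_sum)
  have wc: "h (?w (cos (theta x))) = h x" if x: "x \<in> {t..T}" for x
  proof (cases "theta x \<le> pi")
    case True
    then have "arccos (cos (theta x)) = theta x" using theta_range[OF x] by (intro arccos_cos) auto
    then show ?thesis using tT by (simp add: theta_def)
  next
    case False
    \<comment> \<open>Beyond the midpoint \<open>arccos\<close> returns the reflected phase, so the
      recovered point is \<open>t + T - x\<close>; here the symmetry of \<open>h\<close>
      enters.\<close>
    have "cos (theta x) = cos (2 * pi - theta x)" by simp
    also have "arccos \<dots> = 2 * pi - theta x" using theta_range[OF x] False by (intro arccos_cos) auto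
    finally have "arccos (cos (theta x)) = 2 * pi - theta x" .
    then have "?w (cos (theta x)) = t + T - x" using tT by (simp add: theta_def field_simps)
    then show ?thesis using sym[OF x] by (simp only:)
  qed
  have "\<bar>h x - (\<Sum>i\<le>n. a i * cos (theta x) ^ i)\<bar> < e" if x: "x \<in> {t..T}" for x
    using g(2)[of "cos (theta x)"] unfolding wc[OF x] unfolding ga by simp
  then show ?thesis by blast
qed

lemma theta_reflect: "theta (t + T - x) = 2 * pi - theta x"
  using tT by (simp add: theta_def field_simps)

lemma l2_approx_uniform:
  assumes f: "continuous_on {t..T} f" and g: "continuous_on {t..T} g"
    and d: "\<And>x. x \<in> {t..T} \<Longrightarrow> \<bar>f x - g x\<bar> \<le> d"
  shows "l2_sq (Icc_measure t T) (\<lambda>x. f x - g x) \<le> measure (Icc_measure t T) {t..T} * d\<^sup>2"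
proof -
  interpret I: finite_measure "Icc_measure t T" by (rule finite_measure_Icc_measure)
  have d0: "d \<ge> 0" using d[of t] tT by (auto intro: order_trans[OF abs_ge_zero])
  have "l2_sq (Icc_measure t T) (\<lambda>x. f x - g x) \<le> (\<integral>x. d\<^sup>2 \<partial>(Icc_measure t T))"
    unfolding l2_sq_def
  proof (rule integral_mono)
    show "integrable (Icc_measure t T) (\<lambda>x. (f x - g x)\<^sup>2)"
      by (intro I.bounded_meas_integrable bounded_meas_power2 continuous_bounded_meas continuous_intros f g)
    show "(f x - g x)\<^sup>2 \<le> d\<^sup>2" if "x \<in> space (Icc_measure t T)" for x
      using d[of x] that d0 by (subst abs_le_square_iff[symmetric]) auto
  qed simp
  then show ?thesis by simp
qed

text \<open>A function odd about the midpoint is not a continuous multiple of \<open>sin theta\<close>, but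
  \<open>h * sin\<^sup>2 / (sin\<^sup>2 + 1/n)\<close> is one, with an even cofactor, and it tends to \<open>h\<close> in mean square.\<close>

lemma trig_dense:
  assumes f: "continuous_on {t..T} f" and e: "e > 0"
  shows "\<exists>n c. l2_sq (Icc_measure t T) (\<lambda>x. f x - (\<Sum>j\<le>n. c j * trig_sys t T j x)) < e"
proof -
  let ?I = "Icc_measure t T"
  interpret I: finite_measure ?I by (rule finite_measure_Icc_measure)
  have fr: "continuous_on {t..T} (\<lambda>x. f (t + T - x))"
    by (rule continuous_on_compose2[OF f]) (auto intro!: continuous_intros)
  define he where "he x = (f x + f (t + T - x)) / 2" for x
  define ho where "ho x = (f x - f (t + T - x)) / 2" for x
  have hec: "continuous_on {t..T} he" and hoc: "continuous_on {t..T} ho"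
    unfolding he_def[abs_def] ho_def[abs_def] by (intro continuous_intros f fr; simp)+
  \<comment> \<open>The summand \<open>1 / Suc n\<close> keeps the denominator positive at the zeros
    of the sine.\<close>
  define k where "k n x = ho x * sin (theta x) / ((sin (theta x))\<^sup>2 + 1 / Suc n)" for n x
  have pos: "(sin (theta x))\<^sup>2 + 1 / Suc n > 0" for x n by (intro add_nonneg_pos) auto
  have kc: "continuous_on {t..T} (k n)" for n
    unfolding k_def[abs_def] using pos[of _ n]
    by (intro continuous_intros hoc theta_cont) (auto simp: less_imp_neq[symmetric] simp del: of_nat_Suc)
  have ksym: "k n (t + T - x) = k n x" for n x
  proof -
    have s: "sin (2 * pi - theta x) = - sin (theta x)" by (simp add: sin_diff)
    have h: "ho (t + T - x) = - ho x" by (simp add: ho_def field_simps)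
    show ?thesis unfolding k_def theta_reflect s h by simp
  qed
  have lim: "l2_lim ?I (\<lambda>n x. sin (theta x) * k n x) ho"
  proof -
    obtain B where B: "B \<ge> 0" "\<And>x. x \<in> space ?I \<Longrightarrow> \<bar>ho x\<bar> \<le> B"
      using bounded_meas_bound[OF continuous_bounded_meas[OF hoc]] by blast
    have eq: "sin (theta x) * k n x = ho x * ((sin (theta x))\<^sup>2 / ((sin (theta x))\<^sup>2 + 1 / Suc n))" for n x
      by (simp add: k_def power2_eq_square)
    show ?thesis
    proof (rule I.bounded_meas_l2_lim)
      show "(\<lambda>x. sin (theta x) * k n x) \<in> borel_measurable ?I" "ho \<in> borel_measurable ?I" for n
        by (intro continuous_on_measurable_Icc_measure continuous_intros theta_cont kc hoc)+
      show "\<bar>ho x\<bar> \<le> B" if "x \<in> space ?I" for x using B that by blast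
      show "\<bar>sin (theta x) * k n x\<bar> \<le> B" if "x \<in> space ?I" for x n
      proof -
        have "0 \<le> (sin (theta x))\<^sup>2 / ((sin (theta x))\<^sup>2 + 1 / Suc n)" "(sin (theta x))\<^sup>2 / ((sin (theta x))\<^sup>2 + 1 / Suc n) \<le> 1"
          using pos[of x n] by (auto simp: field_simps)
        then show ?thesis unfolding eq abs_mult using mult_mono[OF B(2)[OF that], of _ 1] B by fastforce
      qed
      have conv: "(\<lambda>n. sin (theta x) * k n x) \<longlonglongrightarrow> ho x" if "sin (theta x) \<noteq> 0" for x
      proof -
        have "(\<lambda>n. ho x * ((sin (theta x))\<^sup>2 / ((sin (theta x))\<^sup>2 + 1 / Suc n))) \<longlonglongrightarrow>
            ho x * ((sin (theta x))\<^sup>2 / ((sin (theta x))\<^sup>2 + 0))"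
          using that by (intro tendsto_intros LIMSEQ_Suc[OF lim_inverse_n']) auto
        then show ?thesis unfolding eq using that by simp
      qed
      \<comment> \<open>In one period the sine vanishes only at the endpoints and the midpoint,
        which form a null set.\<close>
      have nz: "sin (theta x) \<noteq> 0" if "x \<in> space ?I" "x \<noteq> t" "x \<noteq> T" "x \<noteq> (t + T) / 2" for x
      proof
        assume "sin (theta x) = 0"
        then obtain q :: int where q: "theta x = q * pi" using sin_zero_iff_int2 by blast
        have "0 < theta x" "theta x < 2 * pi" using that tT by (auto simp: theta_def field_simps)
        then have "0 < q" "q < 2" unfolding q by (auto simp: zero_less_mult_iff)
        then have "q = 1" by simp
        then have "theta x = pi" using q by simp
        then have "pi * (2 * (x - t)) = pi * (T - t)" using tT by (simp add: theta_def field_simps)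
        then have "2 * (x - t) = T - t" by (simp only: mult_cancel_left pi_neq_zero) simp
        then show False using that by simp
      qed
      show "AE x in ?I. (\<lambda>n. sin (theta x) * k n x) \<longlonglongrightarrow> ho x"
        using AE_space[of ?I] AE_interval_neq[of t] AE_interval_neq[of T] AE_interval_neq[of "(t + T) / 2"]
        by eventually_elim (intro conv nz)
    qed
  qed
  define V where "V = measure ?I {t..T}"
  have V: "V \<ge> 0" by (simp add: V_def)
  \<comment> \<open>The final error is below \<open>2 * V * d^2 + 2 * (2 * (e / 8) + 2 * V * d^2) =
    6 * V * d^2 + e / 2\<close>; the constant 12 bounds the first part by
    \<open>e / 2\<close>.\<close>
  define d where "d = sqrt (e / (12 * (V + 1)))"
  have d: "d > 0" using e V by (simp add: d_def)
  have Vd: "6 * (V * d\<^sup>2) \<le> e / 2"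
  proof -
    have "V / (V + 1) \<le> 1" using V by simp
    then have "V / (V + 1) * (e / 12) \<le> 1 * (e / 12)" using e by (intro mult_right_mono) auto
    moreover have "V * d\<^sup>2 = V / (V + 1) * (e / 12)" using e V by (simp add: d_def)
    ultimately show ?thesis by linarith
  qed
  have "e / 8 > 0" using e by simp
  from order_tendstoD(2)[OF l2_limD(3)[OF lim] this] obtain n where
    n: "l2_sq ?I (\<lambda>x. sin (theta x) * k n x - ho x) < e / 8" by (auto dest: eventually_happens)
  have "he (t + T - x) = he x" for x by (simp add: he_def add.commute)
  then obtain c1 n1 where c1: "\<And>x. x \<in> {t..T} \<Longrightarrow> \<bar>he x - (\<Sum>i\<le>n1. c1 i * cos (theta x) ^ i)\<bar> < d"
    using even_about_pi[OF hec _ d] by metis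
  obtain c2 n2 where c2: "\<And>x. x \<in> {t..T} \<Longrightarrow> \<bar>k n x - (\<Sum>i\<le>n2. c2 i * cos (theta x) ^ i)\<bar> < d"
    using even_about_pi[OF kc ksym d] by metis
  let ?P = "\<lambda>x. \<Sum>i\<le>n1. c1 i * cos (theta x) ^ i" and ?Q = "\<lambda>x. \<Sum>i\<le>n2. c2 i * cos (theta x) ^ i"
  have Pc: "continuous_on {t..T} ?P" and Qc: "continuous_on {t..T} (\<lambda>x. sin (theta x) * ?Q x)"
    and kc': "continuous_on {t..T} (\<lambda>x. sin (theta x) * k n x)"
    by (intro continuous_intros theta_cont kc)+
  have 1: "l2_sq ?I (\<lambda>x. he x - ?P x) \<le> V * d\<^sup>2"
    unfolding V_def by (rule l2_approx_uniform[OF hec Pc less_imp_le[OF c1]])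
  have 2: "l2_sq ?I (\<lambda>x. sin (theta x) * k n x - sin (theta x) * ?Q x) \<le> V * d\<^sup>2"
    unfolding V_def
  proof (rule l2_approx_uniform[OF kc' Qc])
    fix x assume x: "x \<in> {t..T}"
    have "\<bar>sin (theta x)\<bar> * \<bar>k n x - ?Q x\<bar> \<le> 1 * d"
      using c2[OF x] by (intro mult_mono abs_sin_le_one) auto
    then show "\<bar>sin (theta x) * k n x - sin (theta x) * ?Q x\<bar> \<le> d" by (simp add: abs_mult flip: right_diff_distrib)
  qed
  have sq: "sq_integrable ?I g" if "continuous_on {t..T} g" for g
    by (intro I.bounded_meas_sq continuous_bounded_meas that)
  have "trig_span (\<lambda>x. ?P x + sin (theta x) * ?Q x)"
  proof (rule trig_span_add)
    show "trig_span ?P"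
      using trig_span_power(1)[of 0] by (intro trig_span_sum trig_span_cmult) simp
    have "(\<lambda>x. sin (theta x) * ?Q x) = (\<lambda>x. \<Sum>i\<le>n2. c2 i * (sin (of_int 1 * theta x) * cos (theta x) ^ i))"
      by (simp add: sum_distrib_left mult_ac)
    then show "trig_span (\<lambda>x. sin (theta x) * ?Q x)"
      by (simp only:) (intro trig_span_sum trig_span_cmult trig_span_power)
  qed
  then obtain n' c where nc: "\<And>x. ?P x + sin (theta x) * ?Q x = (\<Sum>j\<le>n'. c j * trig_sys t T j x)"
    unfolding trig_span_def by auto
  have eq: "l2_sq ?I (\<lambda>x. f x - (\<Sum>j\<le>n'. c j * trig_sys t T j x)) =
     l2_sq ?I (\<lambda>x. (he x - ?P x) + (ho x - sin (theta x) * ?Q x))"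
    unfolding nc[symmetric] he_def ho_def by (intro arg_cong[where f="l2_sq ?I"] ext) (simp add: field_simps)
  have 3: "l2_sq ?I (\<lambda>x. (he x - ?P x) + (ho x - sin (theta x) * ?Q x)) \<le>
      2 * l2_sq ?I (\<lambda>x. he x - ?P x) + 2 * l2_sq ?I (\<lambda>x. ho x - sin (theta x) * ?Q x)"
    by (intro l2_sq_add_le sq continuous_on_diff hec hoc Pc Qc)
  have 4: "l2_sq ?I (\<lambda>x. ho x - sin (theta x) * ?Q x) \<le> 2 * l2_sq ?I (\<lambda>x. ho x - sin (theta x) * k n x) +
      2 * l2_sq ?I (\<lambda>x. sin (theta x) * k n x - sin (theta x) * ?Q x)"
    by (intro l2_sq_triangle sq hoc Qc kc')
  have "l2_sq ?I (\<lambda>x. f x - (\<Sum>j\<le>n'. c j * trig_sys t T j x)) < e"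
    unfolding eq using 1 2 3 4 n Vd l2_sq_commute[of ?I ho "\<lambda>x. sin (theta x) * k n x"] by linarith
  then show ?thesis by blast
qed

lemma ortho_system_trig: "ortho_system t T (trig_sys t T)"
  by standard (auto simp: tT trig_sys_continuous trig_sys_orthonormal trig_dense)

end

section \<open>Trace sums\<close>

text \<open>Dirichlet's exchange of the order of integration, from the fundamental theorem:
  \<open>F z * (G b - G z)\<close> vanishes at both ends, and its derivative is the difference of
  the two integrands.\<close>

lemma integral_triangle_swap:
  fixes f g :: "real \<Rightarrow> real"
  assumes f: "continuous_on {a..b} f" and g: "continuous_on {a..b} g" and ab: "a \<le> b"
  shows "integral {a..b} (\<lambda>z. g z * integral {a..z} f) = integral {a..b} (\<lambda>y. f y * integral {y..b} g)"
proof -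
  let ?F = "\<lambda>z. integral {a..z} f" and ?G = "\<lambda>z. integral {a..z} g"
  have F: "(?F has_real_derivative f z) (at z within {a..b})" if "z \<in> {a..b}" for z
    by (rule integral_has_real_derivative[OF f that])
  have G: "(?G has_real_derivative g z) (at z within {a..b})" if "z \<in> {a..b}" for z
    by (rule integral_has_real_derivative[OF g that])
  have Fc: "continuous_on {a..b} ?F" and Gc: "continuous_on {a..b} ?G"
    by (auto intro!: indefinite_integral_continuous_1 integrable_continuous_real f g)
  have Gb: "integral {y..b} g = ?G b - ?G y" if "y \<in> {a..b}" for y
    using Henstock_Kurzweil_Integration.integral_combine[of a y b g] that integrable_continuous_real[OF g] by simp
  have "((\<lambda>z. g z * ?F z - f z * (?G b - ?G z)) has_integral (- (?F b * (?G b - ?G b)) - (- (?F a * (?G b - ?G a))))) {a..b}"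
  proof (rule fundamental_theorem_of_calculus[OF ab])
    fix z assume z: "z \<in> {a..b}"
    have "((\<lambda>z. - (?F z * (?G b - ?G z))) has_real_derivative g z * ?F z - f z * (?G b - ?G z)) (at z within {a..b})"
      by (rule derivative_eq_intros F[OF z] G[OF z] refl)+ (simp add: algebra_simps)
    then show "((\<lambda>z. - (?F z * (?G b - ?G z))) has_vector_derivative g z * ?F z - f z * (?G b - ?G z)) (at z within {a..b})"
      by (simp only: has_real_derivative_iff_has_vector_derivative)
  qed
  then have "integral {a..b} (\<lambda>z. g z * ?F z - f z * (?G b - ?G z)) = 0"
    by (simp add: integral_unique)
  moreover have "integral {a..b} (\<lambda>z. g z * ?F z - f z * (?G b - ?G z)) =
     integral {a..b} (\<lambda>z. g z * ?F z) - integral {a..b} (\<lambda>z. f z * (?G b - ?G z))"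
    by (intro Henstock_Kurzweil_Integration.integral_diff integrable_continuous_real continuous_intros f g Fc Gc)
  moreover have "integral {a..b} (\<lambda>z. f z * (?G b - ?G z)) = integral {a..b} (\<lambda>y. f y * integral {y..b} g)"
  proof (rule Henstock_Kurzweil_Integration.integral_cong)
    fix y assume "y \<in> {a..b}"
    from Gb[OF this] show "f y * (?G b - ?G y) = f y * integral {y..b} g" by simp
  qed
  ultimately show ?thesis by simp
qed

lemma l2_sq_indicator_le:
  assumes "bounded_meas N f" "finite_measure N" "bounded_meas N (indicator S)"
  shows "l2_sq N (\<lambda>x. indicator S x * f x) \<le> l2_sq N f"
proof -
  interpret N: finite_measure N by fact
  show ?thesis
    unfolding l2_sq_def
    using assms
    by (intro integral_mono N.bounded_meas_integrable bounded_meas_power2 bounded_meas_mult) (auto split: split_indicator)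
qed

context ortho_system
begin

lemma integral_indicator_I:
  fixes h :: "real \<Rightarrow> real"
  assumes h: "continuous_on {a..b} h" and uv: "a \<le> u" "v \<le> b"
  shows "(\<integral>x. indicator {u..v} x * h x \<partial>I) = integral {u..v} h"
proof -
  have "(\<integral>x. indicator {u..v} x * h x \<partial>I) = (\<integral>x. indicator {a..b} x *\<^sub>R (indicator {u..v} x * h x) \<partial>lborel)"
    unfolding Icc_measure_def by (subst integral_restrict_space) auto
  also have "\<dots> = (\<integral>x. indicator {u..v} x *\<^sub>R h x \<partial>lborel)"
    using uv by (intro Bochner_Integration.integral_cong) (auto split: split_indicator)
  also have "\<dots> = (\<integral>x. h x \<partial>(Icc_measure u v))"
    unfolding Icc_measure_def by (subst integral_restrict_space) auto
  also have "\<dots> = integral {u..v} h"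
    by (rule integral_Icc_measure[OF continuous_on_subset[OF h]]) (use uv in auto)
  finally show ?thesis .
qed

lemma coef_indicator:
  assumes f: "continuous_on {a..b} f" and uv: "a \<le> u" "v \<le> b"
  shows "coef (\<lambda>x. indicator {u..v} x * f x) j = integral {u..v} (\<lambda>x. f x * \<phi> j x)"
  using integral_indicator_I[OF continuous_on_mult[OF f phi_cont[of j]] uv]
  by (simp add: coef_def l2_inner_def mult.assoc)

lemma indicator_mult_sq:
  assumes f: "continuous_on {a..b} f"
  shows "sq_integrable I (\<lambda>x. indicator {u..v} x * f x)"
  by (intro I.bounded_meas_sq bounded_meas_mult borel_set_Icc_measure continuous_bounded_meas f) auto

text \<open>Consecutive intervals have orthogonal images, so the bilinear Parseval sums vanish in the limit.\<close>

lemma parseval_consecutive: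
  assumes f: "continuous_on {a..b} f" and g: "continuous_on {a..b} g" and uyv: "a \<le> u" "u \<le> y" "y \<le> v" "v \<le> b"
  shows "(\<lambda>p. \<Sum>j\<le>p. integral {u..y} (\<lambda>x. f x * \<phi> j x) * integral {y..v} (\<lambda>x. g x * \<phi> j x)) \<longlonglongrightarrow> 0"
    and "\<bar>\<Sum>j\<le>p. integral {u..y} (\<lambda>x. f x * \<phi> j x) * integral {y..v} (\<lambda>x. g x * \<phi> j x)\<bar> \<le> (l2_sq I f + l2_sq I g) / 2"
proof -
  let ?f = "\<lambda>x. indicator {u..y} x * f x" and ?g = "\<lambda>x. indicator {y..v} x * g x"
  have c: "integral {u..y} (\<lambda>x. f x * \<phi> j x) = coef ?f j" "integral {y..v} (\<lambda>x. g x * \<phi> j x) = coef ?g j" for j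
    using uyv by (auto simp: coef_indicator f g)
  have sf: "spanned ?f" by (rule spanned_interval[OF f, of u y]) (use uyv in auto)
  have "l2_inner I ?f ?g = (\<integral>x. 0 \<partial>I)"
    unfolding l2_inner_def
  proof (rule integral_cong_AE)
    show "(\<lambda>x. ?f x * ?g x) \<in> borel_measurable I"
      using sq_integrable_measurable[OF indicator_mult_sq[OF f, of u y]]
        sq_integrable_measurable[OF indicator_mult_sq[OF g, of y v]] by simp
    show "AE x in I. ?f x * ?g x = 0"
      using AE_interval_neq[of y] by eventually_elim (auto split: split_indicator)
  qed simp
  then show "(\<lambda>p. \<Sum>j\<le>p. integral {u..y} (\<lambda>x. f x * \<phi> j x) * integral {y..v} (\<lambda>x. g x * \<phi> j x)) \<longlonglongrightarrow> 0"
    unfolding c using parseval[OF sf indicator_mult_sq[OF g, of y v]] by simp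
  have "l2_sq I ?f \<le> l2_sq I f" "l2_sq I ?g \<le> l2_sq I g"
    by (intro l2_sq_indicator_le continuous_bounded_meas f g I.finite_measure_axioms borel_set_Icc_measure; simp)+
  then show "\<bar>\<Sum>j\<le>p. integral {u..y} (\<lambda>x. f x * \<phi> j x) * integral {y..v} (\<lambda>x. g x * \<phi> j x)\<bar> \<le> (l2_sq I f + l2_sq I g) / 2"
    unfolding c
    by (intro order_trans[OF coef_prod_bound[OF indicator_mult_sq[OF f] indicator_mult_sq[OF g]]] divide_right_mono add_mono) auto
qed

text \<open>The sum of the diagonal Fourier coefficients of the kernel \<open>f x * g y\<close> on
  the triangle \<open>u \<le> x \<le> y \<le> v\<close>. Both ends vary: the trace over the first
  two variables moves \<open>v\<close>, the trace over the last two moves \<open>u\<close>.\<close>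

definition trace_sum :: "(real \<Rightarrow> real) \<Rightarrow> (real \<Rightarrow> real) \<Rightarrow> nat \<Rightarrow> real \<Rightarrow> real \<Rightarrow> real" where
  "trace_sum f g p u v = (\<Sum>j\<le>p. integral {u..v} (\<lambda>y. g y * \<phi> j y * integral {u..y} (\<lambda>x. f x * \<phi> j x)))"

text \<open>With \<open>F = \<integral>\<^sub>u f \<phi>\<close>, \<open>G = \<integral>\<^sub>u g \<phi>\<close> one has \<open>2 \<integral> F dG = F G + \<integral> (F dG - G dF)\<close>.
  The second integrand is \<open>\<phi> H\<close> with \<open>H = g F - f G\<close>, whose derivative \<open>g' F - f' G\<close> no longer contains
  \<open>\<phi>\<close>; integrating by parts against \<open>\<Psi> = \<integral>\<^sup>v \<phi>\<close> leaves sums over products of coefficients of functions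
  with disjoint supports.\<close>

lemma trace_sum_split:
  assumes "\<forall>x\<in>{a..b}. (f has_real_derivative f' x) (at x within {a..b})" "continuous_on {a..b} f'"
    and "\<forall>x\<in>{a..b}. (g has_real_derivative g' x) (at x within {a..b})" "continuous_on {a..b} g'"
    and uv: "a \<le> u" "u \<le> v" "v \<le> b"
  shows "2 * trace_sum f g p u v =
     (\<Sum>j\<le>p. integral {u..v} (\<lambda>x. f x * \<phi> j x) * integral {u..v} (\<lambda>x. g x * \<phi> j x)) +
     (\<integral>y. g' y * (\<Sum>j\<le>p. integral {u..y} (\<lambda>x. f x * \<phi> j x) * integral {y..v} (\<lambda>x. 1 * \<phi> j x))
         - f' y * (\<Sum>j\<le>p. integral {u..y} (\<lambda>x. g x * \<phi> j x) * integral {y..v} (\<lambda>x. 1 * \<phi> j x)) \<partial>(Icc_measure u v))"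
proof -
  have f: "(f has_real_derivative f' x) (at x within {a..b})"
    and g: "(g has_real_derivative g' x) (at x within {a..b})" if "x \<in> {a..b}" for x
    using assms that by auto
  have fc: "continuous_on {a..b} f" and gc: "continuous_on {a..b} g"
    by (rule DERIV_continuous_on[OF f] DERIV_continuous_on[OF g]; assumption)+
  have sub: "{u..v} \<subseteq> {a..b}" using uv by auto
  have fc': "continuous_on {u..v} f" and gc': "continuous_on {u..v} g" and fc1: "continuous_on {u..v} f'"
    and gc1: "continuous_on {u..v} g'" and pc: "continuous_on {u..v} (\<phi> j)" for j
    by (rule continuous_on_subset[OF _ sub]; fact fc gc assms(2) assms(4) phi_cont)+
  define F where "F j y = integral {u..y} (\<lambda>x. f x * \<phi> j x)" for j y
  define G where "G j y = integral {u..y} (\<lambda>x. g x * \<phi> j x)" for j y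
  \<comment> \<open>The factor \<open>1\<close> presents these integrals as coefficients of the
    constant function, the form in which \<open>parseval_consecutive\<close> applies to
    them.\<close>
  define Q where "Q j y = integral {u..y} (\<lambda>x. 1 * \<phi> j x)" for j y
  define P where "P j y = integral {y..v} (\<lambda>x. 1 * \<phi> j x)" for j y
  have PQ: "P j y = Q j v - Q j y" if "y \<in> {u..v}" for j y
  proof -
    have "(\<lambda>x. 1 * \<phi> j x) integrable_on {u..v}" by (intro integrable_continuous_real continuous_intros pc)
    then show ?thesis
      unfolding P_def Q_def
      using Henstock_Kurzweil_Integration.integral_combine[of u y v "\<lambda>x. 1 * \<phi> j x"] that by simp
  qed
  have dF: "(F j has_real_derivative f y * \<phi> j y) (at y within {u..v})"
    and dG: "(G j has_real_derivative g y * \<phi> j y) (at y within {u..v})"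
    and dQ: "(Q j has_real_derivative 1 * \<phi> j y) (at y within {u..v})" if "y \<in> {u..v}" for j y
    unfolding F_def[abs_def] G_def[abs_def] Q_def[abs_def]
    by (intro integral_has_real_derivative that continuous_intros fc' gc' pc)+
  have Fc: "continuous_on {u..v} (F j)" and Gc: "continuous_on {u..v} (G j)" and Qc: "continuous_on {u..v} (Q j)" for j
    by (rule DERIV_continuous_on[OF dF] DERIV_continuous_on[OF dG] DERIV_continuous_on[OF dQ]; assumption)+
  have Pc: "continuous_on {u..v} (P j)" for j
    by (rule continuous_on_eq[of _ "\<lambda>y. Q j v - Q j y"]) (auto intro!: continuous_intros Qc simp: PQ)
  have df: "(f has_real_derivative f' y) (at y within {u..v})" and dg: "(g has_real_derivative g' y) (at y within {u..v})"
    if "y \<in> {u..v}" for y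
    using that sub f[of y] g[of y] by (auto intro: DERIV_subset)
  have uu: "F j u = 0" "G j u = 0" for j by (auto simp: F_def G_def)
  have one: "2 * integral {u..v} (\<lambda>y. g y * \<phi> j y * F j y) =
     F j v * G j v + integral {u..v} (\<lambda>y. g' y * (F j y * P j y) - f' y * (G j y * P j y))" for j
  proof -
    \<comment> \<open>\<open>?D\<close> is the derivative of \<open>F * G\<close> and
      \<open>?E\<close> that of \<open>?H\<close> below. \<open>?H\<close> vanishes at
      \<open>u\<close> because \<open>F\<close> and \<open>G\<close> do, and at \<open>v\<close>
      because of its last factor.\<close>
    let ?D = "\<lambda>y. f y * \<phi> j y * G j y + F j y * (g y * \<phi> j y)"
    let ?E = "\<lambda>y. (g' y * F j y - f' y * G j y) * (Q j v - Q j y) - (g y * F j y - f y * G j y) * \<phi> j y"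
    have "(?D has_integral (F j v * G j v - F j u * G j u)) {u..v}"
    proof (rule fundamental_theorem_of_calculus[OF uv(2)])
      fix y assume y: "y \<in> {u..v}"
      have "((\<lambda>y. F j y * G j y) has_real_derivative ?D y) (at y within {u..v})"
        by (rule derivative_eq_intros dF[OF y] dG[OF y] refl)+ (simp add: algebra_simps)
      then show "((\<lambda>y. F j y * G j y) has_vector_derivative ?D y) (at y within {u..v})"
        by (simp only: has_real_derivative_iff_has_vector_derivative)
    qed
    then have D: "integral {u..v} ?D = F j v * G j v" using uu by (simp add: integral_unique)
    let ?H = "\<lambda>y. (g y * F j y - f y * G j y) * (Q j v - Q j y)"
    have "(?E has_integral (?H v - ?H u)) {u..v}"
    proof (rule fundamental_theorem_of_calculus[OF uv(2)])
      fix y assume y: "y \<in> {u..v}"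
      have "(?H has_real_derivative ?E y) (at y within {u..v})"
        by (rule derivative_eq_intros dF[OF y] dG[OF y] dQ[OF y] df[OF y] dg[OF y] refl)+ (simp add: algebra_simps)
      then show "(?H has_vector_derivative ?E y) (at y within {u..v})"
        by (simp only: has_real_derivative_iff_has_vector_derivative)
    qed
    then have E: "integral {u..v} ?E = 0" using uu by (simp add: integral_unique)
    have "2 * integral {u..v} (\<lambda>y. g y * \<phi> j y * F j y) = integral {u..v} (\<lambda>y. 2 * (g y * \<phi> j y * F j y))" by simp
    also have "\<dots> = integral {u..v} (\<lambda>y. ?D y + (- ?E y + (g' y * (F j y * P j y) - f' y * (G j y * P j y))))"
      by (intro Henstock_Kurzweil_Integration.integral_cong) (simp add: PQ algebra_simps)
    also have "\<dots> = integral {u..v} ?D + (- integral {u..v} ?E +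
        integral {u..v} (\<lambda>y. g' y * (F j y * P j y) - f' y * (G j y * P j y)))"
      by (subst Henstock_Kurzweil_Integration.integral_add
          Henstock_Kurzweil_Integration.integral_neg[symmetric]
          | intro integrable_continuous_real continuous_intros fc' gc' fc1 gc1 pc Fc Gc Qc Pc | rule refl)+
    finally show ?thesis using D E by simp
  qed
  let ?A = "\<lambda>y. g' y * (\<Sum>j\<le>p. F j y * P j y) - f' y * (\<Sum>j\<le>p. G j y * P j y)"
  have Ac: "continuous_on {u..v} ?A" by (intro continuous_intros gc1 fc1 Fc Gc Pc)
  have "2 * trace_sum f g p u v = (\<Sum>j\<le>p. 2 * integral {u..v} (\<lambda>y. g y * \<phi> j y * F j y))"
    by (simp add: trace_sum_def F_def sum_distrib_left)
  also have "\<dots> = (\<Sum>j\<le>p. F j v * G j v) + (\<Sum>j\<le>p. integral {u..v} (\<lambda>y. g' y * (F j y * P j y) - f' y * (G j y * P j y)))"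
    by (simp only: one sum.distrib)
  also have "(\<Sum>j\<le>p. integral {u..v} (\<lambda>y. g' y * (F j y * P j y) - f' y * (G j y * P j y))) =
     integral {u..v} (\<lambda>y. \<Sum>j\<le>p. g' y * (F j y * P j y) - f' y * (G j y * P j y))"
    by (rule Henstock_Kurzweil_Integration.integral_sum[symmetric])
       (auto intro!: integrable_continuous_real continuous_intros gc1 fc1 Fc Gc Pc)
  also have "(\<lambda>y. \<Sum>j\<le>p. g' y * (F j y * P j y) - f' y * (G j y * P j y)) = ?A"
    by (simp add: sum_subtractf sum_distrib_left)
  also have "integral {u..v} ?A = (\<integral>y. ?A y \<partial>(Icc_measure u v))"
    by (rule integral_Icc_measure[OF Ac, symmetric])
  finally show ?thesis unfolding F_def G_def P_def .
qed

text \<open>In \<open>trace_sum_split\<close> the products of full coefficients converge by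
  Parseval, and the remainder vanishes by dominated convergence, because pointwise it consists of
  sums over consecutive intervals. The factor 2 on the left is the origin of the one half. The bound
  is uniform in the endpoints, since the traces have to converge in mean square as functions of
  them.\<close>

lemma trace_sum_limit:
  assumes f: "C1_on {a..b} f" and g: "C1_on {a..b} g"
  shows "\<And>u v. a \<le> u \<Longrightarrow> u \<le> v \<Longrightarrow> v \<le> b \<Longrightarrow>
      (\<lambda>p. trace_sum f g p u v) \<longlonglongrightarrow> (1/2) * integral {u..v} (\<lambda>x. f x * g x)"
    and "\<exists>B. \<forall>p u v. a \<le> u \<longrightarrow> u \<le> v \<longrightarrow> v \<le> b \<longrightarrow> \<bar>trace_sum f g p u v\<bar> \<le> B"
proof -
  from f obtain f' where f': "\<forall>x\<in>{a..b}. (f has_real_derivative f' x) (at x within {a..b})" "continuous_on {a..b} f'"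
    unfolding C1_on_def by blast
  from g obtain g' where g': "\<forall>x\<in>{a..b}. (g has_real_derivative g' x) (at x within {a..b})" "continuous_on {a..b} g'"
    unfolding C1_on_def by blast
  have fc: "continuous_on {a..b} f" and gc: "continuous_on {a..b} g"
    by (rule DERIV_continuous_on[OF f'(1)[rule_format]] DERIV_continuous_on[OF g'(1)[rule_format]]; assumption)+
  have c1: "continuous_on {a..b} (\<lambda>x. 1 :: real)" by simp
  note split = trace_sum_split[OF f' g']
  obtain Df where Df: "Df \<ge> 0" "\<And>x. x \<in> {a..b} \<Longrightarrow> \<bar>f' x\<bar> \<le> Df"
    using bounded_meas_bound[OF continuous_bounded_meas[OF f'(2)]] by auto
  obtain Dg where Dg: "Dg \<ge> 0" "\<And>x. x \<in> {a..b} \<Longrightarrow> \<bar>g' x\<bar> \<le> Dg"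
    using bounded_meas_bound[OF continuous_bounded_meas[OF g'(2)]] by auto
  define Cf where "Cf = (l2_sq I f + l2_sq I (\<lambda>x. 1)) / 2"
  define Cg where "Cg = (l2_sq I g + l2_sq I (\<lambda>x. 1)) / 2"
  have C0: "Cf \<ge> 0" "Cg \<ge> 0" by (auto simp: Cf_def Cg_def)
  \<comment> \<open>The integrand of the remainder; at each \<open>y\<close> its sums pair the
    interval \<open>[u, y]\<close> with \<open>[y, v]\<close>.\<close>
  define A where "A u v p y = g' y * (\<Sum>j\<le>p. integral {u..y} (\<lambda>x. f x * \<phi> j x) * integral {y..v} (\<lambda>x. 1 * \<phi> j x))
         - f' y * (\<Sum>j\<le>p. integral {u..y} (\<lambda>x. g x * \<phi> j x) * integral {y..v} (\<lambda>x. 1 * \<phi> j x))" for u v p y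
  have Ab: "\<bar>A u v p y\<bar> \<le> Dg * Cf + Df * Cg" if uv: "a \<le> u" "v \<le> b" and y: "u \<le> y" "y \<le> v" for u v p y
  proof -
    have "\<bar>A u v p y\<bar> \<le> \<bar>g' y\<bar> * \<bar>\<Sum>j\<le>p. integral {u..y} (\<lambda>x. f x * \<phi> j x) * integral {y..v} (\<lambda>x. 1 * \<phi> j x)\<bar>
         + \<bar>f' y\<bar> * \<bar>\<Sum>j\<le>p. integral {u..y} (\<lambda>x. g x * \<phi> j x) * integral {y..v} (\<lambda>x. 1 * \<phi> j x)\<bar>"
      unfolding A_def by (rule order_trans[OF abs_triangle_ineq4]) (simp add: abs_mult)
    also have "\<dots> \<le> Dg * Cf + Df * Cg"
      unfolding Cf_def Cg_def
      using uv y Dg Df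
      by (intro add_mono mult_mono parseval_consecutive(2) fc gc c1) auto
    finally show ?thesis .
  qed
  have Am: "A u v p \<in> borel_measurable (Icc_measure u v)" if uv: "a \<le> u" "v \<le> b" for u v p
  proof (rule continuous_on_measurable_Icc_measure)
    have sub: "{u..v} \<subseteq> {a..b}" using uv by auto
    have int: "continuous_on {u..v} (\<lambda>y. integral {u..y} h)" if "continuous_on {a..b} h" for h :: "real \<Rightarrow> real"
      by (intro indefinite_integral_continuous_1 integrable_continuous_real continuous_on_subset[OF that sub])
    have int2: "continuous_on {u..v} (\<lambda>y. integral {y..v} h)" if "continuous_on {a..b} h" for h :: "real \<Rightarrow> real"
      by (intro indefinite_integral_continuous_1' integrable_continuous_real continuous_on_subset[OF that sub])
    show "continuous_on {u..v} (A u v p)"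
      unfolding A_def[abs_def]
      by (intro continuous_intros int int2 fc gc phi_cont continuous_on_subset[OF f'(2) sub] continuous_on_subset[OF g'(2) sub])
  qed
  have Alim: "(\<lambda>p. \<integral>y. A u v p y \<partial>(Icc_measure u v)) \<longlonglongrightarrow> 0" if uv: "a \<le> u" "v \<le> b" for u v
  proof -
    interpret U: finite_measure "Icc_measure u v" by (rule finite_measure_Icc_measure)
    have "(\<lambda>p. \<integral>y. A u v p y \<partial>(Icc_measure u v)) \<longlonglongrightarrow> (\<integral>y. 0 \<partial>(Icc_measure u v))"
    proof (rule integral_dominated_convergence[where w="\<lambda>_. Dg * Cf + Df * Cg"])
      show "AE y in Icc_measure u v. (\<lambda>p. A u v p y) \<longlonglongrightarrow> 0"
      proof (rule AE_I2)
        fix y assume "y \<in> space (Icc_measure u v)"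
        then have y: "u \<le> y" "y \<le> v" by auto
        have "(\<lambda>p. A u v p y) \<longlonglongrightarrow> g' y * 0 - f' y * 0"
          unfolding A_def by (intro tendsto_diff tendsto_mult_left parseval_consecutive(1) fc gc c1 uv y)
        then show "(\<lambda>p. A u v p y) \<longlonglongrightarrow> 0" by simp
      qed
      show "AE y in Icc_measure u v. norm (A u v p y) \<le> Dg * Cf + Df * Cg" for p
        using Ab[OF uv] by (intro AE_I2) auto
    qed (use Am[OF uv] in auto)
    then show ?thesis by simp
  qed
  have S: "2 * trace_sum f g p u v = (\<Sum>j\<le>p. coef (\<lambda>x. indicator {u..v} x * f x) j * coef (\<lambda>x. indicator {u..v} x * g x) j)
      + (\<integral>y. A u v p y \<partial>(Icc_measure u v))" if uv: "a \<le> u" "u \<le> v" "v \<le> b" for p u v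
    unfolding split[OF uv] A_def coef_indicator[OF fc uv(1,3)] coef_indicator[OF gc uv(1,3)] ..
  show "(\<lambda>p. trace_sum f g p u v) \<longlonglongrightarrow> (1/2) * integral {u..v} (\<lambda>x. f x * g x)" if uv: "a \<le> u" "u \<le> v" "v \<le> b" for u v
  proof -
    have sf: "spanned (\<lambda>x. indicator {u..v} x * f x)" by (rule spanned_interval[OF fc, of u v]) (use uv in auto)
    have ipe: "l2_inner I (\<lambda>x. indicator {u..v} x * f x) (\<lambda>x. indicator {u..v} x * g x) = integral {u..v} (\<lambda>x. f x * g x)"
      unfolding l2_inner_def integral_indicator_I[OF continuous_on_mult[OF fc gc] uv(1,3), symmetric]
      by (intro Bochner_Integration.integral_cong) (auto split: split_indicator)
    have "(\<lambda>p. (1/2) * (2 * trace_sum f g p u v)) \<longlonglongrightarrow> (1/2) * (integral {u..v} (\<lambda>x. f x * g x) + 0)"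
      unfolding S[OF uv] ipe[symmetric]
      by (intro tendsto_mult_left tendsto_add parseval sf indicator_mult_sq gc Alim uv)
    then show ?thesis by simp
  qed
  let ?B = "((l2_sq I f + l2_sq I g) / 2 + (Dg * Cf + Df * Cg) * (b - a)) / 2"
  have "\<bar>trace_sum f g p u v\<bar> \<le> ?B" if uv: "a \<le> u" "u \<le> v" "v \<le> b" for p u v
  proof -
    interpret U: finite_measure "Icc_measure u v" by (rule finite_measure_Icc_measure)
    have "l2_sq I (\<lambda>x. indicator {u..v} x * f x) \<le> l2_sq I f" "l2_sq I (\<lambda>x. indicator {u..v} x * g x) \<le> l2_sq I g"
      by (intro l2_sq_indicator_le continuous_bounded_meas fc gc I.finite_measure_axioms borel_set_Icc_measure; simp)+
    then have 1: "\<bar>\<Sum>j\<le>p. coef (\<lambda>x. indicator {u..v} x * f x) j * coef (\<lambda>x. indicator {u..v} x * g x) j\<bar>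
        \<le> (l2_sq I f + l2_sq I g) / 2"
      by (intro order_trans[OF coef_prod_bound[OF indicator_mult_sq[OF fc] indicator_mult_sq[OF gc]]] divide_right_mono add_mono) auto
    have D0: "Dg * Cf + Df * Cg \<ge> 0" using Df Dg C0 by auto
    have "\<bar>\<integral>y. A u v p y \<partial>(Icc_measure u v)\<bar> \<le> (\<integral>y. \<bar>A u v p y\<bar> \<partial>(Icc_measure u v))"
      by (rule integral_abs_bound)
    also have "\<dots> \<le> (\<integral>y. Dg * Cf + Df * Cg \<partial>(Icc_measure u v))"
    proof (rule integral_mono)
      show "integrable (Icc_measure u v) (\<lambda>y. \<bar>A u v p y\<bar>)"
        using Ab[OF uv(1,3)] Am[OF uv(1,3)]
        by (intro integrable_abs U.bounded_meas_integrable bounded_measI[where B="Dg * Cf + Df * Cg"]) auto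
    qed (use Ab[OF uv(1,3)] in auto)
    also have "\<dots> = (v - u) * (Dg * Cf + Df * Cg)"
      using integral_Icc_measure[of u v "\<lambda>_. Dg * Cf + Df * Cg"] uv by simp
    also have "\<dots> \<le> (b - a) * (Dg * Cf + Df * Cg)" using uv D0 by (intro mult_right_mono) auto
    finally have 2: "\<bar>\<integral>y. A u v p y \<partial>(Icc_measure u v)\<bar> \<le> (Dg * Cf + Df * Cg) * (b - a)" by (simp add: mult.commute)
    have "\<bar>2 * trace_sum f g p u v\<bar> \<le> (l2_sq I f + l2_sq I g) / 2 + (Dg * Cf + Df * Cg) * (b - a)"
      unfolding S[OF uv] using 1 2 by linarith
    then show ?thesis by simp
  qed
  then show "\<exists>B. \<forall>p u v. a \<le> u \<longrightarrow> u \<le> v \<longrightarrow> v \<le> b \<longrightarrow> \<bar>trace_sum f g p u v\<bar> \<le> B" by blast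
qed

end

section \<open>Limits along partitions\<close>

lemma partition_mono:
  assumes "partition a s p N" "i \<le> j" "j \<le> N"
  shows "p i \<le> p j"
  using assms(2,3)
proof (induction j rule: dec_induct)
  case (step j)
  have "p j < p (Suc j)" using assms(1) step by (simp add: partition_def)
  with step show ?case by simp
qed simp

lemma partition_ends:
  assumes "partition a s p N"
  shows "p 0 = a" "p N = s"
  using assms by (auto simp: partition_def)

lemma partition_range:
  assumes "partition a s p N" "k \<le> N"
  shows "a \<le> p k" "p k \<le> s"
  using partition_mono[OF assms(1), of 0 k] partition_mono[OF assms(1), of k N] partition_ends[OF assms(1)] assms(2) by auto

text \<open>Cells are open on the left and closed on the right, like the differences of the
  indicators of \<open>{..p (Suc k)}\<close> and \<open>{..p k}\<close> that represent increments.
  The left endpoint of the partition therefore lies in no cell.\<close>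

definition cell :: "(nat \<Rightarrow> real) \<Rightarrow> real \<Rightarrow> nat" where
  "cell p z = (LEAST k. z \<le> p (Suc k))"

lemma cell_props:
  assumes p: "partition a s p N" and z: "a < z" "z \<le> s"
  shows "cell p z < N" "p (cell p z) < z" "z \<le> p (Suc (cell p z))"
proof -
  have "N \<noteq> 0" using p z by (cases N) (auto simp: partition_def)
  then have ex: "z \<le> p (Suc (N - 1))" using p z by (auto simp: partition_def)
  show 1: "z \<le> p (Suc (cell p z))" unfolding cell_def by (rule LeastI[of _ "N - 1"]) (rule ex)
  have "cell p z \<le> N - 1" unfolding cell_def by (rule Least_le) (rule ex)
  then show "cell p z < N" using \<open>N \<noteq> 0\<close> by simp
  show "p (cell p z) < z"
  proof (cases "cell p z")
    case 0
    then show ?thesis using p z by (auto simp: partition_def)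
  next
    case (Suc k)
    then have "\<not> z \<le> p (Suc k)" using not_less_Least[of k "\<lambda>k. z \<le> p (Suc k)"] by (simp add: cell_def)
    then show ?thesis using Suc by simp
  qed
qed

lemma cell_unique:
  assumes p: "partition a s p N" and k: "k < N" "p k < z" "z \<le> p (Suc k)"
  shows "cell p z = k"
proof -
  have z: "a < z" "z \<le> s" using partition_range[OF p, of k] partition_range[OF p, of "Suc k"] k by auto
  note c = cell_props[OF p z]
  show ?thesis
  proof (rule ccontr)
    assume "cell p z \<noteq> k"
    then consider "Suc (cell p z) \<le> k" | "Suc k \<le> cell p z" by linarith
    then show False
      using partition_mono[OF p, of "Suc (cell p z)" k] partition_mono[OF p, of "Suc k" "cell p z"] c k by cases auto
  qed
qed

lemma partition_sum:
  assumes p: "partition a s p N"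
  shows "(\<Sum>k<N. q k * (indicator {..p (Suc k)} z - indicator {..p k} z)) =
    (if a < z \<and> z \<le> s then q (cell p z) else (0 :: real))"
proof (cases "a < z \<and> z \<le> s")
  case True
  note c = cell_props[OF p True[THEN conjunct1] True[THEN conjunct2]]
  have "(indicator {..p (Suc k)} z - indicator {..p k} z) = (if k = cell p z then 1 else 0 :: real)" if "k < N" for k
  proof (cases "k = cell p z")
    case eq: True
    have "p k < z" "z \<le> p (Suc k)" unfolding eq using c by auto
    then show ?thesis using eq by (simp add: indicator_def)
  next
    case False
    then have "\<not> (p k < z \<and> z \<le> p (Suc k))" using cell_unique[OF p that, of z] by blast
    moreover have "p k \<le> p (Suc k)" using that by (intro partition_mono[OF p]) auto
    ultimately show ?thesis using False by (auto simp: indicator_def)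
  qed
  then have "(\<Sum>k<N. q k * (indicator {..p (Suc k)} z - indicator {..p k} z)) = (\<Sum>k<N. if k = cell p z then q k else 0)"
    by (intro sum.cong) auto
  then show ?thesis using c True by simp
next
  case False
  have "(indicator {..p (Suc k)} z - indicator {..p k} z) = (0 :: real)" if "k < N" for k
    using False partition_range[OF p, of k] partition_range[OF p, of "Suc k"] that by (auto split: split_indicator)
  then have "(\<Sum>k<N. q k * (indicator {..p (Suc k)} z - indicator {..p k} z)) = 0" by simp
  then show ?thesis using False by auto
qed

lemma mesh_ge: "k < N \<Longrightarrow> p (Suc k) - p k \<le> mesh p N"
  by (auto simp: mesh_def intro!: Max_ge)

lemma cell_tendsto:
  assumes p: "\<And>n. partition a s (P n) (N n)" and mesh: "(\<lambda>n. mesh (P n) (N n)) \<longlonglongrightarrow> 0" and z: "a < z" "z \<le> s"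
  shows "(\<lambda>n. P n (cell (P n) z)) \<longlonglongrightarrow> z" "(\<lambda>n. P n (Suc (cell (P n) z))) \<longlonglongrightarrow> z"
proof -
  note c = cell_props[OF p z]
  have m: "P n (Suc (cell (P n) z)) - P n (cell (P n) z) \<le> mesh (P n) (N n)" for n
    by (rule mesh_ge[OF c(1)])
  show "(\<lambda>n. P n (cell (P n) z)) \<longlonglongrightarrow> z"
  proof (rule tendsto_sandwich[of "\<lambda>n. z - mesh (P n) (N n)" _ _ "\<lambda>n. z"])
    show "(\<lambda>n. z - mesh (P n) (N n)) \<longlonglongrightarrow> z" using tendsto_diff[OF tendsto_const mesh, of z] by simp
    show "\<forall>\<^sub>F n in sequentially. z - mesh (P n) (N n) \<le> P n (cell (P n) z)"
    proof (intro always_eventually allI)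
      fix n show "z - mesh (P n) (N n) \<le> P n (cell (P n) z)" using m[of n] c(3)[of n] by linarith
    qed
    show "\<forall>\<^sub>F n in sequentially. P n (cell (P n) z) \<le> z"
      using c(2) by (intro always_eventually allI less_imp_le)
  qed simp
  show "(\<lambda>n. P n (Suc (cell (P n) z))) \<longlonglongrightarrow> z"
  proof (rule tendsto_sandwich[of "\<lambda>n. z" _ _ "\<lambda>n. z + mesh (P n) (N n)"])
    show "(\<lambda>n. z + mesh (P n) (N n)) \<longlonglongrightarrow> z" using tendsto_add[OF tendsto_const mesh, of z] by simp
    show "\<forall>\<^sub>F n in sequentially. P n (Suc (cell (P n) z)) \<le> z + mesh (P n) (N n)"
    proof (intro always_eventually allI)
      fix n show "P n (Suc (cell (P n) z)) \<le> z + mesh (P n) (N n)" using m[of n] c(2)[of n] by linarith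
    qed
    show "\<forall>\<^sub>F n in sequentially. z \<le> P n (Suc (cell (P n) z))"
      using c(3) by (intro always_eventually allI)
  qed simp
qed

text \<open>Without such a sequence the defining property of the integrals would hold vacuously and
  the choice would not be pinned down.\<close>

lemma partition_sequence_exists:
  assumes "a \<le> s"
  shows "\<exists>P N. (\<forall>n. partition a s (P n) (N n)) \<and> (\<lambda>n. mesh (P n) (N n)) \<longlonglongrightarrow> 0"
proof (cases "a = s")
  case True
  \<comment> \<open>The empty partition with \<open>N = 0\<close>: inner integrals are taken up to
    every time, including \<open>t\<close> itself.\<close>
  then show ?thesis
    by (intro exI[of _ "\<lambda>n k. a"] exI[of _ "\<lambda>n. 0"]) (auto simp: partition_def mesh_def)
next
  case False
  with assms have as: "a < s" by simp
  define P where "P n k = a + (s - a) * real k / real (Suc n)" for n k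
  have d: "P n (Suc k) - P n k = (s - a) / real (Suc n)" for n k
    by (simp add: P_def add_divide_distrib[symmetric] diff_divide_distrib[symmetric] algebra_simps)
  have pos: "0 < (s - a) / real (Suc n)" for n using as by simp
  have "P n k < P n (Suc k)" for n k using d[of n k] pos[of n] by linarith
  then have "partition a s (P n) (Suc n)" for n by (auto simp: partition_def P_def)
  moreover have "mesh (P n) (Suc n) = (s - a) / real (Suc n)" for n
    unfolding mesh_def d by (simp add: lessThan_empty_iff image_constant_conv del: of_nat_Suc)
  moreover have "(\<lambda>n. (s - a) / real (Suc n)) \<longlonglongrightarrow> 0"
    using LIMSEQ_Suc[OF lim_const_over_n[of "s - a"]] by simp
  ultimately show ?thesis
    by (intro exI[of _ P] exI[of _ Suc]) simp
qed

text \<open>The stochastic integrals are \<open>SOME\<close>-choices among mean-square limits of sums over arbitrary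
  partitions; such a choice agrees almost surely with any limit found by other means.\<close>

lemma partition_limit_choice:
  assumes lim: "\<And>P N. (\<And>n. partition a s (P n) (N n)) \<Longrightarrow> (\<lambda>n. mesh (P n) (N n)) \<longlonglongrightarrow> 0 \<Longrightarrow>
      l2_lim M (\<lambda>n. \<sigma> (P n) (N n)) Y"
    and as: "a \<le> s"
    and Y': "Y' = (SOME Y. \<forall>P N. (\<forall>n. partition a s (P n) (N n)) \<and> (\<lambda>n. mesh (P n) (N n)) \<longlonglongrightarrow> 0 \<longrightarrow>
      ms_lim M (\<lambda>n. \<sigma> (P n) (N n)) Y)"
  shows "AE \<omega> in M. Y \<omega> = Y' \<omega>" "Y' \<in> borel_measurable M"
proof -
  define Q where "Q Z \<longleftrightarrow> (\<forall>P N. (\<forall>n. partition a s (P n) (N n)) \<and> (\<lambda>n. mesh (P n) (N n)) \<longlonglongrightarrow> 0 \<longrightarrow>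
      ms_lim M (\<lambda>n. \<sigma> (P n) (N n)) Z)" for Z
  have "Q Y" unfolding Q_def using lim l2_lim_imp_ms_lim by blast
  then have "Q (SOME Z. Q Z)" by (rule someI[of Q Y])
  moreover have "Y' = (SOME Z. Q Z)" unfolding Q_def by (rule Y')
  ultimately have Y'lim: "Q Y'" by simp
  obtain P N where P: "\<And>n. partition a s (P n) (N n)" "(\<lambda>n. mesh (P n) (N n)) \<longlonglongrightarrow> 0"
    using partition_sequence_exists[OF as] by blast
  have 1: "l2_lim M (\<lambda>n. \<sigma> (P n) (N n)) Y" by (rule lim[OF P])
  have 2: "ms_lim M (\<lambda>n. \<sigma> (P n) (N n)) Y'" using Y'lim P unfolding Q_def by blast
  then show "Y' \<in> borel_measurable M" by (simp add: ms_lim_def)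
  show "AE \<omega> in M. Y \<omega> = Y' \<omega>"
    by (rule l2_lim_unique[OF 1 ms_lim_imp_l2_lim[OF 2 l2_limD(1)[OF 1]]])
qed

lemma l2_lim_of_diff:
  assumes Y: "l2_lim M S Y" and sq: "\<And>n. sq_integrable M (R n)"
    and d: "(\<lambda>n. l2_sq M (\<lambda>\<omega>. R n \<omega> - S n \<omega>)) \<longlonglongrightarrow> 0"
  shows "l2_lim M R Y"
proof (rule l2_limI_le[OF sq l2_limD(2)[OF Y]])
  show "l2_sq M (\<lambda>x. R n x - Y x) \<le> 2 * l2_sq M (\<lambda>\<omega>. R n \<omega> - S n \<omega>) + 2 * l2_sq M (\<lambda>\<omega>. S n \<omega> - Y \<omega>)" for n
    by (rule l2_sq_triangle[OF sq l2_limD(1)[OF Y] l2_limD(2)[OF Y]])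
  show "(\<lambda>n. 2 * l2_sq M (\<lambda>\<omega>. R n \<omega> - S n \<omega>) + 2 * l2_sq M (\<lambda>\<omega>. S n \<omega> - Y \<omega>)) \<longlonglongrightarrow> 0"
    using tendsto_add[OF tendsto_mult_left[OF d, of 2] tendsto_mult_left[OF l2_limD(3)[OF Y], of 2]] by simp
qed

section \<open>Expansions of kernels\<close>

text \<open>Truncating outer and inner sums at the same \<open>p\<close> gives the iterated limit,
  as all terms are nonnegative. Domination by \<open>B\<close> bounds from above; freezing finitely
  many outer terms bounds from below.\<close>

lemma nested_sum_tendsto:
  fixes A :: "nat \<Rightarrow> nat \<Rightarrow> real"
  assumes A: "\<And>j. (\<lambda>p. A j p) \<longlonglongrightarrow> B j" and le: "\<And>j p. A j p \<le> B j" and nn: "\<And>j p. 0 \<le> A j p"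
    and B: "(\<lambda>p. \<Sum>j\<le>p. B j) \<longlonglongrightarrow> S"
  shows "(\<lambda>p. \<Sum>j\<le>p. A j p) \<longlonglongrightarrow> S"
proof (rule order_tendstoI)
  have "B j \<ge> 0" for j using le[of j 0] nn[of j 0] by linarith
  then have "incseq (\<lambda>p. \<Sum>j\<le>p. B j)" by (intro incseq_SucI) simp
  from incseq_le[OF this B] have SB: "(\<Sum>j\<le>p. B j) \<le> S" for p .
  {
    fix x assume "S < x"
    have "(\<Sum>j\<le>p. A j p) < x" for p
      using sum_mono[of "{..p}" "\<lambda>j. A j p" B] le SB[of p] \<open>S < x\<close> by fastforce
    then show "\<forall>\<^sub>F p in sequentially. (\<Sum>j\<le>p. A j p) < x" by simp
  }
  fix x assume x: "x < S"
  from order_tendstoD(1)[OF B x] obtain J where J: "x < (\<Sum>j\<le>J. B j)" by (auto dest: eventually_happens)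
  have "(\<lambda>p. \<Sum>j\<le>J. A j p) \<longlonglongrightarrow> (\<Sum>j\<le>J. B j)" by (intro tendsto_sum A)
  from order_tendstoD(1)[OF this J] eventually_ge_at_top[of J]
  show "\<forall>\<^sub>F p in sequentially. x < (\<Sum>j\<le>p. A j p)"
  proof eventually_elim
    case (elim p)
    have "(\<Sum>j\<le>J. A j p) \<le> (\<Sum>j\<le>p. A j p)" using elim(2) nn by (intro sum_mono2) auto
    with elim(1) show ?case by linarith
  qed
qed

text \<open>Pythagoras: the error is the defect in Bessel's inequality, so Parseval's identity for
  the coefficients suffices for convergence.\<close>

lemma orthonormal_expansion_error:
  assumes K: "sq_integrable N K" and e: "\<And>i. i \<in> J \<Longrightarrow> sq_integrable N (e i)" and J: "finite J"
    and orth: "\<And>i k. i \<in> J \<Longrightarrow> k \<in> J \<Longrightarrow> l2_inner N (e i) (e k) = (if i = k then 1 else 0)"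
    and c: "\<And>i. i \<in> J \<Longrightarrow> c i = l2_inner N K (e i)"
  shows "l2_sq N (\<lambda>x. (\<Sum>i\<in>J. c i * e i x) - K x) = l2_sq N K - (\<Sum>i\<in>J. (c i)\<^sup>2)"
proof -
  let ?S = "\<lambda>x. \<Sum>i\<in>J. c i * e i x"
  have S: "sq_integrable N ?S" by (intro sq_integrable_sum sq_integrable_cmult e)
  have KS: "l2_inner N K ?S = (\<Sum>i\<in>J. (c i)\<^sup>2)"
    using e K by (subst l2_inner_sum_right) (auto simp: l2_inner_cmult_right c power2_eq_square)
  have "l2_inner N ?S ?S = (\<Sum>i\<in>J. c i * (\<Sum>k\<in>J. c k * l2_inner N (e i) (e k)))"
  proof -
    have "l2_inner N ?S ?S = (\<Sum>i\<in>J. l2_inner N (\<lambda>x. c i * e i x) ?S)"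
      by (intro l2_inner_sum_left sq_integrable_cmult e S)
    also have "\<dots> = (\<Sum>i\<in>J. c i * (\<Sum>k\<in>J. l2_inner N (e i) (\<lambda>x. c k * e k x)))"
      unfolding l2_inner_cmult_left
      by (intro sum.cong refl arg_cong2[where f="(*)"] l2_inner_sum_right sq_integrable_cmult e)
    finally show ?thesis by (simp only: l2_inner_cmult_right)
  qed
  also have "\<dots> = (\<Sum>i\<in>J. (c i)\<^sup>2)"
    using J by (intro sum.cong refl) (auto simp: orth if_distrib[of "\<lambda>x. _ * x"] power2_eq_square cong: if_cong sum.cong_simp)
  finally have "l2_sq N ?S = (\<Sum>i\<in>J. (c i)\<^sup>2)" by (simp add: l2_sq_inner)
  then show ?thesis
    unfolding l2_sq_diff_expand[OF S K] using KS by (simp add: l2_inner_commute)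
qed

context ortho_system
begin

abbreviation I2 :: "(real \<times> real) measure" where "I2 \<equiv> I \<Otimes>\<^sub>M I"
abbreviation I3 :: "(real \<times> real \<times> real) measure" where "I3 \<equiv> I \<Otimes>\<^sub>M I2"

lemma finite_I2: "finite_measure I2"
  by (intro finite_measure_pair_measure I.finite_measure_axioms)

lemma coef_fst_bounded_meas:
  assumes B: "finite_measure B" and K: "bounded_meas (I \<Otimes>\<^sub>M B) K"
  shows "bounded_meas B (\<lambda>q. coef (\<lambda>x. K (x, q)) j)"
proof -
  have pj: "bounded_meas (B \<Otimes>\<^sub>M I) (\<lambda>p. \<phi> j (snd p))"
    using bounded_meas_tensor[OF bounded_meas_const[of B 1] phi_bounded_meas[of j]] by (simp add: case_prod_beta')
  have "bounded_meas B (\<lambda>q. \<integral>x. K (snd (q, x), fst (q, x)) * \<phi> j (snd (q, x)) \<partial>I)"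
    by (rule bounded_meas_integral[OF I.finite_measure_axioms bounded_meas_mult[OF bounded_meas_swap[OF K] pj]])
  then show ?thesis by (simp add: coef_def l2_inner_def)
qed

text \<open>Parseval in the first variable with the others fixed, integrated over the others;
  Bessel's inequality supplies the majorant.\<close>

lemma parseval_fst:
  assumes B: "finite_measure B" and K: "bounded_meas (I \<Otimes>\<^sub>M B) K"
    and span: "\<And>q. q \<in> space B \<Longrightarrow> spanned (\<lambda>x. K (x, q))"
  shows "(\<lambda>p. \<Sum>j\<le>p. l2_sq B (\<lambda>q. coef (\<lambda>x. K (x, q)) j)) \<longlonglongrightarrow> l2_sq (I \<Otimes>\<^sub>M B) K"
proof -
  interpret B: finite_measure B by fact
  note cb = coef_fst_bounded_meas[OF B K]
  have Ks: "bounded_meas B (\<lambda>q. l2_sq I (\<lambda>x. K (x, q)))"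
    using bounded_meas_integral[OF I.finite_measure_axioms bounded_meas_power2[OF bounded_meas_swap[OF K]]]
    by (simp add: l2_sq_def)
  have "(\<lambda>p. \<integral>q. (\<Sum>j\<le>p. (coef (\<lambda>x. K (x, q)) j)\<^sup>2) \<partial>B) \<longlonglongrightarrow> (\<integral>q. l2_sq I (\<lambda>x. K (x, q)) \<partial>B)"
  proof (rule integral_dominated_convergence[where w="\<lambda>q. l2_sq I (\<lambda>x. K (x, q))"])
    show "(\<lambda>q. \<Sum>j\<le>p. (coef (\<lambda>x. K (x, q)) j)\<^sup>2) \<in> borel_measurable B" for p
      by (intro bounded_meas_measurable bounded_meas_sum bounded_meas_power2 cb)
    show "AE q in B. norm (\<Sum>j\<le>p. (coef (\<lambda>x. K (x, q)) j)\<^sup>2) \<le> l2_sq I (\<lambda>x. K (x, q))" for p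
    proof (rule AE_I2)
      fix q assume "q \<in> space B"
      from bessel[OF spanned_sq[OF span[OF this]], of p]
      show "norm (\<Sum>j\<le>p. (coef (\<lambda>x. K (x, q)) j)\<^sup>2) \<le> l2_sq I (\<lambda>x. K (x, q))" by (simp add: sum_nonneg)
    qed
    show "AE q in B. (\<lambda>p. \<Sum>j\<le>p. (coef (\<lambda>x. K (x, q)) j)\<^sup>2) \<longlonglongrightarrow> l2_sq I (\<lambda>x. K (x, q))"
      by (rule AE_I2) (rule parseval_sq[OF span])
  qed (use Ks in \<open>auto intro: bounded_meas_measurable B.bounded_meas_integrable\<close>)
  moreover have "(\<integral>q. (\<Sum>j\<le>p. (coef (\<lambda>x. K (x, q)) j)\<^sup>2) \<partial>B) = (\<Sum>j\<le>p. l2_sq B (\<lambda>q. coef (\<lambda>x. K (x, q)) j))" for p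
    unfolding l2_sq_def
    by (intro Bochner_Integration.integral_sum B.bounded_meas_integrable bounded_meas_power2 cb)
  moreover have "(\<integral>q. l2_sq I (\<lambda>x. K (x, q)) \<partial>B) = l2_sq (I \<Otimes>\<^sub>M B) K"
    unfolding l2_sq_def
    by (rule bounded_meas_fubini(2)[OF I.finite_measure_axioms B bounded_meas_power2[OF K], symmetric])
  ultimately show ?thesis by simp
qed

lemma bessel_fst:
  assumes B: "finite_measure B" and K: "bounded_meas (I \<Otimes>\<^sub>M B) K"
    and span: "\<And>q. q \<in> space B \<Longrightarrow> spanned (\<lambda>x. K (x, q))"
  shows "(\<Sum>j\<le>p. l2_sq B (\<lambda>q. coef (\<lambda>x. K (x, q)) j)) \<le> l2_sq (I \<Otimes>\<^sub>M B) K"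
  by (rule incseq_le[OF incseq_SucI parseval_fst[OF assms]]) simp

section \<open>Fourier coefficients of kernels, one variable at a time\<close>

definition coef2 :: "(real \<times> real \<Rightarrow> real) \<Rightarrow> nat \<Rightarrow> nat \<Rightarrow> real" where
  "coef2 K j1 j2 = coef (\<lambda>y. coef (\<lambda>x. K (x, y)) j1) j2"

definition coef3 :: "(real \<times> real \<times> real \<Rightarrow> real) \<Rightarrow> nat \<Rightarrow> nat \<Rightarrow> nat \<Rightarrow> real" where
  "coef3 K j1 j2 j3 = coef2 (\<lambda>q. coef (\<lambda>x. K (x, q)) j1) j2 j3"

text \<open>What Parseval's identity needs when applied to one variable after the other: the
  sections in \<open>x\<close>, and then the coefficients as functions of \<open>y\<close>. No
  density statement on the square is involved.\<close>

definition spanned2 :: "(real \<times> real \<Rightarrow> real) \<Rightarrow> bool" where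
  "spanned2 K \<longleftrightarrow> bounded_meas I2 K \<and> (\<forall>y\<in>{a..b}. spanned (\<lambda>x. K (x, y))) \<and>
     (\<forall>j. spanned (\<lambda>y. coef (\<lambda>x. K (x, y)) j))"

definition spanned3 :: "(real \<times> real \<times> real \<Rightarrow> real) \<Rightarrow> bool" where
  "spanned3 K \<longleftrightarrow> bounded_meas I3 K \<and> (\<forall>q\<in>{a..b} \<times> {a..b}. spanned (\<lambda>x. K (x, q))) \<and>
     (\<forall>j. spanned2 (\<lambda>q. coef (\<lambda>x. K (x, q)) j))"

lemma parseval2:
  assumes "spanned2 K"
  shows "(\<lambda>p. \<Sum>j1\<le>p. \<Sum>j2\<le>p. (coef2 K j1 j2)\<^sup>2) \<longlonglongrightarrow> l2_sq I2 K"
    and "(\<Sum>j1\<le>p. \<Sum>j2\<le>p. (coef2 K j1 j2)\<^sup>2) \<le> l2_sq I2 K"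
proof -
  have K: "bounded_meas I2 K" and s: "\<And>y. y \<in> space I \<Longrightarrow> spanned (\<lambda>x. K (x, y))"
    and d: "\<And>j. spanned (\<lambda>y. coef (\<lambda>x. K (x, y)) j)"
    using assms by (auto simp: spanned2_def)
  show "(\<lambda>p. \<Sum>j1\<le>p. \<Sum>j2\<le>p. (coef2 K j1 j2)\<^sup>2) \<longlonglongrightarrow> l2_sq I2 K"
    unfolding coef2_def
    by (rule nested_sum_tendsto[OF parseval_sq[OF d] bessel[OF spanned_sq[OF d]] _
          parseval_fst[OF I.finite_measure_axioms K s]]) (intro sum_nonneg zero_le_power2)
  have "(\<Sum>j1\<le>p. \<Sum>j2\<le>p. (coef2 K j1 j2)\<^sup>2) \<le> (\<Sum>j1\<le>p. l2_sq I (\<lambda>y. coef (\<lambda>x. K (x, y)) j1))"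
    unfolding coef2_def by (intro sum_mono bessel spanned_sq d)
  also have "\<dots> \<le> l2_sq I2 K" by (rule bessel_fst[OF I.finite_measure_axioms K s])
  finally show "(\<Sum>j1\<le>p. \<Sum>j2\<le>p. (coef2 K j1 j2)\<^sup>2) \<le> l2_sq I2 K" .
qed

text \<open>The first variable is split off by \<open>parseval_fst\<close>; for each coefficient the
  remaining two are handled by \<open>parseval2\<close>.\<close>

lemma parseval3:
  assumes "spanned3 K"
  shows "(\<lambda>p. \<Sum>j1\<le>p. \<Sum>j2\<le>p. \<Sum>j3\<le>p. (coef3 K j1 j2 j3)\<^sup>2) \<longlonglongrightarrow> l2_sq I3 K"
proof -
  have K: "bounded_meas I3 K" and s: "\<And>q. q \<in> space I2 \<Longrightarrow> spanned (\<lambda>x. K (x, q))"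
    and d: "\<And>j. spanned2 (\<lambda>q. coef (\<lambda>x. K (x, q)) j)"
    using assms by (auto simp: spanned3_def space_pair_measure)
  show ?thesis
    unfolding coef3_def
    by (rule nested_sum_tendsto[OF parseval2(1)[OF d] parseval2(2)[OF d] _ parseval_fst[OF finite_I2 K s]])
       (intro sum_nonneg zero_le_power2)
qed

lemma phi_tensor2_inner:
  "l2_inner I2 (\<lambda>(x, y). \<phi> i x * \<phi> j y) (\<lambda>(x, y). \<phi> k x * \<phi> l y) = (if i = k \<and> j = l then 1 else 0)"
  by (subst tensor_inner[OF I.finite_measure_axioms I.finite_measure_axioms]) (auto simp: phi_bounded_meas phi_inner)

lemma phi_tensor2_bounded_meas: "bounded_meas I2 (\<lambda>(x, y). \<phi> i x * \<phi> j y)"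
  by (intro bounded_meas_tensor phi_bounded_meas)

lemma phi_tensor3_inner:
  "l2_inner I3 (\<lambda>(x, q). \<phi> i x * (case q of (y, z) \<Rightarrow> \<phi> j y * \<phi> k z)) (\<lambda>(x, q). \<phi> i' x * (case q of (y, z) \<Rightarrow> \<phi> j' y * \<phi> k' z)) =
     (if i = i' \<and> j = j' \<and> k = k' then 1 else 0)"
  by (subst tensor_inner[OF I.finite_measure_axioms finite_I2])
     (auto simp: phi_bounded_meas phi_tensor2_bounded_meas phi_inner phi_tensor2_inner)

lemma tensor_fst_inner:
  assumes B: "finite_measure B" and K: "bounded_meas (I \<Otimes>\<^sub>M B) K" and h: "bounded_meas B h"
  shows "l2_inner (I \<Otimes>\<^sub>M B) K (\<lambda>(x, q). \<phi> j x * h q) = l2_inner B (\<lambda>q. coef (\<lambda>x. K (x, q)) j) h"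
proof -
  have b: "bounded_meas (I \<Otimes>\<^sub>M B) (\<lambda>p. K p * (case p of (x, q) \<Rightarrow> \<phi> j x * h q))"
    by (intro bounded_meas_mult K bounded_meas_tensor phi_bounded_meas h)
  have "l2_inner (I \<Otimes>\<^sub>M B) K (\<lambda>(x, q). \<phi> j x * h q) = (\<integral>q. \<integral>x. (K (x, q) * \<phi> j x) * h q \<partial>I \<partial>B)"
    using bounded_meas_fubini(2)[OF I.finite_measure_axioms B b] by (simp add: l2_inner_def mult.assoc)
  then show ?thesis by (simp add: l2_inner_def coef_def)
qed

lemma coef2_inner: "bounded_meas I2 K \<Longrightarrow> coef2 K j1 j2 = l2_inner I2 K (\<lambda>(x, y). \<phi> j1 x * \<phi> j2 y)"
  unfolding coef2_def
  by (subst tensor_fst_inner[OF I.finite_measure_axioms _ phi_bounded_meas]) (auto simp: coef_def)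

lemma coef3_inner:
  assumes K: "bounded_meas I3 K"
  shows "coef3 K j1 j2 j3 = l2_inner I3 K (\<lambda>(x, q). \<phi> j1 x * (case q of (y, z) \<Rightarrow> \<phi> j2 y * \<phi> j3 z))"
  unfolding coef3_def
  by (subst tensor_fst_inner[OF finite_I2 K phi_tensor2_bounded_meas])
     (rule coef2_inner[OF coef_fst_bounded_meas[OF finite_I2 K]])

lemma expansion2:
  assumes K: "spanned2 K"
  shows "l2_lim I2 (\<lambda>p q. \<Sum>j1\<le>p. \<Sum>j2\<le>p. coef2 K j1 j2 * (case q of (x, y) \<Rightarrow> \<phi> j1 x * \<phi> j2 y)) K"
proof -
  interpret I2: finite_measure I2 by (rule finite_I2)
  have Kb: "bounded_meas I2 K" using K by (simp add: spanned2_def)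
  let ?e = "\<lambda>i q. case i of (j1, j2) \<Rightarrow> (case q of (x, y) \<Rightarrow> \<phi> j1 x * \<phi> j2 y)"
  let ?S = "\<lambda>p q. \<Sum>j1\<le>p. \<Sum>j2\<le>p. coef2 K j1 j2 * (case q of (x, y) \<Rightarrow> \<phi> j1 x * \<phi> j2 y)"
  have S: "?S p q = (\<Sum>i\<in>{..p}\<times>{..p}. (case i of (j1, j2) \<Rightarrow> coef2 K j1 j2) * ?e i q)" for p q
    by (subst sum.cartesian_product) (auto intro!: sum.cong)
  have "l2_sq I2 (\<lambda>q. ?S p q - K q) = l2_sq I2 K - (\<Sum>i\<in>{..p}\<times>{..p}. (case i of (j1, j2) \<Rightarrow> coef2 K j1 j2)\<^sup>2)" for p
    unfolding S
  proof (rule orthonormal_expansion_error)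
    show "sq_integrable I2 (?e i)" for i
      by (cases i) (auto intro: I2.bounded_meas_sq phi_tensor2_bounded_meas)
    show "l2_inner I2 (?e i) (?e k) = (if i = k then 1 else 0)" for i k
      by (cases i; cases k) (simp only: prod.case phi_tensor2_inner prod.inject)
    show "(case i of (j1, j2) \<Rightarrow> coef2 K j1 j2) = l2_inner I2 K (?e i)" for i
      by (cases i) (simp only: prod.case coef2_inner[OF Kb])
  qed (auto intro: I2.bounded_meas_sq Kb)
  also have "\<dots> p = l2_sq I2 K - (\<Sum>j1\<le>p. \<Sum>j2\<le>p. (coef2 K j1 j2)\<^sup>2)" for p
    by (subst sum.cartesian_product) (auto intro!: sum.cong)
  finally have eq: "l2_sq I2 (\<lambda>q. ?S p q - K q) = l2_sq I2 K - (\<Sum>j1\<le>p. \<Sum>j2\<le>p. (coef2 K j1 j2)\<^sup>2)" for p .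
  show ?thesis
    unfolding l2_lim_def eq
  proof (intro conjI allI)
    show "sq_integrable I2 (?S p)" for p
      by (intro I2.bounded_meas_sq bounded_meas_sum bounded_meas_cmult phi_tensor2_bounded_meas)
    show "sq_integrable I2 K" by (rule I2.bounded_meas_sq[OF Kb])
    show "(\<lambda>p. l2_sq I2 K - (\<Sum>j1\<le>p. \<Sum>j2\<le>p. (coef2 K j1 j2)\<^sup>2)) \<longlonglongrightarrow> 0"
      using tendsto_diff[OF tendsto_const parseval2(1)[OF K], of "l2_sq I2 K"] by simp
  qed
qed

lemma expansion3:
  assumes K: "spanned3 K"
  shows "l2_lim I3 (\<lambda>p q. \<Sum>j1\<le>p. \<Sum>j2\<le>p. \<Sum>j3\<le>p. coef3 K j1 j2 j3 *
     (case q of (x, r) \<Rightarrow> \<phi> j1 x * (case r of (y, z) \<Rightarrow> \<phi> j2 y * \<phi> j3 z))) K"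
proof -
  interpret I3: finite_measure I3 by (intro finite_measure_pair_measure finite_I2 I.finite_measure_axioms)
  have Kb: "bounded_meas I3 K" using K by (simp add: spanned3_def)
  let ?b = "\<lambda>j1 j2 j3 q. case q of (x, r) \<Rightarrow> \<phi> j1 x * (case r of (y, z) \<Rightarrow> \<phi> j2 y * \<phi> j3 z)"
  let ?e = "\<lambda>i q. case i of (j1, j2, j3) \<Rightarrow> ?b j1 j2 j3 q"
  let ?S = "\<lambda>p q. \<Sum>j1\<le>p. \<Sum>j2\<le>p. \<Sum>j3\<le>p. coef3 K j1 j2 j3 * ?b j1 j2 j3 q"
  let ?J = "\<lambda>p. {..p}\<times>{..p}\<times>{..p :: nat}"
  have cart: "(\<Sum>j1\<le>p. \<Sum>j2\<le>p. \<Sum>j3\<le>p. f j1 j2 j3) = (\<Sum>i\<in>?J p. case i of (j1, j2, j3) \<Rightarrow> f j1 j2 j3)"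
    for f :: "nat \<Rightarrow> nat \<Rightarrow> nat \<Rightarrow> real" and p
    by (simp add: sum.cartesian_product)
  have S: "?S p q = (\<Sum>i\<in>?J p. (case i of (j1, j2, j3) \<Rightarrow> coef3 K j1 j2 j3) * ?e i q)" for p q
    unfolding cart by (auto intro!: sum.cong)
  have bb: "bounded_meas I3 (?b i j k)" for i j k
    by (intro bounded_meas_tensor phi_bounded_meas)
  have "l2_sq I3 (\<lambda>q. ?S p q - K q) = l2_sq I3 K - (\<Sum>i\<in>?J p. (case i of (j1, j2, j3) \<Rightarrow> coef3 K j1 j2 j3)\<^sup>2)" for p
    unfolding S
  proof (rule orthonormal_expansion_error)
    show "sq_integrable I3 (?e i)" for i
      by (cases i) (auto intro: I3.bounded_meas_sq bb)
    show "l2_inner I3 (?e i) (?e k) = (if i = k then 1 else 0)" for i k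
      by (cases i; cases k) (simp only: prod.case phi_tensor3_inner prod.inject)
    show "(case i of (j1, j2, j3) \<Rightarrow> coef3 K j1 j2 j3) = l2_inner I3 K (?e i)" for i
      by (cases i) (simp only: prod.case coef3_inner[OF Kb])
  qed (auto intro: I3.bounded_meas_sq Kb)
  also have "\<dots> p = l2_sq I3 K - (\<Sum>j1\<le>p. \<Sum>j2\<le>p. \<Sum>j3\<le>p. (coef3 K j1 j2 j3)\<^sup>2)" for p
    unfolding cart by (auto intro!: sum.cong)
  finally have eq: "l2_sq I3 (\<lambda>q. ?S p q - K q) = l2_sq I3 K - (\<Sum>j1\<le>p. \<Sum>j2\<le>p. \<Sum>j3\<le>p. (coef3 K j1 j2 j3)\<^sup>2)" for p .
  show ?thesis
    unfolding l2_lim_def eq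
  proof (intro conjI allI)
    show "sq_integrable I3 (?S p)" for p
      by (intro I3.bounded_meas_sq bounded_meas_sum bounded_meas_cmult bb)
    show "sq_integrable I3 K" by (rule I3.bounded_meas_sq[OF Kb])
    show "(\<lambda>p. l2_sq I3 K - (\<Sum>j1\<le>p. \<Sum>j2\<le>p. \<Sum>j3\<le>p. (coef3 K j1 j2 j3)\<^sup>2)) \<longlonglongrightarrow> 0"
      using tendsto_diff[OF tendsto_const parseval3[OF K], of "l2_sq I3 K"] by simp
  qed
qed

text \<open>For a truncated kernel the function to be projected depends on the truncation level as
  well. Projections are contractions, so both limits may be taken together.\<close>

lemma proj_lim:
  assumes lim: "l2_lim I g' g" and g: "spanned g"
  shows "l2_lim I (\<lambda>p. proj p (g' p)) g"
proof (rule l2_limI_le[OF proj_sq spanned_sq[OF g]])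
  note sg = l2_limD(1)[OF lim] and sg' = spanned_sq[OF g]
  show "l2_sq I (\<lambda>x. proj p (g' p) x - g x) \<le> 2 * l2_sq I (\<lambda>x. g' p x - g x) + 2 * l2_sq I (\<lambda>x. proj p g x - g x)" for p
  proof -
    have "l2_sq I (\<lambda>x. proj p (g' p) x - g x) \<le> 2 * l2_sq I (\<lambda>x. proj p (g' p) x - proj p g x) + 2 * l2_sq I (\<lambda>x. proj p g x - g x)"
      by (rule l2_sq_triangle[OF proj_sq proj_sq sg'])
    also have "(\<lambda>x. proj p (g' p) x - proj p g x) = proj p (\<lambda>x. g' p x - g x)"
      by (rule ext) (rule proj_diff[OF sg sg', symmetric])
    also have "l2_sq I (proj p (\<lambda>x. g' p x - g x)) \<le> l2_sq I (\<lambda>x. g' p x - g x)"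
      by (intro proj_contract sq_integrable_diff sg sg')
    finally show ?thesis by simp
  qed
  show "(\<lambda>p. 2 * l2_sq I (\<lambda>x. g' p x - g x) + 2 * l2_sq I (\<lambda>x. proj p g x - g x)) \<longlonglongrightarrow> 0"
    using tendsto_add[OF tendsto_mult_left[OF l2_limD(3)[OF lim], of 2]
        tendsto_mult_left[OF l2_limD(3)[OF spanned_proj_lim[OF g]], of 2]] by simp
qed

end

section \<open>Iterated Stratonovich integrals of second order\<close>

lemma (in ortho_system) spanned_cong:
  assumes "\<And>x. x \<in> {a..b} \<Longrightarrow> f x = g x" "spanned f"
  shows "spanned g"
proof -
  have "bounded_meas I f" using assms(2) by (simp add: spanned_def)
  then have "bounded_meas I g"
    using assms(1) measurable_cong[of I f g borel] by (auto simp: bounded_meas_def)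
  moreover have "l2_sq I (\<lambda>x. g x - h x) = l2_sq I (\<lambda>x. f x - h x)" for h
    unfolding l2_sq_def by (intro Bochner_Integration.integral_cong) (auto simp: assms(1))
  ultimately show ?thesis using assms(2) by (simp add: spanned_def)
qed

lemma (in ortho_system) coef_cong:
  "(\<And>x. x \<in> {a..b} \<Longrightarrow> f x = g x) \<Longrightarrow> coef f j = coef g j"
  unfolding coef_def l2_inner_def by (intro Bochner_Integration.integral_cong) auto

definition tri :: "real \<Rightarrow> real \<Rightarrow> real" where
  "tri x y = (if x \<le> y then 1 else 0)"

lemma tri_bound: "\<bar>tri x y\<bar> \<le> 1" "0 \<le> tri x y" "tri x y \<le> 1"
  by (auto simp: tri_def)

lemma indicator_tri: "indicator {..y} x = tri x y"
  by (simp add: tri_def indicator_def)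

text \<open>Away from \<open>x\<close> the function \<open>tri x\<close> is locally constant; the
  jump at \<open>x\<close> itself has to be excluded.\<close>

lemma tendsto_tri:
  assumes "l \<longlonglongrightarrow> y" "x \<noteq> y"
  shows "(\<lambda>n. tri x (l n)) \<longlonglongrightarrow> tri x y"
proof (cases "x < y")
  case True
  have "eventually (\<lambda>n. tri x (l n) = tri x y) sequentially"
    using order_tendstoD(1)[OF assms(1) True] by eventually_elim (use True in \<open>auto simp: tri_def\<close>)
  then show ?thesis by (rule tendsto_eventually)
next
  case False
  then have "y < x" using assms(2) by simp
  have "eventually (\<lambda>n. tri x (l n) = tri x y) sequentially"
    using order_tendstoD(2)[OF assms(1) \<open>y < x\<close>] by eventually_elim (use \<open>y < x\<close> in \<open>auto simp: tri_def\<close>)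
  then show ?thesis by (rule tendsto_eventually)
qed

lemma tendsto_continuous_cell:
  fixes f :: "real \<Rightarrow> real"
  assumes "continuous_on S f" "l \<longlonglongrightarrow> z" "z \<in> S" "\<And>n. l n \<in> S"
  shows "(\<lambda>n. f (l n)) \<longlonglongrightarrow> f z"
  by (rule continuous_on_tendsto_compose[OF assms(1,2,3)]) (simp add: assms(4))

locale wiener_expansion = wiener_interval M F m W t T + ortho_system t T \<phi>
  for M :: "'a measure" and F m W t T \<phi>
begin

lemma I_eq: "I = L"
  by (simp add: L_def)

lemma AE_L_neq: "AE x in L. x \<noteq> c"
  unfolding L_def by (rule AE_interval_neq)

lemma id_measurable_L: "(\<lambda>x. x) \<in> borel_measurable L"
  unfolding L_def by (rule borel_measurable_Icc_measure) simp

lemma fst_measurable_L: "fst \<in> borel_measurable (L \<Otimes>\<^sub>M N)"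
  by (rule measurable_compose[OF measurable_fst id_measurable_L])

lemma snd_measurable_L: "snd \<in> borel_measurable (N \<Otimes>\<^sub>M L)"
  by (rule measurable_compose[OF measurable_snd id_measurable_L])

lemma continuous_measurable_L: "continuous_on {t..T} h \<Longrightarrow> h \<in> borel_measurable L" for h :: "real \<Rightarrow> real"
  unfolding L_def by (rule continuous_on_measurable_Icc_measure)

lemma continuous_bounded_meas_L: "continuous_on {t..T} h \<Longrightarrow> bounded_meas L h" for h :: "real \<Rightarrow> real"
  unfolding L_def by (rule continuous_bounded_meas)

lemma tri_measurable:
  assumes "f \<in> borel_measurable N" "g \<in> borel_measurable N"
  shows "(\<lambda>p. tri (f p) (g p)) \<in> borel_measurable N"
  using assms unfolding tri_def by measurable

lemma AE_L2_neq: "AE p in L2. fst p \<noteq> snd p"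
proof -
  interpret P: pair_sigma_finite L L ..
  have [measurable]: "fst \<in> borel_measurable L2" "snd \<in> borel_measurable L2"
    by (rule fst_measurable_L snd_measurable_L)+
  have "{p \<in> space L2. fst p \<noteq> snd p} \<in> sets L2" by measurable
  from P.AE_pair_measure[OF this] show ?thesis using AE_L_neq by (auto simp: eq_commute)
qed

lemma strat_int_AE_eq:
  assumes lim: "\<And>P N. (\<And>n. partition c s (P n) (N n)) \<Longrightarrow> (\<lambda>n. mesh (P n) (N n)) \<longlonglongrightarrow> 0 \<Longrightarrow>
      l2_lim M (\<lambda>n. strat_sum V X (P n) (N n)) Y" and cs: "c \<le> s"
  shows "AE \<omega> in M. Y \<omega> = strat_int M V X c s \<omega>" "strat_int M V X c s \<in> borel_measurable M"
proof -
  have "strat_int M V X c s = (SOME Y. \<forall>P N. (\<forall>n. partition c s (P n) (N n)) \<and> (\<lambda>n. mesh (P n) (N n)) \<longlonglongrightarrow> 0 \<longrightarrow>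
      ms_lim M (\<lambda>n. strat_sum V X (P n) (N n)) Y)"
    by (simp add: strat_int_def is_strat_int_def)
  note c = partition_limit_choice[where \<sigma>="strat_sum V X", OF _ cs this]
  show "AE \<omega> in M. Y \<omega> = strat_int M V X c s \<omega>" by (rule c(1)) (rule lim)
  show "strat_int M V X c s \<in> borel_measurable M" by (rule c(2)) (rule lim)
qed

lemma ito_int_AE_eq:
  assumes lim: "\<And>P N. (\<And>n. partition c s (P n) (N n)) \<Longrightarrow> (\<lambda>n. mesh (P n) (N n)) \<longlonglongrightarrow> 0 \<Longrightarrow>
      l2_lim M (\<lambda>n. ito_sum V X (P n) (N n)) Y" and cs: "c \<le> s"
  shows "AE \<omega> in M. Y \<omega> = ito_int M V X c s \<omega>" "ito_int M V X c s \<in> borel_measurable M"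
proof -
  have "ito_int M V X c s = (SOME Y. \<forall>P N. (\<forall>n. partition c s (P n) (N n)) \<and> (\<lambda>n. mesh (P n) (N n)) \<longlonglongrightarrow> 0 \<longrightarrow>
      ms_lim M (\<lambda>n. ito_sum V X (P n) (N n)) Y)"
    by (simp add: ito_int_def is_ito_int_def)
  note c = partition_limit_choice[where \<sigma>="ito_sum V X", OF _ cs this]
  show "AE \<omega> in M. Y \<omega> = ito_int M V X c s \<omega>" by (rule c(1)) (rule lim)
  show "ito_int M V X c s \<in> borel_measurable M" by (rule c(2)) (rule lim)
qed

section \<open>Tagged sums and Wiener integrals of continuous functions\<close>

lemma tagged_sum_wint:
  assumes i: "i \<in> {1..m}" and p: "partition t s p N" and s: "s \<le> T"
  shows "wint i (\<lambda>z. \<Sum>k<N. q k * (indicator {..p (Suc k)} z - indicator {..p k} z))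
     (\<lambda>\<omega>. \<Sum>k<N. q k * (W i (p (Suc k)) \<omega> - W i (p k) \<omega>))"
proof -
  have "wint i (\<lambda>z. q k * (indicator {..p (Suc k)} z - indicator {..p k} z)) (\<lambda>\<omega>. q k * (inc i (p (Suc k)) \<omega> - inc i (p k) \<omega>))"
    if "k < N" for k
    using partition_range[OF p, of k] partition_range[OF p, of "Suc k"] that s i
    by (intro wint_cmult wint_diff wint_inc) auto
  then have "wint i (\<lambda>z. \<Sum>k<N. q k * (indicator {..p (Suc k)} z - indicator {..p k} z))
     (\<lambda>\<omega>. \<Sum>k<N. q k * (inc i (p (Suc k)) \<omega> - inc i (p k) \<omega>))"
    by (intro wint_sum i) auto
  then show ?thesis by (simp add: inc_def)
qed

text \<open>At a point \<open>z\<close> the step function equals the tag of the cell of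
  \<open>z\<close>, and it is 0 beyond \<open>s\<close>. Leaving the tags arbitrary covers left
  endpoints and averages of endpoints alike.\<close>

lemma tagged_sum_lim:
  assumes p: "\<And>n. partition t s (P n) (N n)" and s: "s \<in> {t..T}"
    and h: "continuous_on {t..T} h" and B: "B \<ge> 0" "\<And>n k. k < N n \<Longrightarrow> \<bar>q n k\<bar> \<le> B"
    and lim: "\<And>z. t < z \<Longrightarrow> z \<le> s \<Longrightarrow> (\<lambda>n. q n (cell (P n) z)) \<longlonglongrightarrow> h z"
  shows "l2_lim L (\<lambda>n z. \<Sum>k<N n. q n k * (indicator {..P n (Suc k)} z - indicator {..P n k} z)) (\<lambda>z. indicator {..s} z * h z)"
proof -
  obtain C where C: "C \<ge> 0" "\<And>x. x \<in> space L \<Longrightarrow> \<bar>h x\<bar> \<le> C"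
    using bounded_meas_bound[OF continuous_bounded_meas_L[OF h]] by blast
  note hm = continuous_measurable_L[OF h]
  show ?thesis
  proof (rule L.bounded_meas_l2_lim)
    show "(\<lambda>z. \<Sum>k<N n. q n k * (indicator {..P n (Suc k)} z - indicator {..P n k} z)) \<in> borel_measurable L" for n
      by (intro borel_measurable_sum borel_measurable_times borel_measurable_const borel_measurable_diff
          bounded_meas_measurable indicator_bounded_meas)
    show "(\<lambda>z. indicator {..s} z * h z) \<in> borel_measurable L"
      by (intro borel_measurable_times hm bounded_meas_measurable indicator_bounded_meas)
    show "\<bar>\<Sum>k<N n. q n k * (indicator {..P n (Suc k)} z - indicator {..P n k} z)\<bar> \<le> B" for n z
      unfolding partition_sum[OF p] using B cell_props(1)[OF p, of z] by auto
    show "\<bar>indicator {..s} z * h z\<bar> \<le> C" if "z \<in> space L" for z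
      using C that by (auto split: split_indicator)
    show "AE z in L. (\<lambda>n. \<Sum>k<N n. q n k * (indicator {..P n (Suc k)} z - indicator {..P n k} z)) \<longlonglongrightarrow> indicator {..s} z * h z"
      using AE_L_neq[of t] AE_space
    proof eventually_elim
      case (elim z)
      then have "t < z" by auto
      then show ?case unfolding partition_sum[OF p] using lim[of z] by (cases "z \<le> s") auto
    qed
  qed
qed

lemma tagged_sum_int:
  assumes i: "i \<in> {1..m}" and X: "wint i (\<lambda>z. indicator {..s} z * h z) X"
    and p: "\<And>n. partition t s (P n) (N n)" and s: "s \<in> {t..T}"
    and h: "continuous_on {t..T} h" and B: "B \<ge> 0" "\<And>n k. k < N n \<Longrightarrow> \<bar>q n k\<bar> \<le> B"
    and lim: "\<And>z. t < z \<Longrightarrow> z \<le> s \<Longrightarrow> (\<lambda>n. q n (cell (P n) z)) \<longlonglongrightarrow> h z"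
  shows "l2_lim M (\<lambda>n \<omega>. \<Sum>k<N n. q n k * (W i (P n (Suc k)) \<omega> - W i (P n k) \<omega>)) X"
proof -
  have sT: "s \<le> T" using s by simp
  note w = tagged_sum_wint[OF i p sT]
  note l = tagged_sum_lim[OF p s h B lim]
  show ?thesis
    unfolding l2_lim_def
  proof (intro conjI allI)
    show "sq_integrable M (\<lambda>\<omega>. \<Sum>k<N n. q n k * (W i (P n (Suc k)) \<omega> - W i (P n k) \<omega>))" for n
      by (rule wintD(3)[OF w])
    show "sq_integrable M X" by (rule wintD(3)[OF X])
    show "(\<lambda>n. l2_sq M (\<lambda>\<omega>. (\<Sum>k<N n. q n k * (W i (P n (Suc k)) \<omega> - W i (P n k) \<omega>)) - X \<omega>)) \<longlonglongrightarrow> 0"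
      unfolding wint_l2_sq_diff[OF w X] by (rule l2_limD(3)[OF l])
  qed
qed

lemma wint_continuous_exists:
  assumes i: "i \<in> {1..m}" and s: "s \<in> {t..T}" and h: "continuous_on {t..T} h"
  shows "\<exists>X. wint i (\<lambda>z. indicator {..s} z * h z) X"
proof -
  obtain C where C: "C \<ge> 0" "\<And>x. x \<in> space L \<Longrightarrow> \<bar>h x\<bar> \<le> C"
    using bounded_meas_bound[OF continuous_bounded_meas_L[OF h]] by blast
  have "t \<le> s" using s by simp
  from partition_sequence_exists[OF this] obtain P N where
    p: "\<And>n. partition t s (P n) (N n)" and mesh: "(\<lambda>n. mesh (P n) (N n)) \<longlonglongrightarrow> 0" by blast
  have r: "P n k \<in> {t..T}" if "k \<le> N n" for n k using partition_range[OF p that] s by auto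
  have lim: "l2_lim L (\<lambda>n z. \<Sum>k<N n. h (P n k) * (indicator {..P n (Suc k)} z - indicator {..P n k} z)) (\<lambda>z. indicator {..s} z * h z)"
  proof (rule tagged_sum_lim[OF p s h C(1)])
    show "\<bar>h (P n k)\<bar> \<le> C" if "k < N n" for n k using C(2) r[of k n] that by simp
    fix z assume z: "t < z" "z \<le> s"
    have "cell (P n) z \<le> N n" for n using cell_props(1)[OF p z, of n] by simp
    then show "(\<lambda>n. h (P n (cell (P n) z))) \<longlonglongrightarrow> h z"
      using cell_tendsto(1)[OF p mesh z] z s r by (intro tendsto_continuous_cell[OF h]) auto
  qed
  have bm: "bounded_meas L (\<lambda>z. indicator {..s} z * h z)"
    by (intro bounded_meas_mult indicator_bounded_meas continuous_bounded_meas_L h)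
  have "s \<le> T" using s by simp
  from wint_lim[OF tagged_sum_wint[OF i p this] bm lim] show ?thesis by (elim exE conjE) (rule exI)
qed

text \<open>For a deterministic continuous integrand, left tags and averaged tags have the same
  limit, so the Ito and the Stratonovich integral are both the Wiener integral.\<close>

lemma wint_strat_int:
  assumes i: "i \<in> {1..m}" and s: "s \<in> {t..T}" and h: "continuous_on {t..T} h"
  shows "wint i (\<lambda>z. indicator {..s} z * h z) (strat_int M (W i) (\<lambda>u \<omega>. h u) t s)"
    and "wint i (\<lambda>z. indicator {..s} z * h z) (ito_int M (W i) (\<lambda>u \<omega>. h u) t s)"
proof -
  obtain C where C: "C \<ge> 0" "\<And>x. x \<in> space L \<Longrightarrow> \<bar>h x\<bar> \<le> C"
    using bounded_meas_bound[OF continuous_bounded_meas_L[OF h]] by blast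
  have ts: "t \<le> s" using s by simp
  obtain X where X: "wint i (\<lambda>z. indicator {..s} z * h z) X" using wint_continuous_exists[OF i s h] by blast
  note bm = wintD(2)[OF X]
  {
    fix P :: "nat \<Rightarrow> nat \<Rightarrow> real" and N
    assume p: "\<And>n. partition t s (P n) (N n)" and mesh: "(\<lambda>n. mesh (P n) (N n)) \<longlonglongrightarrow> 0"
    have r: "P n k \<in> {t..T}" if "k \<le> N n" for n k using partition_range[OF p that] s by auto
    have l: "(\<lambda>n. h (P n (cell (P n) z))) \<longlonglongrightarrow> h z" "(\<lambda>n. h (P n (Suc (cell (P n) z)))) \<longlonglongrightarrow> h z"
      if z: "t < z" "z \<le> s" for z
    proof -
      have "cell (P n) z \<le> N n" "Suc (cell (P n) z) \<le> N n" for n using cell_props(1)[OF p z, of n] by auto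
      then show "(\<lambda>n. h (P n (cell (P n) z))) \<longlonglongrightarrow> h z" "(\<lambda>n. h (P n (Suc (cell (P n) z)))) \<longlonglongrightarrow> h z"
        using cell_tendsto[OF p mesh z] z s r by (auto intro!: tendsto_continuous_cell[OF h])
    qed
    have b: "\<bar>h (P n k)\<bar> \<le> C" if "k \<le> N n" for n k using C(2) r[OF that] by simp
    have "l2_lim M (\<lambda>n \<omega>. \<Sum>k<N n. h (P n k) * (W i (P n (Suc k)) \<omega> - W i (P n k) \<omega>)) X"
      using b l by (intro tagged_sum_int[OF i X p s h C(1)]) auto
    then have "l2_lim M (\<lambda>n. ito_sum (W i) (\<lambda>u \<omega>. h u) (P n) (N n)) X" by (simp add: ito_sum_def[abs_def])
    moreover have "l2_lim M (\<lambda>n \<omega>. \<Sum>k<N n. (h (P n k) + h (P n (Suc k))) / 2 * (W i (P n (Suc k)) \<omega> - W i (P n k) \<omega>)) X"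
    proof (intro tagged_sum_int[OF i X p s h C(1)])
      show "\<bar>(h (P n k) + h (P n (Suc k))) / 2\<bar> \<le> C" if "k < N n" for n k
        using b[of k n] b[of "Suc k" n] that by auto
      show "(\<lambda>n. (h (P n (cell (P n) z)) + h (P n (Suc (cell (P n) z)))) / 2) \<longlonglongrightarrow> h z" if z: "t < z" "z \<le> s" for z
        using tendsto_divide[OF tendsto_add[OF l[OF z]] tendsto_const, of 2] by simp
    qed
    then have "l2_lim M (\<lambda>n. strat_sum (W i) (\<lambda>u \<omega>. h u) (P n) (N n)) X" by (simp add: strat_sum_def[abs_def])
    ultimately have "l2_lim M (\<lambda>n. ito_sum (W i) (\<lambda>u \<omega>. h u) (P n) (N n)) X"
      "l2_lim M (\<lambda>n. strat_sum (W i) (\<lambda>u \<omega>. h u) (P n) (N n)) X" .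
  }
  note lim = this
  show "wint i (\<lambda>z. indicator {..s} z * h z) (strat_int M (W i) (\<lambda>u \<omega>. h u) t s)"
    by (rule wint_cong_AE[OF X _ bm strat_int_AE_eq[OF lim(2) ts]]) auto
  show "wint i (\<lambda>z. indicator {..s} z * h z) (ito_int M (W i) (\<lambda>u \<omega>. h u) t s)"
    by (rule wint_cong_AE[OF X _ bm ito_int_AE_eq[OF lim(1) ts]]) auto
qed

lemma wint_zeta:
  assumes i: "i \<in> {1..m}"
  shows "wint i (\<phi> j) (zeta M W \<phi> t T i j)"
proof -
  have T: "T \<in> {t..T}" using ab by simp
  have w: "wint i (\<lambda>z. indicator {..T} z * \<phi> j z) (zeta M W \<phi> t T i j)"
    unfolding zeta_def using wint_strat_int(2)[OF i T phi_cont[of j]] .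
  show ?thesis
    by (rule wint_cong_AE[OF w _ continuous_bounded_meas_L[OF phi_cont]])
       (auto intro!: AE_I2 sq_integrable_measurable[OF wintD(3)[OF w]])
qed

section \<open>Triangular kernels and the second order integral\<close>

definition kern2 :: "(real \<Rightarrow> real) \<Rightarrow> (real \<Rightarrow> real) \<Rightarrow> real \<Rightarrow> real \<times> real \<Rightarrow> real" where
  "kern2 f g s p = tri (fst p) (snd p) * (tri (snd p) s * (f (fst p) * g (snd p)))"

lemma kern2_bounded_meas:
  assumes f: "continuous_on {t..T} f" and g: "continuous_on {t..T} g"
  shows "bounded_meas L2 (kern2 f g s)"
proof -
  have 1: "bounded_meas L2 (\<lambda>p. tri (fst p) (snd p))"
    by (rule bounded_measI[OF tri_measurable[OF fst_measurable_L snd_measurable_L] tri_bound(1)])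
  have 2: "bounded_meas L2 (\<lambda>p. tri (snd p) s)"
    by (rule bounded_measI[OF tri_measurable[OF snd_measurable_L borel_measurable_const] tri_bound(1)])
  have 3: "bounded_meas L2 (\<lambda>p. f (fst p) * g (snd p))"
    using bounded_meas_tensor[OF continuous_bounded_meas_L[OF f] continuous_bounded_meas_L[OF g]]
    by (simp add: case_prod_beta')
  show ?thesis unfolding kern2_def[abs_def] by (intro bounded_meas_mult 1 2 3)
qed

lemma kern2_coef:
  assumes f: "continuous_on {t..T} f" and y: "y \<in> {t..T}"
  shows "coef (\<lambda>x. kern2 f g s (x, y)) j = tri y s * (g y * integral {t..y} (\<lambda>x. f x * \<phi> j x))"
proof -
  have "coef (\<lambda>x. kern2 f g s (x, y)) j = coef (\<lambda>x. (tri y s * g y) * (indicator {t..y} x * f x)) j"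
    by (rule coef_cong) (auto simp: kern2_def tri_def)
  also have "\<dots> = (tri y s * g y) * coef (\<lambda>x. indicator {t..y} x * f x) j"
    by (simp add: coef_def l2_inner_cmult_left)
  also have "coef (\<lambda>x. indicator {t..y} x * f x) j = integral {t..y} (\<lambda>x. f x * \<phi> j x)"
    using y by (intro coef_indicator f) auto
  finally show ?thesis by simp
qed

lemma integral_phi_continuous:
  "continuous_on {t..T} f \<Longrightarrow> continuous_on {t..T} (\<lambda>y. integral {t..y} (\<lambda>x. f x * \<phi> j x))"
  by (intro indefinite_integral_continuous_1 integrable_continuous_real continuous_intros phi_cont)

lemma integral_phi_continuous':
  "continuous_on {t..T} f \<Longrightarrow> continuous_on {t..T} (\<lambda>y. integral {y..T} (\<lambda>x. f x * \<phi> j x))"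
  by (intro indefinite_integral_continuous_1' integrable_continuous_real continuous_intros phi_cont)

lemma spanned_tri:
  assumes h: "continuous_on {t..T} h" and s: "s \<in> {t..T}"
  shows "spanned (\<lambda>x. tri x s * h x)"
proof (rule spanned_cong[OF _ spanned_interval[OF h, of t s "{t..s}"]])
  show "indicator {t..s} x * h x = tri x s * h x" if "x \<in> {t..T}" for x
    using that by (auto simp: tri_def split: split_indicator)
qed (use s in auto)

text \<open>The sections in \<open>x\<close> are cut-offs at \<open>y\<close> of continuous
  functions, and their coefficients are cut-offs at \<open>s\<close> of continuous functions of
  \<open>y\<close>; both are covered by \<open>spanned_tri\<close>.\<close>

lemma spanned2_kern2:
  assumes f: "continuous_on {t..T} f" and g: "continuous_on {t..T} g" and s: "s \<in> {t..T}"
  shows "spanned2 (kern2 f g s)"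
  unfolding spanned2_def
proof (intro conjI ballI allI)
  show "bounded_meas I2 (kern2 f g s)" unfolding I_eq by (rule kern2_bounded_meas[OF f g])
  show "spanned (\<lambda>x. kern2 f g s (x, y))" if y: "y \<in> {t..T}" for y
  proof (rule spanned_cong[OF _ spanned_tri[OF _ y]])
    show "continuous_on {t..T} (\<lambda>x. (tri y s * g y) * f x)" by (intro continuous_intros f)
  qed (auto simp: kern2_def)
  show "spanned (\<lambda>y. coef (\<lambda>x. kern2 f g s (x, y)) j)" for j
  proof (rule spanned_cong[OF _ spanned_tri[OF _ s]])
    show "continuous_on {t..T} (\<lambda>y. g y * integral {t..y} (\<lambda>x. f x * \<phi> j x))"
      by (intro continuous_intros g integral_phi_continuous f)
  qed (simp add: kern2_coef[OF f])
qed

lemma kern2_coef2: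
  assumes f: "continuous_on {t..T} f" and g: "continuous_on {t..T} g" and s: "s \<in> {t..T}"
  shows "coef2 (kern2 f g s) j1 j2 = integral {t..s} (\<lambda>y. g y * \<phi> j2 y * integral {t..y} (\<lambda>x. f x * \<phi> j1 x))"
proof -
  have "coef2 (kern2 f g s) j1 j2 = coef (\<lambda>y. indicator {t..s} y * (g y * integral {t..y} (\<lambda>x. f x * \<phi> j1 x))) j2"
    unfolding coef2_def by (rule coef_cong) (auto simp: kern2_coef[OF f] tri_def)
  also have "\<dots> = integral {t..s} (\<lambda>y. (g y * integral {t..y} (\<lambda>x. f x * \<phi> j1 x)) * \<phi> j2 y)"
    using s by (intro coef_indicator continuous_intros g integral_phi_continuous f) auto
  finally show ?thesis by (simp add: mult_ac)
qed

lemma kern2_coef2_trace: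
  assumes "continuous_on {t..T} f" "continuous_on {t..T} g" "s \<in> {t..T}"
  shows "(\<Sum>j\<le>p. coef2 (kern2 f g s) j j) = trace_sum f g p t s"
  by (simp add: trace_sum_def kern2_coef2[OF assms])

text \<open>Orthonormality collapses the trace of the truncated expansion to the sum of the diagonal
  coefficients.\<close>

lemma double_form2:
  assumes ij: "i \<in> {1..m}" "j \<in> {1..m}"
  shows "form2 i j (\<lambda>q. \<Sum>j1\<le>p. \<Sum>j2\<le>p. c j1 j2 * (case q of (x, y) \<Rightarrow> \<phi> j1 x * \<phi> j2 y))
     (ind_eq i j * (\<Sum>k\<le>p. c k k))
     (\<lambda>\<omega>. \<Sum>j1\<le>p. \<Sum>j2\<le>p. c j1 j2 * (zeta M W \<phi> t T i j1 \<omega> * zeta M W \<phi> t T j j2 \<omega>))"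
proof -
  have "form2 i j (\<lambda>q. \<Sum>j1\<le>p. \<Sum>j2\<le>p. c j1 j2 * (case q of (x, y) \<Rightarrow> \<phi> j1 x * \<phi> j2 y))
     (\<Sum>j1\<le>p. \<Sum>j2\<le>p. c j1 j2 * (ind_eq i j * ip (\<phi> j1) (\<phi> j2)))
     (\<lambda>\<omega>. \<Sum>j1\<le>p. \<Sum>j2\<le>p. c j1 j2 * (zeta M W \<phi> t T i j1 \<omega> * zeta M W \<phi> t T j j2 \<omega>))"
    by (intro form2_sum form2_cmult form2_single wint_zeta ij)
  moreover have "(\<Sum>j1\<le>p. \<Sum>j2\<le>p. c j1 j2 * (ind_eq i j * ip (\<phi> j1) (\<phi> j2))) = ind_eq i j * (\<Sum>k\<le>p. c k k)"
    unfolding I_eq[symmetric] phi_inner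
    by (simp add: if_distrib[of "\<lambda>x. _ * x"] sum_distrib_left mult.commute cong: if_cong)
  ultimately show ?thesis by (simp only:)
qed

lemma C1_on_continuous: "C1_on S f \<Longrightarrow> continuous_on S f"
  unfolding C1_on_def using DERIV_continuous_on by blast

text \<open>The trace term is the Stratonovich correction: the diagonal counts one half in the trapezoidal sums and in
  the trace sums of the expansion.\<close>

lemma chaos2_strat_int:
  assumes ij: "i \<in> {1..m}" "j \<in> {1..m}" and f: "C1_on {t..T} f" and g: "C1_on {t..T} g" and s: "s \<in> {t..T}"
    and X: "\<And>u. u \<in> {t..T} \<Longrightarrow> wint i (\<lambda>z. indicator {..u} z * f z) (X u)"
  shows "chaos2 i j (kern2 f g s) (ind_eq i j * ((1/2) * integral {t..s} (\<lambda>x. f x * g x)))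
     (strat_int M (W j) (\<lambda>u \<omega>. g u * X u \<omega>) t s)"
proof -
  have fc: "continuous_on {t..T} f" and gc: "continuous_on {t..T} g" using f g by (auto dest: C1_on_continuous)
  have ts: "t \<le> s" "s \<le> T" using s by auto
  let ?K = "kern2 f g s"
  let ?k = "ind_eq i j * ((1/2) * integral {t..s} (\<lambda>x. f x * g x))"
  note Kb = kern2_bounded_meas[OF fc gc, of s]
  obtain C where C: "C \<ge> 0" "\<And>x. x \<in> space L \<Longrightarrow> \<bar>f x\<bar> \<le> C"
    using bounded_meas_bound[OF continuous_bounded_meas_L[OF fc]] by blast
  obtain D where D: "D \<ge> 0" "\<And>x. x \<in> space L \<Longrightarrow> \<bar>g x\<bar> \<le> D"
    using bounded_meas_bound[OF continuous_bounded_meas_L[OF gc]] by blast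
  note R = double_form2[OF ij, where c="coef2 ?K"]
  have RK: "l2_lim L2 (\<lambda>p q. \<Sum>j1\<le>p. \<Sum>j2\<le>p. coef2 ?K j1 j2 * (case q of (x, y) \<Rightarrow> \<phi> j1 x * \<phi> j2 y)) ?K"
    using expansion2[OF spanned2_kern2[OF fc gc s]] unfolding I_eq .
  have Rk: "(\<lambda>p. ind_eq i j * (\<Sum>k\<le>p. coef2 ?K k k)) \<longlonglongrightarrow> ?k"
    unfolding kern2_coef2_trace[OF fc gc s] by (intro tendsto_mult_left trace_sum_limit(1) f g) (use ts in auto)
  \<comment> \<open>The candidate limit comes from the expansion and is thus the same for all
    sequences of partitions.\<close>
  from form2_converges[OF R RK Rk Kb] obtain Y where
    Y: "l2_lim M (\<lambda>p \<omega>. \<Sum>j1\<le>p. \<Sum>j2\<le>p. coef2 ?K j1 j2 * (zeta M W \<phi> t T i j1 \<omega> * zeta M W \<phi> t T j j2 \<omega>)) Y"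
    and Yc: "chaos2 i j ?K ?k Y" by blast
  have lim: "l2_lim M (\<lambda>n. strat_sum (W j) (\<lambda>u \<omega>. g u * X u \<omega>) (P n) (N n)) Y"
    if p: "\<And>n. partition t s (P n) (N n)" and mesh: "(\<lambda>n. mesh (P n) (N n)) \<longlonglongrightarrow> 0" for P :: "nat \<Rightarrow> nat \<Rightarrow> real" and N
  proof -
    have r: "P n k \<in> {t..T}" if "k \<le> N n" for n k using partition_range[OF p that] s by auto
    define fk where "fk n k x = (1/2) * (g (P n k) * (indicator {..P n k} x * f x) + g (P n (Suc k)) * (indicator {..P n (Suc k)} x * f x))" for n k x
    define Xk where "Xk n k \<omega> = (1/2) * (g (P n k) * X (P n k) \<omega> + g (P n (Suc k)) * X (P n (Suc k)) \<omega>)" for n k \<omega>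
    define hk where "hk n k z = (indicator {..P n (Suc k)} z - indicator {..P n k} z :: real)" for n k z
    define Zk where "Zk n k \<omega> = inc j (P n (Suc k)) \<omega> - inc j (P n k) \<omega>" for n k \<omega>
    have w1: "wint i (fk n k) (Xk n k)" and w2: "wint j (hk n k) (Zk n k)" if "k < N n" for n k
      unfolding fk_def[abs_def] Xk_def[abs_def] hk_def[abs_def] Zk_def[abs_def]
      using r[of k n] r[of "Suc k" n] that
      by (intro wint_cmult wint_add wint_diff wint_inc X ij; simp)+
    define KK where "KK n q = (\<Sum>k<N n. (case q of (x, y) \<Rightarrow> fk n k x * hk n k y))" for n q
    define kk where "kk n = (\<Sum>k<N n. ind_eq i j * ip (fk n k) (hk n k))" for n
    define QQ where "QQ n \<omega> = (\<Sum>k<N n. Xk n k \<omega> * Zk n k \<omega>)" for n \<omega>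
    have F: "form2 i j (KK n) (kk n) (QQ n)" for n
      unfolding KK_def[abs_def] kk_def QQ_def[abs_def] using w1[of _ n] w2[of _ n] by (intro form2_sum form2_single) auto
    have QS: "QQ n = strat_sum (W j) (\<lambda>u \<omega>. g u * X u \<omega>) (P n) (N n)" for n
      by (auto simp: QQ_def Xk_def Zk_def strat_sum_def inc_def)
    \<comment> \<open>\<open>l n\<close> and \<open>r n\<close> are the endpoints of the cell that
      contains \<open>y\<close>; only this cell contributes to the sum.\<close>
    have tag: "\<exists>l r. (\<forall>n. l n \<in> {t..T} \<and> r n \<in> {t..T} \<and> l n < y \<and> y \<le> r n \<and>
        (\<forall>x. (\<Sum>k<N n. fk n k x * hk n k y) = (1/2) * (g (l n) * (tri x (l n) * f x) + g (r n) * (tri x (r n) * f x)))) \<and>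
        l \<longlonglongrightarrow> y \<and> r \<longlonglongrightarrow> y" if y: "t < y" "y \<le> s" for y
    proof (intro exI conjI allI)
      show "(\<lambda>n. P n (cell (P n) y)) \<longlonglongrightarrow> y" "(\<lambda>n. P n (Suc (cell (P n) y))) \<longlonglongrightarrow> y"
        by (rule cell_tendsto[OF p mesh y])+
      fix n
      note c = cell_props[OF p y, of n]
      show "P n (cell (P n) y) \<in> {t..T}" "P n (Suc (cell (P n) y)) \<in> {t..T}" using c(1) by (intro r; simp)+
      show "P n (cell (P n) y) < y" "y \<le> P n (Suc (cell (P n) y))" by (rule c)+
      fix x
      show "(\<Sum>k<N n. fk n k x * hk n k y) = (1/2) * (g (P n (cell (P n) y)) * (tri x (P n (cell (P n) y)) * f x) +
          g (P n (Suc (cell (P n) y))) * (tri x (P n (Suc (cell (P n) y))) * f x))"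
        unfolding hk_def partition_sum[OF p] using y by (simp add: fk_def indicator_tri)
    qed
    have tag0: "(\<Sum>k<N n. fk n k x * hk n k y) = 0" if "s < y" for n x y
      unfolding hk_def partition_sum[OF p] using that by simp
    have bnd: "\<bar>\<Sum>k<N n. fk n k x * hk n k y\<bar> \<le> D * C" if x: "x \<in> {t..T}" for n x y
    proof (cases "t < y \<and> y \<le> s")
      case True
      then obtain l r where l: "l n \<in> {t..T}" "r n \<in> {t..T}" and
        e: "(\<Sum>k<N n. fk n k x * hk n k y) = (1/2) * (g (l n) * (tri x (l n) * f x) + g (r n) * (tri x (r n) * f x))"
        using tag[of y] by blast
      have "\<bar>g u * (tri x u * f x)\<bar> \<le> D * (1 * C)" if "u \<in> {t..T}" for u
        unfolding abs_mult using C D x that tri_bound by (intro mult_mono mult_nonneg_nonneg) auto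
      from this[OF l(1)] this[OF l(2)] show ?thesis unfolding e by simp
    next
      case False
      then show ?thesis unfolding hk_def partition_sum[OF p] using C D by auto
    qed
    have KKb: "bounded_meas L2 (KK n)" for n by (rule form2_bound(2)[OF F])
    obtain E where E: "\<And>q. q \<in> space L2 \<Longrightarrow> \<bar>?K q\<bar> \<le> E" using bounded_meas_bound[OF Kb] by blast
    have KKlim: "l2_lim L2 KK ?K"
    proof (rule L2.bounded_meas_l2_lim[OF bounded_meas_measurable[OF KKb] bounded_meas_measurable[OF Kb] _ _ E])
      show "\<bar>KK n q\<bar> \<le> D * C" if "q \<in> space L2" for n q
        using bnd that by (auto simp: KK_def space_pair_measure)
      have y: "AE q in L2. snd q \<noteq> t"
      proof -
        interpret P: pair_sigma_finite L L ..
        have [measurable]: "snd \<in> borel_measurable L2" by (rule snd_measurable_L)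
        have "{p \<in> space L2. snd p \<noteq> t} \<in> sets L2" by measurable
        from P.AE_pair_measure[OF this] show ?thesis using AE_L_neq by auto
      qed
      show "AE q in L2. (\<lambda>n. KK n q) \<longlonglongrightarrow> ?K q"
        using AE_L2_neq y AE_space
      proof eventually_elim
        case (elim q)
        obtain x y where q: "q = (x, y)" by (cases q)
        with elim have xy: "x \<noteq> y" "t < y" "y \<in> {t..T}" "x \<in> {t..T}" by (auto simp: space_pair_measure)
        show ?case
        proof (cases "y \<le> s")
          case True
          from tag[OF xy(2) True] obtain l r where l: "\<And>n. l n \<in> {t..T}" "\<And>n. r n \<in> {t..T}" and
            e: "\<And>n. (\<Sum>k<N n. fk n k x * hk n k y) = (1/2) * (g (l n) * (tri x (l n) * f x) + g (r n) * (tri x (r n) * f x))"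
            and lr: "l \<longlonglongrightarrow> y" "r \<longlonglongrightarrow> y" by blast
          have "(\<lambda>n. (1/2) * (g (l n) * (tri x (l n) * f x) + g (r n) * (tri x (r n) * f x))) \<longlonglongrightarrow>
             (1/2) * (g y * (tri x y * f x) + g y * (tri x y * f x))"
            by (intro tendsto_mult_left tendsto_add tendsto_mult tendsto_const tendsto_tri
                tendsto_continuous_cell[OF gc] lr l xy)
          then show ?thesis using True by (simp add: q KK_def e kern2_def tri_def[of y s] mult_ac)
        next
          case False
          then show ?thesis using tag0[of y] by (simp add: q KK_def kern2_def tri_def)
        qed
      qed
    qed
    have kklim: "kk \<longlonglongrightarrow> ?k"
    proof -
      have int: "integrable L (\<lambda>x. fk n k x * hk n k x)" if "k < N n" for n k
        using w1[OF that] w2[OF that] by (intro sq_integrable_mult) (auto dest: wintD(4))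
      have kke: "kk n = ind_eq i j * (\<integral>x. (\<Sum>k<N n. fk n k x * hk n k x) \<partial>L)" for n
        using int[of _ n] by (simp add: kk_def l2_inner_def sum_distrib_left Bochner_Integration.integral_sum)
      have "(\<lambda>n. \<integral>x. (\<Sum>k<N n. fk n k x * hk n k x) \<partial>L) \<longlonglongrightarrow> (\<integral>x. indicator {t..s} x * ((1/2) * (f x * g x)) \<partial>L)"
      proof (rule integral_dominated_convergence[where w="\<lambda>_. D * C"])
        show "(\<lambda>x. indicator {t..s} x * ((1/2) * (f x * g x))) \<in> borel_measurable L"
          using sq_integrable_measurable[OF indicator_mult_sq[OF continuous_on_mult_left[OF continuous_on_mult[OF fc gc]], of t s "1/2"]]
          unfolding I_eq .
        show "(\<lambda>x. \<Sum>k<N n. fk n k x * hk n k x) \<in> borel_measurable L" for n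
          using int[of _ n] by (intro borel_measurable_sum) auto
        show "AE x in L. norm (\<Sum>k<N n. fk n k x * hk n k x) \<le> D * C" for n
          using bnd by (intro AE_I2) auto
        show "AE x in L. (\<lambda>n. \<Sum>k<N n. fk n k x * hk n k x) \<longlonglongrightarrow> indicator {t..s} x * ((1/2) * (f x * g x))"
          using AE_L_neq[of t] AE_space
        proof eventually_elim
          case (elim x)
          then have x: "t < x" "x \<in> {t..T}" by auto
          show ?case
          proof (cases "x \<le> s")
            case True
            from tag[OF x(1) True] obtain l r where l: "\<And>n. l n \<in> {t..T}" "\<And>n. r n \<in> {t..T}" "\<And>n. l n < x" "\<And>n. x \<le> r n" and
              e: "\<And>n. (\<Sum>k<N n. fk n k x * hk n k x) = (1/2) * (g (l n) * (tri x (l n) * f x) + g (r n) * (tri x (r n) * f x))"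
              and lr: "l \<longlonglongrightarrow> x" "r \<longlonglongrightarrow> x" by blast
            \<comment> \<open>On the diagonal \<open>l n < x \<le> r n\<close>: the inner integral
              up to \<open>l n\<close> does not reach \<open>x\<close>, the one up to
              \<open>r n\<close> does. One of the two averaged values survives.\<close>
            have e': "(\<Sum>k<N n. fk n k x * hk n k x) = (1/2) * (f x * g (r n))" for n
              unfolding e using l(3,4)[of n] by (simp add: tri_def)
            have "(\<lambda>n. (1/2) * (f x * g (r n))) \<longlonglongrightarrow> (1/2) * (f x * g x)"
              by (intro tendsto_mult_left tendsto_continuous_cell[OF gc] lr l x)
            then show ?thesis using True x by (simp add: e')
          next
            case False
            then show ?thesis using tag0[of x] by simp
          qed
        qed
      qed auto
      moreover have "(\<integral>x. indicator {t..s} x * ((1/2) * (f x * g x)) \<partial>L) = (1/2) * integral {t..s} (\<lambda>x. f x * g x)"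
        using integral_indicator_I[OF continuous_on_mult_left[OF continuous_on_mult[OF fc gc]], of t s "1/2"] ts
        unfolding I_eq by simp
      ultimately show ?thesis unfolding kke by (intro tendsto_mult_left) simp
    qed
    have "l2_lim M QQ Y"
      by (rule l2_lim_of_diff[OF Y form2_bound(1)[OF F] form2_diff_lim[OF F R KKlim RK kklim Rk]])
    then show ?thesis unfolding QS .
  qed
  note ae = strat_int_AE_eq[OF lim ts(1)]
  obtain K' k' Q' where a: "bounded_meas L2 ?K" "\<And>n. form2 i j (K' n) (k' n) (Q' n)" "l2_lim L2 K' ?K" "k' \<longlonglongrightarrow> ?k"
    "l2_lim M Q' Y" by (rule chaos2E[OF Yc]) (rule that)
  show ?thesis
    by (rule chaos2I[OF a(1-4) l2_lim_unique_limit[OF a(5) ae(2) ae(1)]])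
qed

end

section \<open>Iterated Stratonovich integrals of third order\<close>

lemma bounded_meas_cong:
  "(\<And>x. x \<in> space N \<Longrightarrow> f x = g x) \<Longrightarrow> bounded_meas N f \<Longrightarrow> bounded_meas N g"
  using measurable_cong[of N f g borel] by (auto simp: bounded_meas_def)

lemma sum_diagonal: "(\<Sum>i\<le>p. \<Sum>j\<le>p. (if i = j then f i j else 0)) = (\<Sum>k\<le>p. f k k)"
  for f :: "nat \<Rightarrow> nat \<Rightarrow> real" and p :: nat
  by (intro sum.cong refl) simp

lemma (in ortho_system) spanned2_cong:
  assumes eq: "\<And>x y. x \<in> {a..b} \<Longrightarrow> y \<in> {a..b} \<Longrightarrow> K (x, y) = K' (x, y)" and K: "spanned2 K"
  shows "spanned2 K'"
proof -
  have b: "bounded_meas I2 K'"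
    using K by (intro bounded_meas_cong[of I2 K K']) (auto simp: spanned2_def space_pair_measure eq)
  have s: "spanned (\<lambda>x. K' (x, y))" if "y \<in> {a..b}" for y
    by (rule spanned_cong[of "\<lambda>x. K (x, y)"]) (use that K in \<open>auto simp: spanned2_def eq\<close>)
  have c: "coef (\<lambda>x. K (x, y)) j = coef (\<lambda>x. K' (x, y)) j" if "y \<in> {a..b}" for y j
    by (rule coef_cong) (use that eq in auto)
  have "spanned (\<lambda>y. coef (\<lambda>x. K' (x, y)) j)" for j
    by (rule spanned_cong[of "\<lambda>y. coef (\<lambda>x. K (x, y)) j"]) (use K c in \<open>auto simp: spanned2_def\<close>)
  with b s show ?thesis by (simp add: spanned2_def)
qed

lemma (in ortho_system) coef2_cong:
  assumes eq: "\<And>x y. x \<in> {a..b} \<Longrightarrow> y \<in> {a..b} \<Longrightarrow> K (x, y) = K' (x, y)"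
  shows "coef2 K i j = coef2 K' i j"
  unfolding coef2_def by (intro coef_cong) (simp add: eq)

lemma (in ortho_system) coef_continuous:
  assumes "continuous_on {a..b} f"
  shows "coef f j = integral {a..b} (\<lambda>x. f x * \<phi> j x)"
  unfolding coef_def l2_inner_def
  by (rule integral_Icc_measure) (intro continuous_intros assms phi_cont)

context wiener_expansion
begin

lemma chaos3_sq:
  assumes "chaos3 i j l K a b c Q"
  shows "sq_integrable L3 K" "sq_integrable L a" "sq_integrable L b" "sq_integrable L c"
proof -
  obtain K' a' b' c' Q' where a: "\<And>n. form3 i j l (K' n) (a' n) (b' n) (c' n) (Q' n)" "l2_lim L3 K' K" "l2_lim L a' a"
    "l2_lim L b' b" "l2_lim L c' c" "l2_lim M Q' Q" by (rule chaos3E[OF assms(1)]) (rule that)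
  show "sq_integrable L3 K" "sq_integrable L a" "sq_integrable L b" "sq_integrable L c"
    by (rule l2_limD(2)[OF a(2)] l2_limD(2)[OF a(3)] l2_limD(2)[OF a(4)] l2_limD(2)[OF a(5)])+
qed

section \<open>The simplex kernel and its coefficients\<close>

definition kern3 :: "(real \<Rightarrow> real) \<Rightarrow> (real \<Rightarrow> real) \<Rightarrow> (real \<Rightarrow> real) \<Rightarrow> real \<times> real \<times> real \<Rightarrow> real" where
  "kern3 f g h p = (case p of (x, y, z) \<Rightarrow> tri x y * (tri y z * (f x * (g y * h z))))"

lemma kern3_bounded_meas:
  assumes f: "continuous_on {t..T} f" and g: "continuous_on {t..T} g" and h: "continuous_on {t..T} h"
  shows "bounded_meas L3 (kern3 f g h)"
proof -
  have y: "(\<lambda>p. fst (snd p)) \<in> borel_measurable L3" by (rule measurable_compose[OF measurable_snd fst_measurable_L])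
  have z: "(\<lambda>p. snd (snd p)) \<in> borel_measurable L3" by (rule measurable_compose[OF measurable_snd snd_measurable_L])
  have 1: "bounded_meas L3 (\<lambda>p. tri (fst p) (fst (snd p)))"
    by (rule bounded_measI[OF tri_measurable[OF fst_measurable_L y] tri_bound(1)])
  have 2: "bounded_meas L3 (\<lambda>p. tri (fst (snd p)) (snd (snd p)))"
    by (rule bounded_measI[OF tri_measurable[OF y z] tri_bound(1)])
  have 3: "bounded_meas L3 (\<lambda>p. f (fst p) * (g (fst (snd p)) * h (snd (snd p))))"
    using bounded_meas_tensor[OF continuous_bounded_meas_L[OF f]
        bounded_meas_tensor[OF continuous_bounded_meas_L[OF g] continuous_bounded_meas_L[OF h]]]
    by (simp add: case_prod_beta')
  have "bounded_meas L3 (\<lambda>p. tri (fst p) (fst (snd p)) * (tri (fst (snd p)) (snd (snd p)) * (f (fst p) * (g (fst (snd p)) * h (snd (snd p))))))"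
    by (intro bounded_meas_mult 1 2 3)
  then show ?thesis unfolding kern3_def[abs_def] by (simp add: case_prod_beta')
qed

text \<open>Integrating out \<open>x\<close> leaves a triangular kernel of second order in which
  \<open>g\<close> has absorbed the inner integral, so the second order results apply.\<close>

lemma kern3_coef:
  assumes f: "continuous_on {t..T} f" and y: "y \<in> {t..T}" "z \<in> {t..T}"
  shows "coef (\<lambda>x. kern3 f g h (x, y, z)) j = kern2 (\<lambda>y. g y * integral {t..y} (\<lambda>x. f x * \<phi> j x)) h T (y, z)"
proof -
  have "coef (\<lambda>x. kern3 f g h (x, y, z)) j = coef (\<lambda>x. (tri y z * (g y * h z)) * (indicator {t..y} x * f x)) j"
    by (rule coef_cong) (auto simp: kern3_def tri_def)
  also have "\<dots> = (tri y z * (g y * h z)) * coef (\<lambda>x. indicator {t..y} x * f x) j"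
    by (simp add: coef_def l2_inner_cmult_left)
  also have "coef (\<lambda>x. indicator {t..y} x * f x) j = integral {t..y} (\<lambda>x. f x * \<phi> j x)"
    using y by (intro coef_indicator f) auto
  finally show ?thesis using y by (simp add: kern2_def tri_def)
qed

lemma spanned3_kern3:
  assumes f: "continuous_on {t..T} f" and g: "continuous_on {t..T} g" and h: "continuous_on {t..T} h"
  shows "spanned3 (kern3 f g h)"
  unfolding spanned3_def
proof (intro conjI ballI allI)
  show "bounded_meas I3 (kern3 f g h)" unfolding I_eq by (rule kern3_bounded_meas[OF f g h])
  show "spanned (\<lambda>x. kern3 f g h (x, q))" if q: "q \<in> {t..T} \<times> {t..T}" for q
  proof (rule spanned_cong[OF _ spanned_tri])
    show "continuous_on {t..T} (\<lambda>x. (tri (fst q) (snd q) * (g (fst q) * h (snd q))) * f x)" by (intro continuous_intros f)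
    show "fst q \<in> {t..T}" using q by auto
  qed (auto simp: kern3_def case_prod_beta)
  show "spanned2 (\<lambda>q. coef (\<lambda>x. kern3 f g h (x, q)) j)" for j
  proof (rule spanned2_cong[OF _ spanned2_kern2[OF _ h]])
    show "continuous_on {t..T} (\<lambda>y. g y * integral {t..y} (\<lambda>x. f x * \<phi> j x))"
      by (intro continuous_intros g integral_phi_continuous f)
    show "T \<in> {t..T}" using ab by simp
  qed (simp add: kern3_coef[OF f])
qed

text \<open>The coefficients with their indices in the order of the variables; \<open>coeff3\<close>
  lists them in reverse.\<close>

abbreviation C3 :: "(real \<Rightarrow> real) \<Rightarrow> (real \<Rightarrow> real) \<Rightarrow> (real \<Rightarrow> real) \<Rightarrow> nat \<Rightarrow> nat \<Rightarrow> nat \<Rightarrow> real" where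
  "C3 f g h j1 j2 j3 \<equiv> coeff3 \<phi> f g h t T j3 j2 j1"

lemma kern3_coef3:
  assumes f: "continuous_on {t..T} f" and g: "continuous_on {t..T} g" and h: "continuous_on {t..T} h"
  shows "coef3 (kern3 f g h) j1 j2 j3 = C3 f g h j1 j2 j3"
proof -
  let ?G = "\<lambda>y. g y * integral {t..y} (\<lambda>x. f x * \<phi> j1 x)"
  have G: "continuous_on {t..T} ?G" by (intro continuous_intros g integral_phi_continuous f)
  have T: "T \<in> {t..T}" using ab by simp
  have "coef3 (kern3 f g h) j1 j2 j3 = coef2 (kern2 ?G h T) j2 j3"
    unfolding coef3_def by (rule coef2_cong) (simp add: kern3_coef[OF f])
  also have "\<dots> = C3 f g h j1 j2 j3"
    unfolding kern2_coef2[OF G h T] coeff3_def by (simp only: mult_ac)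
  finally show ?thesis .
qed

lemma C3_middle:
  assumes f: "continuous_on {t..T} f" and g: "continuous_on {t..T} g" and h: "continuous_on {t..T} h"
  shows "C3 f g h j1 j2 j3 = integral {t..T} (\<lambda>y. (g y * (integral {t..y} (\<lambda>x. f x * \<phi> j1 x) *
     integral {y..T} (\<lambda>z. h z * \<phi> j3 z))) * \<phi> j2 y)"
proof -
  have "C3 f g h j1 j2 j3 = integral {t..T} (\<lambda>y. (g y * \<phi> j2 y * integral {t..y} (\<lambda>x. f x * \<phi> j1 x)) *
      integral {y..T} (\<lambda>z. h z * \<phi> j3 z))"
    unfolding coeff3_def
    by (rule integral_triangle_swap) (use ab in \<open>auto intro!: continuous_intros f g h phi_cont integral_phi_continuous\<close>)
  then show ?thesis by (simp only: mult_ac)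
qed

text \<open>Two exchanges of the order of integration make the first variable the outermost one, so
  that the coefficient becomes a simple Fourier coefficient in that variable.
  \<open>C3_middle\<close> does the same for the second variable.\<close>

lemma C3_first:
  assumes f: "continuous_on {t..T} f" and g: "continuous_on {t..T} g" and h: "continuous_on {t..T} h"
  shows "C3 f g h j1 j2 j3 = integral {t..T} (\<lambda>x. (f x * integral {x..T} (\<lambda>z. h z * \<phi> j3 z * integral {x..z} (\<lambda>y. g y * \<phi> j2 y))) * \<phi> j1 x)"
proof -
  let ?H = "\<lambda>y. g y * \<phi> j2 y * integral {y..T} (\<lambda>z. h z * \<phi> j3 z)"
  have "C3 f g h j1 j2 j3 = integral {t..T} (\<lambda>y. ?H y * integral {t..y} (\<lambda>x. f x * \<phi> j1 x))"
    unfolding C3_middle[OF f g h] by (simp only: mult_ac)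
  also have "\<dots> = integral {t..T} (\<lambda>x. f x * \<phi> j1 x * integral {x..T} ?H)"
    by (rule integral_triangle_swap)
       (use ab in \<open>auto intro!: continuous_intros f g h phi_cont integral_phi_continuous'\<close>)
  also have "\<dots> = integral {t..T} (\<lambda>x. (f x * integral {x..T} (\<lambda>z. h z * \<phi> j3 z * integral {x..z} (\<lambda>y. g y * \<phi> j2 y))) * \<phi> j1 x)"
  proof (rule Henstock_Kurzweil_Integration.integral_cong)
    fix x assume x: "x \<in> {t..T}"
    then have sub: "{x..T} \<subseteq> {t..T}" "x \<le> T" by auto
    have "integral {x..T} (\<lambda>z. h z * \<phi> j3 z * integral {x..z} (\<lambda>y. g y * \<phi> j2 y)) = integral {x..T} ?H"
      by (rule integral_triangle_swap)
         (auto intro!: continuous_intros continuous_on_subset[OF g sub(1)] continuous_on_subset[OF h sub(1)]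
            continuous_on_subset[OF phi_cont sub(1)] sub(2))
    then show "f x * \<phi> j1 x * integral {x..T} ?H =
      (f x * integral {x..T} (\<lambda>z. h z * \<phi> j3 z * integral {x..z} (\<lambda>y. g y * \<phi> j2 y))) * \<phi> j1 x" by simp
  qed
  finally show ?thesis .
qed

section \<open>Partial traces of the truncated expansion\<close>

lemma trace_sum_continuous_right:
  assumes f: "continuous_on {t..T} f" and g: "continuous_on {t..T} g"
  shows "continuous_on {t..T} (\<lambda>z. trace_sum f g p t z)"
  unfolding trace_sum_def
  by (intro continuous_intros indefinite_integral_continuous_1 integrable_continuous_real f g phi_cont integral_phi_continuous)

text \<open>In the definition the moving endpoint \<open>u\<close> occurs in both integrals. After
  the exchange it is only the lower limit of the outer one.\<close>

lemma trace_sum_continuous_left: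
  assumes f: "continuous_on {t..T} f" and g: "continuous_on {t..T} g"
  shows "continuous_on {t..T} (\<lambda>u. trace_sum f g p u T)"
proof (rule continuous_on_eq)
  show "continuous_on {t..T} (\<lambda>u. \<Sum>j\<le>p. integral {u..T} (\<lambda>y. f y * \<phi> j y * integral {y..T} (\<lambda>z. g z * \<phi> j z)))"
    by (intro continuous_intros indefinite_integral_continuous_1' integrable_continuous_real f g phi_cont integral_phi_continuous')
  fix u assume u: "u \<in> {t..T}"
  then have sub: "{u..T} \<subseteq> {t..T}" "u \<le> T" by auto
  show "(\<Sum>j\<le>p. integral {u..T} (\<lambda>y. f y * \<phi> j y * integral {y..T} (\<lambda>z. g z * \<phi> j z))) = trace_sum f g p u T"
    unfolding trace_sum_def
    by (intro sum.cong refl integral_triangle_swap[symmetric])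
       (auto intro!: continuous_intros continuous_on_subset[OF g sub(1)] continuous_on_subset[OF f sub(1)]
            continuous_on_subset[OF phi_cont sub(1)] sub(2))
qed

lemma coef_sum_continuous:
  fixes p :: nat
  assumes u: "continuous_on {t..T} u" and G: "\<And>k. k \<le> p \<Longrightarrow> continuous_on {t..T} (G k)"
  shows "coef (\<lambda>x. u x * (\<Sum>k\<le>p. G k x)) j = (\<Sum>k\<le>p. integral {t..T} (\<lambda>x. (u x * G k x) * \<phi> j x))"
proof -
  have "coef (\<lambda>x. u x * (\<Sum>k\<le>p. G k x)) j = integral {t..T} (\<lambda>x. (u x * (\<Sum>k\<le>p. G k x)) * \<phi> j x)"
    by (rule coef_continuous) (auto intro!: continuous_intros u G)
  also have "\<dots> = integral {t..T} (\<lambda>x. \<Sum>k\<le>p. (u x * G k x) * \<phi> j x)"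
    by (simp add: sum_distrib_left sum_distrib_right)
  also have "\<dots> = (\<Sum>k\<le>p. integral {t..T} (\<lambda>x. (u x * G k x) * \<phi> j x))"
    by (rule Henstock_Kurzweil_Integration.integral_sum)
       (auto intro!: integrable_continuous_real continuous_intros phi_cont u G)
  finally show ?thesis .
qed

text \<open>Recognising the summed coefficients as those of one explicit function identifies the
  trace of the truncated expansion with a projection of it. The two lemmas on the middle and the
  left trace serve the same purpose.\<close>

lemma trace_right_coef:
  assumes f: "continuous_on {t..T} f" and g: "continuous_on {t..T} g" and h: "continuous_on {t..T} h"
  shows "coef (\<lambda>z. h z * trace_sum f g p t z) j = (\<Sum>k\<le>p. C3 f g h k k j)"
proof -
  have "coef (\<lambda>z. h z * trace_sum f g p t z) j = (\<Sum>k\<le>p. integral {t..T} (\<lambda>z. (h z *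
      integral {t..z} (\<lambda>y. g y * \<phi> k y * integral {t..y} (\<lambda>x. f x * \<phi> k x))) * \<phi> j z))"
    unfolding trace_sum_def
    by (intro coef_sum_continuous h indefinite_integral_continuous_1 integrable_continuous_real continuous_intros
        f g phi_cont integral_phi_continuous)
  then show ?thesis unfolding coeff3_def by (simp only: mult_ac)
qed

lemma trace_middle_coef:
  assumes f: "continuous_on {t..T} f" and g: "continuous_on {t..T} g" and h: "continuous_on {t..T} h"
  shows "coef (\<lambda>y. g y * (\<Sum>k\<le>p. integral {t..y} (\<lambda>x. f x * \<phi> k x) * integral {y..T} (\<lambda>x. h x * \<phi> k x))) j =
     (\<Sum>k\<le>p. C3 f g h k j k)"
  unfolding C3_middle[OF f g h]
  by (intro coef_sum_continuous g continuous_intros integral_phi_continuous integral_phi_continuous' f h)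

lemma trace_left_coef:
  assumes f: "continuous_on {t..T} f" and g: "continuous_on {t..T} g" and h: "continuous_on {t..T} h"
  shows "coef (\<lambda>x. f x * trace_sum g h p x T) j = (\<Sum>k\<le>p. C3 f g h j k k)"
proof -
  have "coef (\<lambda>x. f x * trace_sum g h p x T) j = integral {t..T} (\<lambda>x. (f x * trace_sum g h p x T) * \<phi> j x)"
    by (rule coef_continuous) (intro continuous_intros f trace_sum_continuous_left g h)
  also have "\<dots> = integral {t..T} (\<lambda>x. \<Sum>k\<le>p. (f x * integral {x..T} (\<lambda>y. g y * \<phi> k y * integral {y..T} (\<lambda>z. h z * \<phi> k z))) * \<phi> j x)"
  proof (rule Henstock_Kurzweil_Integration.integral_cong)
    fix x assume x: "x \<in> {t..T}"
    then have sub: "{x..T} \<subseteq> {t..T}" "x \<le> T" by auto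
    have "trace_sum g h p x T = (\<Sum>k\<le>p. integral {x..T} (\<lambda>y. g y * \<phi> k y * integral {y..T} (\<lambda>z. h z * \<phi> k z)))"
      unfolding trace_sum_def
      by (intro sum.cong refl integral_triangle_swap)
         (auto intro!: continuous_intros continuous_on_subset[OF g sub(1)] continuous_on_subset[OF h sub(1)]
            continuous_on_subset[OF phi_cont sub(1)] sub(2))
    then show "(f x * trace_sum g h p x T) * \<phi> j x =
      (\<Sum>k\<le>p. (f x * integral {x..T} (\<lambda>y. g y * \<phi> k y * integral {y..T} (\<lambda>z. h z * \<phi> k z))) * \<phi> j x)"
      by (simp add: sum_distrib_left sum_distrib_right)
  qed
  also have "\<dots> = (\<Sum>k\<le>p. integral {t..T} (\<lambda>x. (f x * integral {x..T} (\<lambda>y. g y * \<phi> k y * integral {y..T} (\<lambda>z. h z * \<phi> k z))) * \<phi> j x))"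
    by (rule Henstock_Kurzweil_Integration.integral_sum)
       (auto intro!: integrable_continuous_real continuous_intros f g h phi_cont indefinite_integral_continuous_1' integral_phi_continuous')
  also have "\<dots> = (\<Sum>k\<le>p. C3 f g h j k k)"
  proof (intro sum.cong refl)
    fix k
    show "integral {t..T} (\<lambda>x. (f x * integral {x..T} (\<lambda>y. g y * \<phi> k y * integral {y..T} (\<lambda>z. h z * \<phi> k z))) * \<phi> j x) = C3 f g h j k k"
      unfolding C3_first[OF f g h]
    proof (rule Henstock_Kurzweil_Integration.integral_cong)
      fix x assume x: "x \<in> {t..T}"
      then have sub: "{x..T} \<subseteq> {t..T}" "x \<le> T" by auto
      have "integral {x..T} (\<lambda>z. h z * \<phi> k z * integral {x..z} (\<lambda>y. g y * \<phi> k y)) =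
          integral {x..T} (\<lambda>y. g y * \<phi> k y * integral {y..T} (\<lambda>z. h z * \<phi> k z))"
        by (rule integral_triangle_swap)
           (auto intro!: continuous_intros continuous_on_subset[OF g sub(1)] continuous_on_subset[OF h sub(1)]
              continuous_on_subset[OF phi_cont sub(1)] sub(2))
      then show "(f x * integral {x..T} (\<lambda>y. g y * \<phi> k y * integral {y..T} (\<lambda>z. h z * \<phi> k z))) * \<phi> j x =
        (f x * integral {x..T} (\<lambda>z. h z * \<phi> k z * integral {x..z} (\<lambda>y. g y * \<phi> k y))) * \<phi> j x" by simp
    qed
  qed
  finally show ?thesis .
qed

text \<open>By orthonormality each contraction keeps only equal indices in the contracted pair; the
  free index remains as an expansion in \<open>\<phi>\<close>.\<close>

lemma triple_form3:
  assumes ijl: "i \<in> {1..m}" "j \<in> {1..m}" "l \<in> {1..m}"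
  shows "form3 i j l (\<lambda>q. \<Sum>j1\<le>p. \<Sum>j2\<le>p. \<Sum>j3\<le>p. c j1 j2 j3 * (case q of (x, r) \<Rightarrow> \<phi> j1 x * (case r of (y, z) \<Rightarrow> \<phi> j2 y * \<phi> j3 z)))
     (\<lambda>z. ind_eq i j * (\<Sum>j3\<le>p. (\<Sum>k\<le>p. c k k j3) * \<phi> j3 z))
     (\<lambda>y. ind_eq i l * (\<Sum>j2\<le>p. (\<Sum>k\<le>p. c k j2 k) * \<phi> j2 y))
     (\<lambda>x. ind_eq j l * (\<Sum>j1\<le>p. (\<Sum>k\<le>p. c j1 k k) * \<phi> j1 x))
     (\<lambda>\<omega>. \<Sum>j1\<le>p. \<Sum>j2\<le>p. \<Sum>j3\<le>p. c j1 j2 j3 * (zeta M W \<phi> t T i j1 \<omega> * zeta M W \<phi> t T j j2 \<omega> * zeta M W \<phi> t T l j3 \<omega>))"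
proof -
  have ipd: "ip (\<phi> i) (\<phi> j) = (if i = j then 1 else 0)" for i j unfolding I_eq[symmetric] by (rule phi_inner)
  have F: "form3 i j l (\<lambda>q. \<Sum>j1\<le>p. \<Sum>j2\<le>p. \<Sum>j3\<le>p. c j1 j2 j3 * (case q of (x, y, z) \<Rightarrow> \<phi> j1 x * (\<phi> j2 y * \<phi> j3 z)))
     (\<lambda>z. \<Sum>j1\<le>p. \<Sum>j2\<le>p. \<Sum>j3\<le>p. c j1 j2 j3 * (ind_eq i j * ip (\<phi> j1) (\<phi> j2) * \<phi> j3 z))
     (\<lambda>y. \<Sum>j1\<le>p. \<Sum>j2\<le>p. \<Sum>j3\<le>p. c j1 j2 j3 * (ind_eq i l * ip (\<phi> j1) (\<phi> j3) * \<phi> j2 y))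
     (\<lambda>x. \<Sum>j1\<le>p. \<Sum>j2\<le>p. \<Sum>j3\<le>p. c j1 j2 j3 * (ind_eq j l * ip (\<phi> j2) (\<phi> j3) * \<phi> j1 x))
     (\<lambda>\<omega>. \<Sum>j1\<le>p. \<Sum>j2\<le>p. \<Sum>j3\<le>p. c j1 j2 j3 * (zeta M W \<phi> t T i j1 \<omega> * zeta M W \<phi> t T j j2 \<omega> * zeta M W \<phi> t T l j3 \<omega>))"
    by (intro form3_sum form3_cmult form3_single wint_zeta ijl)
  have K: "(case q of (x, y, z) \<Rightarrow> \<phi> j1 x * (\<phi> j2 y * \<phi> j3 z)) = (case q of (x, r) \<Rightarrow> \<phi> j1 x * (case r of (y, z) \<Rightarrow> \<phi> j2 y * \<phi> j3 z))"
    for q j1 j2 j3 by (simp add: case_prod_beta)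
  have A: "(\<Sum>j1\<le>p. \<Sum>j2\<le>p. \<Sum>j3\<le>p. c j1 j2 j3 * (ind_eq i j * ip (\<phi> j1) (\<phi> j2) * \<phi> j3 z)) =
     ind_eq i j * (\<Sum>j3\<le>p. (\<Sum>k\<le>p. c k k j3) * \<phi> j3 z)" for z
  proof -
    have "(\<Sum>j1\<le>p. \<Sum>j2\<le>p. \<Sum>j3\<le>p. c j1 j2 j3 * (ind_eq i j * ip (\<phi> j1) (\<phi> j2) * \<phi> j3 z)) =
       (\<Sum>j1\<le>p. \<Sum>j2\<le>p. if j1 = j2 then \<Sum>j3\<le>p. c j1 j2 j3 * (ind_eq i j * \<phi> j3 z) else 0)"
      unfolding ipd by (intro sum.cong refl) auto
    also have "\<dots> = (\<Sum>k\<le>p. \<Sum>j3\<le>p. c k k j3 * (ind_eq i j * \<phi> j3 z))" by (rule sum_diagonal)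
    also have "\<dots> = ind_eq i j * (\<Sum>j3\<le>p. (\<Sum>k\<le>p. c k k j3) * \<phi> j3 z)"
      by (subst sum.swap) (simp add: sum_distrib_left sum_distrib_right mult_ac)
    finally show ?thesis .
  qed
  have B: "(\<Sum>j1\<le>p. \<Sum>j2\<le>p. \<Sum>j3\<le>p. c j1 j2 j3 * (ind_eq i l * ip (\<phi> j1) (\<phi> j3) * \<phi> j2 y)) =
     ind_eq i l * (\<Sum>j2\<le>p. (\<Sum>k\<le>p. c k j2 k) * \<phi> j2 y)" for y
  proof -
    have "(\<Sum>j1\<le>p. \<Sum>j2\<le>p. \<Sum>j3\<le>p. c j1 j2 j3 * (ind_eq i l * ip (\<phi> j1) (\<phi> j3) * \<phi> j2 y)) =
       (\<Sum>j2\<le>p. \<Sum>j1\<le>p. \<Sum>j3\<le>p. if j1 = j3 then c j1 j2 j3 * (ind_eq i l * \<phi> j2 y) else 0)"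
      unfolding ipd by (subst sum.swap) (intro sum.cong refl, auto)
    also have "\<dots> = (\<Sum>j2\<le>p. \<Sum>k\<le>p. c k j2 k * (ind_eq i l * \<phi> j2 y))" by (simp only: sum_diagonal)
    also have "\<dots> = ind_eq i l * (\<Sum>j2\<le>p. (\<Sum>k\<le>p. c k j2 k) * \<phi> j2 y)"
      by (simp add: sum_distrib_left sum_distrib_right mult_ac)
    finally show ?thesis .
  qed
  have C: "(\<Sum>j1\<le>p. \<Sum>j2\<le>p. \<Sum>j3\<le>p. c j1 j2 j3 * (ind_eq j l * ip (\<phi> j2) (\<phi> j3) * \<phi> j1 x)) =
     ind_eq j l * (\<Sum>j1\<le>p. (\<Sum>k\<le>p. c j1 k k) * \<phi> j1 x)" for x
  proof -
    have "(\<Sum>j1\<le>p. \<Sum>j2\<le>p. \<Sum>j3\<le>p. c j1 j2 j3 * (ind_eq j l * ip (\<phi> j2) (\<phi> j3) * \<phi> j1 x)) =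
       (\<Sum>j1\<le>p. \<Sum>j2\<le>p. \<Sum>j3\<le>p. if j2 = j3 then c j1 j2 j3 * (ind_eq j l * \<phi> j1 x) else 0)"
      unfolding ipd by (intro sum.cong refl) auto
    also have "\<dots> = (\<Sum>j1\<le>p. \<Sum>k\<le>p. c j1 k k * (ind_eq j l * \<phi> j1 x))" by (simp only: sum_diagonal)
    also have "\<dots> = ind_eq j l * (\<Sum>j1\<le>p. (\<Sum>k\<le>p. c j1 k k) * \<phi> j1 x)"
      by (simp add: sum_distrib_left sum_distrib_right mult_ac)
    finally show ?thesis .
  qed
  show ?thesis using F unfolding K A B C .
qed

lemma l2_lim_continuous_bounded:
  assumes c: "\<And>p. continuous_on {t..T} (G p)" and g: "continuous_on {t..T} g"
    and B: "\<And>p x. x \<in> {t..T} \<Longrightarrow> \<bar>G p x\<bar> \<le> B" and lim: "\<And>x. x \<in> {t..T} \<Longrightarrow> (\<lambda>p. G p x) \<longlonglongrightarrow> g x"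
  shows "l2_lim I G g"
proof -
  obtain C where C: "\<And>x. x \<in> space I \<Longrightarrow> \<bar>g x\<bar> \<le> C" using bounded_meas_bound[OF continuous_bounded_meas[OF g]] by blast
  show ?thesis
    by (rule I.bounded_meas_l2_lim[OF _ _ _ _ C])
       (use c g B lim in \<open>auto intro: continuous_on_measurable_Icc_measure\<close>)
qed

text \<open>The truncated expansion is the third order form of the projected kernel; each of its traces is the
  projection of a partial trace that converges boundedly.\<close>

lemma truncation_traces_lim:
  assumes f: "C1_on {t..T} f" and g: "C1_on {t..T} g" and h: "C1_on {t..T} h"
  shows "l2_lim L (\<lambda>p z. d * (\<Sum>j\<le>p. (\<Sum>k\<le>p. C3 f g h k k j) * \<phi> j z)) (\<lambda>z. d * (h z * ((1/2) * integral {t..z} (\<lambda>x. f x * g x))))"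
    and "l2_lim L (\<lambda>p y. d * (\<Sum>j\<le>p. (\<Sum>k\<le>p. C3 f g h k j k) * \<phi> j y)) (\<lambda>y. 0)"
    and "l2_lim L (\<lambda>p x. d * (\<Sum>j\<le>p. (\<Sum>k\<le>p. C3 f g h j k k) * \<phi> j x)) (\<lambda>x. d * (f x * ((1/2) * integral {x..T} (\<lambda>y. g y * h y))))"
proof -
  have fc: "continuous_on {t..T} f" and gc: "continuous_on {t..T} g" and hc: "continuous_on {t..T} h"
    using f g h by (auto dest: C1_on_continuous)
  obtain Bf where Bf: "Bf \<ge> 0" "\<And>x. x \<in> space I \<Longrightarrow> \<bar>f x\<bar> \<le> Bf" using bounded_meas_bound[OF continuous_bounded_meas[OF fc]] by blast
  obtain Bg where Bg: "Bg \<ge> 0" "\<And>x. x \<in> space I \<Longrightarrow> \<bar>g x\<bar> \<le> Bg" using bounded_meas_bound[OF continuous_bounded_meas[OF gc]] by blast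
  obtain Bh where Bh: "Bh \<ge> 0" "\<And>x. x \<in> space I \<Longrightarrow> \<bar>h x\<bar> \<le> Bh" using bounded_meas_bound[OF continuous_bounded_meas[OF hc]] by blast
  obtain B1 where B1: "\<And>p u v. t \<le> u \<Longrightarrow> u \<le> v \<Longrightarrow> v \<le> T \<Longrightarrow> \<bar>trace_sum f g p u v\<bar> \<le> B1" using trace_sum_limit(2)[OF f g] by blast
  obtain B2 where B2: "\<And>p u v. t \<le> u \<Longrightarrow> u \<le> v \<Longrightarrow> v \<le> T \<Longrightarrow> \<bar>trace_sum g h p u v\<bar> \<le> B2" using trace_sum_limit(2)[OF g h] by blast
  have cfg: "continuous_on {t..T} (\<lambda>z. h z * ((1/2) * integral {t..z} (\<lambda>x. f x * g x)))"
    by (intro continuous_intros hc indefinite_integral_continuous_1 integrable_continuous_real fc gc)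
  have cgh: "continuous_on {t..T} (\<lambda>x. f x * ((1/2) * integral {x..T} (\<lambda>y. g y * h y)))"
    by (intro continuous_intros fc indefinite_integral_continuous_1' integrable_continuous_real gc hc)
  have "l2_lim I (\<lambda>p z. h z * trace_sum f g p t z) (\<lambda>z. h z * ((1/2) * integral {t..z} (\<lambda>x. f x * g x)))"
  proof (rule l2_lim_continuous_bounded[OF _ cfg])
    show "continuous_on {t..T} (\<lambda>z. h z * trace_sum f g p t z)" for p
      by (intro continuous_intros hc trace_sum_continuous_right fc gc)
    show "\<bar>h z * trace_sum f g p t z\<bar> \<le> Bh * B1" if "z \<in> {t..T}" for p z
      unfolding abs_mult using Bh B1[of t z p] that by (intro mult_mono) auto
    show "(\<lambda>p. h z * trace_sum f g p t z) \<longlonglongrightarrow> h z * ((1/2) * integral {t..z} (\<lambda>x. f x * g x))" if "z \<in> {t..T}" for z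
      using that by (intro tendsto_mult_left trace_sum_limit(1)[OF f g]) auto
  qed
  from l2_lim_cmult[OF proj_lim[OF this spanned_continuous[OF cfg]], of d]
  show "l2_lim L (\<lambda>p z. d * (\<Sum>j\<le>p. (\<Sum>k\<le>p. C3 f g h k k j) * \<phi> j z)) (\<lambda>z. d * (h z * ((1/2) * integral {t..z} (\<lambda>x. f x * g x))))"
    unfolding proj_def trace_right_coef[OF fc gc hc] I_eq .
  \<comment> \<open>With the middle variable fixed at \<open>y\<close>, the outer variables range
    over \<open>[t, y]\<close> and \<open>[y, T]\<close>. These are consecutive intervals, so this
    trace tends to 0.\<close>
  let ?m = "\<lambda>p y. \<Sum>k\<le>p. integral {t..y} (\<lambda>x. f x * \<phi> k x) * integral {y..T} (\<lambda>x. h x * \<phi> k x)"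
  have z: "continuous_on {t..T} (\<lambda>y. 0 :: real)" by simp
  have "l2_lim I (\<lambda>p y. g y * ?m p y) (\<lambda>y. 0)"
  proof (rule l2_lim_continuous_bounded[OF _ z])
    show "continuous_on {t..T} (\<lambda>y. g y * ?m p y)" for p
      by (intro continuous_intros gc integral_phi_continuous integral_phi_continuous' fc hc)
    show "\<bar>g y * ?m p y\<bar> \<le> Bg * ((l2_sq I f + l2_sq I h) / 2)" if "y \<in> {t..T}" for p y
      unfolding abs_mult using Bg that by (intro mult_mono parseval_consecutive(2) fc hc) auto
    show "(\<lambda>p. g y * ?m p y) \<longlonglongrightarrow> 0" if "y \<in> {t..T}" for y
      using tendsto_mult_left[OF parseval_consecutive(1)[OF fc hc], of t y T "g y"] that by simp
  qed
  from l2_lim_cmult[OF proj_lim[OF this spanned_continuous[OF z]], of d]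
  show "l2_lim L (\<lambda>p y. d * (\<Sum>j\<le>p. (\<Sum>k\<le>p. C3 f g h k j k) * \<phi> j y)) (\<lambda>y. 0)"
    unfolding proj_def trace_middle_coef[OF fc gc hc] I_eq by simp
  have "l2_lim I (\<lambda>p x. f x * trace_sum g h p x T) (\<lambda>x. f x * ((1/2) * integral {x..T} (\<lambda>y. g y * h y)))"
  proof (rule l2_lim_continuous_bounded[OF _ cgh])
    show "continuous_on {t..T} (\<lambda>x. f x * trace_sum g h p x T)" for p
      by (intro continuous_intros fc trace_sum_continuous_left gc hc)
    show "\<bar>f x * trace_sum g h p x T\<bar> \<le> Bf * B2" if "x \<in> {t..T}" for p x
      unfolding abs_mult using Bf B2[of x T p] that by (intro mult_mono) auto
    show "(\<lambda>p. f x * trace_sum g h p x T) \<longlonglongrightarrow> f x * ((1/2) * integral {x..T} (\<lambda>y. g y * h y))" if "x \<in> {t..T}" for x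
      using that by (intro tendsto_mult_left trace_sum_limit(1)[OF g h]) auto
  qed
  from l2_lim_cmult[OF proj_lim[OF this spanned_continuous[OF cgh]], of d]
  show "l2_lim L (\<lambda>p x. d * (\<Sum>j\<le>p. (\<Sum>k\<le>p. C3 f g h j k k) * \<phi> j x)) (\<lambda>x. d * (f x * ((1/2) * integral {x..T} (\<lambda>y. g y * h y))))"
    unfolding proj_def trace_left_coef[OF fc gc hc] I_eq .
qed

section \<open>Stratonovich sums of third order\<close>

lemma AE_L3_neq: "AE q in L3. fst (snd q) \<noteq> snd (snd q) \<and> snd (snd q) \<noteq> t"
proof -
  interpret P: pair_sigma_finite L L2 ..
  interpret Q: pair_sigma_finite L L ..
  have [measurable]: "(\<lambda>p. fst (snd p)) \<in> borel_measurable L3" "(\<lambda>p. snd (snd p)) \<in> borel_measurable L3"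
    by (rule measurable_compose[OF measurable_snd fst_measurable_L] measurable_compose[OF measurable_snd snd_measurable_L])+
  have m: "{q \<in> space L3. fst (snd q) \<noteq> snd (snd q) \<and> snd (snd q) \<noteq> t} \<in> sets L3" by measurable
  have [measurable]: "snd \<in> borel_measurable L2" by (rule snd_measurable_L)
  have "{p \<in> space L2. snd p \<noteq> t} \<in> sets L2" by measurable
  from Q.AE_pair_measure[OF this] have "AE p in L2. snd p \<noteq> t" using AE_L_neq by auto
  with AE_L2_neq have "AE r in L2. fst r \<noteq> snd r \<and> snd r \<noteq> t" by eventually_elim simp
  then show ?thesis by (intro P.AE_pair_measure[OF m]) auto
qed

text \<open>Each cell contributes an averaged second order integral times an increment, so the sum
  lies in \<open>chaos3\<close>. Its kernel at \<open>(x, y, z)\<close> is the average of the second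
  order kernels at the two ends of the cell of \<open>z\<close>, and its traces are computed from
  the same cell. The constant \<open>d\<close> stands for \<open>ind_eq i j\<close>.\<close>

lemma strat_sums3_lim:
  assumes ijl: "i \<in> {1..m}" "j \<in> {1..m}" "l \<in> {1..m}"
    and fc: "continuous_on {t..T} f" and gc: "continuous_on {t..T} g" and hc: "continuous_on {t..T} h"
    and X: "\<forall>u\<in>{t..T}. chaos2 i j (kern2 f g u) (d * ((1/2) * integral {t..u} (\<lambda>x. f x * g x))) (X u)"
    and p: "\<And>n. partition t T (P n) (N n)" and mesh: "(\<lambda>n. mesh (P n) (N n)) \<longlonglongrightarrow> 0"
  shows "\<exists>K a b c. (\<forall>n. chaos3 i j l (K n) (a n) (b n) (c n) (strat_sum (W l) (\<lambda>u \<omega>. h u * X u \<omega>) (P n) (N n))) \<and>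
     l2_lim L3 K (kern3 f g h) \<and> l2_lim L a (\<lambda>z. d * (h z * ((1/2) * integral {t..z} (\<lambda>x. f x * g x)))) \<and>
     l2_lim L b (\<lambda>y. 0) \<and> l2_lim L c (\<lambda>x. ind_eq j l * (f x * ((1/2) * integral {x..T} (\<lambda>y. g y * h y))))"
proof -
  have tT: "t \<le> T" "T \<in> {t..T}" using ab by auto
  have r: "P n k \<in> {t..T}" if "k \<le> N n" for n k using partition_range[OF p that] by auto
  obtain Bf where Bf: "Bf \<ge> 0" "\<And>x. x \<in> space L \<Longrightarrow> \<bar>f x\<bar> \<le> Bf" using bounded_meas_bound[OF continuous_bounded_meas_L[OF fc]] by blast
  obtain Bg where Bg: "Bg \<ge> 0" "\<And>x. x \<in> space L \<Longrightarrow> \<bar>g x\<bar> \<le> Bg" using bounded_meas_bound[OF continuous_bounded_meas_L[OF gc]] by blast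
  obtain Bh where Bh: "Bh \<ge> 0" "\<And>x. x \<in> space L \<Longrightarrow> \<bar>h x\<bar> \<le> Bh" using bounded_meas_bound[OF continuous_bounded_meas_L[OF hc]] by blast
  let ?B = "Bh * (Bf * Bg)"
  have B0: "?B \<ge> 0" using Bf Bg Bh by simp
  \<comment> \<open>The trace of the inner double integral as a function of its upper limit;
    continuity makes its averages over the cells converge.\<close>
  define \<kappa> where "\<kappa> u = d * ((1/2) * integral {t..u} (\<lambda>x. f x * g x))" for u
  have \<kappa>c: "continuous_on {t..T} \<kappa>" unfolding \<kappa>_def[abs_def]
    by (intro continuous_intros indefinite_integral_continuous_1 integrable_continuous_real fc gc)
  define Kk where "Kk n k q = (1/2) * (h (P n k) * kern2 f g (P n k) q + h (P n (Suc k)) * kern2 f g (P n (Suc k)) q)" for n k q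
  define \<kappa>k where "\<kappa>k n k = (1/2) * (h (P n k) * \<kappa> (P n k) + h (P n (Suc k)) * \<kappa> (P n (Suc k)))" for n k
  define Xk where "Xk n k \<omega> = (1/2) * (h (P n k) * X (P n k) \<omega> + h (P n (Suc k)) * X (P n (Suc k)) \<omega>)" for n k \<omega>
  define hk where "hk n k z = (indicator {..P n (Suc k)} z - indicator {..P n k} z :: real)" for n k z
  define Zk where "Zk n k \<omega> = inc l (P n (Suc k)) \<omega> - inc l (P n k) \<omega>" for n k \<omega>
  have w1: "chaos2 i j (Kk n k) (\<kappa>k n k) (Xk n k)" and w2: "wint l (hk n k) (Zk n k)" if "k < N n" for n k
  proof -
    have u: "P n k \<in> {t..T}" "P n (Suc k) \<in> {t..T}" using r[of k n] r[of "Suc k" n] that by auto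
    show "chaos2 i j (Kk n k) (\<kappa>k n k) (Xk n k)"
      unfolding Kk_def[abs_def] \<kappa>k_def \<kappa>_def Xk_def[abs_def]
      by (intro chaos2_cmult chaos2_add X[rule_format] u)
    show "wint l (hk n k) (Zk n k)"
      unfolding hk_def[abs_def] Zk_def[abs_def] by (intro wint_diff wint_inc ijl u)
  qed
  define K where "K n q = (\<Sum>k<N n. (case q of (x, y, z) \<Rightarrow> Kk n k (x, y) * hk n k z))" for n q
  define a where "a n z = (\<Sum>k<N n. \<kappa>k n k * hk n k z)" for n z
  define b where "b n y = (\<Sum>k<N n. ind_eq i l * (\<integral>x. Kk n k (x, y) * hk n k x \<partial>L))" for n y
  define c where "c n x = (\<Sum>k<N n. ind_eq j l * (\<integral>y. Kk n k (x, y) * hk n k y \<partial>L))" for n x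
  have F: "chaos3 i j l (K n) (a n) (b n) (c n) (\<lambda>\<omega>. \<Sum>k<N n. Xk n k \<omega> * Zk n k \<omega>)" for n
    unfolding K_def[abs_def] a_def[abs_def] b_def[abs_def] c_def[abs_def]
    using w1[of _ n] w2[of _ n] by (intro chaos3_sum chaos2_tensor) auto
  have QS: "(\<lambda>\<omega>. \<Sum>k<N n. Xk n k \<omega> * Zk n k \<omega>) = strat_sum (W l) (\<lambda>u \<omega>. h u * X u \<omega>) (P n) (N n)" for n
    by (auto simp: Xk_def Zk_def strat_sum_def inc_def)
  have sum_eq: "(\<Sum>k<N n. Kk n k (x, y) * hk n k z) = (if t < z \<and> z \<le> T then Kk n (cell (P n) z) (x, y) else 0)" for n x y z
    unfolding hk_def by (rule partition_sum[OF p])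
  have kb: "\<bar>h u * kern2 f g u' (x, y)\<bar> \<le> ?B" if "u \<in> {t..T}" "x \<in> {t..T}" "y \<in> {t..T}" for u u' x y
  proof -
    have "\<bar>h u * kern2 f g u' (x, y)\<bar> \<le> Bh * (1 * (1 * (Bf * Bg)))"
      unfolding kern2_def abs_mult fst_conv snd_conv using that Bf Bg Bh tri_bound
      by (intro mult_mono mult_nonneg_nonneg) auto
    then show ?thesis by simp
  qed
  have bnd: "\<bar>\<Sum>k<N n. Kk n k (x, y) * hk n k z\<bar> \<le> ?B" if xy: "x \<in> {t..T}" "y \<in> {t..T}" for n x y z
  proof (cases "t < z \<and> z \<le> T")
    case True
    then have cl: "cell (P n) z < N n" using cell_props(1)[OF p, of z n] by simp
    have "P n (cell (P n) z) \<in> {t..T}" "P n (Suc (cell (P n) z)) \<in> {t..T}" using cl by (intro r; simp)+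
    from kb[OF this(1) xy] kb[OF this(2) xy] show ?thesis
      unfolding sum_eq using True by (simp add: Kk_def) (smt (verit, best))
  next
    case False
    then show ?thesis unfolding sum_eq using B0 by auto
  qed
  have tag: "\<exists>u v. (\<forall>n. u n \<in> {t..T} \<and> v n \<in> {t..T} \<and> u n < z \<and> z \<le> v n \<and>
      (\<forall>x y. (\<Sum>k<N n. Kk n k (x, y) * hk n k z) = (1/2) * (h (u n) * kern2 f g (u n) (x, y) + h (v n) * kern2 f g (v n) (x, y)))) \<and>
      u \<longlonglongrightarrow> z \<and> v \<longlonglongrightarrow> z" if z: "t < z" "z \<le> T" for z
  proof (intro exI conjI allI)
    show "(\<lambda>n. P n (cell (P n) z)) \<longlonglongrightarrow> z" "(\<lambda>n. P n (Suc (cell (P n) z))) \<longlonglongrightarrow> z"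
      by (rule cell_tendsto[OF p mesh z])+
    fix n
    note cp = cell_props[OF p z, of n]
    show "P n (cell (P n) z) \<in> {t..T}" "P n (Suc (cell (P n) z)) \<in> {t..T}" using cp(1) by (intro r; simp)+
    show "P n (cell (P n) z) < z" "z \<le> P n (Suc (cell (P n) z))" by (rule cp)+
    fix x y
    show "(\<Sum>k<N n. Kk n k (x, y) * hk n k z) = (1/2) * (h (P n (cell (P n) z)) * kern2 f g (P n (cell (P n) z)) (x, y) +
        h (P n (Suc (cell (P n) z))) * kern2 f g (P n (Suc (cell (P n) z))) (x, y))"
      unfolding sum_eq using z by (simp add: Kk_def)
  qed
  have K3b: "bounded_meas L3 (kern3 f g h)" by (rule kern3_bounded_meas[OF fc gc hc])
  obtain E where E: "\<And>q. q \<in> space L3 \<Longrightarrow> \<bar>kern3 f g h q\<bar> \<le> E" using bounded_meas_bound[OF K3b] by blast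
  have "l2_lim L3 K (kern3 f g h)"
  proof (rule L3.bounded_meas_l2_lim[OF sq_integrable_measurable[OF chaos3_sq(1)[OF F]] bounded_meas_measurable[OF K3b] _ _ E])
    show "\<bar>K n q\<bar> \<le> ?B" if "q \<in> space L3" for n q
      using bnd that by (auto simp: K_def space_pair_measure)
    show "AE q in L3. (\<lambda>n. K n q) \<longlonglongrightarrow> kern3 f g h q"
      using AE_L3_neq AE_space
    proof eventually_elim
      case (elim q)
      obtain x y z where q: "q = (x, y, z)" by (cases q)
      with elim have xyz: "y \<noteq> z" "t < z" "z \<in> {t..T}" "z \<le> T" by (auto simp: space_pair_measure)
      from tag[OF xyz(2,4)] obtain u v where u: "\<And>n. u n \<in> {t..T}" "\<And>n. v n \<in> {t..T}" and
        e: "\<And>n. (\<Sum>k<N n. Kk n k (x, y) * hk n k z) = (1/2) * (h (u n) * kern2 f g (u n) (x, y) + h (v n) * kern2 f g (v n) (x, y))"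
        and uv: "u \<longlonglongrightarrow> z" "v \<longlonglongrightarrow> z" by blast
      have "(\<lambda>n. (1/2) * (h (u n) * kern2 f g (u n) (x, y) + h (v n) * kern2 f g (v n) (x, y))) \<longlonglongrightarrow>
         (1/2) * (h z * (tri x y * (tri y z * (f x * g y))) + h z * (tri x y * (tri y z * (f x * g y))))"
        unfolding kern2_def fst_conv snd_conv
        by (intro tendsto_mult_left tendsto_add tendsto_mult tendsto_const tendsto_tri tendsto_continuous_cell[OF hc] uv u xyz)
      then show ?case unfolding q K_def prod.case e by (simp add: kern3_def mult_ac)
    qed
  qed
  moreover have "l2_lim L a (\<lambda>z. d * (h z * ((1/2) * integral {t..z} (\<lambda>x. f x * g x))))"
  proof -
    obtain Bk where Bk: "Bk \<ge> 0" "\<And>x. x \<in> space L \<Longrightarrow> \<bar>h x * \<kappa> x\<bar> \<le> Bk"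
      using bounded_meas_bound[OF continuous_bounded_meas_L[OF continuous_on_mult[OF hc \<kappa>c]]] by blast
    have "l2_lim L (\<lambda>n z. \<Sum>k<N n. \<kappa>k n k * (indicator {..P n (Suc k)} z - indicator {..P n k} z)) (\<lambda>z. indicator {..T} z * (h z * \<kappa> z))"
    proof (rule tagged_sum_lim[OF p tT(2) continuous_on_mult[OF hc \<kappa>c] Bk(1)])
      show "\<bar>\<kappa>k n k\<bar> \<le> Bk" if "k < N n" for n k
        using Bk(2)[of "P n k"] Bk(2)[of "P n (Suc k)"] r[of k n] r[of "Suc k" n] that
        unfolding \<kappa>k_def by (simp add: abs_le_iff)
      fix z assume z: "t < z" "z \<le> T"
      have cl: "cell (P n) z \<le> N n" "Suc (cell (P n) z) \<le> N n" for n using cell_props(1)[OF p z, of n] by auto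
      have "(\<lambda>n. (1/2) * (h (P n (cell (P n) z)) * \<kappa> (P n (cell (P n) z)) + h (P n (Suc (cell (P n) z))) * \<kappa> (P n (Suc (cell (P n) z)))))
          \<longlonglongrightarrow> (1/2) * (h z * \<kappa> z + h z * \<kappa> z)"
        using cell_tendsto[OF p mesh z] z r cl
        by (intro tendsto_mult_left tendsto_add tendsto_mult tendsto_continuous_cell[OF hc] tendsto_continuous_cell[OF \<kappa>c]) auto
      then show "(\<lambda>n. \<kappa>k n (cell (P n) z)) \<longlonglongrightarrow> h z * \<kappa> z" by (simp add: \<kappa>k_def mult.commute)
    qed
    then have "l2_lim L a (\<lambda>z. indicator {..T} z * (h z * \<kappa> z))" by (simp add: a_def[abs_def] hk_def)
    moreover have "AE z in L. indicator {..T} z * (h z * \<kappa> z) = h z * \<kappa> z" by (rule AE_I2) simp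
    ultimately have "l2_lim L a (\<lambda>z. h z * \<kappa> z)"
      by (rule l2_lim_unique_limit[OF _ continuous_measurable_L[OF continuous_on_mult[OF hc \<kappa>c]]])
    then show ?thesis by (simp add: \<kappa>_def mult_ac)
  qed
  moreover have int: "integrable L (\<lambda>x. Kk n k (x, y) * hk n k x)" "integrable L (\<lambda>y'. Kk n k (y, y') * hk n k y')"
    if "k < N n" "y \<in> {t..T}" for n k y
  proof -
    have Kb: "bounded_meas L2 (Kk n k)" using w1[OF that(1)] by (simp add: chaos2_def)
    have y: "y \<in> space L" using that by simp
    note hb = wintD(2)[OF w2[OF that(1)]]
    show "integrable L (\<lambda>y'. Kk n k (y, y') * hk n k y')"
      by (intro L.bounded_meas_integrable bounded_meas_mult hb bounded_meas_section[OF Kb y])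
    show "integrable L (\<lambda>x. Kk n k (x, y) * hk n k x)"
      using bounded_meas_section[OF bounded_meas_swap[OF Kb] y] hb by (intro L.bounded_meas_integrable bounded_meas_mult) auto
  qed
  moreover have "l2_lim L b (\<lambda>y. 0)"
  proof (rule L.bounded_meas_l2_lim[OF sq_integrable_measurable[OF chaos3_sq(3)[OF F]]])
    have be: "b n y = ind_eq i l * (\<integral>x. (\<Sum>k<N n. Kk n k (x, y) * hk n k x) \<partial>L)" if "y \<in> {t..T}" for n y
      using int(1)[of _ n y] that by (simp add: b_def sum_distrib_left Bochner_Integration.integral_sum)
    have m: "(\<lambda>x. \<Sum>k<N n. Kk n k (x, y) * hk n k x) \<in> borel_measurable L" if "y \<in> {t..T}" for n y
      using int(1)[of _ n y] that by (intro borel_measurable_sum) auto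
    show "\<bar>b n y\<bar> \<le> ?B * measure L (space L)" if "y \<in> space L" for n y
    proof -
      have y: "y \<in> {t..T}" using that by simp
      have "\<bar>\<integral>x. (\<Sum>k<N n. Kk n k (x, y) * hk n k x) \<partial>L\<bar> \<le> (\<integral>x. \<bar>\<Sum>k<N n. Kk n k (x, y) * hk n k x\<bar> \<partial>L)"
        by (rule integral_abs_bound)
      also have "\<dots> \<le> (\<integral>x. ?B \<partial>L)"
        using B0 bnd y m[OF y] by (intro integral_mono integrable_abs L.bounded_meas_integrable bounded_measI[where B="?B"]) auto
      finally have "\<bar>\<integral>x. (\<Sum>k<N n. Kk n k (x, y) * hk n k x) \<partial>L\<bar> \<le> ?B * measure L (space L)" by (simp add: mult_ac)
      then show ?thesis unfolding be[OF y] using ind_eq_bound order_trans by blast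
    qed
    show "AE y in L. (\<lambda>n. b n y) \<longlonglongrightarrow> 0"
    proof (rule AE_I2)
      fix y assume "y \<in> space L"
      then have y: "y \<in> {t..T}" by simp
      have "(\<lambda>n. \<integral>x. (\<Sum>k<N n. Kk n k (x, y) * hk n k x) \<partial>L) \<longlonglongrightarrow> (\<integral>x. 0 \<partial>L)"
      proof (rule integral_dominated_convergence[where w="\<lambda>_. ?B"])
        show "(\<lambda>x. \<Sum>k<N n. Kk n k (x, y) * hk n k x) \<in> borel_measurable L" for n by (rule m[OF y])
        show "AE x in L. norm (\<Sum>k<N n. Kk n k (x, y) * hk n k x) \<le> ?B" for n
          using bnd y by (intro AE_I2) auto
        show "AE x in L. (\<lambda>n. \<Sum>k<N n. Kk n k (x, y) * hk n k x) \<longlonglongrightarrow> 0"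
          using AE_L_neq[of t] AE_L_neq[of y] AE_space
        proof eventually_elim
          case (elim x)
          then have x: "t < x" "x \<le> T" "x \<in> {t..T}" by auto
          from tag[OF x(1,2)] obtain u v where u: "\<And>n. u n \<in> {t..T}" "\<And>n. v n \<in> {t..T}" "\<And>n. u n < x" and
            e: "\<And>n. (\<Sum>k<N n. Kk n k (x, y) * hk n k x) = (1/2) * (h (u n) * kern2 f g (u n) (x, y) + h (v n) * kern2 f g (v n) (x, y))"
            and uv: "u \<longlonglongrightarrow> x" "v \<longlonglongrightarrow> x" by blast
          have "(\<lambda>n. (1/2) * (h (u n) * kern2 f g (u n) (x, y) + h (v n) * kern2 f g (v n) (x, y))) \<longlonglongrightarrow>
             (1/2) * (h x * (tri x y * (tri y x * (f x * g y))) + h x * (tri x y * (tri y x * (f x * g y))))"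
            unfolding kern2_def fst_conv snd_conv using elim
            by (intro tendsto_mult_left tendsto_add tendsto_mult tendsto_const tendsto_tri tendsto_continuous_cell[OF hc] uv u x) auto
          \<comment> \<open>The contraction puts the third variable equal to the first, so both
            \<open>x \<le> y\<close> and \<open>y \<le> x\<close> would be required; this fails off
            the single point \<open>x = y\<close>.\<close>
          moreover have "tri x y * (tri y x * (f x * g y)) = 0" using elim by (auto simp: tri_def)
          ultimately show ?case by (simp add: e)
        qed
      qed auto
      then have "(\<lambda>n. ind_eq i l * (\<integral>x. (\<Sum>k<N n. Kk n k (x, y) * hk n k x) \<partial>L)) \<longlonglongrightarrow> ind_eq i l * 0"
        by (intro tendsto_mult_left) simp
      then show "(\<lambda>n. b n y) \<longlonglongrightarrow> 0" unfolding be[OF y] by simp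
    qed
  qed auto
  moreover have "l2_lim L c (\<lambda>x. ind_eq j l * (f x * ((1/2) * integral {x..T} (\<lambda>y. g y * h y))))"
  proof -
    let ?c = "\<lambda>x. ind_eq j l * (f x * ((1/2) * integral {x..T} (\<lambda>y. g y * h y)))"
    have cc: "continuous_on {t..T} ?c"
      by (intro continuous_intros fc indefinite_integral_continuous_1' integrable_continuous_real gc hc)
    obtain Bc where Bc: "\<And>x. x \<in> space L \<Longrightarrow> \<bar>?c x\<bar> \<le> Bc" using bounded_meas_bound[OF continuous_bounded_meas_L[OF cc]] by blast
    have ce: "c n x = ind_eq j l * (\<integral>y. (\<Sum>k<N n. Kk n k (x, y) * hk n k y) \<partial>L)" if "x \<in> {t..T}" for n x
      using int(2)[of _ n x] that by (simp add: c_def sum_distrib_left Bochner_Integration.integral_sum)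
    have m: "(\<lambda>y. \<Sum>k<N n. Kk n k (x, y) * hk n k y) \<in> borel_measurable L" if "x \<in> {t..T}" for n x
      using int(2)[of _ n x] that by (intro borel_measurable_sum) auto
    show ?thesis
    proof (rule L.bounded_meas_l2_lim[OF sq_integrable_measurable[OF chaos3_sq(4)[OF F]] continuous_measurable_L[OF cc] _ _ Bc])
      show "\<bar>c n x\<bar> \<le> ?B * measure L (space L)" if "x \<in> space L" for n x
      proof -
        have x: "x \<in> {t..T}" using that by simp
        have "\<bar>\<integral>y. (\<Sum>k<N n. Kk n k (x, y) * hk n k y) \<partial>L\<bar> \<le> (\<integral>y. \<bar>\<Sum>k<N n. Kk n k (x, y) * hk n k y\<bar> \<partial>L)"
          by (rule integral_abs_bound)
        also have "\<dots> \<le> (\<integral>y. ?B \<partial>L)"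
          using B0 bnd x m[OF x] by (intro integral_mono integrable_abs L.bounded_meas_integrable bounded_measI[where B="?B"]) auto
        finally have "\<bar>\<integral>y. (\<Sum>k<N n. Kk n k (x, y) * hk n k y) \<partial>L\<bar> \<le> ?B * measure L (space L)" by (simp add: mult_ac)
        then show ?thesis unfolding ce[OF x] using ind_eq_bound order_trans by blast
      qed
      show "AE x in L. (\<lambda>n. c n x) \<longlonglongrightarrow> ?c x"
      proof (rule AE_I2)
        fix x assume "x \<in> space L"
        then have x: "x \<in> {t..T}" by simp
        have gh: "continuous_on {t..T} (\<lambda>y. f x * ((1/2) * (g y * h y)))" by (intro continuous_intros gc hc)
        have "(\<lambda>n. \<integral>y. (\<Sum>k<N n. Kk n k (x, y) * hk n k y) \<partial>L) \<longlonglongrightarrow> (\<integral>y. indicator {x..T} y * (f x * ((1/2) * (g y * h y))) \<partial>L)"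
        proof (rule integral_dominated_convergence[where w="\<lambda>_. ?B"])
          show "(\<lambda>y. \<Sum>k<N n. Kk n k (x, y) * hk n k y) \<in> borel_measurable L" for n by (rule m[OF x])
          show "(\<lambda>y. indicator {x..T} y * (f x * ((1/2) * (g y * h y)))) \<in> borel_measurable L"
            using sq_integrable_measurable[OF indicator_mult_sq[OF gh, of x T]] unfolding I_eq .
          show "AE y in L. norm (\<Sum>k<N n. Kk n k (x, y) * hk n k y) \<le> ?B" for n
            using bnd x by (intro AE_I2) auto
          show "AE y in L. (\<lambda>n. \<Sum>k<N n. Kk n k (x, y) * hk n k y) \<longlonglongrightarrow> indicator {x..T} y * (f x * ((1/2) * (g y * h y)))"
            using AE_L_neq[of t] AE_space
          proof eventually_elim
            case (elim y)
            then have y: "t < y" "y \<le> T" "y \<in> {t..T}" by auto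
            from tag[OF y(1,2)] obtain u v where u: "\<And>n. u n \<in> {t..T}" "\<And>n. v n \<in> {t..T}" "\<And>n. u n < y" "\<And>n. y \<le> v n" and
              e: "\<And>n. (\<Sum>k<N n. Kk n k (x, y) * hk n k y) = (1/2) * (h (u n) * kern2 f g (u n) (x, y) + h (v n) * kern2 f g (v n) (x, y))"
              and uv: "u \<longlonglongrightarrow> y" "v \<longlonglongrightarrow> y" by blast
            \<comment> \<open>As in second order, \<open>u n < y \<le> v n\<close>: the kernel at
              the left end of the cell vanishes and the one at the right end does not.\<close>
            have e': "(\<Sum>k<N n. Kk n k (x, y) * hk n k y) = tri x y * (f x * ((1/2) * (g y * h (v n))))" for n
              unfolding e using u(3,4)[of n] by (simp add: kern2_def tri_def)
            have "(\<lambda>n. tri x y * (f x * ((1/2) * (g y * h (v n))))) \<longlonglongrightarrow> tri x y * (f x * ((1/2) * (g y * h y)))"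
              by (intro tendsto_mult_left tendsto_continuous_cell[OF hc] uv u y)
            moreover have "indicator {x..T} y = tri x y" using y by (simp add: tri_def indicator_def)
            ultimately show ?case unfolding e' by simp
          qed
        qed auto
        moreover have "(\<integral>y. indicator {x..T} y * (f x * ((1/2) * (g y * h y))) \<partial>L) = f x * ((1/2) * integral {x..T} (\<lambda>y. g y * h y))"
          using integral_indicator_I[OF gh, of x T] x unfolding I_eq by simp
        ultimately show "(\<lambda>n. c n x) \<longlonglongrightarrow> ?c x"
          unfolding ce[OF x] by (intro tendsto_mult_left) simp
      qed
    qed
  qed
  ultimately show ?thesis using F unfolding QS by blast
qed

text \<open>The limit \<open>Y\<close> is taken along the truncated expansions. Stratonovich sums
  over any sequence of partitions have the same limiting kernel and traces, hence the limit
  \<open>Y\<close>, and the chosen outer integral agrees with \<open>Y\<close> almost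
  surely.\<close>

theorem strat_iter3_expansion:
  assumes ijl: "i \<in> {1..m}" "j \<in> {1..m}" "l \<in> {1..m}"
    and f: "C1_on {t..T} f" and g: "C1_on {t..T} g" and h: "C1_on {t..T} h"
  shows "l2_lim M (\<lambda>p \<omega>. \<Sum>j1\<le>p. \<Sum>j2\<le>p. \<Sum>j3\<le>p. coeff3 \<phi> f g h t T j3 j2 j1 *
      (zeta M W \<phi> t T i j1 \<omega> * zeta M W \<phi> t T j j2 \<omega> * zeta M W \<phi> t T l j3 \<omega>))
    (strat_iter3 M W i j l f g h t T)"
proof -
  have fc: "continuous_on {t..T} f" and gc: "continuous_on {t..T} g" and hc: "continuous_on {t..T} h"
    using f g h by (auto dest: C1_on_continuous)
  have tT: "t \<le> T" using ab by simp
  define X1 where "X1 s = strat_int M (W i) (\<lambda>u \<omega>. f u) t s" for s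
  define X2 where "X2 s = strat_int M (W j) (\<lambda>u \<omega>. g u * X1 u \<omega>) t s" for s
  have X1: "wint i (\<lambda>z. indicator {..u} z * f z) (X1 u)" if "u \<in> {t..T}" for u
    unfolding X1_def by (rule wint_strat_int(1)[OF ijl(1) that fc])
  have X2: "\<forall>u\<in>{t..T}. chaos2 i j (kern2 f g u) (ind_eq i j * ((1/2) * integral {t..u} (\<lambda>x. f x * g x))) (X2 u)"
    unfolding X2_def by (intro ballI chaos2_strat_int[OF ijl(1,2) f g _ X1])
  let ?S = "\<lambda>p \<omega>. \<Sum>j1\<le>p. \<Sum>j2\<le>p. \<Sum>j3\<le>p. C3 f g h j1 j2 j3 *
      (zeta M W \<phi> t T i j1 \<omega> * zeta M W \<phi> t T j j2 \<omega> * zeta M W \<phi> t T l j3 \<omega>)"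
  note R = form3_chaos3[OF triple_form3[OF ijl, where c="C3 f g h"]]
  have RK: "l2_lim L3 (\<lambda>p q. \<Sum>j1\<le>p. \<Sum>j2\<le>p. \<Sum>j3\<le>p. C3 f g h j1 j2 j3 *
      (case q of (x, r) \<Rightarrow> \<phi> j1 x * (case r of (y, z) \<Rightarrow> \<phi> j2 y * \<phi> j3 z))) (kern3 f g h)"
    using expansion3[OF spanned3_kern3[OF fc gc hc]] unfolding I_eq kern3_coef3[OF fc gc hc] .
  note Rt = truncation_traces_lim[OF f g h]
  from chaos3_converges[OF R RK Rt(1) Rt(2) Rt(3)] obtain Y where Y: "l2_lim M ?S Y" by blast
  have lim: "l2_lim M (\<lambda>n. strat_sum (W l) (\<lambda>u \<omega>. h u * X2 u \<omega>) (P n) (N n)) Y"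
    if p: "\<And>n. partition t T (P n) (N n)" and mesh: "(\<lambda>n. mesh (P n) (N n)) \<longlonglongrightarrow> 0" for P :: "nat \<Rightarrow> nat \<Rightarrow> real" and N
  proof -
    from strat_sums3_lim[OF ijl fc gc hc X2 p mesh] obtain K a b c where
      Q: "\<And>n. chaos3 i j l (K n) (a n) (b n) (c n) (strat_sum (W l) (\<lambda>u \<omega>. h u * X2 u \<omega>) (P n) (N n))"
      and l: "l2_lim L3 K (kern3 f g h)" "l2_lim L a (\<lambda>z. ind_eq i j * (h z * ((1/2) * integral {t..z} (\<lambda>x. f x * g x))))"
        "l2_lim L b (\<lambda>y. 0)" "l2_lim L c (\<lambda>x. ind_eq j l * (f x * ((1/2) * integral {x..T} (\<lambda>y. g y * h y))))"
      by (elim exE conjE) (rule that, auto)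
    show ?thesis
      by (rule l2_lim_of_diff[OF Y chaos3_bound(1)[OF Q]
            chaos3_diff_lim[OF Q R l(1) RK l(2) Rt(1) l(3) Rt(2) l(4) Rt(3)]])
  qed
  have "strat_iter3 M W i j l f g h t T = strat_int M (W l) (\<lambda>u \<omega>. h u * X2 u \<omega>) t T"
    by (simp add: strat_iter3_def X1_def X2_def Let_def)
  then show ?thesis
    using l2_lim_unique_limit[OF Y strat_int_AE_eq(2)[OF lim tT] strat_int_AE_eq(1)[OF lim tT]] by simp
qed

end

lemma C2_on_imp_C1_on: "C2_on S f \<Longrightarrow> C1_on S f"
  unfolding C1_on_def C2_on_def using DERIV_continuous_on by blast

theorem theorem3:
  fixes M :: "'a measure" and F :: "real \<Rightarrow> 'a measure" and m :: nat
    and W :: "nat \<Rightarrow> real \<Rightarrow> 'a \<Rightarrow> real"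
    and \<phi> :: "nat \<Rightarrow> real \<Rightarrow> real"
    and \<psi>1 \<psi>2 \<psi>3 :: "real \<Rightarrow> real" and t T :: real and i1 i2 i3 :: nat
  assumes W: "wiener_mdim M F m W"
    and tT: "0 \<le> t" "t < T"
    and phi: "\<phi> = legendre_sys t T \<or> \<phi> = trig_sys t T"
    and psi2: "C1_on {t..T} \<psi>2"
    and psi1: "C2_on {t..T} \<psi>1" and psi3: "C2_on {t..T} \<psi>3"
    and idx: "i1 \<in> {1..m}" "i2 \<in> {1..m}" "i3 \<in> {1..m}"
  shows "ms_lim M
           (\<lambda>p \<omega>. \<Sum>j1\<le>p. \<Sum>j2\<le>p. \<Sum>j3\<le>p.
               coeff3 \<phi> \<psi>1 \<psi>2 \<psi>3 t T j3 j2 j1 *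
               zeta M W \<phi> t T i1 j1 \<omega> * zeta M W \<phi> t T i2 j2 \<omega> * zeta M W \<phi> t T i3 j3 \<omega>)
           (strat_iter3 M W i1 i2 i3 \<psi>1 \<psi>2 \<psi>3 t T)"
proof -
  have "ortho_system t T \<phi>"
    using phi ortho_system_legendre[OF tT(2)] ortho_system_trig[OF tT(2)] by auto
  moreover have "wiener_interval M F m W t T"
    by (simp add: wiener_interval_def W tT)
  ultimately interpret wiener_expansion M F m W t T \<phi>
    by (simp add: wiener_expansion_def)
  from strat_iter3_expansion[OF idx C2_on_imp_C1_on[OF psi1] psi2 C2_on_imp_C1_on[OF psi3]]
  show ?thesis
    unfolding mult.assoc[symmetric] by (rule l2_lim_imp_ms_lim)
qed

end
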